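(* Let $F:(-\infty,0)\to\mathbb R$ be a convex increasing function of class $C^2$, with $F(-\infty):=\lim_{x\to-\infty}F(x)$. Let $D$ be a regular domain, $z_0\in D$, $g_D:=g_D(\cdot,z_0)$, and let $t_0>0$ be such that for every $0<t\le t_0$ the set $U_t:=\{z\in D:g_D(z,z_0)>t\}$ is a regular subdomain, relatively compact in $D$, with boundary of class $C^1$, whose boundary $\partial U_t$ coincides exactly with the level line $\{z\in D:g_D(z,z_0)=t\}$. Let $M:=F\circ(-g_D)$ (a subharmonic function on $D$), and let $u$ be a subharmonic function on $D$ with $u(z_0)\ne-\infty$ and Riesz measure $\nu_u$ such that $u\le M$ on $D\setminus U_{t_0}$; let $b\ge0$. Then there exist constants $C\ge0$, depending only on $z_0,D,U_{t_0},b$, and $\overline C_M\ge0$, depending only on $z_0,D,U_{t_0},M$, such that: (a) for every convex increasing function $f:\mathbb R^+\to\mathbb R^+$ with $f(0)=0$ and $f(t_0)\le b$, $$\int_{D\setminus U_{t_0}}(f\circ g_D)\,d\nu_u\le\int_0^{t_0}f(t)F''(-t)\,dt+C\,\overline C_M-C\,u(z_0);$$ (b) for every convex decreasing function $f:\mathbb R^+\to\mathbb R^+$ with right derivative $f'_{\mathrm{right}}(0)<+\infty$ and with $f(0)\le b/t_0$, $$\int_{D\setminus U_{t_0}}g_D\,f\bigl(1/g_D\bigr)\,d\nu_u\le\int_0^{t_0}t\,f(1/t)\,F''(-t)\,dt+C\,\overline C_M-C\,u(z_0).$$ In particular, if the integral on the right-hand side of (a) (respectively (b)) is finite, then so is the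 integral on the left-hand side. If $u=\log|h|$ with $h\not\equiv0$ holomorphic on $D$ and vanishing on $\mathtt Z=\{\mathtt z_k\}_{k\in\mathbb N}\subset D$, then the left-hand sides of (a) and (b) may be written respectively as the sums $$\sum_{\mathtt z_k\in D\setminus U_{t_0}}f\bigl(g_D(\mathtt z_k,z_0)\bigr),\qquad \sum_{\mathtt z_k\in D\setminus U_{t_0}}g_D(\mathtt z_k,z_0)\,f\bigl(1/g_D(\mathtt z_k,z_0)\bigr).$$
   Context: $\mathbb C_\infty=\mathbb C\cup\{\infty\}$; a domain is an open connected subset of $\mathbb C_\infty$, and $D\ne\mathbb C_\infty$; closures, boundaries and relative compactness are understood in $\mathbb C_\infty$. $\mathbb R^+=[0,+\infty)$; increasing/decreasing are non-strict. "Regular" means regular for the Dirichlet problem. $g_D(\cdot,z_0)$ is the Green function of $D$ with pole $z_0$, $g_D(z_0,z_0)=+\infty$. Subharmonicity near $\infty$ is understood via the inversion $z\mapsto1/\bar z$. The Riesz measure of a subharmonic $u\not\equiv-\infty$ is $\nu_u=\frac1{2\pi}\Delta u$. A holomorphic $h\not\equiv0$ vanishes on $\mathtt Z$ if at each point $z$ the multiplicity of the zero of $h$ is at least the number of repetitions of $z$ in $\mathtt Z$.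
   Formalization: As h may have zeros beyond those listed in Z, the left-hand sides equal the sums only when Z lists the zeros of h exactly with multiplicity; for general Z the formal theorem says that the sums are at most the left-hand sides and satisfy the same estimates and finiteness. *)

theory Defs
  imports "HOL-Complex_Analysis.Complex_Analysis"
begin

section \<open>The Riemann sphere\<close>

text \<open>The sphere is the one-point compactification of the plane; \<open>None\<close> is the point at infinity.\<close>

abbreviation csphere :: "complex option topology" where
  "csphere \<equiv> Alexandroff_compactification euclidean"

definition recip_chart :: "complex \<Rightarrow> complex option" where
  "recip_chart w = (if w = 0 then None else Some (1 / w))"

definition inversion_chart :: "complex \<Rightarrow> complex option" where
  "inversion_chart w = recip_chart (cnj w)"

text \<open>
  Below, a local notion on an open subset of the sphere is the planar notion in the two charts
  \<open>Some\<close> and \<open>inversion_chart\<close>. For the conformally invariant notions used here the two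
  conditions agree on the overlap of the charts.
\<close>

definition sphere_domain :: "complex option set \<Rightarrow> bool" where
  "sphere_domain D \<longleftrightarrow>
     openin csphere D \<and> connectedin csphere D \<and> D \<noteq> {} \<and> D \<noteq> UNIV"

definition sphere_borel :: "complex option measure" where
  "sphere_borel = sigma UNIV {V. openin csphere V}"

section \<open>Differentiability classes and the Laplacian in the plane\<close>

definition dir_deriv :: "complex \<Rightarrow> (complex \<Rightarrow> real) \<Rightarrow> complex \<Rightarrow> real" where
  "dir_deriv v h z = frechet_derivative h (at z) v"

fun Ck_on :: "nat \<Rightarrow> complex set \<Rightarrow> (complex \<Rightarrow> real) \<Rightarrow> bool" where
  "Ck_on 0 S h \<longleftrightarrow> continuous_on S h"
| "Ck_on (Suc k) S h \<longleftrightarrow>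
     h differentiable_on S \<and> Ck_on k S (dir_deriv 1 h) \<and> Ck_on k S (dir_deriv \<i> h)"

definition laplacian :: "(complex \<Rightarrow> real) \<Rightarrow> complex \<Rightarrow> real" where
  "laplacian h z = dir_deriv 1 (dir_deriv 1 h) z + dir_deriv \<i> (dir_deriv \<i> h) z"

definition test_function :: "complex set \<Rightarrow> (complex \<Rightarrow> real) \<Rightarrow> bool" where
  "test_function S \<phi> \<longleftrightarrow>
     (\<forall>k. Ck_on k UNIV \<phi>) \<and>
     compact (closure {z. \<phi> z \<noteq> 0}) \<and> closure {z. \<phi> z \<noteq> 0} \<subseteq> S"

text \<open>The set lies locally on one side of its boundary.\<close>

definition planar_C1_boundary :: "complex set \<Rightarrow> bool" where
  "planar_C1_boundary S \<longleftrightarrow>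
     (\<forall>a\<in>frontier S. \<exists>V \<rho>. open V \<and> a \<in> V \<and> Ck_on 1 V \<rho> \<and>
        (\<forall>z\<in>V. frechet_derivative \<rho> (at z) \<noteq> (\<lambda>_. 0)) \<and>
        (\<forall>z\<in>V. z \<in> S \<longleftrightarrow> \<rho> z < 0))"

definition C1_boundary :: "complex option set \<Rightarrow> bool" where
  "C1_boundary S \<longleftrightarrow>
     planar_C1_boundary (Some -` S) \<and> planar_C1_boundary (inversion_chart -` S)"

section \<open>Harmonic functions, regular domains and Green functions\<close>

definition planar_harmonic_on :: "complex set \<Rightarrow> (complex \<Rightarrow> real) \<Rightarrow> bool" where
  "planar_harmonic_on S h \<longleftrightarrow> Ck_on 2 S h \<and> (\<forall>z\<in>S. laplacian h z = 0)"

definition harmonic_on :: "complex option set \<Rightarrow> (complex option \<Rightarrow> real) \<Rightarrow> bool" where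
  "harmonic_on S h \<longleftrightarrow>
     planar_harmonic_on (Some -` S) (h \<circ> Some) \<and>
     planar_harmonic_on (inversion_chart -` S) (h \<circ> inversion_chart)"

definition regular_domain :: "complex option set \<Rightarrow> bool" where
  "regular_domain D \<longleftrightarrow> sphere_domain D \<and>
     (\<forall>\<phi>. continuous_map (subtopology csphere (csphere frontier_of D)) euclideanreal \<phi> \<longrightarrow>
        (\<exists>h. harmonic_on D h \<and>
           (\<forall>\<zeta>\<in>csphere frontier_of D. (h \<longlongrightarrow> \<phi> \<zeta>) (atin_within csphere \<zeta> D))))"

text \<open>
  The boundary value 0 is required at every boundary point. For general domains an exceptional
  set of capacity zero is allowed there; for regular domains it is empty.
\<close>

definition green_function ::
  "complex option set \<Rightarrow> complex option \<Rightarrow> (complex option \<Rightarrow> ereal) \<Rightarrow> bool" where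
  "green_function D w g \<longleftrightarrow>
     (\<forall>z\<in>D - {w}. \<bar>g z\<bar> \<noteq> \<infinity>) \<and> harmonic_on (D - {w}) (\<lambda>z. real_of_ereal (g z)) \<and>
     (\<forall>V. openin csphere V \<and> w \<in> V \<longrightarrow> (\<exists>B. \<forall>z\<in>D - V. \<bar>g z\<bar> \<le> ereal B)) \<and>
     g w = \<infinity> \<and>
     (case w of
        Some a \<Rightarrow> \<exists>B. \<forall>\<^sub>F z in at a. \<bar>real_of_ereal (g (Some z)) + ln (norm (z - a))\<bar> \<le> B
      | None \<Rightarrow> \<exists>B. \<forall>\<^sub>F z in at_infinity. \<bar>real_of_ereal (g (Some z)) - ln (norm z)\<bar> \<le> B) \<and>
     (\<forall>\<zeta>\<in>csphere frontier_of D. (g \<longlongrightarrow> 0) (atin_within csphere \<zeta> D))"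

definition superlevel ::
  "complex option set \<Rightarrow> (complex option \<Rightarrow> ereal) \<Rightarrow> real \<Rightarrow> complex option set" where
  "superlevel D g t = {z \<in> D. g z > ereal t}"

section \<open>Subharmonic functions and Riesz measures\<close>

text \<open>
  Mean value over a circle of a function with values in \<open>[-\<infinity>, \<infinity>)\<close>, as the integral of the
  positive part minus that of the negative part; \<open>e2ennreal\<close> sends negative numbers to 0.
\<close>

definition circle_mean :: "(complex \<Rightarrow> ereal) \<Rightarrow> complex \<Rightarrow> real \<Rightarrow> ereal" where
  "circle_mean u z r =
     (enn2ereal (\<integral>\<^sup>+t\<in>{0..2*pi}. e2ennreal (u (z + rcis r t)) \<partial>lborel)
      - enn2ereal (\<integral>\<^sup>+t\<in>{0..2*pi}. e2ennreal (- u (z + rcis r t)) \<partial>lborel)) / ereal (2 * pi)"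

definition planar_subharmonic_on :: "complex set \<Rightarrow> (complex \<Rightarrow> ereal) \<Rightarrow> bool" where
  "planar_subharmonic_on S u \<longleftrightarrow>
     (\<forall>z\<in>S. u z < \<infinity>) \<and>
     (\<forall>z\<in>S. \<forall>c. u z < c \<longrightarrow> (\<forall>\<^sub>F w in nhds z. u w < c)) \<and>
     (\<forall>z\<in>S. \<exists>\<rho>>0. \<forall>r. 0 < r \<and> r < \<rho> \<longrightarrow> u z \<le> circle_mean u z r)"

definition subharmonic_on :: "complex option set \<Rightarrow> (complex option \<Rightarrow> ereal) \<Rightarrow> bool" where
  "subharmonic_on S u \<longleftrightarrow>
     planar_subharmonic_on (Some -` S) (u \<circ> Some) \<and>
     planar_subharmonic_on (inversion_chart -` S) (u \<circ> inversion_chart)"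

text \<open>
  The Riesz measure is the locally finite Borel measure equal to \<open>\<Delta>u/(2\<pi>)\<close> in the sense of
  distributions in each chart \<open>c\<close>. It is determined on \<open>D\<close> only. The value \<open>-\<infinity>\<close> of \<open>u\<close>, taken on
  a Lebesgue null set unless \<open>u\<close> is identically \<open>-\<infinity>\<close>, is read as 0.
\<close>

definition chart_laplace_measure ::
  "(complex \<Rightarrow> complex option) \<Rightarrow> complex option set \<Rightarrow> (complex option \<Rightarrow> ereal) \<Rightarrow>
     complex option measure \<Rightarrow> bool" where
  "chart_laplace_measure c D u \<nu> \<longleftrightarrow>
     (\<forall>\<phi>. test_function (c -` D) \<phi> \<longrightarrow>
        (\<integral>z. (if z \<in> range c then \<phi> (inv c z) else 0) \<partial>\<nu>) =
        1 / (2 * pi) * (\<integral>w. real_of_ereal (u (c w)) * laplacian \<phi> w \<partial>lborel))"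

definition riesz_measure ::
  "complex option set \<Rightarrow> (complex option \<Rightarrow> ereal) \<Rightarrow> complex option measure \<Rightarrow> bool" where
  "riesz_measure D u \<nu> \<longleftrightarrow>
     sets \<nu> = sets sphere_borel \<and>
     (\<forall>K. compactin csphere K \<and> K \<subseteq> D \<longrightarrow> emeasure \<nu> K < \<infinity>) \<and>
     chart_laplace_measure Some D u \<nu> \<and> chart_laplace_measure inversion_chart D u \<nu>"

section \<open>Holomorphic functions and their zeros\<close>

definition sphere_holomorphic_on :: "(complex option \<Rightarrow> complex) \<Rightarrow> complex option set \<Rightarrow> bool" where
  "sphere_holomorphic_on h D \<longleftrightarrow>
     (h \<circ> Some) holomorphic_on (Some -` D) \<and>
     (h \<circ> recip_chart) holomorphic_on (recip_chart -` D)"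

definition zero_mult :: "(complex option \<Rightarrow> complex) \<Rightarrow> complex option \<Rightarrow> int" where
  "zero_mult h z =
     (case z of Some a \<Rightarrow> zorder (h \<circ> Some) a | None \<Rightarrow> zorder (h \<circ> recip_chart) 0)"

text \<open>Finiteness is explicit because \<open>card\<close> of an infinite set is 0.\<close>

definition vanishes_on ::
  "complex option set \<Rightarrow> (complex option \<Rightarrow> complex) \<Rightarrow> (nat \<Rightarrow> complex option) \<Rightarrow> bool" where
  "vanishes_on D h Z \<longleftrightarrow>
     (\<forall>z\<in>D. finite {k. Z k = z} \<and> int (card {k. Z k = z}) \<le> zero_mult h z)"

definition zero_sequence ::
  "complex option set \<Rightarrow> (complex option \<Rightarrow> complex) \<Rightarrow> (nat \<Rightarrow> complex option) \<Rightarrow> bool" where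
  "zero_sequence D h Z \<longleftrightarrow>
     (\<forall>z\<in>D. finite {k. Z k = z} \<and> int (card {k. Z k = z}) = zero_mult h z)"

definition log_abs :: "complex \<Rightarrow> ereal" where
  "log_abs w = (if w = 0 then -\<infinity> else ereal (ln (norm w)))"

section \<open>One-variable functions and the quantities compared\<close>

definition C2_on :: "real set \<Rightarrow> (real \<Rightarrow> real) \<Rightarrow> bool" where
  "C2_on S F \<longleftrightarrow>
     F differentiable_on S \<and> deriv F differentiable_on S \<and> continuous_on S (deriv (deriv F))"

definition extend_neg_inf :: "(real \<Rightarrow> real) \<Rightarrow> ereal \<Rightarrow> ereal" where
  "extend_neg_inf F x =
     (if x = -\<infinity> then Lim at_bot (\<lambda>s. ereal (F s)) else ereal (F (real_of_ereal x)))"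

definition right_deriv :: "(real \<Rightarrow> real) \<Rightarrow> real \<Rightarrow> ereal" where
  "right_deriv f x = Lim (at_right x) (\<lambda>t. ereal ((f t - f x) / (t - x)))"

definition weighted_mass ::
  "complex option measure \<Rightarrow> complex option set \<Rightarrow> (complex option \<Rightarrow> ereal) \<Rightarrow>
     (real \<Rightarrow> real) \<Rightarrow> ennreal" where
  "weighted_mass \<nu> A g w = (\<integral>\<^sup>+z\<in>A. ennreal (w (real_of_ereal (g z))) \<partial>\<nu>)"

definition weighted_zero_sum ::
  "(nat \<Rightarrow> complex option) \<Rightarrow> complex option set \<Rightarrow> (complex option \<Rightarrow> ereal) \<Rightarrow>
     (real \<Rightarrow> real) \<Rightarrow> ennreal" where
  "weighted_zero_sum Z A g w =
     (\<Sum>k. if Z k \<in> A then ennreal (w (real_of_ereal (g (Z k)))) else 0)"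

definition majorant_integral :: "(real \<Rightarrow> real) \<Rightarrow> real \<Rightarrow> (real \<Rightarrow> real) \<Rightarrow> ennreal" where
  "majorant_integral F t0 w =
     (\<integral>\<^sup>+t\<in>{0<..<t0}. ennreal (w t * deriv (deriv F) (- t)) \<partial>lborel)"

end

(* Part (b) is part (a) for the perspective t * f (1/t) of f, which is convex, increasing and
   vanishes at 0.

   For (a) the key is the inequality
     integral over D - U_{t0} of (g_D - s)^+ d nu_u  <=  F(-s) - u(z0)    (0 < s < t0).
   Smooth x |-> (x - s)^+ to a convex function that is 0 for x <= s1 and affine for x >= s, compose
   it with g_D, and smooth the logarithmic pole at z0. The Laplacian of this test function is
   2 pi times a difference of two probability densities: one lives on {s1 <= g_D <= s}, where
   u <= F(-s1); the other is radial around z0, and the mean of u against it is at least u(z0).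
   Let s1 tend to s.

   A convex f with f(0) = 0 is a limit of nonnegative combinations of the functions (x - kh)^+.
   Summing the key inequality over the knots, Taylor's formula for F with integral remainder turns
   the values F(-kh) into the integral of f(t) F''(-t).

   Only nonnegative test functions enter, and only through an inequality. So the counting measure of
   a sequence on which h vanishes may replace the Riesz measure of log|h|. The Riesz measure of
   log|h| is purely atomic, with mass at each point the order of the zero of h there. *)

theory Submission
  imports Defs
begin

section \<open>Smooth functions in the plane\<close>

text \<open>A convex increasing f with f(t0) <= b may be arbitrarily steep just below t0, so the
  knots cannot run up to t0. They stop at t0/2, where the chord to t0 bounds the total slope by
  2b/t0; for values x of g_D beyond t0/2 the crude bound b <= (4b/t0)(x - t0/4) uses the key
  inequality once more, at s = t0/4. The coefficients of -u(z0) add up to C = 6b/t0. This sum has to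
  be exact, because u(z0) may have either sign, whereas the terms with F may be rounded up.

  The constant attached to M must be a function of M, not of F. Every level line is nonempty, so M
  can be sampled at fixed points where g_D is t0/8 and t0/2, which returns F(-t0/8) and F(-t0/2).
  The derivative F'(-t0/2) left over by Taylor's formula is at most the slope of the chord between
  them.

  A subharmonic function is given by a local sub-mean-value property only, and its Riesz measure by
  distributions in two charts. Hence everything is tested against smooth functions on the sphere,
  and circle means, area means and local integrability have to come before the key
  inequality.\<close>

lemma dir_deriv_eqI:
  assumes "(h has_derivative h') (at z)"
  shows "dir_deriv v h z = h' v"
  using frechet_derivative_at[OF assms] by (simp add: dir_deriv_def)

lemma has_derivative_cong_open:
  assumes "open S" "z \<in> S" "\<And>w. w \<in> S \<Longrightarrow> f w = g w"
  shows "(f has_derivative L) (at z) \<longleftrightarrow> (g has_derivative L) (at z)"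
  using assms has_derivative_transform_within_open[of f L z UNIV S g]
    has_derivative_transform_within_open[of g L z UNIV S f] by auto

lemma dir_deriv_cong:
  assumes "open S" "z \<in> S" "\<And>w. w \<in> S \<Longrightarrow> f w = g w"
  shows "dir_deriv v f z = dir_deriv v g z"
  using has_derivative_cong_open[OF assms] by (simp add: dir_deriv_def frechet_derivative_def)

lemma laplacian_cong:
  assumes "open S" "z \<in> S" "\<And>w. w \<in> S \<Longrightarrow> f w = g w"
  shows "laplacian f z = laplacian g z"
proof -
  have "dir_deriv v (dir_deriv v f) z = dir_deriv v (dir_deriv v g) z" for v
    by (intro dir_deriv_cong[OF assms(1,2)] dir_deriv_cong[OF assms(1) _ assms(3)])
  thus ?thesis by (simp add: laplacian_def)
qed

lemma Ck_on_cong: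
  assumes "open S" "\<And>w. w \<in> S \<Longrightarrow> f w = g w"
  shows "Ck_on k S f \<longleftrightarrow> Ck_on k S g"
  using assms(2)
proof (induction k arbitrary: f g)
  case 0
  then show ?case by (simp cong: continuous_on_cong)
next
  case (Suc k)
  have "f differentiable_on S \<longleftrightarrow> g differentiable_on S"
    using has_derivative_cong_open[OF assms(1) _ Suc.prems]
    by (simp add: differentiable_on_eq_differentiable_at[OF assms(1)] differentiable_def)
  moreover have "Ck_on k S (dir_deriv v f) \<longleftrightarrow> Ck_on k S (dir_deriv v g)" for v
    by (intro Suc.IH dir_deriv_cong[OF assms(1)] Suc.prems)
  ultimately show ?case by simp
qed

lemma Ck_on_subset: "Ck_on k S f \<Longrightarrow> T \<subseteq> S \<Longrightarrow> Ck_on k T f"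
  by (induction k arbitrary: f) (auto intro: continuous_on_subset differentiable_on_subset)

lemma Ck_on_SucD: "Ck_on (Suc k) S f \<Longrightarrow> Ck_on k S f"
proof (induction k arbitrary: f)
  case 0
  thus ?case by (simp add: differentiable_imp_continuous_on)
next
  case (Suc k)
  have "Ck_on (Suc k) S (dir_deriv 1 f)" "Ck_on (Suc k) S (dir_deriv \<i> f)"
    using Suc.prems by simp_all
  hence "Ck_on k S (dir_deriv 1 f)" "Ck_on k S (dir_deriv \<i> f)" by (blast intro: Suc.IH)+
  with Suc.prems show ?case by simp
qed

lemma Ck_on_le: "Ck_on n S f \<Longrightarrow> k \<le> n \<Longrightarrow> Ck_on k S f"
  by (induction n) (simp, metis Ck_on_SucD le_SucE)

text \<open>Differentiability at a point and \<open>dir_deriv\<close> do not see the set, so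
  smoothness on open pieces glues. Test functions that are defined by cases are shown to be smooth
  in this way.\<close>

lemma Ck_on_local:
  assumes "\<And>z. z \<in> S \<Longrightarrow> \<exists>V. open V \<and> z \<in> V \<and> Ck_on k V f"
  shows "Ck_on k S f"
  using assms
proof (induction k arbitrary: f)
  case 0
  have "isCont f z" if "z \<in> S" for z
    using 0[OF that] by (auto simp: continuous_on_eq_continuous_at)
  then show ?case by (simp add: continuous_at_imp_continuous_on)
next
  case (Suc k)
  have "f differentiable at z" if "z \<in> S" for z
    using Suc.prems[OF that] by (auto simp: differentiable_on_eq_differentiable_at)
  hence "f differentiable_on S"
    by (meson differentiable_at_imp_differentiable_on)
  moreover have "Ck_on k S (dir_deriv v f)" if "v = 1 \<or> v = \<i>" for v
  proof (rule Suc.IH)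
    fix z assume "z \<in> S"
    with Suc.prems[OF this] that show "\<exists>V. open V \<and> z \<in> V \<and> Ck_on k V (dir_deriv v f)" by auto
  qed
  ultimately show ?case by simp
qed

lemma Ck_on_Un:
  assumes "open S" "open T" "Ck_on k S f" "Ck_on k T f"
  shows "Ck_on k (S \<union> T) f"
  by (rule Ck_on_local) (use assms in auto)

lemma Ck_on_differentiable:
  assumes "Ck_on (Suc k) S f" "open S" "z \<in> S"
  shows "f differentiable (at z)"
  using assms by (auto simp: differentiable_on_eq_differentiable_at)

lemma Ck_on_has_derivative:
  assumes "Ck_on (Suc k) S f" "open S" "z \<in> S"
  shows "(f has_derivative (\<lambda>v. dir_deriv v f z)) (at z)"
  using Ck_on_differentiable[OF assms] unfolding dir_deriv_def frechet_derivative_works .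

lemma dir_deriv_decompose:
  assumes "f differentiable (at z)"
  shows "dir_deriv v f z = Re v * dir_deriv 1 f z + Im v * dir_deriv \<i> f z"
proof -
  let ?L = "frechet_derivative f (at z)"
  have L: "linear ?L"
    using assms by (simp add: linear_frechet_derivative)
  have "?L v = ?L (Re v *\<^sub>R 1 + Im v *\<^sub>R \<i>)"
    by (rule arg_cong[of _ _ ?L]) (simp add: complex_eq_iff)
  also have "\<dots> = Re v * ?L 1 + Im v * ?L \<i>"
    by (simp only: linear_add[OF L] linear_cmul[OF L] real_scaleR_def)
  finally show ?thesis by (simp add: dir_deriv_def)
qed

lemma Ck_on_const [simp]: "Ck_on k S (\<lambda>_. c)"
proof (induction k arbitrary: c)
  case (Suc k)
  have "dir_deriv v (\<lambda>_. c) = (\<lambda>_. 0)" for v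
    by (rule ext) (rule dir_deriv_eqI[of _ "\<lambda>_. 0", simplified], simp)
  with Suc show ?case by simp
qed simp

lemma Ck_on_add:
  assumes "open S" "Ck_on k S f" "Ck_on k S g"
  shows "Ck_on k S (\<lambda>z. f z + g z)"
  using assms(2,3)
proof (induction k arbitrary: f g)
  case (Suc k)
  have "dir_deriv v (\<lambda>z. f z + g z) z = dir_deriv v f z + dir_deriv v g z" if "z \<in> S" for v z
    by (rule dir_deriv_eqI) (intro has_derivative_add Ck_on_has_derivative[OF Suc.prems(1) assms(1) that]
        Ck_on_has_derivative[OF Suc.prems(2) assms(1) that])
  hence "Ck_on k S (dir_deriv v (\<lambda>z. f z + g z)) \<longleftrightarrow>
      Ck_on k S (\<lambda>z. dir_deriv v f z + dir_deriv v g z)" for v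
    by (intro Ck_on_cong assms)
  with Suc show ?case by (auto intro: differentiable_on_add)
qed (auto intro: continuous_intros)

lemma Ck_on_mult:
  assumes "open S" "Ck_on k S f" "Ck_on k S g"
  shows "Ck_on k S (\<lambda>z. f z * g z)"
  using assms(2,3)
proof (induction k arbitrary: f g)
  case (Suc k)
  have "dir_deriv v (\<lambda>z. f z * g z) z = f z * dir_deriv v g z + dir_deriv v f z * g z"
    if "z \<in> S" for v z
    by (rule dir_deriv_eqI[where h' = "\<lambda>v. f z * dir_deriv v g z + dir_deriv v f z * g z"])
       (intro has_derivative_mult Ck_on_has_derivative[OF Suc.prems(1) assms(1) that]
        Ck_on_has_derivative[OF Suc.prems(2) assms(1) that])
  hence "Ck_on k S (dir_deriv v (\<lambda>z. f z * g z)) \<longleftrightarrow>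
      Ck_on k S (\<lambda>z. f z * dir_deriv v g z + dir_deriv v f z * g z)" for v
    by (intro Ck_on_cong assms)
  moreover have "Ck_on k S f" "Ck_on k S g" using Suc.prems Ck_on_SucD by blast+
  ultimately show ?case using Suc by (auto intro!: differentiable_on_mult Ck_on_add assms)
qed (auto intro: continuous_intros)

lemma Ck_on_cmult: "open S \<Longrightarrow> Ck_on k S f \<Longrightarrow> Ck_on k S (\<lambda>z. c * f z)"
  by (intro Ck_on_mult) auto

lemma Ck_on_uminus: "open S \<Longrightarrow> Ck_on k S f \<Longrightarrow> Ck_on k S (\<lambda>z. - f z)"
  using Ck_on_cmult[of S k f "-1"] by simp

lemma Ck_on_diff: "open S \<Longrightarrow> Ck_on k S f \<Longrightarrow> Ck_on k S g \<Longrightarrow> Ck_on k S (\<lambda>z. f z - g z)"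
  using Ck_on_add[of S k f "\<lambda>z. - g z"] Ck_on_uminus[of S k g] by simp

section \<open>Real parts of holomorphic functions\<close>

lemma has_derivative_Re_holomorphic:
  assumes "f holomorphic_on S" "open S" "z \<in> S"
  shows "((\<lambda>w. Re (f w)) has_derivative (\<lambda>v. Re (deriv f z * v))) (at z)"
proof -
  have "(f has_derivative (\<lambda>v. deriv f z * v)) (at z)"
    using holomorphic_derivI[OF assms] by (simp add: has_field_derivative_def)
  thus ?thesis by (rule has_derivative_Re)
qed

lemma dir_deriv_Re_holomorphic:
  assumes "f holomorphic_on S" "open S" "z \<in> S"
  shows "dir_deriv v (\<lambda>w. Re (f w)) z = Re (v * deriv f z)"
  using dir_deriv_eqI[OF has_derivative_Re_holomorphic[OF assms]] by (simp add: mult.commute)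

lemma Ck_on_Re_holomorphic:
  assumes "f holomorphic_on S" "open S"
  shows "Ck_on k S (\<lambda>w. Re (f w))"
  using assms(1)
proof (induction k arbitrary: f)
  case 0
  thus ?case by (auto intro!: continuous_intros holomorphic_on_imp_continuous_on)
next
  case (Suc k)
  have "Ck_on k S (dir_deriv v (\<lambda>w. Re (f w))) \<longleftrightarrow> Ck_on k S (\<lambda>w. Re (v * deriv f w))" for v
    by (intro Ck_on_cong assms dir_deriv_Re_holomorphic[OF Suc.prems assms(2)])
  moreover have "Ck_on k S (\<lambda>w. Re (v * deriv f w))" for v
    by (intro Suc.IH holomorphic_intros holomorphic_deriv Suc.prems assms)
  moreover have "(\<lambda>w. Re (f w)) differentiable_on S"
    using has_derivative_Re_holomorphic[OF Suc.prems assms(2)] assms(2)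
    by (auto simp: differentiable_on_eq_differentiable_at differentiable_def)
  ultimately show ?case by simp
qed

text \<open>The second derivative in direction v is the real part of v^2 f'', and the squares of the
  two directions 1 and \<i> cancel.\<close>

lemma laplacian_Re_holomorphic:
  assumes "f holomorphic_on S" "open S" "z \<in> S"
  shows "laplacian (\<lambda>w. Re (f w)) z = 0"
proof -
  have "dir_deriv v (dir_deriv v (\<lambda>w. Re (f w))) z = Re (v * v * deriv (deriv f) z)" for v
  proof -
    have "dir_deriv v (dir_deriv v (\<lambda>w. Re (f w))) z = dir_deriv v (\<lambda>w. Re (v * deriv f w)) z"
      by (intro dir_deriv_cong[OF assms(2,3)] dir_deriv_Re_holomorphic[OF assms(1,2)])
    also have "\<dots> = Re (v * deriv (\<lambda>w. v * deriv f w) z)"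
      by (intro dir_deriv_Re_holomorphic[OF _ assms(2,3)] holomorphic_intros holomorphic_deriv assms)
    also have "deriv (\<lambda>w. v * deriv f w) z = v * deriv (deriv f) z"
      using holomorphic_deriv[OF assms(1,2)] assms(2,3)
      by (intro deriv_cmult) (auto simp: holomorphic_on_imp_differentiable_at)
    finally show ?thesis by (simp add: mult.assoc)
  qed
  thus ?thesis by (simp add: laplacian_def)
qed

lemma Ck_on_Re [simp]: "Ck_on k UNIV Re" and Ck_on_Im [simp]: "Ck_on k UNIV Im"
  using Ck_on_Re_holomorphic[of "\<lambda>z. z" UNIV k] Ck_on_Re_holomorphic[of "\<lambda>z. - \<i> * z" UNIV k]
  by (auto intro: holomorphic_intros)

section \<open>Composition with a map of the plane\<close>

lemma has_derivative_complex_components: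
  assumes "((\<lambda>w. Re (h w)) has_derivative p) (at z)" "((\<lambda>w. Im (h w)) has_derivative q) (at z)"
  shows "(h has_derivative (\<lambda>v. Complex (p v) (q v))) (at z)"
proof -
  have "((\<lambda>w. complex_of_real (Re (h w)) + \<i> * complex_of_real (Im (h w))) has_derivative
      (\<lambda>v. complex_of_real (p v) + \<i> * complex_of_real (q v))) (at z)"
    by (intro derivative_intros assms)
  thus ?thesis by (simp add: complex_eq flip: Complex_eq)
qed

lemma has_derivative_compose_plane:
  assumes h: "((\<lambda>w. Re (h w)) has_derivative p) (at z)" "((\<lambda>w. Im (h w)) has_derivative q) (at z)"
    and f: "f differentiable (at (h z))"
  shows "((\<lambda>w. f (h w)) has_derivative
           (\<lambda>v. dir_deriv 1 f (h z) * p v + dir_deriv \<i> f (h z) * q v)) (at z)"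
proof -
  have "(f has_derivative frechet_derivative f (at (h z))) (at (h z))"
    using f by (simp add: frechet_derivative_works)
  from has_derivative_compose[OF has_derivative_complex_components[OF h] this]
  have "((\<lambda>w. f (h w)) has_derivative (\<lambda>v. dir_deriv (Complex (p v) (q v)) f (h z))) (at z)"
    by (simp add: dir_deriv_def)
  thus ?thesis
    by (subst (asm) dir_deriv_decompose[OF f]) (simp add: mult.commute)
qed

text \<open>The inner map enters through its real and imaginary parts because \<open>Ck_on\<close>
  speaks of real functions. By the chain rule a derivative of the composition is a sum of products
  in which the order has dropped by one.\<close>

lemma Ck_on_compose_plane:
  assumes "open S" "open T" "h ` S \<subseteq> T" "Ck_on k T f"
    and "Ck_on k S (\<lambda>w. Re (h w))" "Ck_on k S (\<lambda>w. Im (h w))"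
  shows "Ck_on k S (\<lambda>w. f (h w))"
  using assms(4-6)
proof (induction k arbitrary: f)
  case 0
  have "continuous_on S (\<lambda>w. Complex (Re (h w)) (Im (h w)))"
    using 0 unfolding Complex_eq by (auto intro!: continuous_intros)
  hence "continuous_on S h" by simp
  with 0 assms(3) show ?case by (auto intro: continuous_on_compose2)
next
  case (Suc k)
  have D: "((\<lambda>w. f (h w)) has_derivative
     (\<lambda>v. dir_deriv 1 f (h z) * dir_deriv v (\<lambda>w. Re (h w)) z + dir_deriv \<i> f (h z) * dir_deriv v (\<lambda>w. Im (h w)) z)) (at z)"
    if "z \<in> S" for z
    using that assms(1-3) Suc.prems
    by (intro has_derivative_compose_plane Ck_on_has_derivative Ck_on_differentiable[of k T]) blast+
  hence "(\<lambda>w. f (h w)) differentiable_on S"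
    using assms(1) by (auto simp: differentiable_on_eq_differentiable_at differentiable_def)
  moreover have "Ck_on k S (dir_deriv v (\<lambda>w. f (h w)))" if "v = 1 \<or> v = \<i>" for v
  proof -
    note prems = Suc.prems(2,3)[THEN Ck_on_SucD]
    have "Ck_on k S (\<lambda>z. dir_deriv 1 f (h z) * dir_deriv v (\<lambda>w. Re (h w)) z + dir_deriv \<i> f (h z) * dir_deriv v (\<lambda>w. Im (h w)) z)"
      by (intro Ck_on_add Ck_on_mult Suc.IH[of "dir_deriv 1 f"] Suc.IH[of "dir_deriv \<i> f"] assms(1) prems)
         (use Suc.prems that in auto)
    thus ?thesis using dir_deriv_eqI[OF D] by (subst Ck_on_cong[OF assms(1)]) auto
  qed
  ultimately show ?case by simp
qed

section \<open>Smooth functions of one variable\<close>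

text \<open>Each derivative is an existentially quantified witness instead of an iterated
  \<open>deriv\<close>, so that closure properties are proved by exhibiting the next derivative. The
  derivative is two-sided at every point of \<open>I\<close>, whether or not \<open>I\<close> is
  open.\<close>

fun Dk_on :: "nat \<Rightarrow> real set \<Rightarrow> (real \<Rightarrow> real) \<Rightarrow> bool" where
  "Dk_on 0 I p \<longleftrightarrow> continuous_on I p"
| "Dk_on (Suc k) I p \<longleftrightarrow>
     (\<exists>p'. (\<forall>x\<in>I. (p has_real_derivative p' x) (at x)) \<and> Dk_on k I p')"

lemma Dk_on_SucI:
  assumes "\<And>x. x \<in> I \<Longrightarrow> (p has_real_derivative p' x) (at x)" "Dk_on k I p'"
  shows "Dk_on (Suc k) I p"
  using assms by auto

lemma Dk_on_SucD: "Dk_on (Suc k) I p \<Longrightarrow> Dk_on k I p"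
proof (induction k arbitrary: p)
  case 0
  then show ?case by (auto intro!: continuous_at_imp_continuous_on intro: DERIV_isCont)
next
  case (Suc k)
  from Suc.prems obtain p' where "\<forall>x\<in>I. (p has_real_derivative p' x) (at x)" "Dk_on (Suc k) I p'"
    by auto
  with Suc.IH[of p'] show ?case unfolding Dk_on.simps(2)[of k] by blast
qed

lemma Dk_on_const [simp]: "Dk_on k I (\<lambda>_. c)"
proof (induction k arbitrary: c)
  case (Suc k)
  then show ?case by (auto intro!: exI[of _ "\<lambda>_. 0"])
qed auto

lemma Dk_on_id [simp]: "Dk_on k I (\<lambda>x. x)"
proof (cases k)
  case (Suc k)
  then show ?thesis by (auto intro!: exI[of _ "\<lambda>_. 1"])
qed auto

lemma Dk_on_add: "Dk_on k I p \<Longrightarrow> Dk_on k I q \<Longrightarrow> Dk_on k I (\<lambda>x. p x + q x)"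
proof (induction k arbitrary: p q)
  case (Suc k)
  then obtain p' q' where "\<forall>x\<in>I. (p has_real_derivative p' x) (at x)" "Dk_on k I p'"
      "\<forall>x\<in>I. (q has_real_derivative q' x) (at x)" "Dk_on k I q'" by auto
  moreover from this have "\<forall>x\<in>I. ((\<lambda>x. p x + q x) has_real_derivative p' x + q' x) (at x)"
    by (blast intro: DERIV_add)
  ultimately show ?case using Suc.IH[of p' q']
    by (intro Dk_on_SucI[of I _ "\<lambda>x. p' x + q' x"]) auto
qed (auto intro: continuous_intros)

lemma Dk_on_mult: "Dk_on k I p \<Longrightarrow> Dk_on k I q \<Longrightarrow> Dk_on k I (\<lambda>x. p x * q x)"
proof (induction k arbitrary: p q)
  case (Suc k)
  then obtain p' q' where "\<forall>x\<in>I. (p has_real_derivative p' x) (at x)" "Dk_on k I p'"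
      "\<forall>x\<in>I. (q has_real_derivative q' x) (at x)" "Dk_on k I q'" by auto
  moreover from this have "\<forall>x\<in>I. ((\<lambda>x. p x * q x) has_real_derivative p' x * q x + q' x * p x) (at x)"
    by (blast intro: DERIV_mult)
  moreover have "Dk_on k I p" "Dk_on k I q" using Suc.prems Dk_on_SucD by blast+
  ultimately have "Dk_on k I (\<lambda>x. p' x * q x + q' x * p x)"
      "\<forall>x\<in>I. ((\<lambda>x. p x * q x) has_real_derivative p' x * q x + q' x * p x) (at x)"
    by (auto intro!: Dk_on_add Suc.IH)
  thus ?case by (intro Dk_on_SucI[of I _ "\<lambda>x. p' x * q x + q' x * p x"]) auto
qed (auto intro: continuous_intros)

lemma Dk_on_cmult: "Dk_on k I q \<Longrightarrow> Dk_on k I (\<lambda>x. c * q x)"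
  by (intro Dk_on_mult) auto

lemma Dk_on_diff: "Dk_on k I p \<Longrightarrow> Dk_on k I q \<Longrightarrow> Dk_on k I (\<lambda>x. p x - q x)"
  using Dk_on_add[of k I p "\<lambda>x. -1 * q x"] Dk_on_cmult[of k I q "-1"] by simp

lemma Dk_on_inverse:
  assumes "\<And>x. x \<in> I \<Longrightarrow> p x \<noteq> 0"
  shows "Dk_on k I p \<Longrightarrow> Dk_on k I (\<lambda>x. inverse (p x))"
proof (induction k)
  case 0
  with assms show ?case by (auto intro: continuous_intros)
next
  case (Suc k)
  then obtain p' where p': "\<forall>x\<in>I. (p has_real_derivative p' x) (at x)" "Dk_on k I p'" by auto
  have "Dk_on k I (\<lambda>x. -1 * (p' x * (inverse (p x) * inverse (p x))))"
    using Suc Dk_on_SucD p' by (intro Dk_on_cmult Dk_on_mult) blast+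
  moreover have "((\<lambda>x. inverse (p x)) has_real_derivative -1 * (p' x * (inverse (p x) * inverse (p x)))) (at x)"
    if "x \<in> I" for x
    using p'(1) that assms[OF that] by (auto intro!: derivative_eq_intros simp: algebra_simps)
  ultimately show ?case by (rule Dk_on_SucI[rotated])
qed

lemma Dk_on_compose:
  "Dk_on k J p \<Longrightarrow> Dk_on k I q \<Longrightarrow> q ` I \<subseteq> J \<Longrightarrow> Dk_on k I (\<lambda>x. p (q x))"
proof (induction k arbitrary: p)
  case 0
  then show ?case by (auto intro: continuous_on_compose2)
next
  case (Suc k)
  then obtain p' q' where *: "\<forall>x\<in>J. (p has_real_derivative p' x) (at x)" "Dk_on k J p'"
      "\<forall>x\<in>I. (q has_real_derivative q' x) (at x)" "Dk_on k I q'" by auto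
  have "Dk_on k I (\<lambda>x. p' (q x) * q' x)"
    using * Dk_on_SucD[OF Suc.prems(2)] Suc.prems(3) by (intro Dk_on_mult Suc.IH[of p']) blast+
  moreover have "((\<lambda>x. p (q x)) has_real_derivative p' (q x) * q' x) (at x)" if "x \<in> I" for x
    using *(1,3) that Suc.prems(3) by (intro DERIV_chain2) auto
  ultimately show ?case by (rule Dk_on_SucI[rotated])
qed

lemma has_derivative_compose_real:
  assumes "(p has_real_derivative p') (at (f z))" "(f has_derivative f') (at z)"
  shows "((\<lambda>w. p (f w)) has_derivative (\<lambda>v. p' * f' v)) (at z)"
  using has_derivative_compose[OF assms(2) assms(1)[unfolded has_field_derivative_def]] by simp

lemma Ck_on_compose_real:
  assumes "open S"
  shows "Dk_on k I p \<Longrightarrow> Ck_on k S f \<Longrightarrow> f ` S \<subseteq> I \<Longrightarrow> Ck_on k S (\<lambda>z. p (f z))"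
proof (induction k arbitrary: p)
  case 0
  then show ?case by (auto intro: continuous_on_compose2)
next
  case (Suc k)
  then obtain p' where p': "\<forall>x\<in>I. (p has_real_derivative p' x) (at x)" "Dk_on k I p'" by auto
  have D: "((\<lambda>z. p (f z)) has_derivative (\<lambda>v. p' (f z) * dir_deriv v f z)) (at z)" if "z \<in> S" for z
  proof -
    have "f z \<in> I" using Suc.prems(3) that by blast
    from has_derivative_compose_real[OF bspec[OF p'(1) this] Ck_on_has_derivative[OF Suc.prems(2) assms that]]
    show ?thesis .
  qed
  hence "(\<lambda>w. p (f w)) differentiable_on S"
    using assms(1) by (auto simp: differentiable_on_eq_differentiable_at differentiable_def)
  moreover have "Ck_on k S (dir_deriv v (\<lambda>w. p (f w)))" if "v = 1 \<or> v = \<i>" for v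
  proof -
    note prems = Suc.prems(2)[THEN Ck_on_SucD]
    have "Ck_on k S (\<lambda>z. p' (f z) * dir_deriv v f z)"
      by (intro Ck_on_mult Suc.IH[of p'] assms prems) (use Suc.prems p' that in auto)
    thus ?thesis using dir_deriv_eqI[OF D] by (subst Ck_on_cong[OF assms(1)]) auto
  qed
  ultimately show ?case by simp
qed

subsection \<open>Smooth steps, ramps and logarithmic profiles\<close>

text \<open>\<open>exp_bump 1\<close> is the classical flat function exp(-1/x). The polynomial in
  1/x is carried along because the family is then closed under differentiation.\<close>

definition exp_bump :: "real poly \<Rightarrow> real \<Rightarrow> real" where
  "exp_bump p x = (if x > 0 then poly p (1 / x) * exp (- (1 / x)) else 0)"

lemma poly_times_exp_tendsto_0: "((\<lambda>y::real. poly p y * exp (- y)) \<longlongrightarrow> 0) at_top"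
proof -
  have "((\<lambda>y::real. \<Sum>i\<le>degree p. coeff p i * (y ^ i / exp y)) \<longlongrightarrow> (\<Sum>i\<le>degree p. coeff p i * 0)) at_top"
    by (intro tendsto_intros tendsto_power_div_exp_0)
  thus ?thesis by (simp add: poly_altdef sum_distrib_right sum_divide_distrib exp_minus divide_inverse mult.assoc)
qed

lemma exp_bump_tendsto_0: "(exp_bump p \<longlongrightarrow> 0) (at_right 0)"
proof -
  have "((\<lambda>x. poly p (inverse x) * exp (- inverse x)) \<longlongrightarrow> 0) (at_right 0)"
    by (rule filterlim_compose[OF poly_times_exp_tendsto_0 filterlim_inverse_at_top_right])
  moreover have "\<forall>\<^sub>F x in at_right 0. poly p (inverse x) * exp (- inverse x) = exp_bump p x"
    by (auto simp: eventually_at_right_less exp_bump_def inverse_eq_divide eventually_at_filter)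
  ultimately show ?thesis by (rule Lim_transform_eventually)
qed

text \<open>With y = 1/x one has d/dx = -y^2 d/dy, which turns p(y) exp(-y) into y^2 (p - p')(y)
  exp(-y); the two \<open>pCons 0\<close> are the factor y^2. At 0 the difference quotient from the
  right is again a member of the family, with polynomial y p(y), and tends to 0.\<close>

lemma exp_bump_has_derivative:
  "(exp_bump p has_real_derivative exp_bump (pCons 0 (pCons 0 (p - pderiv p))) x) (at x)"
proof -
  consider "x > 0" | "x < 0" | "x = 0" by linarith
  thus ?thesis
  proof cases
    case 1
    have "((\<lambda>x. poly p (1 / x) * exp (- (1 / x))) has_real_derivative
        exp_bump (pCons 0 (pCons 0 (p - pderiv p))) x) (at x)"
      using 1 by (auto intro!: derivative_eq_intros poly_DERIV[THEN DERIV_chain2] simp: exp_bump_def field_simps power2_eq_square)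
    thus ?thesis
      by (rule has_field_derivative_transform_within_open[of _ _ _ "{0<..}"]) (use 1 in \<open>auto simp: exp_bump_def\<close>)
  next
    case 2
    have "((\<lambda>x. 0) has_real_derivative exp_bump (pCons 0 (pCons 0 (p - pderiv p))) x) (at x)"
      using 2 by (simp add: exp_bump_def)
    thus ?thesis
      by (rule has_field_derivative_transform_within_open[of _ _ _ "{..<0}"]) (use 2 in \<open>auto simp: exp_bump_def\<close>)
  next
    case 3
    have "((\<lambda>h. exp_bump p h / h) \<longlongrightarrow> 0) (at_left 0)"
      by (rule tendsto_eventually) (auto simp: exp_bump_def eventually_at_filter)
    moreover have "((\<lambda>h. exp_bump p h / h) \<longlongrightarrow> 0) (at_right 0)"
      by (rule Lim_transform_eventually[OF exp_bump_tendsto_0[of "pCons 0 p"]])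
         (auto simp: exp_bump_def eventually_at_filter)
    ultimately have "((\<lambda>h. exp_bump p h / h) \<longlongrightarrow> 0) (at 0)" by (rule filterlim_split_at)
    thus ?thesis using 3 by (simp add: has_field_derivative_iff exp_bump_def)
  qed
qed

lemma Dk_on_exp_bump: "Dk_on k I (exp_bump p)"
proof (induction k arbitrary: p)
  case 0
  show ?case
    by (auto intro!: continuous_at_imp_continuous_on intro: DERIV_isCont[OF exp_bump_has_derivative])
next
  case (Suc k)
  show ?case by (rule Dk_on_SucI[OF exp_bump_has_derivative Suc])
qed

lemma exp_bump_1_mono: "x \<le> y \<Longrightarrow> exp_bump 1 x \<le> exp_bump 1 y"
  by (auto simp: exp_bump_def field_simps)

text \<open>The witness hidden in \<open>Dk_on\<close> could vary with the order. Uniqueness of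
  derivatives identifies all of them with one function, which is therefore smooth of every
  order.\<close>

lemma Dk_on_derivative:
  assumes "\<And>k. Dk_on k UNIV p" "\<And>x. (p has_real_derivative p' x) (at x)"
  shows "Dk_on k UNIV p'"
proof -
  obtain q where q: "\<forall>x. (p has_real_derivative q x) (at x)" "Dk_on k UNIV q"
    using assms(1)[of "Suc k"] by auto
  have "q = p'" using q(1) assms(2) DERIV_unique by blast
  with q show ?thesis by simp
qed

lemma Dk_on_ex_derivative:
  assumes "\<And>k. Dk_on k UNIV p"
  obtains p' where "\<And>x. (p has_real_derivative p' x) (at x)" "\<And>k. Dk_on k UNIV p'"
proof -
  obtain q where q: "\<forall>x. (p has_real_derivative q x) (at x)"
    using assms[of "Suc 0"] by auto
  with Dk_on_derivative[OF assms] that show ?thesis by blast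
qed

text \<open>The usual quotient e(x - \<alpha>) / (e(x - \<alpha>) + e(\<beta> - x)) with e the flat
  function: the denominator is positive since \<alpha> < \<beta> keeps the two arguments from being
  nonpositive together.\<close>

lemma smooth_step:
  fixes \<alpha> \<beta> :: real
  assumes "\<alpha> < \<beta>"
  obtains \<sigma> \<sigma>' where "\<And>k. Dk_on k UNIV \<sigma>" "\<And>k. Dk_on k UNIV \<sigma>'"
    "\<And>x. (\<sigma> has_real_derivative \<sigma>' x) (at x)" "\<And>x. 0 \<le> \<sigma> x" "\<And>x. \<sigma> x \<le> 1"
    "\<And>x. x \<le> \<alpha> \<Longrightarrow> \<sigma> x = 0" "\<And>x. x \<ge> \<beta> \<Longrightarrow> \<sigma> x = 1"
    "\<And>x. 0 \<le> \<sigma>' x" "\<And>x. x \<le> \<alpha> \<or> x \<ge> \<beta> \<Longrightarrow> \<sigma>' x = 0"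
proof -
  let ?e = "exp_bump 1"
  define \<sigma> where "\<sigma> x = ?e (x - \<alpha>) * inverse (?e (x - \<alpha>) + ?e (\<beta> - x))" for x
  have e0: "0 \<le> ?e x" for x by (simp add: exp_bump_def)
  have epos: "?e x > 0 \<longleftrightarrow> x > 0" for x by (simp add: exp_bump_def)
  have ezero: "?e x = 0 \<longleftrightarrow> x \<le> 0" for x by (simp add: exp_bump_def)
  have den: "?e (x - \<alpha>) + ?e (\<beta> - x) > 0" for x
    using e0[of "x - \<alpha>"] e0[of "\<beta> - x"] epos[of "x - \<alpha>"] epos[of "\<beta> - x"] assms by linarith
  have S: "Dk_on k UNIV \<sigma>" for k
  proof -
    have a: "Dk_on k UNIV (\<lambda>x. ?e (x - \<alpha>))"
      by (rule Dk_on_compose[where J = UNIV and p = ?e and q = "\<lambda>x. x - \<alpha>"])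
        (auto intro!: Dk_on_exp_bump Dk_on_diff)
    have b: "Dk_on k UNIV (\<lambda>x. ?e (\<beta> - x))"
      by (rule Dk_on_compose[where J = UNIV and p = ?e and q = "\<lambda>x. \<beta> - x"])
        (auto intro!: Dk_on_exp_bump Dk_on_diff)
    have "?e (x - \<alpha>) + ?e (\<beta> - x) \<noteq> 0" for x using den[of x] by linarith
    thus ?thesis unfolding \<sigma>_def
      by (intro Dk_on_mult Dk_on_inverse Dk_on_add a b)
  qed
  obtain \<sigma>' where d: "\<And>x. (\<sigma> has_real_derivative \<sigma>' x) (at x)" "\<And>k. Dk_on k UNIV \<sigma>'"
    using Dk_on_ex_derivative[OF S] by blast
  have nn: "0 \<le> \<sigma> x" and le1: "\<sigma> x \<le> 1" for x
    using den[of x] e0[of "x - \<alpha>"] e0[of "\<beta> - x"] by (auto simp: \<sigma>_def field_simps)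
  have z0: "\<sigma> x = 0" if "x \<le> \<alpha>" for x using that by (simp add: \<sigma>_def ezero)
  have z1: "\<sigma> x = 1" if "x \<ge> \<beta>" for x
    using that den[of x] by (simp add: \<sigma>_def exp_bump_def)
  have mono: "\<sigma> x \<le> \<sigma> y" if "x \<le> y" for x y
  proof -
    have "?e (x - \<alpha>) * ?e (\<beta> - y) \<le> ?e (y - \<alpha>) * ?e (\<beta> - x)"
      using that by (intro mult_mono exp_bump_1_mono e0) auto
    thus ?thesis using den[of x] den[of y]
      by (simp add: \<sigma>_def field_simps)
  qed
  have d0: "0 \<le> \<sigma>' x" for x
    by (rule mono_on_imp_deriv_nonneg[OF _ d(1), of UNIV]) (auto simp: mono_on_def mono)
  \<comment> \<open>The closed half-lines consist of global minima and maxima of \<sigma>, so the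
    derivative vanishes at the end points as well.\<close>
  have d1: "\<sigma>' x = 0" if "x \<le> \<alpha> \<or> x \<ge> \<beta>" for x
  proof (cases "x \<le> \<alpha>")
    case True
    show ?thesis by (rule DERIV_local_min[OF d(1), of 1]) (use True nn z0 in auto)
  next
    case False
    show ?thesis by (rule DERIV_local_max[OF d(1), of 1]) (use False that le1 z1 in auto)
  qed
  show ?thesis by (rule that[OF S d(2) d(1) nn le1 z0 z1 d0 d1])
qed

lemma ex_antiderivative:
  fixes f :: "real \<Rightarrow> real"
  assumes "continuous_on UNIV f"
  obtains F where "\<And>x. (F has_real_derivative f x) (at x)" "F c = v"
proof -
  have "\<exists>F. \<forall>x::real. -\<infinity> < ereal x \<longrightarrow> ereal x < \<infinity> \<longrightarrow> (F has_vector_derivative f x) (at x)"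
    by (rule einterval_antiderivative) (use assms in \<open>auto simp: continuous_on_eq_continuous_at\<close>)
  then obtain F where F: "\<And>x. (F has_real_derivative f x) (at x)"
    by (auto simp: has_real_derivative_iff_has_vector_derivative)
  show ?thesis
    by (rule that[of "\<lambda>x. F x - F c + v"]) (auto intro!: derivative_eq_intros F)
qed

text \<open>A smooth convex substitute for the positive part, obtained as the antiderivative of a
  smooth step. The offset c is the root of the affine branch; it lies between \<alpha> and \<beta>
  because the slope stays between 0 and 1.\<close>

lemma convex_ramp:
  fixes \<alpha> \<beta> :: real
  assumes "\<alpha> < \<beta>"
  obtains \<eta> \<eta>' \<eta>'' c where "\<And>k. Dk_on k UNIV \<eta>"
    "\<And>x. (\<eta> has_real_derivative \<eta>' x) (at x)" "\<And>x. (\<eta>' has_real_derivative \<eta>'' x) (at x)"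
    "\<And>x. 0 \<le> \<eta>'' x" "\<And>x. x \<le> \<alpha> \<or> x \<ge> \<beta> \<Longrightarrow> \<eta>'' x = 0"
    "\<And>x. x \<le> \<alpha> \<Longrightarrow> \<eta> x = 0" "\<And>x. 0 \<le> \<eta> x" "\<And>x. x \<ge> \<beta> \<Longrightarrow> \<eta> x = x - c"
    "\<And>x. x - \<beta> \<le> \<eta> x" "\<alpha> \<le> c" "c \<le> \<beta>"
proof -
  obtain \<sigma> \<sigma>' where s: "\<And>k. Dk_on k UNIV \<sigma>" "\<And>k. Dk_on k UNIV \<sigma>'"
    "\<And>x. (\<sigma> has_real_derivative \<sigma>' x) (at x)" "\<And>x. 0 \<le> \<sigma> x" "\<And>x. \<sigma> x \<le> 1"
    "\<And>x. x \<le> \<alpha> \<Longrightarrow> \<sigma> x = 0" "\<And>x. x \<ge> \<beta> \<Longrightarrow> \<sigma> x = 1"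
    "\<And>x. 0 \<le> \<sigma>' x" "\<And>x. x \<le> \<alpha> \<or> x \<ge> \<beta> \<Longrightarrow> \<sigma>' x = 0"
    using smooth_step[OF assms] by metis
  have "continuous_on UNIV \<sigma>" using s(1)[of 0] by simp
  then obtain \<eta> where chi: "\<And>x. (\<eta> has_real_derivative \<sigma> x) (at x)" "\<eta> \<alpha> = 0"
    using ex_antiderivative[of \<sigma> \<alpha> 0] by metis
  have mvt: "\<exists>\<xi>. x < \<xi> \<and> \<xi> < y \<and> \<eta> y - \<eta> x = (y - x) * \<sigma> \<xi>" if "x < y" for x y
    using MVT2[OF that, of \<eta> \<sigma>] chi(1) by blast
  have D: "Dk_on k UNIV \<eta>" for k
    using Dk_on_SucD[OF Dk_on_SucI[OF chi(1) s(1)]] .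
  have z: "\<eta> x = 0" if "x \<le> \<alpha>" for x
  proof (cases "x = \<alpha>")
    case False
    with that mvt[of x \<alpha>] obtain \<xi> where "\<xi> < \<alpha>" "\<eta> \<alpha> - \<eta> x = (\<alpha> - x) * \<sigma> \<xi>" by auto
    with s(6)[of \<xi>] chi(2) show ?thesis by simp
  qed (use chi in simp)
  have nn: "0 \<le> \<eta> x" for x
  proof (cases "x \<le> \<alpha>")
    case False
    then obtain \<xi> where "\<eta> x - \<eta> \<alpha> = (x - \<alpha>) * \<sigma> \<xi>" using mvt[of \<alpha> x] by auto
    with s(4)[of \<xi>] chi(2) False show ?thesis by simp
  qed (use z in simp)
  have up: "\<eta> x \<le> x - \<alpha>" if "x \<ge> \<alpha>" for x
  proof (cases "x = \<alpha>")
    case False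
    with that mvt[of \<alpha> x] obtain \<xi> where *: "\<eta> x - \<eta> \<alpha> = (x - \<alpha>) * \<sigma> \<xi>" by auto
    have "(x - \<alpha>) * \<sigma> \<xi> \<le> (x - \<alpha>) * 1" using s(5)[of \<xi>] that by (intro mult_left_mono) auto
    with * chi(2) show ?thesis by simp
  qed (use chi in simp)
  define c where "c = \<beta> - \<eta> \<beta>"
  have lin: "\<eta> x = x - c" if "x \<ge> \<beta>" for x
  proof (cases "x = \<beta>")
    case False
    with that mvt[of \<beta> x] obtain \<xi> where "\<beta> < \<xi>" "\<eta> x - \<eta> \<beta> = (x - \<beta>) * \<sigma> \<xi>" by auto
    with s(7)[of \<xi>] show ?thesis by (simp add: c_def)
  qed (simp add: c_def)
  have c: "\<alpha> \<le> c" "c \<le> \<beta>" using up[of \<beta>] nn[of \<beta>] assms by (auto simp: c_def)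
  have low: "x - \<beta> \<le> \<eta> x" for x
    using lin[of x] nn[of x] c by (cases "x \<ge> \<beta>") auto
  show ?thesis by (rule that[OF D chi(1) s(3) s(8) s(9) z nn lin low c])
qed

text \<open>Here x stands for |z - a|^2, so that ln x / 2 is ln |z - a|, and four times x \<kappa>''
  + \<kappa>' = (x \<kappa>')' is the Laplacian of the radial function. Prescribing x \<kappa>' =
  \<sigma> / 2 with a smooth step \<sigma> therefore smooths the logarithmic pole and spreads its
  Laplacian as 2 \<sigma>' over an annulus.\<close>

lemma log_profile:
  fixes \<alpha> \<beta> :: real
  assumes "0 < \<alpha>" "\<alpha> < \<beta>"
  obtains \<kappa> \<kappa>' \<kappa>'' \<sigma> \<sigma>' where "\<And>k. Dk_on k UNIV \<kappa>"
    "\<And>x. (\<kappa> has_real_derivative \<kappa>' x) (at x)" "\<And>x. (\<kappa>' has_real_derivative \<kappa>'' x) (at x)"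
    "\<And>x. x \<ge> \<beta> \<Longrightarrow> \<kappa> x = ln x / 2" "\<And>x. x \<le> \<beta> \<Longrightarrow> \<kappa> x \<le> ln \<beta> / 2"
    "\<And>x. \<kappa> x \<ge> ln \<alpha> / 2"
    "\<And>x. x * \<kappa>'' x + \<kappa>' x = \<sigma>' x / 2" "\<And>x. (\<sigma> has_real_derivative \<sigma>' x) (at x)"
    "continuous_on UNIV \<sigma>'"
    "\<And>x. 0 \<le> \<sigma>' x" "\<And>x. x \<le> \<alpha> \<or> x \<ge> \<beta> \<Longrightarrow> \<sigma>' x = 0"
    "\<And>x. x \<le> \<alpha> \<Longrightarrow> \<sigma> x = 0" "\<And>x. x \<ge> \<beta> \<Longrightarrow> \<sigma> x = 1"
proof -
  obtain \<sigma> \<sigma>' where s: "\<And>k. Dk_on k UNIV \<sigma>" "\<And>k. Dk_on k UNIV \<sigma>'"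
    "\<And>x. (\<sigma> has_real_derivative \<sigma>' x) (at x)" "\<And>x. 0 \<le> \<sigma> x" "\<And>x. \<sigma> x \<le> 1"
    "\<And>x. x \<le> \<alpha> \<Longrightarrow> \<sigma> x = 0" "\<And>x. x \<ge> \<beta> \<Longrightarrow> \<sigma> x = 1"
    "\<And>x. 0 \<le> \<sigma>' x" "\<And>x. x \<le> \<alpha> \<or> x \<ge> \<beta> \<Longrightarrow> \<sigma>' x = 0"
    using smooth_step[OF assms(2)] by metis
  have "\<alpha> / 2 < \<alpha>" using assms by simp
  \<comment> \<open>The function \<eta> + c equals x from \<alpha> on and stays at least \<alpha> /
    2 everywhere: a smooth divisor that replaces x where \<sigma> vanishes anyway.\<close>
  then obtain \<eta> c where r: "\<And>k. Dk_on k UNIV \<eta>" "\<And>x. 0 \<le> \<eta> x"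
      "\<And>x. x \<ge> \<alpha> \<Longrightarrow> \<eta> x = x - c" "\<alpha> / 2 \<le> c"
    using convex_ramp[of "\<alpha> / 2" \<alpha>] by metis
  define \<kappa>' where "\<kappa>' x = 1 / 2 * (\<sigma> x * inverse (\<eta> x + c))" for x
  have pos: "\<eta> x + c > 0" for x using r(2)[of x] r(4) assms by linarith
  have eq: "x * \<kappa>' x = \<sigma> x / 2" for x
  proof (cases "x \<le> \<alpha>")
    case False
    with r(3)[of x] assms show ?thesis by (simp add: \<kappa>'_def)
  qed (simp add: \<kappa>'_def s(6))
  have S: "Dk_on k UNIV \<kappa>'" for k
  proof -
    have "\<eta> x + c \<noteq> 0" for x using pos[of x] by linarith
    thus ?thesis unfolding \<kappa>'_def by (intro Dk_on_cmult Dk_on_mult Dk_on_inverse Dk_on_add s(1) r(1)) auto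
  qed
  obtain \<kappa>'' where d: "\<And>x. (\<kappa>' has_real_derivative \<kappa>'' x) (at x)" "\<And>k. Dk_on k UNIV \<kappa>''"
    using Dk_on_ex_derivative[OF S] by blast
  have cont: "continuous_on UNIV \<kappa>'" using S[of 0] by simp
  then obtain \<kappa> where k: "\<And>x. (\<kappa> has_real_derivative \<kappa>' x) (at x)" "\<kappa> \<beta> = ln \<beta> / 2"
    using ex_antiderivative[of \<kappa>' \<beta> "ln \<beta> / 2"] by metis
  have mvt: "\<exists>\<xi>. x < \<xi> \<and> \<xi> < y \<and> \<kappa> y - \<kappa> x = (y - x) * \<kappa>' \<xi>" if "x < y" for x y
    using MVT2[OF that, of \<kappa> \<kappa>'] k(1) by blast
  have D: "Dk_on k UNIV \<kappa>" for k
    using Dk_on_SucD[OF Dk_on_SucI[OF k(1) S]] .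
  have k'nn: "0 \<le> \<kappa>' x" for x using pos[of x] s(4)[of x] by (simp add: \<kappa>'_def)
  have lnmvt: "\<exists>\<xi>. x < \<xi> \<and> \<xi> < y \<and> (\<kappa> y - ln y / 2) - (\<kappa> x - ln x / 2) = (y - x) * (\<kappa>' \<xi> - 1 / (2 * \<xi>))"
    if "x < y" "0 < x" for x y
    using that by (intro MVT2) (auto intro!: derivative_eq_intros k(1))
  have lg: "\<kappa> x = ln x / 2" if "x \<ge> \<beta>" for x
  proof (cases "x = \<beta>")
    case False
    with that lnmvt[of \<beta> x] assms obtain \<xi> where xi: "\<beta> < \<xi>"
      "(\<kappa> x - ln x / 2) - (\<kappa> \<beta> - ln \<beta> / 2) = (x - \<beta>) * (\<kappa>' \<xi> - 1 / (2 * \<xi>))" by auto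
    have "\<kappa>' \<xi> = 1 / (2 * \<xi>)" using eq[of \<xi>] s(7)[of \<xi>] xi assms by (simp add: field_simps)
    with xi(2) k(2) show ?thesis by simp
  qed (use k in simp)
  have mono: "\<kappa> x \<le> \<kappa> y" if "x \<le> y" for x y
  proof (cases "x = y")
    case False
    with that mvt[of x y] obtain \<xi> where "\<kappa> y - \<kappa> x = (y - x) * \<kappa>' \<xi>" by auto
    moreover have "0 \<le> (y - x) * \<kappa>' \<xi>" using that k'nn[of \<xi>] by simp
    ultimately show ?thesis by simp
  qed simp
  have ge: "\<kappa> \<alpha> \<ge> ln \<alpha> / 2"
  proof -
    from lnmvt[of \<alpha> \<beta>] assms obtain \<xi> where xi: "\<alpha> < \<xi>" "\<xi> < \<beta>"
      "(\<kappa> \<beta> - ln \<beta> / 2) - (\<kappa> \<alpha> - ln \<alpha> / 2) = (\<beta> - \<alpha>) * (\<kappa>' \<xi> - 1 / (2 * \<xi>))" by auto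
    have "\<kappa>' \<xi> \<le> 1 / (2 * \<xi>)"
      using eq[of \<xi>] s(5)[of \<xi>] xi assms by (simp add: field_simps)
    hence "(\<beta> - \<alpha>) * (\<kappa>' \<xi> - 1 / (2 * \<xi>)) \<le> 0" using assms by (simp add: mult_nonneg_nonpos)
    with xi k(2) show ?thesis by simp
  qed
  have flat: "\<kappa> x = \<kappa> \<alpha>" if "x \<le> \<alpha>" for x
  proof (cases "x = \<alpha>")
    case False
    with that mvt[of x \<alpha>] obtain \<xi> where "\<xi> < \<alpha>" "\<kappa> \<alpha> - \<kappa> x = (\<alpha> - x) * \<kappa>' \<xi>" by auto
    with s(6)[of \<xi>] show ?thesis by (simp add: \<kappa>'_def)
  qed simp
  have ge': "\<kappa> x \<ge> ln \<alpha> / 2" for x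
    using ge flat[of x] mono[of \<alpha> x] by linarith
  have lap: "x * \<kappa>'' x + \<kappa>' x = \<sigma>' x / 2" for x
  proof -
    have "((\<lambda>x. x * \<kappa>' x) has_real_derivative x * \<kappa>'' x + \<kappa>' x) (at x)"
      by (auto intro!: derivative_eq_intros d(1))
    moreover have "((\<lambda>x. \<sigma> x / 2) has_real_derivative \<sigma>' x / 2) (at x)"
      by (auto intro!: derivative_eq_intros s)
    ultimately show ?thesis unfolding eq by (rule DERIV_unique)
  qed
  have c: "continuous_on UNIV \<sigma>'" using s(2)[of 0] by simp
  have up: "\<kappa> x \<le> ln \<beta> / 2" if "x \<le> \<beta>" for x using mono[OF that] k(2) by simp
  show ?thesis
  proof (rule that[of \<kappa> \<kappa>' \<kappa>'' \<sigma>' \<sigma>])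
    show "Dk_on k UNIV \<kappa>" for k by (rule D)
    show "(\<kappa> has_real_derivative \<kappa>' x) (at x)" for x by (rule k(1))
    show "(\<kappa>' has_real_derivative \<kappa>'' x) (at x)" for x by (rule d(1))
    show "\<kappa> x = ln x / 2" if "x \<ge> \<beta>" for x using that by (rule lg)
    show "\<kappa> x \<le> ln \<beta> / 2" if "x \<le> \<beta>" for x using that by (rule up)
    show "\<kappa> x \<ge> ln \<alpha> / 2" for x by (rule ge')
    show "x * \<kappa>'' x + \<kappa>' x = \<sigma>' x / 2" for x by (rule lap)
    show "(\<sigma> has_real_derivative \<sigma>' x) (at x)" for x by (rule s(3))
    show "continuous_on UNIV \<sigma>'" by (rule c)
    show "0 \<le> \<sigma>' x" for x by (rule s(8))
    show "\<sigma>' x = 0" if "x \<le> \<alpha> \<or> x \<ge> \<beta>" for x using that by (rule s(9))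
    show "\<sigma> x = 0" if "x \<le> \<alpha>" for x using that by (rule s(6))
    show "\<sigma> x = 1" if "x \<ge> \<beta>" for x using that by (rule s(7))
  qed
qed

subsection \<open>The Laplacian\<close>

lemma dir_deriv_add:
  assumes "f differentiable (at z)" "g differentiable (at z)"
  shows "dir_deriv v (\<lambda>w. f w + g w) z = dir_deriv v f z + dir_deriv v g z"
proof -
  from assms have "(f has_derivative frechet_derivative f (at z)) (at z)"
    "(g has_derivative frechet_derivative g (at z)) (at z)" by (simp_all add: frechet_derivative_works)
  from dir_deriv_eqI[OF has_derivative_add[OF this]] show ?thesis by (simp add: dir_deriv_def)
qed

lemma dir_deriv_mult:
  assumes "f differentiable (at z)" "g differentiable (at z)"
  shows "dir_deriv v (\<lambda>w. f w * g w) z = f z * dir_deriv v g z + dir_deriv v f z * g z"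
proof -
  from assms have "(f has_derivative frechet_derivative f (at z)) (at z)"
    "(g has_derivative frechet_derivative g (at z)) (at z)" by (simp_all add: frechet_derivative_works)
  from dir_deriv_eqI[OF has_derivative_mult[OF this]] show ?thesis by (simp add: dir_deriv_def)
qed

lemma dir_deriv_cmult:
  assumes "f differentiable (at z)"
  shows "dir_deriv v (\<lambda>w. c * f w) z = c * dir_deriv v f z"
  using dir_deriv_mult[of "\<lambda>_. c" z f v] assms dir_deriv_eqI[of "\<lambda>_. c" "\<lambda>_. 0" z v] by simp

lemma Ck2_differentiable:
  assumes "Ck_on 2 S f" "open S" "z \<in> S"
  shows "f differentiable (at z)" "dir_deriv 1 f differentiable (at z)" "dir_deriv \<i> f differentiable (at z)"
  using assms Ck_on_differentiable[of "Suc 0" S f z] Ck_on_differentiable[of 0 S "dir_deriv 1 f" z]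
    Ck_on_differentiable[of 0 S "dir_deriv \<i> f" z] by (auto simp: numeral_2_eq_2)

lemma laplacian_add:
  assumes "open S" "z \<in> S" "Ck_on 2 S f" "Ck_on 2 S g"
  shows "laplacian (\<lambda>w. f w + g w) z = laplacian f z + laplacian g z"
proof -
  note d = Ck2_differentiable[OF assms(3,1)] Ck2_differentiable[OF assms(4,1)]
  have "dir_deriv v (dir_deriv v (\<lambda>w. f w + g w)) z =
      dir_deriv v (dir_deriv v f) z + dir_deriv v (dir_deriv v g) z" if "v = 1 \<or> v = \<i>" for v
  proof -
    have "dir_deriv v (dir_deriv v (\<lambda>w. f w + g w)) z =
        dir_deriv v (\<lambda>w. dir_deriv v f w + dir_deriv v g w) z"
      by (intro dir_deriv_cong[OF assms(1,2)] dir_deriv_add d)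
    also have "\<dots> = dir_deriv v (dir_deriv v f) z + dir_deriv v (dir_deriv v g) z"
      using that d[OF assms(2)] by (intro dir_deriv_add) auto
    finally show ?thesis .
  qed
  thus ?thesis by (simp add: laplacian_def)
qed

lemma laplacian_cmult:
  assumes "open S" "z \<in> S" "Ck_on 2 S f"
  shows "laplacian (\<lambda>w. c * f w) z = c * laplacian f z"
proof -
  note d = Ck2_differentiable[OF assms(3,1)]
  have "dir_deriv v (dir_deriv v (\<lambda>w. c * f w)) z = c * dir_deriv v (dir_deriv v f) z"
    if "v = 1 \<or> v = \<i>" for v
  proof -
    have "dir_deriv v (dir_deriv v (\<lambda>w. c * f w)) z = dir_deriv v (\<lambda>w. c * dir_deriv v f w) z"
      by (intro dir_deriv_cong[OF assms(1,2)] dir_deriv_cmult d)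
    also have "\<dots> = c * dir_deriv v (dir_deriv v f) z"
      using that d[OF assms(2)] by (intro dir_deriv_cmult) auto
    finally show ?thesis .
  qed
  thus ?thesis by (simp add: laplacian_def algebra_simps)
qed

lemma laplacian_diff:
  assumes "open S" "z \<in> S" "Ck_on 2 S f" "Ck_on 2 S g"
  shows "laplacian (\<lambda>w. f w - g w) z = laplacian f z - laplacian g z"
  using laplacian_add[OF assms(1-3) Ck_on_cmult[OF assms(1,4), of "-1"]] laplacian_cmult[OF assms(1,2,4), of "-1"]
  by simp

lemma laplacian_const [simp]: "laplacian (\<lambda>_. c) z = 0"
  using laplacian_Re_holomorphic[of "\<lambda>_. of_real c" UNIV z] by simp

lemma laplacian_compose_real:
  assumes "open S" "z \<in> S" "Ck_on 2 S f" "\<And>w. w \<in> S \<Longrightarrow> f w \<in> I"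
    and p: "\<And>x. x \<in> I \<Longrightarrow> (p has_real_derivative p' x) (at x)"
      "\<And>x. x \<in> I \<Longrightarrow> (p' has_real_derivative p'' x) (at x)"
  shows "laplacian (\<lambda>w. p (f w)) z =
    p'' (f z) * ((dir_deriv 1 f z)\<^sup>2 + (dir_deriv \<i> f z)\<^sup>2) + p' (f z) * laplacian f z"
proof -
  note d = Ck2_differentiable[OF assms(3,1)]
  have D: "(f has_derivative (\<lambda>v. dir_deriv v f w)) (at w)" if "w \<in> S" for w
    using d(1)[OF that] unfolding dir_deriv_def frechet_derivative_works .
  have "dir_deriv v (dir_deriv v (\<lambda>w. p (f w))) z =
      p'' (f z) * (dir_deriv v f z)\<^sup>2 + p' (f z) * dir_deriv v (dir_deriv v f) z"
    if v: "v = 1 \<or> v = \<i>" for v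
  proof -
    have "dir_deriv v (dir_deriv v (\<lambda>w. p (f w))) z = dir_deriv v (\<lambda>w. p' (f w) * dir_deriv v f w) z"
      by (intro dir_deriv_cong[OF assms(1,2)] dir_deriv_eqI has_derivative_compose_real p D assms(4))
    also have "\<dots> = p' (f z) * dir_deriv v (dir_deriv v f) z + dir_deriv v (\<lambda>w. p' (f w)) z * dir_deriv v f z"
      using v d[OF assms(2)] has_derivative_compose_real[OF p(2)[OF assms(4)] D, OF assms(2,2)]
      by (intro dir_deriv_mult) (auto simp: differentiable_def)
    also have "dir_deriv v (\<lambda>w. p' (f w)) z = p'' (f z) * dir_deriv v f z"
      by (intro dir_deriv_eqI has_derivative_compose_real p D assms)
    finally show ?thesis by (simp add: power2_eq_square algebra_simps)
  qed
  thus ?thesis by (simp add: laplacian_def algebra_simps)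
qed

text \<open>The last three hypotheses say that the components of h have orthogonal gradients of
  equal length; J is the squared conformal factor. In this form the orientation does not matter,
  which is essential because the transition map 1/cnj w between the charts reverses it.\<close>

lemma laplacian_compose_plane:
  assumes "open S" "z \<in> S" "open T" "h ` S \<subseteq> T" "Ck_on 2 T f"
    and "Ck_on 2 S (\<lambda>w. Re (h w))" "Ck_on 2 S (\<lambda>w. Im (h w))"
    and "laplacian (\<lambda>w. Re (h w)) z = 0" "laplacian (\<lambda>w. Im (h w)) z = 0"
    and "(dir_deriv 1 (\<lambda>w. Re (h w)) z)\<^sup>2 + (dir_deriv \<i> (\<lambda>w. Re (h w)) z)\<^sup>2 = J"
    and "(dir_deriv 1 (\<lambda>w. Im (h w)) z)\<^sup>2 + (dir_deriv \<i> (\<lambda>w. Im (h w)) z)\<^sup>2 = J"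
    and "dir_deriv 1 (\<lambda>w. Re (h w)) z * dir_deriv 1 (\<lambda>w. Im (h w)) z +
         dir_deriv \<i> (\<lambda>w. Re (h w)) z * dir_deriv \<i> (\<lambda>w. Im (h w)) z = 0"
  shows "laplacian (\<lambda>w. f (h w)) z = J * laplacian f (h z)"
proof -
  let ?p = "\<lambda>w. Re (h w)" and ?q = "\<lambda>w. Im (h w)"
  note df = Ck2_differentiable[OF assms(5,3)]
  note dp = Ck2_differentiable[OF assms(6,1)] and dq = Ck2_differentiable[OF assms(7,1)]
  have hT: "h w \<in> T" if "w \<in> S" for w using that assms(4) by auto
  have D: "((\<lambda>w. F (h w)) has_derivative
      (\<lambda>v. dir_deriv 1 F (h w) * dir_deriv v ?p w + dir_deriv \<i> F (h w) * dir_deriv v ?q w)) (at w)"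
    if "w \<in> S" "F differentiable (at (h w))" for w F
    by (rule has_derivative_compose_plane[where h = h and f = F, OF _ _ that(2)])
       (use dp(1)[OF that(1)] dq(1)[OF that(1)] in \<open>simp_all add: dir_deriv_def frechet_derivative_works\<close>)
  have *: "dir_deriv v (dir_deriv v (\<lambda>w. f (h w))) z =
      (dir_deriv 1 (dir_deriv 1 f) (h z) * dir_deriv v ?p z + dir_deriv \<i> (dir_deriv 1 f) (h z) * dir_deriv v ?q z) * dir_deriv v ?p z
      + dir_deriv 1 f (h z) * dir_deriv v (dir_deriv v ?p) z
      + (dir_deriv 1 (dir_deriv \<i> f) (h z) * dir_deriv v ?p z + dir_deriv \<i> (dir_deriv \<i> f) (h z) * dir_deriv v ?q z) * dir_deriv v ?q z
      + dir_deriv \<i> f (h z) * dir_deriv v (dir_deriv v ?q) z"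
    if v: "v = 1 \<or> v = \<i>" for v
  proof -
    have d1: "(\<lambda>w. dir_deriv 1 f (h w)) differentiable (at z)" "(\<lambda>w. dir_deriv \<i> f (h w)) differentiable (at z)"
      using D[OF assms(2)] df[OF hT[OF assms(2)]] by (auto simp: differentiable_def)
    have d2: "dir_deriv v ?p differentiable (at z)" "dir_deriv v ?q differentiable (at z)"
      using v dp[OF assms(2)] dq[OF assms(2)] by auto
    have "dir_deriv v (dir_deriv v (\<lambda>w. f (h w))) z =
       dir_deriv v (\<lambda>w. dir_deriv 1 f (h w) * dir_deriv v ?p w + dir_deriv \<i> f (h w) * dir_deriv v ?q w) z"
      by (intro dir_deriv_cong[OF assms(1,2)] dir_deriv_eqI[OF D] df hT)
    also have "\<dots> = dir_deriv v (\<lambda>w. dir_deriv 1 f (h w) * dir_deriv v ?p w) z +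
        dir_deriv v (\<lambda>w. dir_deriv \<i> f (h w) * dir_deriv v ?q w) z"
      by (intro dir_deriv_add differentiable_mult d1 d2)
    also have "dir_deriv v (\<lambda>w. dir_deriv 1 f (h w) * dir_deriv v ?p w) z =
        dir_deriv 1 f (h z) * dir_deriv v (dir_deriv v ?p) z + dir_deriv v (\<lambda>w. dir_deriv 1 f (h w)) z * dir_deriv v ?p z"
      by (intro dir_deriv_mult d1 d2)
    also have "dir_deriv v (\<lambda>w. dir_deriv \<i> f (h w) * dir_deriv v ?q w) z =
        dir_deriv \<i> f (h z) * dir_deriv v (dir_deriv v ?q) z + dir_deriv v (\<lambda>w. dir_deriv \<i> f (h w)) z * dir_deriv v ?q z"
      by (intro dir_deriv_mult d1 d2)
    also have "dir_deriv v (\<lambda>w. dir_deriv 1 f (h w)) z =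
        dir_deriv 1 (dir_deriv 1 f) (h z) * dir_deriv v ?p z + dir_deriv \<i> (dir_deriv 1 f) (h z) * dir_deriv v ?q z"
      by (intro dir_deriv_eqI[OF D] df hT assms)
    also have "dir_deriv v (\<lambda>w. dir_deriv \<i> f (h w)) z =
        dir_deriv 1 (dir_deriv \<i> f) (h z) * dir_deriv v ?p z + dir_deriv \<i> (dir_deriv \<i> f) (h z) * dir_deriv v ?q z"
      by (intro dir_deriv_eqI[OF D] df hT assms)
    finally show ?thesis by (simp add: algebra_simps)
  qed
  let ?A = "dir_deriv 1 (dir_deriv 1 f) (h z)" and ?B = "dir_deriv \<i> (dir_deriv 1 f) (h z)"
  let ?C = "dir_deriv 1 (dir_deriv \<i> f) (h z)" and ?E = "dir_deriv \<i> (dir_deriv \<i> f) (h z)"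
  have "laplacian (\<lambda>w. f (h w)) z =
     ?A * ((dir_deriv 1 ?p z)\<^sup>2 + (dir_deriv \<i> ?p z)\<^sup>2) + ?E * ((dir_deriv 1 ?q z)\<^sup>2 + (dir_deriv \<i> ?q z)\<^sup>2)
     + (?B + ?C) * (dir_deriv 1 ?p z * dir_deriv 1 ?q z + dir_deriv \<i> ?p z * dir_deriv \<i> ?q z)
     + dir_deriv 1 f (h z) * laplacian ?p z + dir_deriv \<i> f (h z) * laplacian ?q z"
    unfolding laplacian_def *[of 1, simplified] *[of \<i>, simplified]
    by (simp add: power2_eq_square algebra_simps)
  also have "\<dots> = J * laplacian f (h z)"
    unfolding assms(8-12) by (simp add: laplacian_def algebra_simps)
  finally show ?thesis .
qed

lemma Ck_on_norm_sq: "Ck_on k UNIV (\<lambda>z. (norm (z - a))\<^sup>2)"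
proof -
  have "Ck_on k UNIV (\<lambda>z. (Re z - Re a) * (Re z - Re a) + (Im z - Im a) * (Im z - Im a))"
    by (intro Ck_on_add Ck_on_mult Ck_on_diff) auto
  thus ?thesis by (simp add: cmod_def power2_eq_square)
qed

lemma dir_deriv_norm_sq: "dir_deriv v (\<lambda>z. (norm (z - a))\<^sup>2) z = 2 * ((z - a) \<bullet> v)"
  unfolding power2_norm_eq_inner
  by (rule dir_deriv_eqI) (auto intro!: derivative_eq_intros simp: inner_commute)

lemma laplacian_norm_sq: "laplacian (\<lambda>z. (norm (z - a))\<^sup>2) z = 4"
proof -
  have "dir_deriv v (\<lambda>z. 2 * ((z - a) \<bullet> v)) z = 2 * (v \<bullet> v)" for v
    by (rule dir_deriv_eqI) (auto intro!: derivative_eq_intros simp: inner_commute)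
  hence "laplacian (\<lambda>z. (norm (z - a))\<^sup>2) z = 2 * (1 \<bullet> (1::complex)) + 2 * (\<i> \<bullet> \<i>)"
    by (simp only: laplacian_def dir_deriv_norm_sq[abs_def])
  thus ?thesis by simp
qed

text \<open>The gradient of |z - a|^2 has squared length 4 |z - a|^2 and its Laplacian is 4.
  Profiles in the squared modulus are smooth at the centre too.\<close>

lemma laplacian_radial:
  assumes "\<And>x. (p has_real_derivative p' x) (at x)" "\<And>x. (p' has_real_derivative p'' x) (at x)"
  shows "laplacian (\<lambda>z. p ((norm (z - a))\<^sup>2)) z =
    4 * ((norm (z - a))\<^sup>2 * p'' ((norm (z - a))\<^sup>2) + p' ((norm (z - a))\<^sup>2))"
proof -
  have *: "(2 * ((z - a) \<bullet> 1))\<^sup>2 + (2 * ((z - a) \<bullet> \<i>))\<^sup>2 = 4 * (norm (z - a))\<^sup>2"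
    unfolding cmod_power2 by (simp add: inner_complex_def power2_eq_square algebra_simps)
  have "laplacian (\<lambda>z. p ((norm (z - a))\<^sup>2)) z =
     p'' ((norm (z - a))\<^sup>2) * (4 * (norm (z - a))\<^sup>2) + p' ((norm (z - a))\<^sup>2) * 4"
    using laplacian_compose_real[OF open_UNIV UNIV_I Ck_on_norm_sq UNIV_I assms, of a z]
    by (simp only: dir_deriv_norm_sq laplacian_norm_sq *)
  thus ?thesis by (simp add: algebra_simps)
qed

section \<open>Harmonic functions in the plane\<close>

lemma has_real_derivative_along:
  assumes "v differentiable (at (w + of_real x * p))"
  shows "((\<lambda>x. v (w + of_real x * p)) has_real_derivative dir_deriv p v (w + of_real x * p)) (at x)"
proof -
  let ?L = "frechet_derivative v (at (w + of_real x * p))"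
  have L: "(v has_derivative ?L) (at (w + of_real x * p))"
    using assms by (simp add: frechet_derivative_works)
  have "((\<lambda>x. w + of_real x * p) has_derivative (\<lambda>t. of_real t * p)) (at x)"
    by (auto intro!: derivative_eq_intros)
  from has_derivative_compose[OF this L]
  have "((\<lambda>x. v (w + of_real x * p)) has_derivative (\<lambda>t. ?L (of_real t * p))) (at x)" .
  moreover have "?L (of_real t * p) = t * ?L p" for t
    using linear_cmul[OF linear_frechet_derivative[OF assms], of t p] by (simp add: scaleR_conv_of_real)
  ultimately show ?thesis
    unfolding has_field_derivative_def dir_deriv_def by (simp add: mult.commute[of _ "?L p"])
qed

text \<open>The mean value theorem is applied to the second difference over a parallelogram, in
  direction p and then in direction q. The second difference is symmetric in p and q, so the two
  orders can be compared.\<close>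

lemma mixed_increment:
  assumes S: "open S" and v: "\<And>z. z \<in> S \<Longrightarrow> v differentiable (at z)"
    "\<And>z. z \<in> S \<Longrightarrow> dir_deriv p v differentiable (at z)" and h: "h > 0"
    and sub: "\<And>x y. 0 \<le> x \<Longrightarrow> x \<le> h \<Longrightarrow> 0 \<le> y \<Longrightarrow> y \<le> h \<Longrightarrow> a + of_real x * p + of_real y * q \<in> S"
  obtains \<xi> \<eta> where "0 < \<xi>" "\<xi> < h" "0 < \<eta>" "\<eta> < h"
    "v (a + of_real h * p + of_real h * q) - v (a + of_real h * q) - (v (a + of_real h * p) - v a)
      = h * h * dir_deriv q (dir_deriv p v) (a + of_real \<xi> * p + of_real \<eta> * q)"
proof -
  let ?F = "\<lambda>x. v ((a + of_real h * q) + of_real x * p) - v (a + of_real x * p)"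
  let ?F' = "\<lambda>x. dir_deriv p v ((a + of_real h * q) + of_real x * p) - dir_deriv p v (a + of_real x * p)"
  have "\<exists>\<xi>. 0 < \<xi> \<and> \<xi> < h \<and> ?F h - ?F 0 = (h - 0) * ?F' \<xi>"
  proof (rule MVT2[OF h])
    fix x assume x: "0 \<le> x" "x \<le> h"
    have "(a + of_real h * q) + of_real x * p \<in> S" "a + of_real x * p \<in> S"
      using sub[OF x, of h] sub[OF x, of 0] h by (auto simp: algebra_simps)
    thus "(?F has_real_derivative ?F' x) (at x)"
      by (intro DERIV_diff has_real_derivative_along v)
  qed
  then obtain \<xi> where xi: "0 < \<xi>" "\<xi> < h" "?F h - ?F 0 = h * ?F' \<xi>" by auto
  let ?G = "\<lambda>y. dir_deriv p v ((a + of_real \<xi> * p) + of_real y * q)"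
  have "\<exists>\<eta>. 0 < \<eta> \<and> \<eta> < h \<and> ?G h - ?G 0 = (h - 0) * dir_deriv q (dir_deriv p v) ((a + of_real \<xi> * p) + of_real \<eta> * q)"
  proof (rule MVT2[OF h])
    fix y assume y: "0 \<le> y" "y \<le> h"
    have "a + of_real \<xi> * p + of_real y * q \<in> S" using sub[of \<xi> y] xi y by auto
    thus "(?G has_real_derivative dir_deriv q (dir_deriv p v) ((a + of_real \<xi> * p) + of_real y * q)) (at y)"
      by (intro has_real_derivative_along v)
  qed
  then obtain \<eta> where eta: "0 < \<eta>" "\<eta> < h"
    "?G h - ?G 0 = h * dir_deriv q (dir_deriv p v) (a + of_real \<xi> * p + of_real \<eta> * q)" by auto
  show ?thesis
    by (rule that[OF xi(1,2) eta(1,2)]) (use xi(3) eta(3) in \<open>simp add: algebra_simps\<close>)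
qed

text \<open>Both orders of differentiation evaluate the same second difference over a small square,
  so the mixed derivatives agree at two points near z. Continuity then excludes a gap at z.\<close>

lemma mixed_partials_commute:
  assumes S: "open S" "z \<in> S" and v: "Ck_on 2 S v"
  shows "dir_deriv 1 (dir_deriv \<i> v) z = dir_deriv \<i> (dir_deriv 1 v) z"
proof (rule ccontr)
  let ?A = "dir_deriv \<i> (dir_deriv 1 v)" and ?B = "dir_deriv 1 (dir_deriv \<i> v)"
  assume ne: "?B z \<noteq> ?A z"
  note d = Ck2_differentiable[OF v S(1)]
  have "continuous_on S ?A" "continuous_on S ?B" using v by (auto simp: numeral_2_eq_2)
  hence cont: "isCont ?A z" "isCont ?B z" using S by (auto simp: continuous_on_eq_continuous_at)
  define e where "e = \<bar>?A z - ?B z\<bar> / 2"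
  have e: "e > 0" using ne by (simp add: e_def)
  obtain d1 where d1: "d1 > 0" "\<And>w. dist w z < d1 \<Longrightarrow> \<bar>?A w - ?A z\<bar> < e"
    using cont(1) e unfolding continuous_at_eps_delta by (auto simp: dist_real_def)
  obtain d2 where d2: "d2 > 0" "\<And>w. dist w z < d2 \<Longrightarrow> \<bar>?B w - ?B z\<bar> < e"
    using cont(2) e unfolding continuous_at_eps_delta by (auto simp: dist_real_def)
  obtain d3 where d3: "d3 > 0" "ball z d3 \<subseteq> S" using S open_contains_ball by blast
  \<comment> \<open>Points of the square are at distance at most 2h from z; the third keeps 2h
    strictly below all three radii.\<close>
  define h where "h = min d1 (min d2 d3) / 3"
  have h: "h > 0" using d1 d2 d3 by (simp add: h_def)
  have close: "dist (z + of_real x * p + of_real y * q) z < min d1 (min d2 d3)"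
    if "0 \<le> x" "x \<le> h" "0 \<le> y" "y \<le> h" "norm p = 1" "norm q = 1" for x y p q
  proof -
    have "norm (of_real x * p + of_real y * q) \<le> x + y"
      using that by (intro order.trans[OF norm_triangle_ineq]) (simp add: norm_mult)
    also have "\<dots> < min d1 (min d2 d3)" using that h by (simp add: h_def)
    finally show ?thesis by (simp add: dist_norm add.assoc)
  qed
  have sub: "z + of_real x * p + of_real y * q \<in> S"
    if "0 \<le> x" "x \<le> h" "0 \<le> y" "y \<le> h" "norm p = 1" "norm q = 1" for x y p q
    using close[OF that] d3(2) by (auto simp: dist_commute subset_iff)
  have s1: "z + of_real x * 1 + of_real y * \<i> \<in> S" and s2: "z + of_real x * \<i> + of_real y * 1 \<in> S"
    if "0 \<le> x" "x \<le> h" "0 \<le> y" "y \<le> h" for x y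
    by (rule sub[OF that]; simp)+
  obtain \<xi> \<eta> where 1: "0 < \<xi>" "\<xi> < h" "0 < \<eta>" "\<eta> < h"
    "v (z + of_real h * 1 + of_real h * \<i>) - v (z + of_real h * \<i>) - (v (z + of_real h * 1) - v z)
      = h * h * ?A (z + of_real \<xi> * 1 + of_real \<eta> * \<i>)"
    by (rule mixed_increment[where S = S and v = v and a = z and h = h and p = 1 and q = \<i>])
       (use S d h s1 in blast)+
  obtain \<xi>' \<eta>' where 2: "0 < \<xi>'" "\<xi>' < h" "0 < \<eta>'" "\<eta>' < h"
    "v (z + of_real h * \<i> + of_real h * 1) - v (z + of_real h * 1) - (v (z + of_real h * \<i>) - v z)
      = h * h * ?B (z + of_real \<xi>' * \<i> + of_real \<eta>' * 1)"
    by (rule mixed_increment[where S = S and v = v and a = z and h = h and p = \<i> and q = 1])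
       (use S d h s2 in blast)+
  have "h * h * ?A (z + of_real \<xi> * 1 + of_real \<eta> * \<i>) = h * h * ?B (z + of_real \<xi>' * \<i> + of_real \<eta>' * 1)"
    unfolding 1(5)[symmetric] 2(5)[symmetric] by (simp add: algebra_simps)
  hence eq: "?A (z + of_real \<xi> * 1 + of_real \<eta> * \<i>) = ?B (z + of_real \<xi>' * \<i> + of_real \<eta>' * 1)"
    using h by simp
  have "\<bar>?A (z + of_real \<xi> * 1 + of_real \<eta> * \<i>) - ?A z\<bar> < e"
    using close[of \<xi> \<eta> 1 \<i>] 1 by (intro d1(2)) auto
  moreover have "\<bar>?B (z + of_real \<xi>' * \<i> + of_real \<eta>' * 1) - ?B z\<bar> < e"
    using close[of \<xi>' \<eta>' \<i> 1] 2 by (intro d2(2)) auto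
  ultimately show False using eq unfolding e_def by (auto simp: abs_if split: if_splits)
qed

text \<open>Of the Cauchy-Riemann equations for v_x - \<i> v_y one is the Laplace equation and the
  other the symmetry of the mixed derivatives.\<close>

lemma harmonic_complex_gradient:
  assumes S: "open S" and v: "planar_harmonic_on S v"
  shows "(\<lambda>w. Complex (dir_deriv 1 v w) (- dir_deriv \<i> v w)) holomorphic_on S"
proof (rule holomorphic_onI)
  fix z assume z: "z \<in> S"
  have v2: "Ck_on 2 S v" and lap: "laplacian v z = 0" using v z by (auto simp: planar_harmonic_on_def)
  note d = Ck2_differentiable[OF v2 S z]
  let ?A = "dir_deriv 1 (dir_deriv 1 v) z" and ?B = "dir_deriv \<i> (dir_deriv 1 v) z"
  have D: "(F has_derivative (\<lambda>u. Re u * dir_deriv 1 F z + Im u * dir_deriv \<i> F z)) (at z)"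
    if "F differentiable (at z)" for F
  proof -
    have "(F has_derivative (\<lambda>u. dir_deriv u F z)) (at z)"
      using that unfolding dir_deriv_def frechet_derivative_works .
    thus ?thesis by (subst (asm) dir_deriv_decompose[OF that])
  qed
  have c: "((\<lambda>w. Re (Complex (dir_deriv 1 v w) (- dir_deriv \<i> v w))) has_derivative
      (\<lambda>u. Re u * ?A + Im u * ?B)) (at z)"
    using D[OF d(2)] by simp
  have yy: "dir_deriv \<i> (dir_deriv \<i> v) z = - ?A" using lap by (simp add: laplacian_def)
  have "((\<lambda>w. - dir_deriv \<i> v w) has_derivative (\<lambda>u. - (Re u * ?B + Im u * (- ?A)))) (at z)"
    using has_derivative_minus[OF D[OF d(3)]] unfolding yy mixed_partials_commute[OF S z v2] .
  hence "((\<lambda>w. Im (Complex (dir_deriv 1 v w) (- dir_deriv \<i> v w))) has_derivative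
      (\<lambda>u. - (Re u * ?B + Im u * (- ?A)))) (at z)" by simp
  from has_derivative_complex_components[OF c this]
  have "((\<lambda>w. Complex (dir_deriv 1 v w) (- dir_deriv \<i> v w)) has_derivative
      (\<lambda>u. Complex (Re u * ?A + Im u * ?B) (- (Re u * ?B + Im u * (- ?A))))) (at z)" .
  moreover have "(\<lambda>u. Complex (Re u * ?A + Im u * ?B) (- (Re u * ?B + Im u * (- ?A)))) = (*) (Complex ?A (- ?B))"
    by (auto simp: complex_eq_iff algebra_simps)
  ultimately have "((\<lambda>w. Complex (dir_deriv 1 v w) (- dir_deriv \<i> v w)) has_field_derivative Complex ?A (- ?B)) (at z)"
    by (simp add: has_field_derivative_def)
  thus "(\<lambda>w. Complex (dir_deriv 1 v w) (- dir_deriv \<i> v w)) field_differentiable at z within S"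
    using field_differentiable_at_within field_differentiable_def by blast
qed

lemma has_derivative_complex_gradient:
  assumes "v differentiable (at z)"
  shows "(v has_derivative (\<lambda>u. Re (Complex (dir_deriv 1 v z) (- dir_deriv \<i> v z) * u))) (at z)"
proof -
  have "(v has_derivative (\<lambda>u. dir_deriv u v z)) (at z)"
    using assms unfolding dir_deriv_def frechet_derivative_works .
  thus ?thesis by (subst (asm) dir_deriv_decompose[OF assms]) (simp add: mult.commute)
qed

text \<open>On a disc the complex gradient has a primitive, whose real part has the same
  differential as v. The difference is constant by convexity.\<close>

lemma harmonic_eq_Re_holomorphic:
  assumes "planar_harmonic_on (ball a r) v"
  obtains P where "P holomorphic_on ball a r" "\<And>w. w \<in> ball a r \<Longrightarrow> v w = Re (P w)"
proof (cases "r > 0")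
  case r: True
  let ?f = "\<lambda>w. Complex (dir_deriv 1 v w) (- dir_deriv \<i> v w)"
  obtain P where P: "\<And>w. w \<in> ball a r \<Longrightarrow> (P has_field_derivative ?f w) (at w within ball a r)"
    using holomorphic_convex_primitive'[OF convex_ball open_ball harmonic_complex_gradient[OF open_ball assms]] by blast
  have P': "(P has_field_derivative ?f w) (at w)" if "w \<in> ball a r" for w
    using P[OF that] that by (simp add: at_within_open[OF _ open_ball])
  have vd: "v differentiable (at w)" if "w \<in> ball a r" for w
    using assms that Ck2_differentiable(1)[OF _ open_ball] by (auto simp: planar_harmonic_on_def)
  have "((\<lambda>w. v w - Re (P w)) has_derivative (\<lambda>_. 0)) (at w within ball a r)" if "w \<in> ball a r" for w
  proof -
    have "((\<lambda>w. v w - Re (P w)) has_derivative (\<lambda>u. Re (?f w * u) - Re (?f w * u))) (at w)"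
      using P'[OF that] unfolding has_field_derivative_def
      by (intro has_derivative_diff has_derivative_complex_gradient vd that has_derivative_Re)
    thus ?thesis by (simp add: has_derivative_at_withinI)
  qed
  from has_derivative_zero_constant[OF convex_ball this]
  obtain c where c: "\<And>w. w \<in> ball a r \<Longrightarrow> v w - Re (P w) = c" by blast
  have "P holomorphic_on ball a r" unfolding holomorphic_on_open[OF open_ball] using P' by blast
  hence "(\<lambda>w. P w + of_real c) holomorphic_on ball a r" by (intro holomorphic_intros)
  moreover have "v w = Re (P w + of_real c)" if "w \<in> ball a r" for w using c[OF that] by simp
  ultimately show ?thesis using that by blast
next
  case False
  hence "ball a r = {}" by simp
  show ?thesis by (rule that[of "\<lambda>_. 0"]) (use \<open>ball a r = {}\<close> in auto)
qed

lemma planar_harmonic_on_subset: "planar_harmonic_on S v \<Longrightarrow> T \<subseteq> S \<Longrightarrow> planar_harmonic_on T v"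
  by (auto simp: planar_harmonic_on_def intro: Ck_on_subset)

text \<open>Harmonicity is defined with class C^2 only, while test functions built from the Green
  function must be smooth of every order; the local real-part representation bridges this.\<close>

lemma planar_harmonic_on_smooth:
  assumes "planar_harmonic_on S v" "open S"
  shows "Ck_on k S v"
proof (rule Ck_on_local)
  fix z assume "z \<in> S"
  then obtain r where r: "r > 0" "ball z r \<subseteq> S" using assms(2) open_contains_ball by blast
  obtain P where P: "P holomorphic_on ball z r" "\<And>w. w \<in> ball z r \<Longrightarrow> v w = Re (P w)"
    using harmonic_eq_Re_holomorphic[OF planar_harmonic_on_subset[OF assms(1) r(2)]] by blast
  have "Ck_on k (ball z r) v \<longleftrightarrow> Ck_on k (ball z r) (\<lambda>w. Re (P w))"
    by (intro Ck_on_cong open_ball P(2))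
  hence "Ck_on k (ball z r) v" using Ck_on_Re_holomorphic[OF P(1) open_ball] by simp
  with r show "\<exists>V. open V \<and> z \<in> V \<and> Ck_on k V v" by (intro exI[of _ "ball z r"]) auto
qed

lemma planar_harmonic_on_Re_holomorphic:
  "f holomorphic_on S \<Longrightarrow> open S \<Longrightarrow> planar_harmonic_on S (\<lambda>w. Re (f w))"
  unfolding planar_harmonic_on_def using Ck_on_Re_holomorphic laplacian_Re_holomorphic by blast

lemma planar_harmonic_on_cong:
  assumes "open S" "\<And>w. w \<in> S \<Longrightarrow> f w = g w"
  shows "planar_harmonic_on S f \<longleftrightarrow> planar_harmonic_on S g"
  unfolding planar_harmonic_on_def
  using Ck_on_cong[OF assms] laplacian_cong[OF assms(1) _ assms(2)] by auto

lemma planar_harmonic_on_add: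
  assumes "open S" "planar_harmonic_on S f" "planar_harmonic_on S g"
  shows "planar_harmonic_on S (\<lambda>w. f w + g w)"
  using assms laplacian_add[OF assms(1)] by (auto simp: planar_harmonic_on_def intro!: Ck_on_add)

section \<open>The logarithmic pole and the minimum principle\<close>

lemma Dk_on_ln: "Dk_on k {0<..} ln"
proof (cases k)
  case 0
  thus ?thesis by (auto intro!: continuous_intros)
next
  case (Suc n)
  have "Dk_on n {0<..} inverse" by (rule Dk_on_inverse) auto
  thus ?thesis unfolding Suc by (rule Dk_on_SucI[rotated]) (auto intro: DERIV_ln)
qed

lemma planar_harmonic_on_ln_norm: "planar_harmonic_on (- {a}) (\<lambda>w. ln (norm (w - a)))"
proof -
  let ?s = "\<lambda>w. (norm (w - a))\<^sup>2"
  have C: "Ck_on k (- {a}) ?s" for k by (rule Ck_on_subset[OF Ck_on_norm_sq]) auto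
  have eq: "1 / 2 * ln (?s w) = ln (norm (w - a))" if "w \<in> - {a}" for w
    using that by (simp add: ln_realpow)
  have "Ck_on 2 (- {a}) (\<lambda>w. 1 / 2 * ln (?s w))"
    by (intro Ck_on_cmult Ck_on_compose_real[where I = "{0<..}" and p = ln] Dk_on_ln C) auto
  moreover have "laplacian (\<lambda>w. 1 / 2 * ln (?s w)) z = 0" if "z \<in> - {a}" for z
  proof -
    have n: "?s z \<noteq> 0" using that by auto
    have sq: "(dir_deriv 1 ?s z)\<^sup>2 + (dir_deriv \<i> ?s z)\<^sup>2 = 4 * ?s z"
      unfolding dir_deriv_norm_sq by (subst cmod_power2) (simp add: inner_complex_def power2_eq_square algebra_simps)
    have "laplacian (\<lambda>w. 1 / 2 * ln (?s w)) z =
       - (1 / (2 * (?s z)\<^sup>2)) * ((dir_deriv 1 ?s z)\<^sup>2 + (dir_deriv \<i> ?s z)\<^sup>2) + 1 / (2 * ?s z) * laplacian ?s z"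
      by (rule laplacian_compose_real[of "- {a}" _ _ "{0<..}" "\<lambda>x. 1 / 2 * ln x" "\<lambda>x. 1 / (2 * x)" "\<lambda>x. - (1 / (2 * x\<^sup>2))"])
         (use that C in \<open>auto intro!: derivative_eq_intros simp: power2_eq_square field_simps\<close>)
    also have "\<dots> = 0" unfolding sq laplacian_norm_sq using n by (simp add: field_simps power2_eq_square)
    finally show ?thesis .
  qed
  ultimately have "planar_harmonic_on (- {a}) (\<lambda>w. 1 / 2 * ln (?s w))"
    by (simp add: planar_harmonic_on_def)
  moreover have "planar_harmonic_on (- {a}) (\<lambda>w. 1 / 2 * ln (?s w)) \<longleftrightarrow>
      planar_harmonic_on (- {a}) (\<lambda>w. ln (norm (w - a)))"
    by (intro planar_harmonic_on_cong eq) auto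
  ultimately show ?thesis by blast
qed

text \<open>If v = Re P, then |exp(-P)| = exp(-v) is maximal at the centre, and the maximum modulus
  principle applies.\<close>

lemma harmonic_local_min_constant:
  assumes v: "planar_harmonic_on (ball a r) v" and r: "r > 0" and min: "\<And>w. w \<in> ball a r \<Longrightarrow> v a \<le> v w"
    and w: "w \<in> ball a r"
  shows "v w = v a"
proof -
  obtain P where P: "P holomorphic_on ball a r" "\<And>w. w \<in> ball a r \<Longrightarrow> v w = Re (P w)"
    using harmonic_eq_Re_holomorphic[OF v] by blast
  have "(\<lambda>w. exp (- P w)) constant_on ball a r"
  proof (rule maximum_modulus_principle[where U = "ball a r" and \<xi> = a])
    show "(\<lambda>w. exp (- P w)) holomorphic_on ball a r" by (intro holomorphic_intros P)
    show "\<And>z. z \<in> ball a r \<Longrightarrow> norm (exp (- P z)) \<le> norm (exp (- P a))"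
      using min P(2) r by simp
  qed (use r in auto)
  then obtain c where "\<And>z. z \<in> ball a r \<Longrightarrow> exp (- P z) = c" by (auto simp: constant_on_def)
  hence "norm (exp (- P w)) = norm (exp (- P a))" using w r by simp
  thus ?thesis using P(2) w r by simp
qed

subsection \<open>Removing a bounded singularity\<close>

text \<open>The harmonic conjugate of v is multivalued around the puncture. Lifted by exp to a
  half-plane, the complex gradient has a primitive P whose increment over the period 2 \<pi> \<i> is
  an imaginary constant. Exponentiating and correcting by a linear term gives a periodic function,
  hence a holomorphic q on the punctured disc with |q| = exp(v) |z - a|^(-m). Boundedness of v in
  both directions forces m to be an integer; then q (z - a)^m extends without zeros, and its
  logarithm has real part v.\<close>

lemma harmonic_removable_singularity:
  assumes r: "r > 0" and v: "planar_harmonic_on (ball a r - {a}) v"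
    and B: "\<And>w. w \<in> ball a r - {a} \<Longrightarrow> \<bar>v w\<bar> \<le> B"
  obtains P where "P holomorphic_on ball a r" "\<And>w. w \<in> ball a r - {a} \<Longrightarrow> v w = Re (P w)"
proof -
  define H where "H = {w. Re w < ln r}"
  have openA: "open (ball a r - {a})" by auto
  have H: "open H" "convex H"
    unfolding H_def by (rule open_halfspace_Re_lt, rule convex_halfspace_Re_lt)
  have exp_in: "a + exp w \<in> ball a r - {a}" if "w \<in> H" for w
  proof -
    have "exp (Re w) < r" using that r by (simp add: H_def flip: ln_less_cancel_iff[of "exp (Re w)"])
    thus ?thesis by (simp add: dist_norm)
  qed
  let ?f = "\<lambda>w. Complex (dir_deriv 1 v w) (- dir_deriv \<i> v w)"
  have f: "?f holomorphic_on ball a r - {a}" by (rule harmonic_complex_gradient[OF openA v])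
  have "(?f \<circ> (\<lambda>w. a + exp w)) holomorphic_on H"
    by (rule holomorphic_on_compose_gen[OF _ f]) (auto intro!: holomorphic_intros exp_in)
  hence "(\<lambda>w. ?f (a + exp w) * exp w) holomorphic_on H" unfolding o_def
    by (intro holomorphic_intros)
  then obtain P where P: "\<And>w. w \<in> H \<Longrightarrow> (P has_field_derivative ?f (a + exp w) * exp w) (at w within H)"
    using holomorphic_convex_primitive'[OF H(2,1)] by blast
  have P': "(P has_field_derivative ?f (a + exp w) * exp w) (at w)" if "w \<in> H" for w
    using P[OF that] that by (simp add: at_within_open[OF _ H(1)])
  have vd: "v differentiable (at w)" if "w \<in> ball a r - {a}" for w
    using v that Ck2_differentiable(1)[OF _ openA] by (auto simp: planar_harmonic_on_def)
  have "((\<lambda>w. v (a + exp w) - Re (P w)) has_derivative (\<lambda>_. 0)) (at w within H)" if "w \<in> H" for w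
  proof -
    have "((\<lambda>w. a + exp w) has_derivative (\<lambda>u. exp w * u)) (at w)"
      by (auto intro!: derivative_eq_intros simp: mult.commute)
    from has_derivative_compose[OF this has_derivative_complex_gradient[OF vd[OF exp_in[OF that]]]]
    have "((\<lambda>w. v (a + exp w)) has_derivative (\<lambda>u. Re (?f (a + exp w) * (exp w * u)))) (at w)" .
    moreover have "((\<lambda>w. Re (P w)) has_derivative (\<lambda>u. Re (?f (a + exp w) * exp w * u))) (at w)"
      using P'[OF that] unfolding has_field_derivative_def by (rule has_derivative_Re)
    ultimately have "((\<lambda>w. v (a + exp w) - Re (P w)) has_derivative
        (\<lambda>u. Re (?f (a + exp w) * (exp w * u)) - Re (?f (a + exp w) * exp w * u))) (at w)"
      by (rule has_derivative_diff)
    thus ?thesis by (simp add: has_derivative_at_withinI mult.assoc)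
  qed
  from has_derivative_zero_constant[OF H(2) this]
  obtain c0 where c0: "\<And>w. w \<in> H \<Longrightarrow> v (a + exp w) - Re (P w) = c0" by blast
  have shift: "w + 2 * of_real pi * \<i> \<in> H" if "w \<in> H" for w using that by (simp add: H_def)
  have expshift: "exp (w + 2 * of_real pi * \<i>) = exp w" for w :: complex
    using exp_plus_2pin[of w 1] by (simp add: mult.commute mult.left_commute)
  have "((\<lambda>w. P (w + 2 * of_real pi * \<i>) - P w) has_field_derivative 0) (at w within H)" if "w \<in> H" for w
  proof -
    have "((\<lambda>w. P (w + 2 * of_real pi * \<i>)) has_field_derivative
       ?f (a + exp (w + 2 * of_real pi * \<i>)) * exp (w + 2 * of_real pi * \<i>) * 1) (at w)"
      by (rule DERIV_chain2[where f = P and g = "\<lambda>w. w + 2 * of_real pi * \<i>", OF P'[OF shift[OF that]]])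
         (auto intro!: derivative_eq_intros)
    hence "((\<lambda>w. P (w + 2 * of_real pi * \<i>) - P w) has_field_derivative
       ?f (a + exp w) * exp w - ?f (a + exp w) * exp w) (at w)"
      unfolding expshift by (intro DERIV_diff P' that) simp
    thus ?thesis by (simp add: has_field_derivative_at_within)
  qed
  from has_field_derivative_zero_constant[OF H(2) this]
  obtain c where c: "\<And>w. w \<in> H \<Longrightarrow> P (w + 2 * of_real pi * \<i>) = P w + c"
    by (metis add.commute diff_eq_eq)
  have Hne: "of_real (ln r - 1) \<in> H" by (simp add: H_def)
  have Rec: "Re c = 0"
    using c0[OF Hne] c0[OF shift[OF Hne]] c[OF Hne] unfolding expshift by simp
  \<comment> \<open>The increment c of P equals m times the period 2 \<pi> \<i>, so subtracting m w
    makes the exponent periodic.\<close>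
  define m where "m = Im c / (2 * pi)"
  define Q where "Q w = exp (P w + of_real c0 - of_real m * w)" for w
  have Qshift: "Q (w + 2 * of_real pi * \<i>) = Q w" if "w \<in> H" for w
  proof -
    have "c = of_real m * (2 * of_real pi * \<i>)"
      using Rec by (simp add: m_def complex_eq_iff)
    thus ?thesis using c[OF that] by (simp add: Q_def algebra_simps)
  qed
  have Qhol: "Q holomorphic_on H"
  proof -
    have "P holomorphic_on H"
      unfolding holomorphic_on_open[OF H(1)] using P' by blast
    thus ?thesis unfolding Q_def by (intro holomorphic_intros)
  qed
  define q where "q z = Q (Ln (z - a))" for z
  have LnH: "Ln (z - a) \<in> H" if "z \<in> ball a r - {a}" for z
    using that r by (auto simp: H_def dist_norm norm_minus_commute)
  have qhol: "q holomorphic_on ball a r - {a}"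
  proof (rule holomorphic_onI)
    fix z assume z: "z \<in> ball a r - {a}"
    show "q field_differentiable at z within ball a r - {a}"
    proof (cases "z - a \<in> \<real>\<^sub>\<le>\<^sub>0")
      case False
      have "Q field_differentiable at (Ln (z - a))"
        using Qhol H(1) LnH[OF z] by (simp add: holomorphic_on_imp_differentiable_at)
      moreover have "(\<lambda>z. Ln (z - a)) field_differentiable at z"
        using False by (auto intro!: derivative_eq_intros simp: field_differentiable_def)
      ultimately have "(Q \<circ> (\<lambda>z. Ln (z - a))) field_differentiable at z"
        by (intro field_differentiable_compose) auto
      thus ?thesis unfolding q_def[abs_def] o_def by (rule field_differentiable_at_within)
    next
      case True
      hence neg: "- (z - a) \<notin> \<real>\<^sub>\<le>\<^sub>0" using z by (auto simp: complex_nonpos_Reals_iff complex_eq_iff)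
      \<comment> \<open>On the branch cut of \<open>Ln\<close> the logarithm Ln(-(z - a)) + \<i>
        \<pi> is holomorphic. It differs from Ln(z - a) by 0 or one period, which Q does not
        notice.\<close>
      have in_H: "Ln (- (x - a)) + \<i> * of_real pi \<in> H" if "x \<in> ball a r - {a}" for x
        using that r by (auto simp: H_def dist_norm norm_minus_commute)
      have "Q field_differentiable at (Ln (- (z - a)) + \<i> * of_real pi)"
        using Qhol H(1) in_H[OF z] by (simp add: holomorphic_on_imp_differentiable_at)
      moreover have "(\<lambda>z. Ln (- (z - a)) + \<i> * of_real pi) field_differentiable at z"
        using neg by (auto intro!: derivative_eq_intros simp: field_differentiable_def)
      ultimately have "(Q \<circ> (\<lambda>z. Ln (- (z - a)) + \<i> * of_real pi)) field_differentiable at z"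
        by (intro field_differentiable_compose) auto
      moreover have "(Q \<circ> (\<lambda>z. Ln (- (z - a)) + \<i> * of_real pi)) x = q x" if "x \<in> ball a r - {a}" for x
      proof -
        have "x - a \<noteq> 0" using that by auto
        from Ln_minus[OF this] have "Ln (- (x - a)) + \<i> * of_real pi = Ln (x - a) + 2 * of_real pi * \<i> \<or>
           Ln (- (x - a)) + \<i> * of_real pi = Ln (x - a)" by (auto simp: algebra_simps split: if_splits)
        thus ?thesis unfolding q_def o_def by (elim disjE; simp only: Qshift[OF LnH[OF that]])
      qed
      ultimately have "q field_differentiable at z"
        unfolding field_differentiable_def using z openA
        by (metis (no_types, lifting) has_field_derivative_transform_within_open)
      thus ?thesis by (rule field_differentiable_at_within)
    qed
  qed
  have qnorm: "norm (q z) = exp (v z) * norm (z - a) powr (- m)" if "z \<in> ball a r - {a}" for z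
  proof -
    have ne: "z - a \<noteq> 0" using that by auto
    have "Re (P (Ln (z - a))) + c0 = v z" using c0[OF LnH[OF that]] ne by simp
    hence "norm (q z) = exp (v z - m * ln (norm (z - a)))"
      using ne by (simp add: q_def Q_def)
    thus ?thesis using ne by (simp add: powr_def exp_diff exp_minus field_simps)
  qed
  \<comment> \<open>Rounding up leaves a modulus exp(v) |z - a|^\<theta> with 0 \<le> \<theta> < 1,
    which is bounded near a, so that the product extends to a.\<close>
  define n where "n = \<lceil>m\<rceil>"
  define \<theta> where "\<theta> = of_int n - m"
  have th: "0 \<le> \<theta>" "\<theta> < 1" unfolding \<theta>_def n_def by linarith+
  have Gnorm: "norm (q z * (z - a) powi n) = exp (v z) * norm (z - a) powr \<theta>" if "z \<in> ball a r - {a}" for z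
  proof -
    have ne: "norm (z - a) > 0" using that by auto
    have "norm ((z - a) powi n) = norm (z - a) powr of_int n"
      using ne by (simp add: norm_power_int powr_real_of_int')
    thus ?thesis using ne by (simp add: norm_mult qnorm[OF that] \<theta>_def powr_diff powr_minus field_simps)
  qed
  have "(\<lambda>z. q z * (z - a) powi n) holomorphic_on ball a r - {a}"
    by (intro holomorphic_intros qhol) auto
  moreover have "\<forall>\<^sub>F z in at a. norm (q z * (z - a) powi n) \<le> exp B"
  proof -
    have "\<forall>\<^sub>F z in at a. z \<in> ball a (min r 1) - {a}"
      using r by (intro eventually_at_in_open) auto
    thus ?thesis
    proof eventually_elim
      case (elim z)
      hence z: "z \<in> ball a r - {a}" by auto
      have "norm (z - a) powr \<theta> \<le> 1"
        using elim th by (intro powr_le1) (auto simp: dist_norm norm_minus_commute)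
      moreover have "exp (v z) \<le> exp B" using B[OF z] by simp
      ultimately show ?case unfolding Gnorm[OF z]
        using mult_mono[of "exp (v z)" "exp B" "norm (z - a) powr \<theta>" 1] by simp
    qed
  qed
  ultimately obtain G where G: "G holomorphic_on ball a r"
    "\<And>z. z \<in> ball a r - {a} \<Longrightarrow> G z = q z * (z - a) powi n"
    using holomorphic_on_extend_bounded[of "\<lambda>z. q z * (z - a) powi n" "ball a r" a] r by auto
  have Gn: "norm (G z) = exp (v z) * norm (z - a) powr \<theta>" if "z \<in> ball a r - {a}" for z
    using G(2)[OF that] Gnorm[OF that] by simp
  have ev: "\<forall>\<^sub>F z in at a. z \<in> ball a r - {a}" using r by (intro eventually_at_in_open) auto
  have Gcont: "(G \<longlongrightarrow> G a) (at a)"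
    using holomorphic_on_imp_continuous_on[OF G(1)] r by (simp add: continuous_on_eq_continuous_at isCont_def)
  have lower: "exp (- B) * norm (z - a) powr \<theta> \<le> norm (G z)" if "z \<in> ball a r - {a}" for z
    unfolding Gn[OF that] using B[OF that] by (intro mult_right_mono) auto
  \<comment> \<open>For 0 < \<theta> < 1 the extension G vanishes at a while |G| is at least a
    multiple of |z - a|^\<theta>; its difference quotient at a would then be unbounded.\<close>
  have th0: "\<theta> = 0"
  proof (rule ccontr)
    assume "\<theta> \<noteq> 0"
    with th have pos: "0 < \<theta>" by simp
    have nz: "((\<lambda>z. norm (z - a)) \<longlongrightarrow> 0) (at a)"
      by (rule tendsto_eq_intros refl | simp)+
    have "((\<lambda>z. exp B * norm (z - a) powr \<theta>) \<longlongrightarrow> exp B * 0) (at a)"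
      using pos by (intro tendsto_intros tendsto_zero_powrI[OF nz]) auto
    hence up0: "((\<lambda>z. exp B * norm (z - a) powr \<theta>) \<longlongrightarrow> 0) (at a)" by simp
    have "\<forall>\<^sub>F z in at a. norm (G z) \<le> exp B * norm (z - a) powr \<theta>"
      using ev
    proof eventually_elim
      case (elim z)
      have "exp (v z) \<le> exp B" using B[OF elim] by simp
      thus ?case unfolding Gn[OF elim] by (intro mult_right_mono) auto
    qed
    hence "((\<lambda>z. norm (G z)) \<longlongrightarrow> 0) (at a)"
      by (intro tendsto_sandwich[OF _ _ tendsto_const up0]) auto
    hence "(G \<longlongrightarrow> 0) (at a)" by (rule tendsto_norm_zero_cancel)
    hence Ga: "G a = 0" using tendsto_unique[OF _ Gcont] by auto
    obtain G' where "(G has_field_derivative G') (at a)"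
      using G(1) r by (meson centre_in_ball field_differentiable_def holomorphic_on_imp_differentiable_at open_ball)
    hence "((\<lambda>z. (G z - G a) / (z - a)) \<longlongrightarrow> G') (at a)"
      by (simp add: has_field_derivative_iff)
    hence "((\<lambda>z. norm (G z / (z - a)) * norm (z - a) powr (1 - \<theta>)) \<longlongrightarrow> norm G' * 0) (at a)"
      unfolding Ga using th by (intro tendsto_intros tendsto_zero_powrI[OF nz]) auto
    moreover have "\<forall>\<^sub>F z in at a. exp (- B) \<le> norm (G z / (z - a)) * norm (z - a) powr (1 - \<theta>)"
      using ev
    proof eventually_elim
      case (elim z)
      hence ne: "norm (z - a) > 0" by auto
      have "norm (G z / (z - a)) * norm (z - a) powr (1 - \<theta>) = norm (G z) / norm (z - a) powr \<theta>"
        using ne by (simp add: norm_divide powr_diff field_simps)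
      moreover have "exp (- B) \<le> norm (G z) / norm (z - a) powr \<theta>"
        using lower[OF elim] ne by (simp add: field_simps)
      ultimately show ?case by simp
    qed
    ultimately have "exp (- B) \<le> norm G' * 0" by (intro tendsto_lowerbound[of _ _ "at a"]) auto
    thus False by simp
  qed
  have lower': "exp (- B) \<le> norm (G z)" if "z \<in> ball a r - {a}" for z
    using lower[OF that] th0 that by simp
  have Ga: "exp (- B) \<le> norm (G a)"
    by (rule tendsto_lowerbound[OF tendsto_norm[OF Gcont]]) (use ev lower' in \<open>auto elim: eventually_mono\<close>)
  have Gne: "G z \<noteq> 0" if "z \<in> ball a r" for z
    using lower'[of z] Ga that by (cases "z = a") (auto simp: not_le)
  obtain h where h: "h holomorphic_on ball a r" "\<And>z. z \<in> ball a r \<Longrightarrow> exp (h z) = G z"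
    using holomorphic_logarithm_exists[OF convex_ball open_ball G(1) Gne, of a] r by auto
  have "v z = Re (h z)" if "z \<in> ball a r - {a}" for z
  proof -
    have "exp (Re (h z)) = norm (G z)" using h(2)[of z] that by (metis DiffD1 norm_exp_eq_Re)
    also have "\<dots> = exp (v z)" using Gn[OF that] th0 that by simp
    finally show ?thesis by simp
  qed
  with h(1) that show ?thesis by blast
qed

section \<open>Integration in the plane\<close>

subsection \<open>Change of variables\<close>

text \<open>The change-of-variables theorem is applied in \<open>real^2\<close>, where derivatives
  have determinants. \<open>vec_complex\<close> and \<open>complex_vec\<close> are the linear,
  measure-preserving passage between it and the plane.\<close>

definition vec_complex :: "real^2 \<Rightarrow> complex" where "vec_complex x = Complex (x $ 1) (x $ 2)"
definition complex_vec :: "complex \<Rightarrow> real^2" where "complex_vec z = (\<chi> i. if i = 1 then Re z else Im z)"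

lemma complex_vec_component [simp]: "complex_vec z $ 1 = Re z" "complex_vec z $ 2 = Im z"
  by (simp_all add: complex_vec_def)

lemma vec_complex_inverse [simp]: "complex_vec (vec_complex x) = x" "vec_complex (complex_vec z) = z"
  by (simp_all add: complex_vec_def vec_complex_def vec_eq_iff forall_2)

lemma linear_vec_complex: "linear vec_complex"
  by (rule linearI) (simp_all add: vec_complex_def complex_eq_iff)

lemma linear_complex_vec: "linear complex_vec"
  by (rule linearI) (simp_all add: vec_eq_iff forall_2)

lemma bounded_linear_vec_complex: "bounded_linear vec_complex"
  using linear_vec_complex by (simp add: linear_conv_bounded_linear)

lemma bounded_linear_complex_vec: "bounded_linear complex_vec"
  using linear_complex_vec by (simp add: linear_conv_bounded_linear)

lemma vec_complex_measurable [measurable]: "vec_complex \<in> borel_measurable borel"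
  by (intro borel_measurable_continuous_onI linear_continuous_on bounded_linear_vec_complex)

lemma lborel_distr_vec_complex: "distr lborel borel vec_complex = lborel"
proof (rule sym, rule lborel_eqI)
  fix l u :: complex
  assume le: "\<And>b. b \<in> Basis \<Longrightarrow> l \<bullet> b \<le> u \<bullet> b"
  have "Re l \<le> Re u" "Im l \<le> Im u" using le[of 1] le[of \<i>] by (auto simp: Basis_complex_def)
  have "vec_complex -` box l u = box (complex_vec l) (complex_vec u)"
    by (auto simp: box_def Basis_complex_def vec_complex_def Basis_vec_def inner_axis forall_2)
  moreover have "emeasure lborel (box (complex_vec l) (complex_vec u)) = (\<Prod>b\<in>Basis. (u - l) \<bullet> b)"
  proof -
    have "emeasure lborel (box (complex_vec l) (complex_vec u)) = ennreal (\<Prod>b\<in>Basis. (complex_vec u - complex_vec l) \<bullet> b)"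
    proof -
      have "complex_vec l $ i \<le> complex_vec u $ i" for i
        using \<open>Re l \<le> Re u\<close> \<open>Im l \<le> Im u\<close> exhaust_2[of i] by auto
      thus ?thesis by (intro emeasure_lborel_box) (auto simp: Basis_vec_def inner_axis)
    qed
    also have "(\<Prod>b\<in>Basis. (complex_vec u - complex_vec l) \<bullet> b) = (Re u - Re l) * (Im u - Im l)"
    proof -
      have B: "(Basis :: (real^2) set) = {axis 1 1, axis 2 1}"
        by (auto simp: Basis_vec_def UNIV_2)
      have ne: "axis 1 (1::real) \<noteq> (axis 2 1 :: real^2)" by (simp add: axis_eq_axis)
      show ?thesis unfolding B using ne by (simp add: inner_axis)
    qed
    also have "\<dots> = (\<Prod>b\<in>Basis. (u - l) \<bullet> b)" by (simp add: Basis_complex_def)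
    finally show ?thesis .
  qed
  ultimately show "emeasure (distr lborel borel vec_complex) (box l u) = (\<Prod>b\<in>Basis. (u - l) \<bullet> b)"
    by (simp add: emeasure_distr)
qed simp

text \<open>A finite complement is negligible. In this way the origin, where the inversion is
  undefined, can be left out of a change of variables over the whole plane.\<close>

lemma absolutely_integrable_lborel_iff:
  fixes f :: "'a::euclidean_space \<Rightarrow> real"
  assumes f: "f \<in> borel_measurable borel" and fin: "finite (- S)"
  shows "f absolutely_integrable_on S \<and> integral S f = b \<longleftrightarrow> integrable lborel f \<and> integral\<^sup>L lborel f = b"
proof -
  have neg: "negligible (- S)" using fin by (rule negligible_finite)
  have "f absolutely_integrable_on S \<longleftrightarrow> f absolutely_integrable_on UNIV"
    by (rule absolutely_integrable_spike_set_eq)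
       (rule negligible_subset[OF neg], auto)+
  also have "\<dots> \<longleftrightarrow> integrable lborel f"
    using f by (simp add: set_integrable_def integrable_completion)
  finally have 1: "f absolutely_integrable_on S \<longleftrightarrow> integrable lborel f" .
  have "integral S f = integral UNIV f"
    by (rule integral_spike_set) (rule negligible_subset[OF neg], auto)+
  moreover have "integral UNIV f = integral\<^sup>L lborel f" if "integrable lborel f"
    using integral_lborel[OF that] by simp
  ultimately show ?thesis using 1 by auto
qed

lemma complex_change_of_variables:
  fixes h :: "complex \<Rightarrow> complex" and F :: "complex \<Rightarrow> real"
  assumes fin: "finite (- S)" and der: "\<And>w. w \<in> S \<Longrightarrow> (h has_derivative h' w) (at w)"
    and inj: "inj_on h S" and im: "h ` S = S"
    and J: "\<And>w. w \<in> S \<Longrightarrow> J w = \<bar>Re (h' w 1) * Im (h' w \<i>) - Im (h' w 1) * Re (h' w \<i>)\<bar>"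
    and F: "F \<in> borel_measurable borel" and G: "(\<lambda>w. J w * F (h w)) \<in> borel_measurable borel"
  shows "integrable lborel (\<lambda>w. J w * F (h w)) \<longleftrightarrow> integrable lborel F"
    and "(\<integral>w. J w * F (h w) \<partial>lborel) = (\<integral>w. F w \<partial>lborel)"
proof -
  let ?S = "vec_complex -` S"
  let ?h = "\<lambda>x. complex_vec (h (vec_complex x))"
  let ?h' = "\<lambda>x v. complex_vec (h' (vec_complex x) (vec_complex v))"
  have fin2: "finite (- ?S)"
  proof -
    have "inj vec_complex" by (rule inj_on_inverseI[of _ complex_vec]) simp
    from finite_vimageI[OF fin this] show ?thesis by (simp add: vimage_Compl)
  qed
  have der2: "(?h has_derivative ?h' x) (at x within ?S)" if "x \<in> ?S" for x
  proof -
    have "(vec_complex has_derivative vec_complex) (at x)"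
      by (rule bounded_linear_imp_has_derivative[OF bounded_linear_vec_complex])
    moreover have "(h has_derivative h' (vec_complex x)) (at (vec_complex x))" using der that by simp
    ultimately have "((\<lambda>x. h (vec_complex x)) has_derivative (\<lambda>v. h' (vec_complex x) (vec_complex v))) (at x)"
      by (rule has_derivative_compose)
    moreover have "(complex_vec has_derivative complex_vec) (at (h (vec_complex x)))"
      by (rule bounded_linear_imp_has_derivative[OF bounded_linear_complex_vec])
    ultimately have "(?h has_derivative ?h' x) (at x)" by (rule has_derivative_compose)
    thus ?thesis by (rule has_derivative_at_withinI)
  qed
  have inj2: "inj_on ?h ?S"
    using inj by (auto simp: inj_on_def) (metis vec_complex_inverse)
  have im2: "?h ` ?S = ?S"
  proof
    show "?h ` ?S \<subseteq> ?S" using im by auto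
    show "?S \<subseteq> ?h ` ?S"
    proof
      fix x assume "x \<in> ?S"
      then obtain w where w: "w \<in> S" "vec_complex x = h w" using im by (metis imageE vimageE)
      have "x = ?h (complex_vec w)" using w(2) by (metis vec_complex_inverse)
      thus "x \<in> ?h ` ?S" by (rule image_eqI) (use w(1) in simp)
    qed
  qed
  have det: "\<bar>det (matrix (?h' x))\<bar> = J (vec_complex x)" if "x \<in> ?S" for x
  proof -
    have "vec_complex (axis 1 1) = 1" "vec_complex (axis 2 1) = \<i>"
      by (simp_all add: vec_complex_def axis_def complex_eq_iff)
    thus ?thesis using J that by (simp add: det_2 matrix_def mult.commute)
  qed
  have Smeas: "?S \<in> sets lebesgue"
  proof -
    have "open ?S" using finite_imp_closed[OF fin2] by (simp add: open_closed)
    thus ?thesis by (intro sets_completionI_sets) simp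
  qed
  have "(\<lambda>x. \<bar>det (matrix (?h' x))\<bar> *\<^sub>R (vec (F (vec_complex (?h x))) :: real^1)) absolutely_integrable_on ?S \<and>
       integral ?S (\<lambda>x. \<bar>det (matrix (?h' x))\<bar> *\<^sub>R (vec (F (vec_complex (?h x))) :: real^1)) = vec b
     \<longleftrightarrow> (\<lambda>x. vec (F (vec_complex x)) :: real^1) absolutely_integrable_on (?h ` ?S) \<and>
       integral (?h ` ?S) (\<lambda>x. vec (F (vec_complex x)) :: real^1) = vec b" for b
    by (rule has_absolute_integral_change_of_variables[OF Smeas der2 inj2])
  hence "(\<lambda>x. \<bar>det (matrix (?h' x))\<bar> * F (vec_complex (?h x))) absolutely_integrable_on ?S \<and>
       integral ?S (\<lambda>x. \<bar>det (matrix (?h' x))\<bar> * F (vec_complex (?h x))) = b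
     \<longleftrightarrow> (\<lambda>x. F (vec_complex x)) absolutely_integrable_on ?S \<and> integral ?S (\<lambda>x. F (vec_complex x)) = b" for b
    unfolding im2 by (simp add: absolutely_integrable_on_1_iff integral_on_1_eq vec_eq_iff)
  moreover have "(\<lambda>x. \<bar>det (matrix (?h' x))\<bar> * F (vec_complex (?h x))) absolutely_integrable_on ?S \<longleftrightarrow>
       (\<lambda>x. J (vec_complex x) * F (h (vec_complex x))) absolutely_integrable_on ?S"
    by (rule set_integrable_cong) (auto simp: det)
  moreover have "integral ?S (\<lambda>x. \<bar>det (matrix (?h' x))\<bar> * F (vec_complex (?h x))) =
       integral ?S (\<lambda>x. J (vec_complex x) * F (h (vec_complex x)))"
    by (rule Henstock_Kurzweil_Integration.integral_cong) (simp add: det)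
  ultimately have *: "(\<lambda>x. J (vec_complex x) * F (h (vec_complex x))) absolutely_integrable_on ?S \<and>
       integral ?S (\<lambda>x. J (vec_complex x) * F (h (vec_complex x))) = b
     \<longleftrightarrow> (\<lambda>x. F (vec_complex x)) absolutely_integrable_on ?S \<and> integral ?S (\<lambda>x. F (vec_complex x)) = b" for b
    by simp
  have m1: "(\<lambda>x. F (vec_complex x)) \<in> borel_measurable borel" using F by measurable
  have m2: "(\<lambda>x. J (vec_complex x) * F (h (vec_complex x))) \<in> borel_measurable borel"
    using measurable_compose[OF vec_complex_measurable G] by simp
  have tr: "integrable lborel (\<lambda>x. H (vec_complex x)) \<longleftrightarrow> integrable lborel H"
    "(\<integral>x. H (vec_complex x) \<partial>lborel) = integral\<^sup>L lborel H"
    if "H \<in> borel_measurable borel" for H :: "complex \<Rightarrow> real"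
    using that lborel_distr_vec_complex integrable_distr_eq[of vec_complex lborel borel H]
      integral_distr[of vec_complex lborel borel H] by simp_all
  have iff: "integrable lborel (\<lambda>w. J w * F (h w)) \<and> (\<integral>w. J w * F (h w) \<partial>lborel) = b \<longleftrightarrow>
     integrable lborel F \<and> integral\<^sup>L lborel F = b" for b
    using *[of b] unfolding absolutely_integrable_lborel_iff[OF m1 fin2] absolutely_integrable_lborel_iff[OF m2 fin2]
    using tr[OF F] tr[OF G] by simp
  show "integrable lborel (\<lambda>w. J w * F (h w)) \<longleftrightarrow> integrable lborel F" using iff by blast
  \<comment> \<open>The equivalence for every value b settles the integrable case; if one side is
    not integrable, neither is the other, and both Bochner integrals are 0 by convention.\<close>
  show "(\<integral>w. J w * F (h w) \<partial>lborel) = (\<integral>w. F w \<partial>lborel)"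
    using iff[of "integral\<^sup>L lborel F"] iff not_integrable_integral_eq by metis
qed

lemma integral_rotate:
  fixes F :: "complex \<Rightarrow> real"
  assumes "norm e = 1" and F: "F \<in> borel_measurable borel"
  shows "integrable lborel (\<lambda>w. F (e * w)) \<longleftrightarrow> integrable lborel F"
    and "(\<integral>w. F (e * w) \<partial>lborel) = (\<integral>w. F w \<partial>lborel)"
proof -
  have ne: "e \<noteq> 0" using assms by auto
  have "(1::real) = (Re e)\<^sup>2 + (Im e)\<^sup>2" using assms(1) by (metis cmod_power2 one_power2)
  hence J: "1 = \<bar>Re (e * 1) * Im (e * \<i>) - Im (e * 1) * Re (e * \<i>)\<bar>"
    by (simp add: power2_eq_square)
  have im: "(*) e ` UNIV = UNIV" using ne by (metis surj_def nonzero_mult_div_cancel_left times_divide_eq_right)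
  have m: "(\<lambda>w. 1 * F (e * w)) \<in> borel_measurable borel" using F by measurable
  have inj: "inj_on ((*) e) UNIV" using ne by (simp add: inj_on_def)
  have der: "((*) e has_derivative (\<lambda>_. (*) e) w) (at w)" for w by (auto intro!: derivative_eq_intros)
  note * = complex_change_of_variables[of UNIV "(*) e" "\<lambda>_. (*) e" "\<lambda>_. 1" F, OF _ der inj im J F m]
  show "integrable lborel (\<lambda>w. F (e * w)) \<longleftrightarrow> integrable lborel F"
    "(\<integral>w. F (e * w) \<partial>lborel) = (\<integral>w. F w \<partial>lborel)" using * by simp_all
qed

text \<open>The determinant of the derivative of 1/cnj w is -|c|^2 with c = -1/(cnj w)^2, hence
  |w|^(-4) in absolute value. It has the same shape as the factor by which the Laplacian changes
  under inversion.\<close>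

lemma integral_inversion:
  fixes F :: "complex \<Rightarrow> real"
  assumes F: "F \<in> borel_measurable borel"
  shows "integrable lborel (\<lambda>w. (1 / norm w ^ 4) * F (1 / cnj w)) \<longleftrightarrow> integrable lborel F"
    and "(\<integral>w. (1 / norm w ^ 4) * F (1 / cnj w) \<partial>lborel) = (\<integral>w. F w \<partial>lborel)"
proof -
  let ?h' = "\<lambda>w v. - (cnj v / (cnj w)\<^sup>2)"
  have der: "((\<lambda>w. 1 / cnj w) has_derivative ?h' w) (at w)" if "w \<in> - {0}" for w
  proof -
    have c: "(cnj has_derivative cnj) (at w)"
      by (rule bounded_linear_imp_has_derivative[OF bounded_linear_cnj])
    have ne: "cnj w \<noteq> 0" using that by simp
    have f: "(\<lambda>w. inverse (cnj w)) = (\<lambda>w. 1 / cnj w)" by (simp add: inverse_eq_divide)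
    have f': "(\<lambda>v. - (inverse (cnj w) * cnj v * inverse (cnj w))) = ?h' w"
      using ne by (intro ext) (simp add: field_simps power2_eq_square)
    from Deriv.has_derivative_inverse[OF ne c] show ?thesis unfolding f f' .
  qed
  have im: "(\<lambda>w. 1 / cnj w) ` (- {0}) = - {0::complex}"
  proof -
    have "w \<in> (\<lambda>w. 1 / cnj w) ` (- {0})" if "w \<noteq> 0" for w :: complex
      by (rule image_eqI[of _ _ "1 / cnj w"]) (use that in auto)
    thus ?thesis by auto
  qed
  have J: "1 / norm w ^ 4 = \<bar>Re (?h' w 1) * Im (?h' w \<i>) - Im (?h' w 1) * Re (?h' w \<i>)\<bar>" for w
  proof -
    define c where "c = - (1 / (cnj w)\<^sup>2)"
    have "?h' w 1 = c" "?h' w \<i> = - \<i> * c" by (simp_all add: c_def)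
    hence "Re (?h' w 1) * Im (?h' w \<i>) - Im (?h' w 1) * Re (?h' w \<i>) = - ((Re c)\<^sup>2 + (Im c)\<^sup>2)"
      by (simp only:) (simp add: power2_eq_square)
    hence "\<bar>Re (?h' w 1) * Im (?h' w \<i>) - Im (?h' w 1) * Re (?h' w \<i>)\<bar> = (Re c)\<^sup>2 + (Im c)\<^sup>2"
      by simp
    also have "\<dots> = (norm c)\<^sup>2" by (simp add: cmod_power2)
    also have "norm c = 1 / (norm w)\<^sup>2" by (simp add: c_def norm_divide norm_power)
    finally show ?thesis by (simp add: power_divide flip: power_mult)
  qed
  have m: "(\<lambda>w. (1 / norm w ^ 4) * F (1 / cnj w)) \<in> borel_measurable borel"
  proof -
    have [measurable]: "cnj \<in> borel_measurable borel"
      by (intro borel_measurable_continuous_onI linear_continuous_on bounded_linear_cnj)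
    show ?thesis using F by measurable
  qed
  have inj: "inj_on (\<lambda>w. 1 / cnj w) (- {0::complex})" by (auto simp: inj_on_def)
  note * = complex_change_of_variables[of "- {0}" "\<lambda>w. 1 / cnj w" ?h' "\<lambda>w. 1 / norm w ^ 4" F, OF _ der inj im J F m]
  show "integrable lborel (\<lambda>w. (1 / norm w ^ 4) * F (1 / cnj w)) \<longleftrightarrow> integrable lborel F"
    "(\<integral>w. (1 / norm w ^ 4) * F (1 / cnj w) \<partial>lborel) = (\<integral>w. F w \<partial>lborel)"
    using * by simp_all
qed

lemma integral_translate:
  fixes F :: "complex \<Rightarrow> real"
  assumes F: "F \<in> borel_measurable borel"
  shows "integrable lborel (\<lambda>w. F (c + w)) \<longleftrightarrow> integrable lborel F"
    and "(\<integral>w. F (c + w) \<partial>lborel) = (\<integral>w. F w \<partial>lborel)"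
  using F lborel_distr_plus[of c] integrable_distr_eq[of "(+) c" lborel borel F] integral_distr[of "(+) c" lborel borel F]
  by simp_all

subsection \<open>Radial integrals\<close>

lemma emeasure_complex_ball:
  assumes "r \<ge> 0"
  shows "emeasure lborel (ball (a::complex) r) = ennreal (pi * r\<^sup>2)"
    and "emeasure lborel (cball (a::complex) r) = ennreal (pi * r\<^sup>2)"
  using assms by (simp_all add: emeasure_ball emeasure_cball unit_ball_vol_2)

text \<open>The area of an annulus is \<pi> times the difference of the squared radii, so the image
  of area under the squared modulus has constant density \<pi>. This takes the place of polar
  coordinates.\<close>

lemma distr_norm_sq:
  assumes b: "b > 0"
  shows "distr (density lborel (indicator (ball (0::complex) b))) borel (\<lambda>z. (norm z)\<^sup>2) =
    density lborel (\<lambda>s. ennreal pi * indicator {0<..<b\<^sup>2} s)" (is "?M = ?N")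
proof (rule measure_eqI_lessThan)
  have M: "emeasure ?M {x<..} = emeasure lborel {z \<in> ball (0::complex) b. x < (norm z)\<^sup>2}" for x
  proof -
    have "emeasure ?M {x<..} = (\<integral>\<^sup>+z. indicator (ball 0 b) z * indicator ((\<lambda>z::complex. (norm z)\<^sup>2) -` {x<..}) z \<partial>lborel)"
    proof -
      have m: "(\<lambda>z::complex. (norm z)\<^sup>2) -` {x<..} \<in> sets borel"
        using measurable_sets[of "\<lambda>z::complex. (norm z)\<^sup>2" borel borel "{x<..}"] by simp
      have "emeasure ?M {x<..} = emeasure (density lborel (indicator (ball 0 b))) ((\<lambda>z::complex. (norm z)\<^sup>2) -` {x<..})"
        by (subst emeasure_distr) auto
      also have "\<dots> = (\<integral>\<^sup>+z. indicator (ball 0 b) z * indicator ((\<lambda>z::complex. (norm z)\<^sup>2) -` {x<..}) z \<partial>lborel)"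
        by (rule emeasure_density) (use m in \<open>auto intro!: borel_measurable_indicator\<close>)
      finally show ?thesis .
    qed
    also have "\<dots> = (\<integral>\<^sup>+z. indicator {z \<in> ball (0::complex) b. x < (norm z)\<^sup>2} z \<partial>lborel)"
      by (intro nn_integral_cong) (auto simp: indicator_def)
    also have "\<dots> = emeasure lborel {z \<in> ball (0::complex) b. x < (norm z)\<^sup>2}" by simp
    finally show ?thesis .
  qed
  have N: "emeasure ?N {x<..} = ennreal pi * emeasure lborel ({0<..<b\<^sup>2} \<inter> {x<..})" for x
  proof -
    have "emeasure ?N {x<..} = (\<integral>\<^sup>+s. ennreal pi * indicator ({0<..<b\<^sup>2} \<inter> {x<..}) s \<partial>lborel)"
      by (subst emeasure_density) (auto intro!: nn_integral_cong simp: indicator_def)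
    also have "\<dots> = ennreal pi * emeasure lborel ({0<..<b\<^sup>2} \<inter> {x<..})"
      by (subst nn_integral_cmult) auto
    finally show ?thesis .
  qed
  show "emeasure ?M {x<..} = emeasure ?N {x<..}" for x
  proof -
    consider "x < 0" | "0 \<le> x" "x < b\<^sup>2" | "x \<ge> b\<^sup>2" by linarith
    thus ?thesis
    proof cases
      case 1
      have "{z \<in> ball (0::complex) b. x < (norm z)\<^sup>2} = ball 0 b"
        using 1 by (auto intro: less_le_trans)
      moreover have "{0<..<b\<^sup>2} \<inter> {x<..} = {0<..<b\<^sup>2}" using 1 by auto
      ultimately show ?thesis unfolding M N using b by (simp add: emeasure_complex_ball ennreal_mult)
    next
      case 2
      have x: "x = (sqrt x)\<^sup>2" "sqrt x < b" using 2 b by (auto simp: real_less_lsqrt)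
      have eq: "{z \<in> ball (0::complex) b. x < (norm z)\<^sup>2} = ball 0 b - cball 0 (sqrt x)"
        using 2 by (auto simp: not_le real_sqrt_less_iff) (metis norm_ge_zero real_sqrt_le_iff real_sqrt_unique not_less, metis norm_ge_zero real_less_lsqrt not_less_iff_gr_or_eq real_sqrt_unique real_sqrt_less_iff)
      have "emeasure lborel (ball 0 b - cball (0::complex) (sqrt x)) = ennreal (pi * b\<^sup>2) - ennreal (pi * x)"
        using x 2 b by (subst emeasure_Diff) (auto simp: emeasure_complex_ball cball_subset_ball_iff)
      also have "\<dots> = ennreal pi * ennreal (b\<^sup>2 - x)"
        using 2 by (simp add: ennreal_minus ennreal_mult[symmetric] algebra_simps)
      finally have m: "emeasure ?M {x<..} = ennreal pi * ennreal (b\<^sup>2 - x)" unfolding M eq .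
      have "{0<..<b\<^sup>2} \<inter> {x<..} = {x<..<b\<^sup>2}" using 2 by auto
      thus ?thesis unfolding m N using 2 by simp
    next
      case 3
      have "(norm z)\<^sup>2 \<le> x" if "norm z < b" for z :: complex
        using power_mono[of "norm z" b 2] that 3 by simp
      hence E1: "{z \<in> ball (0::complex) b. x < (norm z)\<^sup>2} = {}" by force
      have E2: "{0<..<b\<^sup>2} \<inter> {x<..} = {}" using 3 by auto
      show ?thesis unfolding M N by (simp only: E1 E2 emeasure_empty mult_zero_right)
    qed
  qed
  show "emeasure ?M {x<..} < \<infinity>" for x
  proof -
    have "emeasure ?M {x<..} \<le> emeasure lborel (ball (0::complex) b)"
      unfolding M by (intro emeasure_mono) auto
    also have "\<dots> < \<infinity>" using b by (simp add: emeasure_complex_ball)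
    finally show ?thesis .
  qed
qed auto

text \<open>In the variable s = |z - a|^2 the area integral becomes \<pi> times the integral of 2
  \<sigma>', and \<sigma> rises by 1. The total 2 \<pi> is the mass of the Laplacian of a
  logarithmic pole.\<close>

lemma integral_radial_profile:
  assumes s: "\<And>x. (\<sigma> has_real_derivative \<sigma>' x) (at x)" "continuous_on UNIV \<sigma>'" "\<And>x. 0 \<le> \<sigma>' x"
    and supp: "\<And>x. x \<le> 0 \<or> x \<ge> \<beta> \<Longrightarrow> \<sigma>' x = 0" and ends: "\<sigma> 0 = 0" "\<sigma> \<beta> = 1" and b: "\<beta> > 0"
  shows "(\<integral>\<^sup>+z. ennreal (2 * \<sigma>' ((norm (z - a))\<^sup>2)) \<partial>(lborel :: complex measure)) = ennreal (2 * pi)"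
proof -
  have [measurable]: "\<sigma>' \<in> borel_measurable borel" by (rule borel_measurable_continuous_onI[OF s(2)])
  have sq: "(sqrt \<beta>)\<^sup>2 = \<beta>" using b by simp
  have "(\<integral>\<^sup>+z. ennreal (2 * \<sigma>' ((norm (z - a))\<^sup>2)) \<partial>(lborel :: complex measure)) =
        (\<integral>\<^sup>+z. ennreal (2 * \<sigma>' ((norm (z - a))\<^sup>2)) \<partial>(distr lborel borel ((+) a)))"
    by (simp add: lborel_distr_plus)
  also have "\<dots> = (\<integral>\<^sup>+z. ennreal (2 * \<sigma>' ((norm z)\<^sup>2)) \<partial>(lborel :: complex measure))"
    by (subst nn_integral_distr) auto
  also have "\<dots> = (\<integral>\<^sup>+z. indicator (ball 0 (sqrt \<beta>)) z * ennreal (2 * \<sigma>' ((norm z)\<^sup>2)) \<partial>(lborel :: complex measure))"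
  proof (intro nn_integral_cong)
    fix z :: complex
    have "\<sigma>' ((norm z)\<^sup>2) = 0" if "\<not> norm z < sqrt \<beta>"
    proof -
      have "(sqrt \<beta>)\<^sup>2 \<le> (norm z)\<^sup>2" using that b by (intro power_mono) auto
      thus ?thesis using supp sq by simp
    qed
    thus "ennreal (2 * \<sigma>' ((norm z)\<^sup>2)) = indicator (ball 0 (sqrt \<beta>)) z * ennreal (2 * \<sigma>' ((norm z)\<^sup>2))"
      by (auto simp: indicator_def)
  qed
  also have "\<dots> = (\<integral>\<^sup>+z. ennreal (2 * \<sigma>' ((norm z)\<^sup>2)) \<partial>density lborel (indicator (ball (0::complex) (sqrt \<beta>))))"
    by (subst nn_integral_density) (auto intro!: borel_measurable_indicator)
  also have "\<dots> = (\<integral>\<^sup>+s. ennreal (2 * \<sigma>' s) \<partial>distr (density lborel (indicator (ball (0::complex) (sqrt \<beta>)))) borel (\<lambda>z. (norm z)\<^sup>2))"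
    by (subst nn_integral_distr) auto
  also have "\<dots> = (\<integral>\<^sup>+s. ennreal pi * indicator {0<..<\<beta>} s * ennreal (2 * \<sigma>' s) \<partial>lborel)"
    using b by (subst distr_norm_sq) (auto simp: nn_integral_density)
  also have "\<dots> = (\<integral>\<^sup>+s. ennreal (2 * pi * \<sigma>' s) * indicator {0..\<beta>} s \<partial>lborel)"
    using supp[of 0] supp[of \<beta>] s(3)
    by (intro nn_integral_cong) (auto simp: indicator_def ennreal_mult[symmetric] mult_ac)
  also have "\<dots> = ennreal (2 * pi * \<sigma> \<beta> - 2 * pi * \<sigma> 0)"
    using b s(3) by (intro nn_integral_FTC_Icc) (auto intro!: derivative_eq_intros s(1)[THEN has_field_derivative_at_within])
  finally show ?thesis using ends by simp
qed

subsection \<open>Integration by parts\<close>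

lemma continuous_on_extend_by_zero:
  fixes f :: "complex \<Rightarrow> real"
  assumes "open S" "continuous_on S f" "compact K" "K \<subseteq> S" "\<And>z. z \<notin> K \<Longrightarrow> f z = 0"
  shows "continuous_on UNIV f" "integrable lborel f"
proof -
  have "continuous_on (- K) f"
    using assms(5) by (subst continuous_on_cong[of _ _ _ "\<lambda>_. 0"]) auto
  hence "continuous_on (S \<union> - K) f"
    using assms compact_imp_closed by (intro continuous_on_open_Un) auto
  moreover have "S \<union> - K = UNIV" using assms by auto
  ultimately show c: "continuous_on UNIV f" by simp
  have "integrable lborel (\<lambda>z. indicator K z *\<^sub>R f z)"
    by (intro borel_integrable_compact assms continuous_on_subset[OF c]) auto
  moreover have "(\<lambda>z. indicator K z *\<^sub>R f z) = f" using assms(5) by (auto simp: indicator_def fun_eq_iff)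
  ultimately show "integrable lborel f" by simp
qed

lemma dir_deriv_zero_off_compact:
  assumes "compact K" "\<And>z. z \<notin> K \<Longrightarrow> f z = 0" "z \<notin> K"
  shows "dir_deriv v f z = 0"
proof -
  have "dir_deriv v f z = dir_deriv v (\<lambda>_. 0) z"
    using assms compact_imp_closed by (intro dir_deriv_cong[of "- K"]) auto
  also have "\<dots> = 0" by (rule dir_deriv_eqI[of _ "\<lambda>_. 0"]) simp
  finally show ?thesis .
qed

text \<open>Difference quotients integrate to 0 by translation invariance. They converge to the
  derivative, dominated by its maximum on a support enlarged by 1, since all increments have length
  at most 1.\<close>

lemma integral_dir_deriv:
  assumes psi: "Ck_on 1 UNIV \<psi>" and K: "compact K" "\<And>z. z \<notin> K \<Longrightarrow> \<psi> z = 0" and v: "v = 1 \<or> v = \<i>"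
  shows "integrable lborel (dir_deriv v \<psi>)" "(\<integral>z. dir_deriv v \<psi> z \<partial>lborel) = 0"
proof -
  have d: "\<psi> differentiable (at z)" for z using psi by (auto simp: differentiable_on_def)
  have c\<psi>: "continuous_on UNIV \<psi>" using Ck_on_SucD[of 0 UNIV \<psi>] psi by simp
  have c: "continuous_on UNIV (dir_deriv v \<psi>)" using psi v by auto
  have dK: "dir_deriv v \<psi> z = 0" if "z \<notin> K" for z by (rule dir_deriv_zero_off_compact[OF K that])
  show int: "integrable lborel (dir_deriv v \<psi>)"
    by (rule continuous_on_extend_by_zero(2)[OF open_UNIV c K(1)]) (use dK in auto)
  have int\<psi>: "integrable lborel \<psi>"
    by (rule continuous_on_extend_by_zero(2)[OF open_UNIV c\<psi> K(1)]) (use K in auto)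
  obtain R where R: "\<And>z. z \<in> K \<Longrightarrow> norm z \<le> R" using compact_imp_bounded[OF K(1)] by (auto simp: bounded_iff)
  have "bounded (dir_deriv v \<psi> ` K)"
    by (intro compact_imp_bounded compact_continuous_image continuous_on_subset[OF c] K) auto
  then obtain B where B: "\<And>z. z \<in> K \<Longrightarrow> \<bar>dir_deriv v \<psi> z\<bar> \<le> B" by (auto simp: bounded_iff)
  have B': "\<bar>dir_deriv v \<psi> z\<bar> \<le> \<bar>B\<bar>" for z using B[of z] dK[of z] by (cases "z \<in> K") auto
  have nv: "norm v = 1" using v by auto
  define g where "g n z = real (Suc n) * (\<psi> (of_real (1 / real (Suc n)) * v + z) - \<psi> z)" for n z
  have [measurable]: "\<psi> \<in> borel_measurable borel" by (rule borel_measurable_continuous_onI[OF c\<psi>])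
  have g0: "(\<integral>z. g n z \<partial>lborel) = 0" for n
    unfolding g_def using integral_translate[of \<psi>] int\<psi> by simp
  have "(\<lambda>n. \<integral>z. g n z \<partial>lborel) \<longlonglongrightarrow> (\<integral>z. dir_deriv v \<psi> z \<partial>lborel)"
  proof (rule integral_dominated_convergence)
    show "dir_deriv v \<psi> \<in> borel_measurable lborel" using int by auto
    show "g n \<in> borel_measurable lborel" for n unfolding g_def by measurable
    show "integrable lborel (\<lambda>z. \<bar>B\<bar> * indicator (cball (0::complex) (R + 1)) z)"
      using emeasure_bounded_finite[OF bounded_cball] by (intro integrable_mult_right integrable_real_indicator) auto
    have "(\<lambda>n. g n z) \<longlonglongrightarrow> dir_deriv v \<psi> z" for z
    proof -
      have "((\<lambda>x. \<psi> (z + of_real x * v)) has_real_derivative dir_deriv v \<psi> (z + of_real 0 * v)) (at 0)"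
        by (rule has_real_derivative_along) (rule d)
      hence "((\<lambda>h. (\<psi> (z + of_real h * v) - \<psi> z) / h) \<longlongrightarrow> dir_deriv v \<psi> z) (at 0)"
        by (simp add: has_field_derivative_iff)
      moreover have "filterlim (\<lambda>n. 1 / real (Suc n)) (at 0) sequentially"
        using LIMSEQ_inverse_real_of_nat by (auto simp: inverse_eq_divide intro!: filterlim_atI simp del: of_nat_Suc)
      ultimately have "(\<lambda>n. (\<psi> (z + of_real (1 / real (Suc n)) * v) - \<psi> z) / (1 / real (Suc n))) \<longlonglongrightarrow> dir_deriv v \<psi> z"
        by (rule filterlim_compose)
      thus ?thesis by (simp add: g_def[abs_def] add.commute mult.commute)
    qed
    thus "AE z in lborel. (\<lambda>n. g n z) \<longlonglongrightarrow> dir_deriv v \<psi> z" by simp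
    have "norm (g n z) \<le> \<bar>B\<bar> * indicator (cball 0 (R + 1)) z" for n z
    proof (cases "z \<in> cball 0 (R + 1)")
      case True
      let ?h = "1 / real (Suc n)"
      have "\<exists>\<xi>>0. \<xi> < ?h \<and> \<psi> (z + of_real ?h * v) - \<psi> (z + of_real 0 * v) = (?h - 0) * dir_deriv v \<psi> (z + of_real \<xi> * v)"
        by (rule MVT2) (auto intro: has_real_derivative_along[OF d])
      then obtain \<xi> where "\<psi> (z + of_real ?h * v) - \<psi> z = ?h * dir_deriv v \<psi> (z + of_real \<xi> * v)" by auto
      hence "g n z = real (Suc n) * (?h * dir_deriv v \<psi> (z + of_real \<xi> * v))"
        unfolding g_def by (simp only: add.commute)
      also have "\<dots> = dir_deriv v \<psi> (z + of_real \<xi> * v)" by (simp del: of_nat_Suc)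
      finally show ?thesis using B' True by simp
    next
      case False
      have "norm (of_real (1 / real (Suc n)) * v) \<le> 1" unfolding norm_mult nv norm_of_real by simp
      hence "norm z \<le> norm (of_real (1 / real (Suc n)) * v + z) + 1"
        using norm_triangle_ineq4[of "of_real (1 / real (Suc n)) * v + z" "of_real (1 / real (Suc n)) * v"] by simp
      with False have "of_real (1 / real (Suc n)) * v + z \<notin> K" "z \<notin> K" using R by force+
      thus ?thesis using K(2) by (simp add: g_def)
    qed
    thus "AE z in lborel. norm (g n z) \<le> \<bar>B\<bar> * indicator (cball 0 (R + 1)) z" for n by simp
  qed
  hence "(\<lambda>n::nat. 0) \<longlonglongrightarrow> (\<integral>z. dir_deriv v \<psi> z \<partial>lborel)" by (simp only: g0)
  thus "(\<integral>z. dir_deriv v \<psi> z \<partial>lborel) = 0" by (rule LIMSEQ_unique[OF _ tendsto_const])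
qed

lemma test_functionD:
  assumes "test_function S \<phi>"
  shows "Ck_on k UNIV \<phi>" "compact (closure {z. \<phi> z \<noteq> 0})" "closure {z. \<phi> z \<noteq> 0} \<subseteq> S"
    "z \<notin> closure {z. \<phi> z \<noteq> 0} \<Longrightarrow> \<phi> z = 0"
proof -
  show "Ck_on k UNIV \<phi>" "compact (closure {z. \<phi> z \<noteq> 0})" "closure {z. \<phi> z \<noteq> 0} \<subseteq> S"
    using assms by (simp_all add: test_function_def)
  show "\<phi> z = 0" if "z \<notin> closure {z. \<phi> z \<noteq> 0}"
    using that closure_subset[of "{z. \<phi> z \<noteq> 0}"] by blast
qed

lemma laplacian_zero_off_compact:
  assumes "compact K" "\<And>z. z \<notin> K \<Longrightarrow> f z = 0" "z \<notin> K"
  shows "laplacian f z = 0"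
proof -
  have "laplacian f z = laplacian (\<lambda>_. 0) z"
    using assms compact_imp_closed by (intro laplacian_cong[of "- K"]) auto
  thus ?thesis by simp
qed

lemma Ck_on_laplacian: "open S \<Longrightarrow> Ck_on (Suc (Suc k)) S f \<Longrightarrow> Ck_on k S (laplacian f)"
  unfolding laplacian_def[abs_def] by (intro Ck_on_add) auto

text \<open>The difference v \<Delta>\<phi> - \<phi> \<Delta>v is the divergence of the field v grad
  \<phi> - \<phi> grad v. Extended by 0 this field is of class C^1 on the whole plane although v is
  controlled on S only, and each component contributes a derivative of integral 0.\<close>

lemma Green_identity:
  assumes S: "open S" and phi: "test_function S \<phi>" and v: "Ck_on 2 S v"
  shows "integrable lborel (\<lambda>z. v z * laplacian \<phi> z)"
    and "(\<integral>z. v z * laplacian \<phi> z \<partial>lborel) = (\<integral>z. \<phi> z * laplacian v z \<partial>lborel)"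
proof -
  let ?K = "closure {z. \<phi> z \<noteq> 0}"
  note K = test_functionD(2,3)[OF phi] and K0 = test_functionD(4)[OF phi]
  have K1: "dir_deriv p \<phi> z = 0" if "z \<notin> ?K" for p z by (rule dir_deriv_zero_off_compact[OF K(1) K0 that])
  have K2: "laplacian \<phi> z = 0" if "z \<notin> ?K" for z by (rule laplacian_zero_off_compact[OF K(1) K0 that])
  have p2: "Ck_on 2 S \<phi>" by (rule Ck_on_subset[OF test_functionD(1)[OF phi]]) simp
  have v1: "Ck_on 1 S v" using Ck_on_le[OF v, of 1] by simp
  have p1: "Ck_on 1 S \<phi>" using Ck_on_le[OF p2, of 1] by simp
  have cv: "continuous_on S v" using Ck_on_le[OF v, of 0] by simp
  have cp: "continuous_on S \<phi>" using Ck_on_le[OF p2, of 0] by simp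
  have clv: "continuous_on S (laplacian v)" and clp: "continuous_on S (laplacian \<phi>)"
    using Ck_on_laplacian[OF S, of 0] v p2 by (auto simp: numeral_2_eq_2)
  show int1: "integrable lborel (\<lambda>z. v z * laplacian \<phi> z)"
    by (rule continuous_on_extend_by_zero(2)[OF S continuous_on_mult[OF cv clp] K]) (simp add: K2)
  have int2: "integrable lborel (\<lambda>z. \<phi> z * laplacian v z)"
    by (rule continuous_on_extend_by_zero(2)[OF S continuous_on_mult[OF cp clv] K]) (subst K0, auto)
  define W where "W p z = (if z \<in> S then v z * dir_deriv p \<phi> z - \<phi> z * dir_deriv p v z else 0)" for p z
  have W0: "W p z = 0" if "z \<notin> ?K" for p z using K0[OF that] K1[OF that] by (simp add: W_def)
  have WC: "Ck_on 1 UNIV (W p)" if "p = 1 \<or> p = \<i>" for p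
  proof -
    have "Ck_on 1 S (dir_deriv p \<phi>)" "Ck_on 1 S (dir_deriv p v)"
      using p2 v that by (auto simp: numeral_2_eq_2)
    hence "Ck_on 1 S (\<lambda>z. v z * dir_deriv p \<phi> z - \<phi> z * dir_deriv p v z)"
      by (intro Ck_on_diff Ck_on_mult S v1 p1)
    hence "Ck_on 1 S (W p)" by (subst Ck_on_cong[OF S]) (auto simp: W_def)
    moreover have "Ck_on 1 (- ?K) (W p)"
      by (subst Ck_on_cong[of _ _ "\<lambda>_. 0"]) (auto simp: W0)
    ultimately have "Ck_on 1 (S \<union> - ?K) (W p)" by (intro Ck_on_Un S) auto
    moreover have "S \<union> - ?K = UNIV" using K(2) by auto
    ultimately show ?thesis by simp
  qed
  have dW: "dir_deriv p (W p) z = v z * dir_deriv p (dir_deriv p \<phi>) z - \<phi> z * dir_deriv p (dir_deriv p v) z"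
    if p: "p = 1 \<or> p = \<i>" for p z
  proof (cases "z \<in> S")
    case True
    note dv = Ck2_differentiable[OF v S True] and dp = Ck2_differentiable[OF p2 S True]
    have dvp: "dir_deriv p v differentiable (at z)" "dir_deriv p \<phi> differentiable (at z)" using dv dp p by auto
    have "dir_deriv p (W p) z = dir_deriv p (\<lambda>z. v z * dir_deriv p \<phi> z + (-1) * (\<phi> z * dir_deriv p v z)) z"
      by (rule dir_deriv_cong[OF S True]) (simp add: W_def)
    also have "\<dots> = dir_deriv p (\<lambda>z. v z * dir_deriv p \<phi> z) z + dir_deriv p (\<lambda>z. (-1) * (\<phi> z * dir_deriv p v z)) z"
      by (intro dir_deriv_add differentiable_mult dv dp dvp differentiable_const)
    also have "dir_deriv p (\<lambda>z. (-1) * (\<phi> z * dir_deriv p v z)) z = (-1) * dir_deriv p (\<lambda>z. \<phi> z * dir_deriv p v z) z"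
      by (intro dir_deriv_cmult differentiable_mult dp dvp)
    also have "dir_deriv p (\<lambda>z. \<phi> z * dir_deriv p v z) z = \<phi> z * dir_deriv p (dir_deriv p v) z + dir_deriv p \<phi> z * dir_deriv p v z"
      by (intro dir_deriv_mult dp dvp)
    also have "dir_deriv p (\<lambda>z. v z * dir_deriv p \<phi> z) z = v z * dir_deriv p (dir_deriv p \<phi>) z + dir_deriv p v z * dir_deriv p \<phi> z"
      by (intro dir_deriv_mult dv dvp)
    finally show ?thesis by simp
  next
    case False
    hence z: "z \<notin> ?K" using K(2) by auto
    have "dir_deriv p (W p) z = 0" by (rule dir_deriv_zero_off_compact[OF K(1) W0 z])
    moreover have "dir_deriv p (dir_deriv p \<phi>) z = 0" by (rule dir_deriv_zero_off_compact[OF K(1) K1 z])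
    ultimately show ?thesis using K0[OF z] by simp
  qed
  have "(\<integral>z. dir_deriv 1 (W 1) z + dir_deriv \<i> (W \<i>) z \<partial>lborel) = 0 + 0"
    using integral_dir_deriv[OF WC K(1) W0, of 1] integral_dir_deriv[OF WC K(1) W0, of \<i>]
    by (subst Bochner_Integration.integral_add) auto
  moreover have "dir_deriv 1 (W 1) z + dir_deriv \<i> (W \<i>) z = v z * laplacian \<phi> z - \<phi> z * laplacian v z" for z
    by (simp add: dW laplacian_def algebra_simps)
  ultimately have "(\<integral>z. v z * laplacian \<phi> z - \<phi> z * laplacian v z \<partial>lborel) = 0" by simp
  thus "(\<integral>z. v z * laplacian \<phi> z \<partial>lborel) = (\<integral>z. \<phi> z * laplacian v z \<partial>lborel)"
    using int1 int2 by simp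
qed

section \<open>Subharmonic functions in the plane\<close>

subsection \<open>Upper semicontinuity\<close>

text \<open>The codomain is polymorphic, so that extended real functions and their real truncations
  are treated together. Neighbourhoods are taken in the plane, not relative to S; the notion thus
  passes from an open set to its compact subsets unchanged.\<close>

definition usc_on :: "complex set \<Rightarrow> (complex \<Rightarrow> 'b::linorder) \<Rightarrow> bool" where
  "usc_on S v \<longleftrightarrow> (\<forall>z\<in>S. \<forall>c. v z < c \<longrightarrow> (\<forall>\<^sub>F w in nhds z. v w < c))"

lemma usc_on_subset: "usc_on S v \<Longrightarrow> T \<subseteq> S \<Longrightarrow> usc_on T v"
  by (auto simp: usc_on_def)

lemma usc_on_add_continuous:
  fixes v :: "complex \<Rightarrow> real"
  assumes "usc_on S v" "continuous_on UNIV g"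
  shows "usc_on S (\<lambda>z. v z + g z)"
  unfolding usc_on_def
proof (intro ballI allI impI)
  fix z c assume z: "z \<in> S" and c: "v z + g z < c"
  define e where "e = (c - (v z + g z)) / 2"
  have e: "e > 0" using c by (simp add: e_def)
  have "\<forall>\<^sub>F w in nhds z. v w < v z + e" using assms(1) z e by (auto simp: usc_on_def)
  moreover have "\<forall>\<^sub>F w in nhds z. g w < g z + e"
  proof -
    have "isCont g z" using assms(2) by (simp add: continuous_on_eq_continuous_at)
    hence "(g \<longlongrightarrow> g z) (nhds z)" by (simp add: continuous_at_imp_continuous_within isCont_def tendsto_at_iff_tendsto_nhds)
    thus ?thesis using e by (auto dest: order_tendstoD(2)[of _ _ _ "g z + e"])
  qed
  ultimately show "\<forall>\<^sub>F w in nhds z. v w + g w < c"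
    by eventually_elim (auto simp: e_def field_simps)
qed

lemma usc_measurable:
  fixes v :: "complex \<Rightarrow> 'b::{second_countable_topology, linorder_topology, zero}"
  assumes "open S" "usc_on S v"
  shows "(\<lambda>w. if w \<in> S then v w else 0) \<in> borel_measurable borel"
proof (rule borel_measurableI_less)
  fix c
  have "open {w \<in> S. v w < c}"
  proof (subst open_subopen, intro ballI)
    fix z assume z: "z \<in> {w \<in> S. v w < c}"
    hence "\<forall>\<^sub>F w in nhds z. v w < c" using assms(2) by (auto simp: usc_on_def)
    then obtain T where "open T" "z \<in> T" "\<forall>w\<in>T. v w < c" by (auto simp: eventually_nhds)
    with assms(1) z show "\<exists>T. open T \<and> z \<in> T \<and> T \<subseteq> {w \<in> S. v w < c}"
      by (intro exI[of _ "T \<inter> S"]) auto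
  qed
  moreover have "{w \<in> space borel. (if w \<in> S then v w else 0) < c} =
      {w \<in> S. v w < c} \<union> (if 0 < c then - S else {})" by auto
  ultimately show "{w \<in> space borel. (if w \<in> S then v w else 0) < c} \<in> sets borel"
    using assms(1) by auto
qed

text \<open>Without a maximum, the open sets on which v stays below some value v q with q in K cover
  K. The largest such value in a finite subcover contradicts itself at its own point q.\<close>

lemma usc_attains_max:
  assumes K: "compact K" "K \<noteq> {}" and v: "usc_on K v"
  shows "\<exists>p\<in>K. \<forall>q\<in>K. v q \<le> v p"
proof (rule ccontr)
  assume neg: "\<not> ?thesis"
  let ?C = "{T. open T \<and> (\<exists>q\<in>K. \<forall>w\<in>T. v w < v q)}"
  have "K \<subseteq> \<Union>?C"
  proof
    fix p assume p: "p \<in> K"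
    then obtain q where q: "q \<in> K" "v p < v q" using neg by (auto simp: not_le)
    hence "\<forall>\<^sub>F w in nhds p. v w < v q" using v p by (auto simp: usc_on_def)
    then obtain T where "open T" "p \<in> T" "\<forall>w\<in>T. v w < v q" by (auto simp: eventually_nhds)
    with q show "p \<in> \<Union>?C" by auto
  qed
  then obtain D where D: "D \<subseteq> ?C" "finite D" "K \<subseteq> \<Union>D"
    by (rule compactE[OF K(1)]) auto
  have "\<forall>T\<in>D. \<exists>q. q \<in> K \<and> (\<forall>w\<in>T. v w < v q)" using D(1) by blast
  from bchoice[OF this] obtain q where q: "\<And>T. T \<in> D \<Longrightarrow> q T \<in> K \<and> (\<forall>w\<in>T. v w < v (q T))" by blast
  let ?I = "(\<lambda>T. v (q T)) ` D"
  have I: "finite ?I" "?I \<noteq> {}" using D(2,3) K(2) by auto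
  obtain T where T: "T \<in> D" "v (q T) = Max ?I" using Max_in[OF I] by auto
  have T2: "v (q T') \<le> v (q T)" if "T' \<in> D" for T' unfolding T(2) using that by (intro Max_ge I) auto
  obtain T' where "T' \<in> D" "q T \<in> T'" using q[OF T(1)] D(3) by blast
  thus False using q[of T'] T2[of T'] by fastforce
qed

subsection \<open>Circle averages\<close>

text \<open>Companion of \<open>circle_mean\<close> for real functions, as one Bochner integral.
  Truncated subharmonic functions are bounded on circles, and for them the two are compared.\<close>

definition circle_average :: "(complex \<Rightarrow> real) \<Rightarrow> complex \<Rightarrow> real \<Rightarrow> real" where
  "circle_average v z r = (\<integral>t. indicator {0..2*pi} t * v (z + rcis r t) \<partial>lborel) / (2 * pi)"

lemma rcis_in_sphere: "r \<ge> 0 \<Longrightarrow> z + rcis r t \<in> sphere z r"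
  by (simp add: dist_norm)

lemma continuous_on_rcis: "continuous_on A (\<lambda>t. rcis r t)"
  unfolding rcis_def by (intro continuous_intros)

lemma rcis_measurable [measurable]: "(\<lambda>t. rcis r t) \<in> borel_measurable borel"
  by (rule borel_measurable_continuous_onI[OF continuous_on_rcis])

lemma circle_integrable:
  fixes v f :: "complex \<Rightarrow> real"
  assumes m: "f \<in> borel_measurable borel" and eq: "\<And>w. w \<in> sphere z r \<Longrightarrow> v w = f w"
    and b: "\<And>w. w \<in> sphere z r \<Longrightarrow> \<bar>v w\<bar> \<le> B" and r: "r \<ge> 0"
  shows "integrable lborel (\<lambda>t. indicator {0..2*pi} t * v (z + rcis r t))"
proof -
  have "(\<lambda>t. indicator {0..2*pi} t * v (z + rcis r t)) = (\<lambda>t. indicator {0..2*pi} t * f (z + rcis r t))"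
    using eq[OF rcis_in_sphere[OF r]] by simp
  moreover have "integrable lborel (\<lambda>t. indicator {0..2*pi} t * f (z + rcis r t))"
  proof (rule Bochner_Integration.integrable_bound)
    show "integrable lborel (\<lambda>t. \<bar>B\<bar> * indicator {0..2*pi} t)"
      by (intro integrable_mult_right integrable_real_indicator) (auto simp: emeasure_lborel_Icc_eq)
    show "(\<lambda>t. indicator {0..2*pi} t * f (z + rcis r t)) \<in> borel_measurable lborel"
      using m by measurable
    show "AE t in lborel. norm (indicator {0..2*pi} t * f (z + rcis r t)) \<le> norm (\<bar>B\<bar> * indicator {0..2*pi} t)"
      using b[OF rcis_in_sphere[OF r]] eq[OF rcis_in_sphere[OF r]]
      by (auto simp: indicator_def abs_mult intro: order_trans[OF _ abs_ge_self])
  qed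
  ultimately show ?thesis by simp
qed

lemma circle_integrable_usc:
  fixes v :: "complex \<Rightarrow> real"
  assumes "open S" "usc_on S v" "cball z r \<subseteq> S" "r \<ge> 0" "\<And>w. w \<in> sphere z r \<Longrightarrow> \<bar>v w\<bar> \<le> B"
  shows "integrable lborel (\<lambda>t. indicator {0..2*pi} t * v (z + rcis r t))"
  by (rule circle_integrable[OF usc_measurable[OF assms(1,2)]]) (use assms in auto)

lemma circle_integrable_continuous:
  fixes v :: "complex \<Rightarrow> real"
  assumes "continuous_on (sphere z r) v" "r \<ge> 0"
  shows "integrable lborel (\<lambda>t. indicator {0..2*pi} t * v (z + rcis r t))"
proof -
  have "continuous_on {0..2*pi} (\<lambda>t. v (z + rcis r t))"
    by (intro continuous_on_compose2[OF assms(1)] continuous_intros continuous_on_rcis)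
       (use rcis_in_sphere[OF assms(2)] in auto)
  from borel_integrable_compact[OF compact_Icc this] show ?thesis by simp
qed

lemma circle_average_mono:
  assumes "integrable lborel (\<lambda>t. indicator {0..2*pi} t * v (z + rcis r t))"
    "integrable lborel (\<lambda>t. indicator {0..2*pi} t * w (z + rcis r t))"
    "\<And>q. q \<in> sphere z r \<Longrightarrow> v q \<le> w q" "r \<ge> 0"
  shows "circle_average v z r \<le> circle_average w z r"
  unfolding circle_average_def
  using assms(3)[OF rcis_in_sphere[OF assms(4)]]
  by (intro divide_right_mono integral_mono assms) (auto simp: indicator_def)

text \<open>Real part of Cauchy's formula: in the parametrization the denominator u - z cancels
  against the derivative of the circle.\<close>

lemma circle_average_Re_holomorphic:
  assumes P: "P holomorphic_on UNIV" and r: "r > 0"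
  shows "circle_average (\<lambda>w. Re (P w)) z r = Re (P z)"
proof -
  have "((\<lambda>u. P u / (u - z)) has_contour_integral (2 * of_real pi * \<i> * P z)) (part_circlepath z r 0 (2 * pi))"
    using Cauchy_integral_circlepath_simple[of P z r z] holomorphic_on_subset[OF P] r by (simp add: circlepath_def)
  hence "((\<lambda>t. P (z + r * cis t) / (z + r * cis t - z) * r * \<i> * cis t) has_integral (2 * of_real pi * \<i> * P z)) {0..2 * pi}"
    by (subst (asm) has_contour_integral_part_circlepath_iff) auto
  moreover have "P (z + r * cis t) / (z + r * cis t - z) * r * \<i> * cis t = \<i> * P (z + rcis r t)" for t
    using r by (simp add: rcis_def)
  ultimately have "((\<lambda>t. \<i> * P (z + rcis r t)) has_integral (2 * of_real pi * \<i> * P z)) {0..2 * pi}" by (simp only:)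
  from has_integral_linear[OF this bounded_linear_Im]
  have hi: "((\<lambda>t. Re (P (z + rcis r t))) has_integral (2 * pi * Re (P z))) {0..2 * pi}"
    by (simp add: o_def)
  have "continuous_on (sphere z r) (\<lambda>w. Re (P w))"
    using holomorphic_on_imp_continuous_on[OF P] by (intro continuous_intros) (auto intro: continuous_on_subset)
  from circle_integrable_continuous[OF this]
  have "set_integrable lborel {0..2*pi} (\<lambda>t. Re (P (z + rcis r t)))"
    using r by (simp add: set_integrable_def)
  from set_borel_integral_eq_integral(2)[OF this]
  have "(\<integral>t. indicator {0..2*pi} t * Re (P (z + rcis r t)) \<partial>lborel) = 2 * pi * Re (P z)"
    using integral_unique[OF hi] by (simp add: set_lebesgue_integral_def)
  thus ?thesis by (simp add: circle_average_def)
qed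

lemma circle_average_add:
  assumes "integrable lborel (\<lambda>t. indicator {0..2*pi} t * v (z + rcis r t))"
    "integrable lborel (\<lambda>t. indicator {0..2*pi} t * w (z + rcis r t))"
  shows "circle_average (\<lambda>q. v q + w q) z r = circle_average v z r + circle_average w z r"
  using assms by (simp add: circle_average_def distrib_left add_divide_distrib)

lemma circle_average_const: "circle_average (\<lambda>_. c) z r = c"
  by (simp add: circle_average_def)

subsection \<open>Trigonometric approximation on a circle\<close>

text \<open>On the circle these are the real trigonometric polynomials. They are generated as real
  parts of entire functions, so that their circle averages are known from the value at the
  centre.\<close>

inductive_set trig_polys :: "complex \<Rightarrow> real \<Rightarrow> (complex \<Rightarrow> real) set" for a :: complex and r :: real where
  base: "(\<lambda>z. Re (c * ((z - a) / of_real r) ^ k)) \<in> trig_polys a r"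
| sum: "f \<in> trig_polys a r \<Longrightarrow> g \<in> trig_polys a r \<Longrightarrow> (\<lambda>z. f z + g z) \<in> trig_polys a r"

lemma trig_polys_Re: "f \<in> trig_polys a r \<Longrightarrow> \<exists>P. P holomorphic_on UNIV \<and> f = (\<lambda>z. Re (P z))"
proof (induction rule: trig_polys.induct)
  case (base c k)
  have "(\<lambda>z. c * ((z - a) * inverse (of_real r)) ^ k) holomorphic_on UNIV" by (intro holomorphic_intros)
  thus ?case by (auto simp: divide_inverse)
next
  case (sum f g)
  then obtain P Q where "P holomorphic_on UNIV" "f = (\<lambda>z. Re (P z))" "Q holomorphic_on UNIV" "g = (\<lambda>z. Re (Q z))" by blast
  thus ?case by (intro exI[of _ "\<lambda>z. P z + Q z"]) (auto intro!: holomorphic_intros)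
qed

text \<open>On the unit circle the conjugate of e is its inverse, which turns a product of real
  parts into frequencies k + j and k - j; the order of j and k keeps the second exponent a natural
  number.\<close>

lemma Re_mult_unit_powers:
  assumes "norm e = 1" "j \<le> k"
  shows "Re (c * e ^ k) * Re (d * e ^ j) = Re ((c * d / 2) * e ^ (k + j)) + Re ((c * cnj d / 2) * e ^ (k - j))"
proof -
  have e: "e * cnj e = 1" using assms(1) by (simp add: complex_norm_square[symmetric])
  have "e ^ k * cnj (e ^ j) = e ^ (k - j) * (e * cnj e) ^ j"
    using assms(2) by (simp add: power_mult_distrib power_add[symmetric] flip: mult.assoc)
  hence 1: "e ^ k * cnj (e ^ j) = e ^ (k - j)" by (simp add: e)
  have "Re x * Re y = Re (x * y / 2) + Re (x * cnj y / 2)" for x y :: complex by (simp add: field_simps)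
  from this[of "c * e ^ k" "d * e ^ j"]
  have "Re (c * e ^ k) * Re (d * e ^ j) = Re (c * e ^ k * (d * e ^ j) / 2) + Re (c * e ^ k * cnj (d * e ^ j) / 2)" .
  also have "c * e ^ k * (d * e ^ j) / 2 = (c * d / 2) * e ^ (k + j)" by (simp add: power_add mult_ac)
  also have "c * e ^ k * cnj (d * e ^ j) / 2 = (c * cnj d / 2) * (e ^ k * cnj (e ^ j))" by (simp add: mult_ac)
  finally show ?thesis unfolding 1 .
qed

lemma trig_approximation:
  assumes r: "r > 0" and f: "continuous_on (sphere a r) f" and e: "e > 0"
  obtains P where "P holomorphic_on UNIV" "\<And>z. z \<in> sphere a r \<Longrightarrow> \<bar>f z - Re (P z)\<bar> < e"
proof -
  let ?S = "sphere a r"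
  \<comment> \<open>Agreement is asked for on the circle only: closure under products rests on |z -
    a| = r and fails off the circle.\<close>
  let ?P = "\<lambda>f. \<exists>g\<in>trig_polys a r. \<forall>z\<in>?S. f z = g z"
  have cont: "continuous_on ?S g" if "g \<in> trig_polys a r" for g
  proof -
    obtain P where P: "P holomorphic_on UNIV" "g = (\<lambda>z. Re (P z))" using trig_polys_Re[OF \<open>g \<in> _\<close>] by blast
    show ?thesis unfolding P(2)
      using holomorphic_on_imp_continuous_on[OF P(1)] by (intro continuous_intros) (auto intro: continuous_on_subset)
  qed
  have unit: "norm ((z - a) / of_real r) = 1" if "z \<in> ?S" for z
    using that r by (simp add: norm_divide dist_norm norm_minus_commute)
  have mult_base: "?P (\<lambda>z. Re (c * ((z - a) / of_real r) ^ k) * Re (d * ((z - a) / of_real r) ^ j))" for c d k j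
  proof (cases "j \<le> k")
    case True
    show ?thesis
      by (intro bexI[OF _ trig_polys.sum[OF trig_polys.base[of "c * d / 2" a r "k + j"] trig_polys.base[of "c * cnj d / 2" a r "k - j"]]] ballI
           Re_mult_unit_powers[OF unit True])
  next
    case False
    hence le: "k \<le> j" by simp
    show ?thesis
      by (intro bexI[OF _ trig_polys.sum[OF trig_polys.base[of "d * c / 2" a r "j + k"] trig_polys.base[of "d * cnj c / 2" a r "j - k"]]] ballI)
         (subst mult.commute, rule Re_mult_unit_powers[OF unit le])
  qed
  have mult1: "?P (\<lambda>z. Re (c * ((z - a) / of_real r) ^ k) * g z)" if "g \<in> trig_polys a r" for c k g
    using that
  proof (induction rule: trig_polys.induct)
    case (base d j)
    show ?case by (rule mult_base)
  next
    case (sum f g)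
    then obtain f' g' where "f' \<in> trig_polys a r" "g' \<in> trig_polys a r"
      "\<forall>z\<in>?S. Re (c * ((z - a) / of_real r) ^ k) * f z = f' z" "\<forall>z\<in>?S. Re (c * ((z - a) / of_real r) ^ k) * g z = g' z" by blast
    thus ?case by (intro bexI[OF _ trig_polys.sum[of f' a r g']]) (auto simp: distrib_left)
  qed
  have mult: "?P (\<lambda>z. f z * g z)" if "f \<in> trig_polys a r" "g \<in> trig_polys a r" for f g
    using that
  proof (induction rule: trig_polys.induct)
    case (base c k)
    show ?case by (rule mult1) fact
  next
    case (sum f1 f2)
    then obtain f' g' where "f' \<in> trig_polys a r" "g' \<in> trig_polys a r"
      "\<forall>z\<in>?S. f1 z * g z = f' z" "\<forall>z\<in>?S. f2 z * g z = g' z" by blast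
    thus ?case by (intro bexI[OF _ trig_polys.sum[of f' a r g']]) (auto simp: distrib_right)
  qed
  have "\<exists>g. ?P g \<and> (\<forall>x\<in>?S. \<bar>f x - g x\<bar> < e)"
  proof (rule Stone_Weierstrass_HOL[where P = ?P])
    show "compact ?S" by simp
    show "?P (\<lambda>x. c)" for c
      by (intro bexI[OF _ trig_polys.base[of "of_real c" a r 0]]) simp
    show "continuous_on ?S g" if "?P g" for g
    proof -
      from that obtain h where "h \<in> trig_polys a r" "\<forall>z\<in>?S. g z = h z" by blast
      thus ?thesis using cont[of h] by (metis (mono_tags, lifting) continuous_on_cong)
    qed
    show "?P (\<lambda>x. g x + h x)" if "?P g \<and> ?P h" for g h
    proof -
      from that obtain g' h' where "g' \<in> trig_polys a r" "h' \<in> trig_polys a r" "\<forall>z\<in>?S. g z = g' z" "\<forall>z\<in>?S. h z = h' z" by blast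
      thus ?thesis by (intro bexI[OF _ trig_polys.sum[of g' a r h']]) auto
    qed
    show "?P (\<lambda>x. g x * h x)" if "?P g \<and> ?P h" for g h
    proof -
      from that obtain g' h' where gh: "g' \<in> trig_polys a r" "h' \<in> trig_polys a r" "\<forall>z\<in>?S. g z = g' z" "\<forall>z\<in>?S. h z = h' z" by blast
      from mult[OF gh(1,2)] gh(3,4) show ?thesis by auto
    qed
    show "\<exists>f. ?P f \<and> f x \<noteq> f y" if xy: "x \<in> ?S \<and> y \<in> ?S \<and> x \<noteq> y" for x y
    proof (cases "Re x = Re y")
      case False
      have "Re (1 * ((x - a) / of_real r) ^ 1) \<noteq> Re (1 * ((y - a) / of_real r) ^ 1)"
        using False r by (simp add: Re_divide_of_real)
      moreover have "?P (\<lambda>z. Re (1 * ((z - a) / of_real r) ^ 1))"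
        by (rule bexI[OF _ trig_polys.base[of "1" a r 1]]) simp
      ultimately show ?thesis by (intro exI[of _ "\<lambda>z. Re (1 * ((z - a) / of_real r) ^ 1)"] conjI)
    next
      case True
      hence "Im x \<noteq> Im y" using xy by (simp add: complex_eq_iff)
      hence "Re (\<i> * ((x - a) / of_real r) ^ 1) \<noteq> Re (\<i> * ((y - a) / of_real r) ^ 1)"
        using r by (simp add: Im_divide_of_real)
      moreover have "?P (\<lambda>z. Re (\<i> * ((z - a) / of_real r) ^ 1))"
        by (rule bexI[OF _ trig_polys.base[of "\<i>" a r 1]]) simp
      ultimately show ?thesis by (intro exI[of _ "\<lambda>z. Re (\<i> * ((z - a) / of_real r) ^ 1)"] conjI)
    qed
  qed (fact f, fact e)
  then obtain g h where g: "h \<in> trig_polys a r" "\<forall>z\<in>?S. g z = h z" "\<forall>x\<in>?S. \<bar>f x - g x\<bar> < e" by blast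
  obtain P where "P holomorphic_on UNIV" "h = (\<lambda>z. Re (P z))" using trig_polys_Re[OF g(1)] by blast
  with g that show ?thesis by auto
qed

subsection \<open>The global sub-mean-value inequality\<close>

definition locally_submean_on :: "complex set \<Rightarrow> (complex \<Rightarrow> real) \<Rightarrow> bool" where
  "locally_submean_on S v \<longleftrightarrow>
     (\<forall>z\<in>S. \<exists>\<rho>>0. \<forall>r. 0 < r \<and> r < \<rho> \<longrightarrow> v z \<le> circle_average v z r)"

text \<open>Maximum principle with the penalty \<delta> |z - a|^2, which makes v - Re P strictly
  subharmonic: an interior maximum would violate the local mean inequality on a small circle. With
  \<delta> = e / r^2 the penalty on the boundary is just e.\<close>

lemma submean_le_harmonic:
  assumes S: "open S" and usc: "usc_on S v" and sub: "locally_submean_on S v"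
    and below: "\<And>w. w \<in> S \<Longrightarrow> - m \<le> v w"
    and r: "r > 0" "cball a r \<subseteq> S" and P: "P holomorphic_on UNIV"
    and le: "\<And>z. z \<in> sphere a r \<Longrightarrow> v z \<le> Re (P z)"
  shows "v a \<le> Re (P a)"
proof (rule field_le_epsilon)
  fix e :: real assume e: "e > 0"
  define \<delta> where "\<delta> = e / r\<^sup>2"
  have d: "\<delta> > 0" using e r by (simp add: \<delta>_def)
  let ?g = "\<lambda>z. \<delta> * (norm (z - a))\<^sup>2 - Re (P z)"
  have Pc: "continuous_on UNIV P" by (rule holomorphic_on_imp_continuous_on[OF P])
  have "usc_on S (\<lambda>z. v z + ?g z)"
    by (intro usc_on_add_continuous usc continuous_intros Pc)
  hence "usc_on (cball a r) (\<lambda>z. v z + ?g z)" by (rule usc_on_subset[OF _ r(2)])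
  moreover have "cball a r \<noteq> {}" using r by simp
  ultimately obtain p where
    p: "p \<in> cball a r" "\<And>q. q \<in> cball a r \<Longrightarrow> v q + ?g q \<le> v p + ?g p"
    using usc_attains_max[OF compact_cball] by blast
  have "dist a p = r"
  proof (rule ccontr)
    assume "dist a p \<noteq> r"
    hence pr: "dist a p < r" using p(1) by simp
    obtain \<rho> where rho: "\<rho> > 0" "\<And>s. 0 < s \<Longrightarrow> s < \<rho> \<Longrightarrow> v p \<le> circle_average v p s"
      using sub p(1) r(2) unfolding locally_submean_on_def by blast
    define s where "s = min \<rho> (r - dist a p) / 2"
    have s: "s > 0" "s < \<rho>" "s < r - dist a p" using rho(1) pr by (auto simp: s_def min_def)
    have sb: "cball p s \<subseteq> cball a r"
    proof
      fix q assume "q \<in> cball p s"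
      thus "q \<in> cball a r" using dist_triangle[of a q p] s(3) by simp
    qed
    \<comment> \<open>On the circle of radius s about p the penalty |q - a|^2 is a constant plus
      twice Re(cnj(p - a) (q - p)). Hence the upper bound for v given by maximality is there the
      real part of the entire function \<open>?P2\<close>, whose value at p falls short of v p by
      \<delta> s^2.\<close>
    define c where "c = v p + ?g p - \<delta> * ((norm (p - a))\<^sup>2 + s\<^sup>2)"
    let ?P2 = "\<lambda>q. of_real c + P q - of_real (2 * \<delta>) * cnj (p - a) * (q - p)"
    have P2: "?P2 holomorphic_on UNIV" by (intro holomorphic_intros P)
    have up: "v q \<le> Re (?P2 q)" if q: "q \<in> sphere p s" for q
    proof -
      have "v q \<le> v p + ?g p - ?g q" using p(2)[of q] sb q by auto
      moreover have "(norm (q - a))\<^sup>2 = (norm (p - a))\<^sup>2 + s\<^sup>2 + 2 * Re (cnj (p - a) * (q - p))"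
      proof -
        have s2: "s\<^sup>2 = (norm (q - p))\<^sup>2" using q by (simp add: dist_norm norm_minus_commute)
        show ?thesis unfolding s2 cmod_power2 by (simp add: power2_eq_square algebra_simps)
      qed
      ultimately have "v q \<le> v p + ?g p - \<delta> * ((norm (p - a))\<^sup>2 + s\<^sup>2 + 2 * Re (cnj (p - a) * (q - p))) + Re (P q)" by simp
      also have "\<dots> = c + Re (P q) - 2 * \<delta> * Re (cnj (p - a) * (q - p))"
        unfolding c_def by (simp add: algebra_simps)
      also have "\<dots> = Re (?P2 q)"
        by (simp add: algebra_simps)
      finally show ?thesis .
    qed
    have P2c: "continuous_on (sphere p s) (\<lambda>q. Re (?P2 q))"
      using holomorphic_on_imp_continuous_on[OF P2] by (intro continuous_on_Re) (auto intro: continuous_on_subset)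
    have "bounded ((\<lambda>q. Re (?P2 q)) ` sphere p s)"
      by (intro compact_imp_bounded compact_continuous_image P2c) auto
    then obtain B where "\<forall>x\<in>(\<lambda>q. Re (?P2 q)) ` sphere p s. norm x \<le> B" unfolding bounded_iff by blast
    from bspec[OF this imageI] have B: "\<And>q. q \<in> sphere p s \<Longrightarrow> \<bar>Re (?P2 q)\<bar> \<le> B"
      unfolding real_norm_def .
    have sS: "cball p s \<subseteq> S" using sb r(2) by auto
    have "\<bar>v q\<bar> \<le> max \<bar>B\<bar> \<bar>m\<bar>" if "q \<in> sphere p s" for q
      using up[OF that] B[OF that] below[of q] that sS by (auto simp: subset_iff abs_le_iff max_def)
    hence "integrable lborel (\<lambda>t. indicator {0..2*pi} t * v (p + rcis s t))"
      using s by (intro circle_integrable_usc[OF S usc sS]) auto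
    from circle_average_mono[OF this circle_integrable_continuous[OF P2c] up]
    have "circle_average v p s \<le> circle_average (\<lambda>q. Re (?P2 q)) p s" using s by simp
    also have "\<dots> = Re (?P2 p)" by (rule circle_average_Re_holomorphic[OF P2 s(1)])
    also have "\<dots> = v p - \<delta> * s\<^sup>2" unfolding c_def by (simp add: algebra_simps)
    finally have "v p \<le> v p - \<delta> * s\<^sup>2" using rho(2)[OF s(1,2)] by simp
    thus False using d s(1) by (simp add: mult_le_0_iff)
  qed
  hence ps: "p \<in> sphere a r" by simp
  have "v a + ?g a \<le> v p + ?g p" using p(2)[of a] r(1) by simp
  also have "v p + ?g p \<le> \<delta> * r\<^sup>2" using le[OF ps] ps by (simp add: dist_norm norm_minus_commute)
  also have "\<dots> = e" using r by (simp add: \<delta>_def)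
  finally show "v a \<le> Re (P a) + e" by simp
qed

lemma submean_le_continuous_average:
  assumes S: "open S" and usc: "usc_on S v" and sub: "locally_submean_on S v"
    and below: "\<And>w. w \<in> S \<Longrightarrow> - m \<le> v w"
    and r: "r > 0" "cball a r \<subseteq> S" and f: "continuous_on (sphere a r) f"
    and le: "\<And>z. z \<in> sphere a r \<Longrightarrow> v z \<le> f z"
  shows "v a \<le> circle_average f a r"
proof (rule field_le_epsilon)
  fix e :: real assume e: "e > 0"
  have "continuous_on (sphere a r) (\<lambda>z. f z + e / 2)" by (intro continuous_intros f)
  \<comment> \<open>Approximating f + e/2 within e/2 puts Re P between f and f + e on the
    circle.\<close>
  then obtain P where P: "P holomorphic_on UNIV" "\<And>z. z \<in> sphere a r \<Longrightarrow> \<bar>f z + e / 2 - Re (P z)\<bar> < e / 2"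
    using trig_approximation[OF r(1), of a "\<lambda>z. f z + e / 2" "e / 2"] e by auto
  have "v a \<le> Re (P a)"
  proof (rule submean_le_harmonic[OF S usc sub below r P(1)])
    show "v z \<le> Re (P z)" if "z \<in> sphere a r" for z
      using le[OF that] P(2)[OF that] unfolding abs_less_iff by linarith
  qed
  also have "\<dots> = circle_average (\<lambda>w. Re (P w)) a r" by (rule circle_average_Re_holomorphic[OF P(1) r(1), symmetric])
  also have "\<dots> \<le> circle_average (\<lambda>z. f z + e) a r"
  proof (rule circle_average_mono)
    have "continuous_on (sphere a r) (\<lambda>w. Re (P w))"
      using holomorphic_on_imp_continuous_on[OF P(1)] by (intro continuous_on_Re) (auto intro: continuous_on_subset)
    thus "integrable lborel (\<lambda>t. indicator {0..2*pi} t * Re (P (a + rcis r t)))"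
      using r by (intro circle_integrable_continuous) auto
    show "integrable lborel (\<lambda>t. indicator {0..2*pi} t * (f (a + rcis r t) + e))"
      using r by (intro circle_integrable_continuous continuous_intros f) auto
    show "Re (P q) \<le> f q + e" if "q \<in> sphere a r" for q using P(2)[OF that] unfolding abs_less_iff by linarith
  qed (use r in auto)
  also have "\<dots> = circle_average f a r + circle_average (\<lambda>_. e) a r"
    using r by (intro circle_average_add circle_integrable_continuous f) auto
  finally show "v a \<le> circle_average f a r + e" by (simp add: circle_average_const)
qed

text \<open>An upper semicontinuous v is on the circle the pointwise limit of the n-Lipschitz
  majorants f n x = sup (v y - n |x - y|), which stay below max v. The inequality for continuous
  majorants then passes to v by dominated convergence.\<close>

lemma global_submean:
  assumes S: "open S" and usc: "usc_on S v" and sub: "locally_submean_on S v"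
    and below: "\<And>w. w \<in> S \<Longrightarrow> - m \<le> v w" and r: "r > 0" "cball a r \<subseteq> S"
  shows "v a \<le> circle_average v a r"
proof -
  let ?K = "sphere a r"
  have K: "?K \<noteq> {}" "?K \<subseteq> S" using r by auto
  obtain p where p: "p \<in> ?K" "\<And>q. q \<in> ?K \<Longrightarrow> v q \<le> v p"
    using usc_attains_max[OF compact_sphere K(1) usc_on_subset[OF usc K(2)]] by blast
  define f where "f n x = (SUP y\<in>?K. v y - real n * dist x y)" for n x
  have bdd: "bdd_above ((\<lambda>y. v y - real n * dist x y) ` ?K)" for n x
    by (rule bdd_aboveI[of _ "v p"]) (use p(2) in \<open>force intro: order_trans[rotated]\<close>)
  have ge: "v x \<le> f n x" if "x \<in> ?K" for n x
    using cSUP_upper[OF that bdd[of n x]] by (simp add: f_def)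
  have fle: "f n x \<le> v p" for n x
    unfolding f_def by (rule cSUP_least[OF K(1)]) (use p(2) in \<open>force intro: order_trans[rotated]\<close>)
  have lip: "f n x \<le> f n x' + real n * dist x x'" for n x x'
    unfolding f_def
  proof (rule cSUP_least[OF K(1)])
    fix y assume y: "y \<in> ?K"
    have "real n * dist x' y \<le> real n * (dist x x' + dist x y)"
      using dist_triangle[of x' y x] by (intro mult_left_mono) (auto simp: dist_commute)
    hence "v y - real n * dist x y \<le> v y - real n * dist x' y + real n * dist x x'" by (simp add: distrib_left)
    also have "v y - real n * dist x' y \<le> (SUP y\<in>?K. v y - real n * dist x' y)"
      by (rule cSUP_upper[OF y bdd])
    finally show "v y - real n * dist x y \<le> (SUP y\<in>?K. v y - real n * dist x' y) + real n * dist x x'" by simp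
  qed
  have cont: "continuous_on A (f n)" for n A
  proof -
    have "n-lipschitz_on UNIV (f n)"
    proof (rule lipschitz_onI)
      show "dist (f n x) (f n y) \<le> real n * dist x y" for x y
        using lip[of n x y] lip[of n y x] by (simp add: dist_real_def abs_le_iff dist_commute)
    qed simp
    thus ?thesis using lipschitz_on_continuous_on continuous_on_subset by blast
  qed
  have conv: "(\<lambda>n. f n x) \<longlonglongrightarrow> v x" if x: "x \<in> ?K" for x
  proof (rule order_tendstoI)
    fix c assume "c < v x"
    thus "\<forall>\<^sub>F n in sequentially. c < f n x" using ge[OF x] by (auto intro: always_eventually less_le_trans)
  next
    fix c assume "v x < c"
    then obtain c' where c': "v x < c'" "c' < c" using dense by blast
    have "\<forall>\<^sub>F w in nhds x. v w < c'" using usc x K(2) c' by (auto simp: usc_on_def)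
    then obtain d where d: "d > 0" "\<And>w. dist w x < d \<Longrightarrow> v w < c'" by (auto simp: eventually_nhds_metric)
    obtain N :: nat where N: "real N * d > v p - c'" using reals_Archimedean3[OF d(1)] by blast
    have "f n x \<le> c'" if "n \<ge> N" for n
      unfolding f_def
    proof (rule cSUP_least[OF K(1)])
      fix y assume y: "y \<in> ?K"
      show "v y - real n * dist x y \<le> c'"
      proof (cases "dist y x < d")
        case True
        with d(2)[of y] show ?thesis by (smt (verit) mult_nonneg_nonneg of_nat_0_le_iff zero_le_dist)
      next
        case False
        have "real N * d \<le> real n * dist x y" using that False d(1) by (intro mult_mono) (auto simp: dist_commute)
        with N p(2)[OF y] show ?thesis by linarith
      qed
    qed
    hence "f n x < c" if "n \<ge> N" for n using that c'(2) by (meson le_less_trans)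
    thus "\<forall>\<^sub>F n in sequentially. f n x < c" by (rule eventually_sequentiallyI)
  qed
  have vb: "\<bar>v q\<bar> \<le> \<bar>v p\<bar> + \<bar>m\<bar>" if "q \<in> ?K" for q using p(2)[OF that] below[of q] that K(2) by (auto simp: abs_le_iff)
  have fb: "\<bar>f n q\<bar> \<le> \<bar>v p\<bar> + \<bar>m\<bar>" if "q \<in> ?K" for n q
    using fle[of n q] ge[OF that, of n] below[of q] that K(2) by (auto simp: abs_le_iff)
  have in_K: "a + rcis r t \<in> ?K" for t using r by (intro rcis_in_sphere) auto
  have "(\<lambda>n. \<integral>t. indicator {0..2*pi} t * f n (a + rcis r t) \<partial>lborel) \<longlonglongrightarrow> (\<integral>t. indicator {0..2*pi} t * v (a + rcis r t) \<partial>lborel)"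
  proof (rule integral_dominated_convergence)
    have "integrable lborel (\<lambda>t. indicator {0..2*pi} t * v (a + rcis r t))"
      using r by (intro circle_integrable_usc[OF S usc r(2) _ vb]) auto
    thus "(\<lambda>t. indicator {0..2*pi} t * v (a + rcis r t)) \<in> borel_measurable lborel" by auto
    have "integrable lborel (\<lambda>t. indicator {0..2*pi} t * f n (a + rcis r t))" for n
      using r by (intro circle_integrable_continuous cont) auto
    thus "(\<lambda>t. indicator {0..2*pi} t * f n (a + rcis r t)) \<in> borel_measurable lborel" for n by auto
    show "integrable lborel (\<lambda>t. indicator {0..2*pi} t * (\<bar>v p\<bar> + \<bar>m\<bar>) :: real)"
      by (intro integrable_mult_left integrable_real_indicator) (auto simp: emeasure_lborel_Icc_eq)
    show "AE t in lborel. (\<lambda>n. indicator {0..2*pi} t * f n (a + rcis r t)) \<longlonglongrightarrow> indicator {0..2*pi} t * v (a + rcis r t)"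
      by (intro AE_I2 tendsto_intros conv in_K)
    show "AE t in lborel. norm (indicator {0..2*pi} t * f n (a + rcis r t)) \<le> indicator {0..2*pi} t * (\<bar>v p\<bar> + \<bar>m\<bar>)" for n
      using fb[OF in_K] by (intro AE_I2) (simp add: abs_mult indicator_def)
  qed
  hence "(\<lambda>n. circle_average (f n) a r) \<longlonglongrightarrow> circle_average v a r"
    unfolding circle_average_def by (intro tendsto_divide tendsto_const) auto
  moreover have "v a \<le> circle_average (f n) a r" for n
    by (rule submean_le_continuous_average[OF S usc sub below r cont ge])
  ultimately show ?thesis by (intro tendsto_lowerbound[of _ _ sequentially]) auto
qed

subsection \<open>Area averages\<close>

lemma integral_periodic_shift:
  fixes h :: "real \<Rightarrow> real"
  assumes m: "h \<in> borel_measurable borel" and b: "\<And>t. \<bar>h t\<bar> \<le> B" and per: "\<And>t. h (t + 2 * pi) = h t"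
    and \<alpha>: "0 \<le> \<alpha>" "\<alpha> \<le> 2 * pi"
  shows "(\<integral>t. indicator {0..2*pi} t * h (t + \<alpha>) \<partial>lborel) = (\<integral>t. indicator {0..2*pi} t * h t \<partial>lborel)"
proof -
  have ico: "(\<integral>t. indicator {0..2*pi} t * k t \<partial>lborel) = (\<integral>t. indicator {0..<2*pi} t * k t \<partial>lborel)"
    if [measurable]: "k \<in> borel_measurable borel" for k :: "real \<Rightarrow> real"
  proof (rule integral_cong_AE)
    show "AE t in lborel. indicator {0..2*pi} t * k t = indicator {0..<2*pi} t * k t"
      using AE_lborel_singleton[of "2*pi"] by eventually_elim (auto simp: indicator_def)
  qed measurable
  have int: "integrable lborel (\<lambda>t. indicator {c..<d} t * h t)" for c d
  proof (rule Bochner_Integration.integrable_bound)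
    show "integrable lborel (\<lambda>t. \<bar>B\<bar> * indicator {c..<d} t)"
      by (cases "c \<le> d") (intro integrable_mult_right integrable_real_indicator, auto)
    show "(\<lambda>t. indicator {c..<d} t * h t) \<in> borel_measurable lborel" using m by measurable
    show "AE t in lborel. norm (indicator {c..<d} t * h t) \<le> norm (\<bar>B\<bar> * indicator {c..<d} t)"
      using b by (intro AE_I2) (auto simp: indicator_def intro: order_trans[OF _ abs_ge_self])
  qed
  have ms: "(\<lambda>t. h (t + \<alpha>)) \<in> borel_measurable borel" using m by measurable
  have "(\<integral>t. indicator {0..2*pi} t * h (t + \<alpha>) \<partial>lborel) = (\<integral>t. indicator {0..<2*pi} t * h (t + \<alpha>) \<partial>lborel)"
    by (rule ico[OF ms])
  also have "\<dots> = (\<integral>t. indicator {\<alpha>..<2*pi+\<alpha>} (\<alpha> + 1 * t) * h (\<alpha> + 1 * t) \<partial>lborel)"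
    by (intro Bochner_Integration.integral_cong) (auto simp: indicator_def add.commute)
  also have "\<dots> = (\<integral>t. indicator {\<alpha>..<2*pi+\<alpha>} t * h t \<partial>lborel)"
    using lborel_integral_real_affine[of 1 "\<lambda>t. indicator {\<alpha>..<2*pi+\<alpha>} t * h t" \<alpha>] by simp
  also have "\<dots> = (\<integral>t. indicator {\<alpha>..<2*pi} t * h t + indicator {2*pi..<2*pi+\<alpha>} t * h t \<partial>lborel)"
    using \<alpha> by (intro Bochner_Integration.integral_cong) (auto simp: indicator_def)
  also have "\<dots> = (\<integral>t. indicator {\<alpha>..<2*pi} t * h t \<partial>lborel) + (\<integral>t. indicator {2*pi..<2*pi+\<alpha>} t * h t \<partial>lborel)"
    by (intro Bochner_Integration.integral_add int)
  also have "(\<integral>t. indicator {2*pi..<2*pi+\<alpha>} t * h t \<partial>lborel) = (\<integral>t. indicator {2*pi..<2*pi+\<alpha>} (2*pi + 1 * t) * h (2*pi + 1 * t) \<partial>lborel)"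
    using lborel_integral_real_affine[of 1 "\<lambda>t. indicator {2*pi..<2*pi+\<alpha>} t * h t" "2*pi"] by simp
  also have "\<dots> = (\<integral>t. indicator {0..<\<alpha>} t * h t \<partial>lborel)"
    using per by (intro Bochner_Integration.integral_cong) (auto simp: indicator_def add.commute)
  also have "(\<integral>t. indicator {\<alpha>..<2*pi} t * h t \<partial>lborel) + (\<integral>t. indicator {0..<\<alpha>} t * h t \<partial>lborel) =
     (\<integral>t. indicator {\<alpha>..<2*pi} t * h t + indicator {0..<\<alpha>} t * h t \<partial>lborel)"
    by (intro Bochner_Integration.integral_add[symmetric] int)
  also have "\<dots> = (\<integral>t. indicator {0..<2*pi} t * h t \<partial>lborel)"
    using \<alpha> by (intro Bochner_Integration.integral_cong) (auto simp: indicator_def)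
  also have "\<dots> = (\<integral>t. indicator {0..2*pi} t * h t \<partial>lborel)" by (rule ico[OF m, symmetric])
  finally show ?thesis .
qed

text \<open>Rotating w by all angles sweeps the circle of radius |w|. The starting angle
  \<open>Arg2pi w\<close> disappears by periodicity.\<close>

lemma rotation_average:
  assumes m: "V \<in> borel_measurable borel" and b: "\<And>z. z \<in> cball a R \<Longrightarrow> \<bar>V z\<bar> \<le> B" and w: "norm w \<le> R"
  shows "(\<integral>t. indicator {0..2*pi} t * V (a + cis t * w) \<partial>lborel) = 2 * pi * circle_average V a (norm w)"
proof -
  let ?h = "\<lambda>t. V (a + rcis (norm w) t)"
  have R: "0 \<le> R" using w norm_ge_zero order_trans by blast
  have "\<bar>V (a + rcis (norm w) t)\<bar> \<le> B" for t using w by (intro b) (simp add: dist_norm)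
  moreover have "?h (t + 2 * pi) = ?h t" for t by (simp add: rcis_def cis.ctr)
  ultimately have "(\<integral>t. indicator {0..2*pi} t * ?h (t + Arg2pi w) \<partial>lborel) = (\<integral>t. indicator {0..2*pi} t * ?h t \<partial>lborel)"
    using m Arg2pi_ge_0[of w] Arg2pi_lt_2pi[of w]
    by (intro integral_periodic_shift[where B = B]) (auto intro!: measurable_compose[OF _ m])
  moreover have "rcis (norm w) (t + Arg2pi w) = cis t * w" for t
  proof -
    have "w = of_real (norm w) * cis (Arg2pi w)" using Arg2pi_eq[of w] by (simp add: cis_conv_exp mult.commute)
    thus ?thesis by (metis (no_types, lifting) cis_mult mult.assoc mult.commute rcis_def)
  qed
  ultimately show ?thesis by (simp add: circle_average_def)
qed

text \<open>Instead of polar coordinates the function \<rho>(|w|) V(a + cis t w) is integrated over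
  angle and plane. Integration over t first yields circle averages, which are at least v a; over w
  first, every angle gives the same integral by rotation invariance. Fubini compares the
  two.\<close>

lemma area_submean:
  assumes S: "open S" and usc: "usc_on S v" and sub: "locally_submean_on S v"
    and below: "\<And>w. w \<in> S \<Longrightarrow> - m \<le> (v w :: real)" and R: "R > 0" "cball a R \<subseteq> S"
    and \<rho>: "\<rho> \<in> borel_measurable borel" "\<And>s. 0 \<le> \<rho> s" "\<And>s. \<rho> s \<le> K" "\<And>s. s > R \<Longrightarrow> \<rho> s = 0"
  shows "integrable lborel (\<lambda>w. v w * \<rho> (norm (w - a)))"
    and "v a * (\<integral>w. \<rho> (norm (w - a)) \<partial>lborel) \<le> (\<integral>w. v w * \<rho> (norm (w - a)) \<partial>lborel)"
    and "integrable lborel (\<lambda>w. \<rho> (norm (w - a)))"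
proof -
  define V where "V w = (if w \<in> S then v w else 0)" for w
  have Vm[measurable]: "V \<in> borel_measurable borel" unfolding V_def by (rule usc_measurable[OF S usc])
  note [measurable] = \<rho>(1)
  have Vv: "V w = v w" if "w \<in> cball a R" for w using that R(2) by (auto simp: V_def)
  obtain p where p: "p \<in> cball a R" "\<And>q. q \<in> cball a R \<Longrightarrow> v q \<le> v p"
    using usc_attains_max[OF compact_cball _ usc_on_subset[OF usc R(2)]] R(1) by (metis cball_eq_empty not_less_iff_gr_or_eq)
  define B where "B = \<bar>v p\<bar> + \<bar>m\<bar>"
  have VB: "\<bar>V w\<bar> \<le> B" if "w \<in> cball a R" for w
    using p(2)[OF that] below[of w] that R(2) unfolding B_def Vv[OF that] by (auto simp: abs_le_iff)
  have B0: "0 \<le> B" by (simp add: B_def)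
  have K0: "0 \<le> K" using \<rho>(2,3) order_trans by blast
  define G where "G w = \<rho> (norm w) * V (a + w)" for w
  have Gm[measurable]: "G \<in> borel_measurable borel" unfolding G_def by measurable
  define F where "F t w = indicator {0..2*pi} t * (\<rho> (norm w) * V (a + cis t * w))" for t w
  have [measurable]: "cis \<in> borel_measurable borel"
    by (intro borel_measurable_continuous_onI continuous_intros)
  have Fint: "integrable (lborel \<Otimes>\<^sub>M lborel) (\<lambda>(t, w). F t w)"
  proof (rule Bochner_Integration.integrable_bound)
    show "integrable (lborel \<Otimes>\<^sub>M lborel) (\<lambda>x. (K * B) * indicator ({0..2*pi} \<times> cball (0::complex) R) x)"
      unfolding lborel_prod
      by (intro integrable_mult_right integrable_real_indicator emeasure_bounded_finite bounded_Times)
         (auto intro!: borel_closed closed_Times)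
    show "(\<lambda>(t, w). F t w) \<in> borel_measurable (lborel \<Otimes>\<^sub>M lborel)"
      unfolding F_def by measurable
    have "norm (F t w) \<le> norm ((K * B) * indicator ({0..2*pi} \<times> cball (0::complex) R) (t, w))" for t w
    proof (cases "norm w \<le> R")
      case True
      hence "\<bar>V (a + cis t * w)\<bar> \<le> B" by (intro VB) (simp add: dist_norm norm_mult)
      hence "\<rho> (norm w) * \<bar>V (a + cis t * w)\<bar> \<le> K * B" using \<rho>(2,3) K0 by (intro mult_mono) auto
      thus ?thesis using True \<rho>(2) B0 K0 by (simp add: F_def abs_mult indicator_def)
    qed (use \<rho>(4) in \<open>simp add: F_def\<close>)
    thus "AE x in lborel \<Otimes>\<^sub>M lborel. norm (case x of (t, w) \<Rightarrow> F t w) \<le> norm ((K * B) * indicator ({0..2*pi} \<times> cball (0::complex) R) x)"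
      by (intro AE_I2) auto
  qed
  have Ft: "(\<integral>w. F t w \<partial>lborel) = indicator {0..2*pi} t * integral\<^sup>L lborel G" for t
  proof -
    have "(\<integral>w. F t w \<partial>lborel) = indicator {0..2*pi} t * (\<integral>w. G (cis t * w) \<partial>lborel)"
      unfolding F_def G_def by (simp add: norm_mult)
    thus ?thesis using integral_rotate(2)[of "cis t" G] by simp
  qed
  have Fw: "(\<integral>t. F t w \<partial>lborel) = \<rho> (norm w) * (2 * pi * circle_average V a (norm w))" for w
  proof (cases "norm w \<le> R")
    case True
    have "(\<integral>t. F t w \<partial>lborel) = (\<integral>t. \<rho> (norm w) * (indicator {0..2*pi} t * V (a + cis t * w)) \<partial>lborel)"
      unfolding F_def by (simp add: mult_ac)
    also have "\<dots> = \<rho> (norm w) * (\<integral>t. indicator {0..2*pi} t * V (a + cis t * w) \<partial>lborel)" by simp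
    finally show ?thesis using rotation_average[OF Vm VB True] by simp
  qed (use \<rho>(4) in \<open>simp add: F_def\<close>)
  have rho_int0: "integrable lborel (\<lambda>w::complex. \<rho> (norm w))"
  proof (rule Bochner_Integration.integrable_bound)
    show "integrable lborel (\<lambda>w. K * indicator (cball (0::complex) R) w)"
      using emeasure_bounded_finite[OF bounded_cball] by (intro integrable_mult_right integrable_real_indicator) auto
    show "AE w in lborel. norm (\<rho> (norm w)) \<le> norm (K * indicator (cball (0::complex) R) w)"
      using \<rho>(2-4) K0 by (intro AE_I2) (auto simp: indicator_def not_le)
  qed measurable
  have tr: "(\<integral>w. H (w - a) \<partial>lborel) = (\<integral>w. H w \<partial>lborel)" "integrable lborel (\<lambda>w. H (w - a)) \<longleftrightarrow> integrable lborel H"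
    if "H \<in> borel_measurable borel" for H :: "complex \<Rightarrow> real"
    using integral_translate[OF that, of "- a"] by simp_all
  show rho_int: "integrable lborel (\<lambda>w. \<rho> (norm (w - a)))"
    using tr(2)[of "\<lambda>w. \<rho> (norm w)"] rho_int0 by simp
  have Gint: "integrable lborel G"
  proof (rule Bochner_Integration.integrable_bound)
    show "integrable lborel (\<lambda>w::complex. B * \<rho> (norm w))" by (intro integrable_mult_right rho_int0)
    have "\<bar>G w\<bar> \<le> B * \<rho> (norm w)" for w
    proof (cases "norm w \<le> R")
      case True
      hence "\<bar>V (a + w)\<bar> \<le> B" by (intro VB) (simp add: dist_norm)
      hence "\<bar>V (a + w)\<bar> * \<rho> (norm w) \<le> B * \<rho> (norm w)" using \<rho>(2) by (intro mult_right_mono) auto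
      thus ?thesis using \<rho>(2)[of "norm w"] by (simp add: G_def abs_mult mult.commute)
    qed (use \<rho>(4) in \<open>simp add: G_def\<close>)
    thus "AE w in lborel. norm (G w) \<le> norm (B * \<rho> (norm w))"
      using B0 \<rho>(2) by (intro AE_I2) (simp add: abs_mult)
  qed simp
  have Gv: "(\<lambda>w. G (w - a)) = (\<lambda>w. v w * \<rho> (norm (w - a)))"
  proof
    fix w show "G (w - a) = v w * \<rho> (norm (w - a))"
      using Vv[of w] \<rho>(4)[of "norm (w - a)"]
      by (cases "norm (w - a) \<le> R") (auto simp: G_def dist_norm norm_minus_commute)
  qed
  show "integrable lborel (\<lambda>w. v w * \<rho> (norm (w - a)))"
    using tr(2)[OF Gm] Gint unfolding Gv by simp
  have "v a * (\<integral>w. \<rho> (norm (w - a)) \<partial>lborel) * (2 * pi) = (\<integral>w. \<rho> (norm w) * (2 * pi * v a) \<partial>(lborel::complex measure))"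
    using tr(1)[of "\<lambda>w. \<rho> (norm w)"] by simp
  also have "\<dots> \<le> (\<integral>w. (\<integral>t. F t w \<partial>lborel) \<partial>lborel)"
  proof (rule integral_mono)
    show "integrable lborel (\<lambda>w::complex. \<rho> (norm w) * (2 * pi * v a))"
      by (intro integrable_mult_left rho_int0)
    show "integrable lborel (\<lambda>w. \<integral>t. F t w \<partial>lborel)"
      using lborel_pair.integrable_snd[OF Fint] by simp
    fix w :: complex
    show "\<rho> (norm w) * (2 * pi * v a) \<le> (\<integral>t. F t w \<partial>lborel)"
    proof (cases "norm w \<le> R")
      case True
      have "v a \<le> circle_average V a (norm w)"
      proof (cases "w = 0")
        case True
        thus ?thesis using circle_average_const[of "V a" a 0] Vv[of a] R by (simp add: circle_average_def)
      next
        case False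
        hence "v a \<le> circle_average v a (norm w)"
          using True R(2) by (intro global_submean[OF S usc sub below]) auto
        also have "\<dots> = circle_average V a (norm w)"
          unfolding circle_average_def using True by (subst Vv) (auto simp: dist_norm)
        finally show ?thesis .
      qed
      thus ?thesis unfolding Fw using \<rho>(2) by (intro mult_left_mono) auto
    qed (use \<rho>(4) Fw in simp)
  qed
  also have "\<dots> = (\<integral>t. (\<integral>w. F t w \<partial>lborel) \<partial>lborel)"
    by (rule lborel_pair.Fubini_integral[OF Fint])
  also have "\<dots> = 2 * pi * integral\<^sup>L lborel G"
    unfolding Ft by simp
  also have "integral\<^sup>L lborel G = (\<integral>w. v w * \<rho> (norm (w - a)) \<partial>lborel)"
    using tr(1)[OF Gm] unfolding Gv by simp
  finally show "v a * (\<integral>w. \<rho> (norm (w - a)) \<partial>lborel) \<le> (\<integral>w. v w * \<rho> (norm (w - a)) \<partial>lborel)"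
    by (simp add: mult.commute)
qed

subsection \<open>Local integrability\<close>

text \<open>Cut off from below at -m, a subharmonic function becomes real and locally bounded but
  keeps upper semicontinuity and the mean inequality. The function itself is recovered as m
  grows.\<close>

definition trunc :: "(complex \<Rightarrow> ereal) \<Rightarrow> nat \<Rightarrow> complex \<Rightarrow> real" where
  "trunc u m z = real_of_ereal (max (u z) (- ereal (real m)))"

lemma ereal_trunc: "u z < \<infinity> \<Longrightarrow> ereal (trunc u m z) = max (u z) (- ereal (real m))"
  unfolding trunc_def by (cases "u z") (auto simp: max_def)

lemma trunc_ge: "u z < \<infinity> \<Longrightarrow> - real m \<le> trunc u m z"
  using ereal_trunc[of u z m] by (metis ereal_less_eq(3) max.cobounded2 uminus_ereal.simps(1))

lemma usc_on_trunc:
  assumes "planar_subharmonic_on S u"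
  shows "usc_on S (trunc u m)"
  unfolding usc_on_def
proof (intro ballI allI impI)
  fix z c assume z: "z \<in> S" and c: "trunc u m z < c"
  have fin: "u z < \<infinity>" using assms z by (auto simp: planar_subharmonic_on_def)
  have lt: "max (u z) (- ereal (real m)) < ereal c" using c ereal_trunc[of u z m, OF fin] by (metis ereal_less(1) less_ereal.simps(1))
  hence "\<forall>\<^sub>F w in nhds z. u w < ereal c" using assms z by (auto simp: planar_subharmonic_on_def)
  thus "\<forall>\<^sub>F w in nhds z. trunc u m w < c"
  proof eventually_elim
    case (elim w)
    hence "u w < \<infinity>" by auto
    from ereal_trunc[of u w m, OF this] elim lt have "ereal (trunc u m w) < ereal c" by simp
    thus ?case by simp
  qed
qed

text \<open>Truncation from below enlarges u, hence raises the integral of the positive part and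
  lowers that of the negative part. Both parts of the truncation are finite, so no difference of
  infinities enters the comparison.\<close>

lemma circle_mean_le_trunc:
  assumes S: "open S" and u: "planar_subharmonic_on S u" and r: "r > 0" "cball z r \<subseteq> S"
  shows "circle_mean u z r \<le> ereal (circle_average (trunc u m) z r)"
    and "- real m \<le> circle_average (trunc u m) z r"
proof -
  let ?v = "trunc u m"
  have fin: "u w < \<infinity>" if "w \<in> S" for w using u that by (auto simp: planar_subharmonic_on_def)
  note usc = usc_on_trunc[OF u, of m]
  have K: "sphere z r \<noteq> {}" "sphere z r \<subseteq> S" using r by auto
  obtain p where p: "p \<in> sphere z r" "\<And>q. q \<in> sphere z r \<Longrightarrow> ?v q \<le> ?v p"
    using usc_attains_max[OF compact_sphere K(1) usc_on_subset[OF usc K(2)]] by blast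
  have inK: "z + rcis r t \<in> sphere z r" for t using r by (intro rcis_in_sphere) auto
  have vb: "\<bar>?v q\<bar> \<le> \<bar>?v p\<bar> + real m" if "q \<in> sphere z r" for q
    using p(2)[OF that] trunc_ge[of u q m] fin[of q] that K(2) by (auto simp: abs_le_iff)
  have int: "integrable lborel (\<lambda>t. indicator {0..2*pi} t * ?v (z + rcis r t))"
    using r by (intro circle_integrable_usc[OF S usc r(2) _ vb]) auto
  let ?p = "\<integral>\<^sup>+t. ennreal (indicator {0..2*pi} t * ?v (z + rcis r t)) \<partial>lborel"
  let ?q = "\<integral>\<^sup>+t. ennreal (- (indicator {0..2*pi} t * ?v (z + rcis r t))) \<partial>lborel"
  have tr: "ereal (?v (z + rcis r t)) = max (u (z + rcis r t)) (- ereal (real m))" for t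
    using inK[of t] K(2) by (intro ereal_trunc fin) auto
  have A: "(\<integral>\<^sup>+t\<in>{0..2*pi}. e2ennreal (u (z + rcis r t)) \<partial>lborel) \<le> ?p"
  proof (rule nn_integral_mono)
    fix t
    have "e2ennreal (u (z + rcis r t)) \<le> e2ennreal (ereal (?v (z + rcis r t)))"
      unfolding tr by (intro e2ennreal_mono) simp
    thus "e2ennreal (u (z + rcis r t)) * indicator {0..2*pi} t \<le> ennreal (indicator {0..2*pi} t * ?v (z + rcis r t))"
      by (auto simp: indicator_def)
  qed
  have B: "?q \<le> (\<integral>\<^sup>+t\<in>{0..2*pi}. e2ennreal (- u (z + rcis r t)) \<partial>lborel)"
  proof (rule nn_integral_mono)
    fix t
    have "e2ennreal (- ereal (?v (z + rcis r t))) \<le> e2ennreal (- u (z + rcis r t))"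
      unfolding tr by (intro e2ennreal_mono) (simp add: ereal_uminus_le_reorder)
    thus "ennreal (- (indicator {0..2*pi} t * ?v (z + rcis r t))) \<le> e2ennreal (- u (z + rcis r t)) * indicator {0..2*pi} t"
      by (auto simp: indicator_def)
  qed
  have fpq: "?p < \<infinity>" "?q < \<infinity>" using int by (auto simp: real_integrable_def less_top)
  have "circle_mean u z r \<le> (enn2ereal ?p - enn2ereal ?q) / ereal (2 * pi)"
    unfolding circle_mean_def using A B
    by (intro ereal_divide_right_mono ereal_minus_mono) (auto simp: less_eq_ennreal.rep_eq)
  also have "enn2ereal ?p - enn2ereal ?q = ereal (enn2real ?p - enn2real ?q)"
    using fpq by (cases ?p; cases ?q) auto
  also have "enn2real ?p - enn2real ?q = (\<integral>t. indicator {0..2*pi} t * ?v (z + rcis r t) \<partial>lborel)"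
    using real_lebesgue_integral_def[OF int] by simp
  finally show "circle_mean u z r \<le> ereal (circle_average ?v z r)" by (simp add: circle_average_def)
  have "circle_average (\<lambda>_. - real m) z r \<le> circle_average ?v z r"
    using r K(2) by (intro circle_average_mono[OF circle_integrable_continuous int] trunc_ge fin) auto
  thus "- real m \<le> circle_average ?v z r" by (simp add: circle_average_const)
qed

text \<open>The truncation at z is the larger of u z and -m, and each of them is at most the
  truncated average.\<close>

lemma locally_submean_on_trunc:
  assumes S: "open S" and u: "planar_subharmonic_on S u"
  shows "locally_submean_on S (trunc u m)"
  unfolding locally_submean_on_def
proof
  fix z assume z: "z \<in> S"
  then obtain \<rho> where rho: "\<rho> > 0" "\<And>r. 0 < r \<Longrightarrow> r < \<rho> \<Longrightarrow> u z \<le> circle_mean u z r"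
    using u unfolding planar_subharmonic_on_def by blast
  obtain d where d: "d > 0" "cball z d \<subseteq> S" using S z open_contains_cball by blast
  have fin: "u z < \<infinity>" using u z by (auto simp: planar_subharmonic_on_def)
  show "\<exists>\<rho>>0. \<forall>r. 0 < r \<and> r < \<rho> \<longrightarrow> trunc u m z \<le> circle_average (trunc u m) z r"
  proof (intro exI[of _ "min \<rho> d"] conjI allI impI)
    fix r assume r: "0 < r \<and> r < min \<rho> d"
    hence sub: "cball z r \<subseteq> S" using d(2) by (auto simp: subset_iff)
    note c = circle_mean_le_trunc[OF S u _ sub, of m]
    have "max (u z) (- ereal (real m)) \<le> ereal (circle_average (trunc u m) z r)"
      using rho(2)[of r] c r by (auto intro: order_trans)
    thus "trunc u m z \<le> circle_average (trunc u m) z r" unfolding ereal_trunc[of u z m, OF fin, symmetric] by simp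
  qed (use rho d in auto)
qed

lemma trunc_ge_real: "u z < \<infinity> \<Longrightarrow> u z \<noteq> - \<infinity> \<Longrightarrow> real_of_ereal (u z) \<le> trunc u m z"
  using ereal_trunc[of u z m] by (cases "u z") (auto simp: max_def split: if_splits)

lemma trunc_eq_real: "u z < \<infinity> \<Longrightarrow> u z \<noteq> - \<infinity> \<Longrightarrow> \<bar>real_of_ereal (u z)\<bar> \<le> real m \<Longrightarrow> trunc u m z = real_of_ereal (u z)"
  using ereal_trunc[of u z m] by (cases "u z") (auto simp: max_def split: if_splits)

lemma trunc_abs_le: "u z < \<infinity> \<Longrightarrow> u z \<noteq> - \<infinity> \<Longrightarrow> \<bar>trunc u m z\<bar> \<le> \<bar>real_of_ereal (u z)\<bar>"
  using ereal_trunc[of u z m] by (cases "u z") (auto simp: max_def split: if_splits)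

lemma subharmonic_measurable:
  assumes "open S" "planar_subharmonic_on S u"
  shows "(\<lambda>w. if w \<in> S then u w else 0) \<in> borel_measurable borel"
  using assms by (intro usc_measurable) (auto simp: usc_on_def planar_subharmonic_on_def)

text \<open>With B bounding the positive part of u on the disc, the area inequality bounds the
  integrals of B - \<open>trunc u m\<close> by (B - u a) times the area, uniformly in m. Fatou's
  lemma makes B - u integrable, and in particular u finite almost everywhere on the disc.\<close>

lemma subharmonic_integrable_cball:
  assumes S: "open S" and u: "planar_subharmonic_on S u" and R: "R > 0" "cball a R \<subseteq> S" and ua: "u a \<noteq> - \<infinity>"
  shows "AE w in lborel. w \<in> cball a R \<longrightarrow> u w \<noteq> - \<infinity>"
    and "integrable lborel (\<lambda>w. indicator (cball a R) w * real_of_ereal (u w))"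
proof -
  let ?K = "cball a R"
  have fin: "u w < \<infinity>" if "w \<in> S" for w using u that by (auto simp: planar_subharmonic_on_def)
  have aS: "a \<in> S" using R by auto
  define U where "U w = (if w \<in> S then u w else 0)" for w
  have Um[measurable]: "U \<in> borel_measurable borel" unfolding U_def by (rule subharmonic_measurable[OF S u])
  note usc = usc_on_trunc[OF u] and sub = locally_submean_on_trunc[OF S u]
  have below: "- real m \<le> trunc u m w" if "w \<in> S" for m w by (rule trunc_ge[of u w m, OF fin[OF that]])
  obtain p where p: "p \<in> ?K" "\<And>q. q \<in> ?K \<Longrightarrow> trunc u 0 q \<le> trunc u 0 p"
    using usc_attains_max[OF compact_cball _ usc_on_subset[OF usc[of 0] R(2)]] R(1) by (metis cball_eq_empty not_less_iff_gr_or_eq)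
  define B where "B = trunc u 0 p"
  have uB: "max (u w) 0 \<le> ereal B" if "w \<in> ?K" for w
  proof -
    have "ereal (trunc u 0 w) \<le> ereal B" using p(2)[OF that] by (simp add: B_def)
    moreover have "ereal (trunc u 0 w) = max (u w) 0"
      using ereal_trunc[of u w 0] fin[of w] that R(2) by (auto simp: zero_ereal_def[symmetric])
    ultimately show ?thesis by simp
  qed
  have B0: "0 \<le> B" using order_trans[OF max.cobounded2 uB[of a]] R(1) by simp
  have vB: "trunc u m w \<le> B" if "w \<in> ?K" for m w
  proof -
    have "ereal (trunc u m w) \<le> ereal B"
      using uB[OF that] ereal_trunc[of u w m] fin[of w] that R(2) B0 by (auto simp: subset_iff)
    thus ?thesis by simp
  qed
  define \<rho> where "\<rho> s = (indicator {..R} s :: real)" for s :: real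
  have rho: "\<rho> \<in> borel_measurable borel" "\<And>s. 0 \<le> \<rho> s" "\<And>s. \<rho> s \<le> 1" "\<And>s. s > R \<Longrightarrow> \<rho> s = 0"
    unfolding \<rho>_def by (auto simp: indicator_def)
  have rhoK: "\<rho> (norm (w - a)) = indicator ?K w" for w
    by (simp add: \<rho>_def indicator_def dist_norm norm_minus_commute)
  have int: "integrable lborel (\<lambda>w. trunc u m w * indicator ?K w)"
    and mean: "trunc u m a * (\<integral>w. indicator ?K w \<partial>lborel) \<le> (\<integral>w. trunc u m w * indicator ?K w \<partial>lborel)"
    and intK: "integrable lborel (\<lambda>w. indicator ?K w :: real)" for m
    using area_submean[OF S usc[of m] sub[of m] below R rho] unfolding rhoK by auto
  define A where "A = (\<integral>w. indicator ?K w \<partial>(lborel::complex measure) :: real)"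
  have A0: "0 \<le> A" unfolding A_def by simp
  let ?C = "(B - real_of_ereal (u a)) * A"
  have up: "(\<integral>\<^sup>+w. ennreal (indicator ?K w * (B - trunc u m w)) \<partial>lborel) \<le> ennreal ?C" for m
  proof -
    have i: "integrable lborel (\<lambda>w. indicator ?K w * (B - trunc u m w))"
      using int[of m] intK by (simp add: right_diff_distrib mult.commute)
    have "(\<integral>w. indicator ?K w * (B - trunc u m w) \<partial>lborel) = B * A - (\<integral>w. trunc u m w * indicator ?K w \<partial>lborel)"
      using int[of m] intK unfolding A_def by (simp add: right_diff_distrib mult.commute)
    also have "\<dots> \<le> B * A - trunc u m a * A" using mean[of m] unfolding A_def by simp
    also have "\<dots> \<le> ?C"
    proof -
      have "real_of_ereal (u a) * A \<le> trunc u m a * A"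
        using A0 ua fin[OF aS] by (intro mult_right_mono trunc_ge_real) auto
      thus ?thesis by (simp add: left_diff_distrib)
    qed
    finally have "(\<integral>w. indicator ?K w * (B - trunc u m w) \<partial>lborel) \<le> ?C" .
    moreover have "(\<integral>\<^sup>+w. ennreal (indicator ?K w * (B - trunc u m w)) \<partial>lborel) = ennreal (\<integral>w. indicator ?K w * (B - trunc u m w) \<partial>lborel)"
      using vB by (intro nn_integral_eq_integral i AE_I2) (auto simp: indicator_def)
    ultimately show ?thesis by (simp add: ennreal_leI)
  qed
  define N where "N w = (if w \<in> ?K then e2ennreal (ereal B - U w) else 0)" for w
  have [measurable]: "Measurable.pred borel (\<lambda>x. x \<in> cball a R)"
    unfolding pred_def using borel_closed[OF closed_cball[of a R]] by (simp add: cball_def)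
  have Nm: "N \<in> borel_measurable lborel" unfolding N_def by measurable
  have lim: "(\<lambda>m. ennreal (indicator ?K w * (B - trunc u m w))) \<longlonglongrightarrow> N w" for w
  proof (cases "w \<in> ?K")
    case True
    hence wS: "w \<in> S" using R(2) by auto
    show ?thesis
    proof (cases "u w = - \<infinity>")
      case False
      obtain M :: nat where M: "\<bar>real_of_ereal (u w)\<bar> \<le> real M" using real_arch_simple by blast
      have "trunc u m w = real_of_ereal (u w)" if "m \<ge> M" for m
        using that M fin[OF wS] False by (intro trunc_eq_real) auto
      hence "\<forall>\<^sub>F m in sequentially. ennreal (indicator ?K w * (B - trunc u m w)) = N w"
        using True wS fin[OF wS] False
        by (intro eventually_sequentiallyI[of M]) (cases "u w", auto simp: N_def U_def)
      thus ?thesis by (rule tendsto_eventually)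
    next
      case uinf: True
      have tm: "trunc u m w = - real m" for m using uinf by (simp add: trunc_def)
      have "(\<lambda>m. ennreal (B + real m)) \<longlonglongrightarrow> top"
      proof (rule tendsto_sandwich[OF _ _ of_nat_tendsto_top_ennreal tendsto_const])
        show "\<forall>\<^sub>F m in sequentially. of_nat m \<le> ennreal (B + real m)"
          using B0 by (intro always_eventually allI) (simp add: ennreal_of_nat_eq_real_of_nat ennreal_leI)
      qed simp
      thus ?thesis using True uinf wS by (simp add: N_def U_def tm)
    qed
  qed (simp add: N_def)
  have fN: "(\<integral>\<^sup>+w. N w \<partial>lborel) \<le> ennreal ?C"
  proof -
    have mm: "(\<lambda>w. ennreal (indicator ?K w * (B - trunc u m w))) \<in> borel_measurable lborel" for m
    proof -
      have "(\<lambda>w. indicator ?K w * (B - trunc u m w)) \<in> borel_measurable lborel"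
        using int[of m] intK by (simp add: right_diff_distrib mult.commute borel_measurable_integrable)
      thus ?thesis by measurable
    qed
    have "(\<integral>\<^sup>+w. N w \<partial>lborel) = (\<integral>\<^sup>+w. liminf (\<lambda>m. ennreal (indicator ?K w * (B - trunc u m w))) \<partial>lborel)"
      by (intro nn_integral_cong lim_imp_Liminf[symmetric] lim) simp
    also have "\<dots> \<le> liminf (\<lambda>m. \<integral>\<^sup>+w. ennreal (indicator ?K w * (B - trunc u m w)) \<partial>lborel)"
      by (rule nn_integral_liminf[OF mm])
    also have "\<dots> \<le> ennreal ?C"
    proof -
      have "liminf (\<lambda>m. \<integral>\<^sup>+w. ennreal (indicator ?K w * (B - trunc u m w)) \<partial>lborel) \<le> liminf (\<lambda>m. ennreal ?C)"
        by (intro Liminf_mono always_eventually allI up)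
      thus ?thesis by (simp add: Liminf_const)
    qed
    finally show ?thesis .
  qed
  have "AE w in lborel. N w \<noteq> \<infinity>"
    using fN by (intro nn_integral_noteq_infinite Nm) (auto simp: top_unique)
  thus ae: "AE w in lborel. w \<in> ?K \<longrightarrow> u w \<noteq> - \<infinity>"
    by eventually_elim (use R(2) in \<open>auto simp: N_def U_def subset_iff\<close>)
  have "integrable lborel (\<lambda>w. indicator ?K w * (B - real_of_ereal (U w)))"
  proof (rule integrableI_bounded)
    have "(\<lambda>w. indicator ?K w * (B - real_of_ereal (U w))) \<in> borel_measurable borel"
      by (intro borel_measurable_times borel_measurable_indicator borel_measurable_diff borel_measurable_real_of_ereal Um) auto
    thus "(\<lambda>w. indicator ?K w * (B - real_of_ereal (U w))) \<in> borel_measurable lborel" by simp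
    have "(\<integral>\<^sup>+w. ennreal (norm (indicator ?K w * (B - real_of_ereal (U w)))) \<partial>lborel) = (\<integral>\<^sup>+w. N w \<partial>lborel)"
    proof (rule nn_integral_cong_AE)
      show "AE w in lborel. ennreal (norm (indicator ?K w * (B - real_of_ereal (U w)))) = N w"
        using ae
      proof eventually_elim
        case (elim w)
        show ?case
        proof (cases "w \<in> ?K")
          case True
          hence "w \<in> S" "u w < \<infinity>" "u w \<noteq> - \<infinity>" "max (u w) 0 \<le> ereal B" using R(2) fin elim uB by auto
          thus ?thesis using True by (cases "u w") (auto simp: N_def U_def)
        qed (simp add: N_def)
      qed
    qed
    also have "\<dots> < \<infinity>" using fN by (simp add: less_top top_unique order_le_less_trans)
    finally show "(\<integral>\<^sup>+w. ennreal (norm (indicator ?K w * (B - real_of_ereal (U w)))) \<partial>lborel) < \<infinity>" .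
  qed
  from Bochner_Integration.integrable_diff[OF integrable_mult_left[OF intK, of B] this]
  have "integrable lborel (\<lambda>w. indicator ?K w * real_of_ereal (U w))" by (simp add: right_diff_distrib)
  moreover have "(\<lambda>w. indicator ?K w * real_of_ereal (U w)) = (\<lambda>w. indicator ?K w * real_of_ereal (u w))"
    using R(2) by (auto simp: U_def indicator_def fun_eq_iff)
  ultimately show "integrable lborel (\<lambda>w. indicator ?K w * real_of_ereal (u w))" by simp
qed

text \<open>Limit of the area inequality for the truncations, dominated by K |u| on the disc. The
  integrability of u comes from its finiteness at the centre.\<close>

lemma subharmonic_weighted_submean:
  assumes S: "open S" and u: "planar_subharmonic_on S u" and R: "R > 0" "cball a R \<subseteq> S" and ua: "u a \<noteq> - \<infinity>"
    and \<rho>: "\<rho> \<in> borel_measurable borel" "\<And>s. 0 \<le> \<rho> s" "\<And>s. \<rho> s \<le> K" "\<And>s. s > R \<Longrightarrow> \<rho> s = 0"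
  shows "integrable lborel (\<lambda>w. real_of_ereal (u w) * \<rho> (norm (w - a)))"
    and "real_of_ereal (u a) * (\<integral>w. \<rho> (norm (w - a)) \<partial>lborel) \<le> (\<integral>w. real_of_ereal (u w) * \<rho> (norm (w - a)) \<partial>lborel)"
proof -
  have fin: "u w < \<infinity>" if "w \<in> S" for w using u that by (auto simp: planar_subharmonic_on_def)
  have aS: "a \<in> S" using R by auto
  note usc = usc_on_trunc[OF u] and sub = locally_submean_on_trunc[OF S u]
  have below: "- real m \<le> trunc u m w" if "w \<in> S" for m w by (rule trunc_ge[of u w m, OF fin[OF that]])
  note ar = area_submean[OF S usc sub below R \<rho>]
  note L = subharmonic_integrable_cball[OF S u R ua]
  let ?f = "\<lambda>w. indicator (cball a R) w * real_of_ereal (u w)"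
  have K0: "0 \<le> K" using \<rho>(2,3) order_trans by blast
  note [measurable] = \<rho>(1)
  have out: "\<rho> (norm (w - a)) = 0" if "w \<notin> cball a R" for w
    using that \<rho>(4) by (simp add: dist_norm norm_minus_commute)
  have eq: "real_of_ereal (u w) * \<rho> (norm (w - a)) = ?f w * \<rho> (norm (w - a))" for w
    using out[of w] by (cases "w \<in> cball a R") (simp_all add: indicator_def)
  have m: "(\<lambda>w. real_of_ereal (u w) * \<rho> (norm (w - a))) \<in> borel_measurable lborel"
    unfolding eq using borel_measurable_integrable[OF L(2)] by measurable
  have bnd: "\<bar>?f w * \<rho> (norm (w - a))\<bar> \<le> K * \<bar>?f w\<bar>" for w
  proof -
    have "\<bar>?f w\<bar> * \<rho> (norm (w - a)) \<le> \<bar>?f w\<bar> * K" using \<rho>(3) by (intro mult_left_mono) auto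
    thus ?thesis by (simp only: abs_mult abs_of_nonneg[OF \<rho>(2)] mult.commute[of K])
  qed
  show "integrable lborel (\<lambda>w. real_of_ereal (u w) * \<rho> (norm (w - a)))"
  proof (rule Bochner_Integration.integrable_bound[OF _ m])
    show "integrable lborel (\<lambda>w. K * \<bar>?f w\<bar>)" using L(2) by (intro integrable_mult_right integrable_abs)
    show "AE w in lborel. norm (real_of_ereal (u w) * \<rho> (norm (w - a))) \<le> norm (K * \<bar>?f w\<bar>)"
      unfolding eq using bnd K0 by (intro AE_I2) (simp add: abs_mult)
  qed
  have "(\<lambda>m. \<integral>w. trunc u m w * \<rho> (norm (w - a)) \<partial>lborel) \<longlonglongrightarrow> (\<integral>w. real_of_ereal (u w) * \<rho> (norm (w - a)) \<partial>lborel)"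
  proof (rule integral_dominated_convergence[OF m])
    show "(\<lambda>w. trunc u m w * \<rho> (norm (w - a))) \<in> borel_measurable lborel" for m
      by (rule borel_measurable_integrable[OF ar(1)])
    show "integrable lborel (\<lambda>w. K * \<bar>?f w\<bar>)" using L(2) by (intro integrable_mult_right integrable_abs)
    show "AE w in lborel. (\<lambda>m. trunc u m w * \<rho> (norm (w - a))) \<longlonglongrightarrow> real_of_ereal (u w) * \<rho> (norm (w - a))"
      using L(1)
    proof eventually_elim
      case (elim w)
      show ?case
      proof (cases "w \<in> cball a R")
        case True
        hence f: "u w < \<infinity>" "u w \<noteq> - \<infinity>" using fin elim R(2) by auto
        obtain M :: nat where M: "\<bar>real_of_ereal (u w)\<bar> \<le> real M" using real_arch_simple by blast
        have "trunc u m w = real_of_ereal (u w)" if "m \<ge> M" for m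
          using that M f by (intro trunc_eq_real) auto
        hence "\<forall>\<^sub>F m in sequentially. trunc u m w = real_of_ereal (u w)" by (rule eventually_sequentiallyI)
        thus ?thesis by (intro tendsto_mult tendsto_const tendsto_eventually)
      qed (use out in simp)
    qed
    show "AE w in lborel. norm (trunc u m w * \<rho> (norm (w - a))) \<le> K * \<bar>?f w\<bar>" for m
      using L(1)
    proof eventually_elim
      case (elim w)
      show ?case
      proof (cases "w \<in> cball a R")
        case True
        hence f: "u w < \<infinity>" "u w \<noteq> - \<infinity>" using fin elim R(2) by auto
        have "\<bar>trunc u m w\<bar> * \<rho> (norm (w - a)) \<le> \<bar>real_of_ereal (u w)\<bar> * K"
          using trunc_abs_le[of u w m, OF f] \<rho>(2,3) by (intro mult_mono) auto
        thus ?thesis using True \<rho>(2) by (simp add: abs_mult mult.commute)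
      qed (use out in simp)
    qed
  qed
  moreover have "real_of_ereal (u a) * (\<integral>w. \<rho> (norm (w - a)) \<partial>lborel) \<le> (\<integral>w. trunc u m w * \<rho> (norm (w - a)) \<partial>lborel)" for m
  proof -
    have "real_of_ereal (u a) * (\<integral>w. \<rho> (norm (w - a)) \<partial>lborel) \<le> trunc u m a * (\<integral>w. \<rho> (norm (w - a)) \<partial>lborel)"
      using \<rho>(2) fin[OF aS] ua by (intro mult_right_mono trunc_ge_real Bochner_Integration.integral_nonneg) auto
    with ar(2)[of m] show ?thesis by linarith
  qed
  ultimately show "real_of_ereal (u a) * (\<integral>w. \<rho> (norm (w - a)) \<partial>lborel) \<le> (\<integral>w. real_of_ereal (u w) * \<rho> (norm (w - a)) \<partial>lborel)"
    by (intro tendsto_lowerbound[of _ _ sequentially]) auto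
qed

section \<open>Charts of the sphere\<close>

lemma inversion_chart_eq: "inversion_chart w = (if w = 0 then None else Some (1 / cnj w))"
  by (simp add: inversion_chart_def recip_chart_def)

lemma insert_None_range_Some [simp]: "insert None (range Some) = UNIV"
  by (simp add: UNIV_option_conv)

lemma open_inverted:
  assumes "open U"
  shows "open {w. w \<noteq> 0 \<and> 1 / cnj w \<in> U}"
proof -
  have "continuous_on (- {0}) (\<lambda>w. 1 / cnj w)" by (intro continuous_intros) auto
  hence "open ((- {0}) \<inter> (\<lambda>w. 1 / cnj w) -` U)"
    by (rule continuous_open_preimage) (auto simp: assms)
  moreover have "(- {0}) \<inter> (\<lambda>w. 1 / cnj w) -` U = {w. w \<noteq> 0 \<and> 1 / cnj w \<in> U}" by auto
  ultimately show ?thesis by simp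
qed

text \<open>The inversion exchanges neighbourhoods of the origin with complements of bounded sets,
  so openness at infinity in the compactification is openness at 0 in the second chart.\<close>

lemma openin_csphere_iff:
  "openin csphere V \<longleftrightarrow> open (Some -` V) \<and> open (inversion_chart -` V)"
proof
  assume "openin csphere V"
  then consider U where "open U" "V = Some ` U" | C where "compact C" "V = insert None (Some ` (- C))"
    by (auto simp: openin_Alexandroff_compactification Compl_eq_Diff_UNIV)
  thus "open (Some -` V) \<and> open (inversion_chart -` V)"
  proof cases
    case 1
    have "Some -` V = U" "inversion_chart -` V = {w. w \<noteq> 0 \<and> 1 / cnj w \<in> U}"
      unfolding 1(2) by (auto simp: inversion_chart_eq split: if_splits)
    with 1(1) open_inverted show ?thesis by simp
  next
    case 2
    have V: "Some -` V = - C" unfolding 2(2) by auto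
    obtain R where R: "\<And>z. z \<in> C \<Longrightarrow> norm z \<le> R" using compact_imp_bounded[OF 2(1)] by (auto simp: bounded_iff)
    have eq: "inversion_chart -` V = ball 0 (1 / (\<bar>R\<bar> + 1)) \<union> {w. w \<noteq> 0 \<and> 1 / cnj w \<in> - C}"
    proof -
      have "1 / cnj w \<notin> C" if "w \<noteq> 0" "norm w < 1 / (\<bar>R\<bar> + 1)" for w
      proof
        assume "1 / cnj w \<in> C"
        from R[OF this] have "1 / norm w \<le> R" by (simp add: norm_divide)
        moreover have "\<bar>R\<bar> + 1 < 1 / norm w" using that by (simp add: field_simps)
        ultimately show False by simp
      qed
      thus ?thesis unfolding 2(2) by (auto simp: inversion_chart_eq split: if_splits)
    qed
    have o: "open (- C)" using 2(1) compact_imp_closed by blast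
    show ?thesis unfolding V eq using o open_inverted[OF o] by (intro conjI open_Un open_ball)
  qed
next
  assume *: "open (Some -` V) \<and> open (inversion_chart -` V)"
  show "openin csphere V"
  proof (cases "None \<in> V")
    case False
    hence "V = Some ` (Some -` V)" by (auto simp: image_iff) (metis not_Some_eq)
    with * show ?thesis unfolding openin_Alexandroff_compactification by auto
  next
    case True
    hence "0 \<in> inversion_chart -` V" by (simp add: inversion_chart_eq)
    then obtain d where d: "d > 0" "ball 0 d \<subseteq> inversion_chart -` V" using * open_contains_ball by blast
    let ?C = "- (Some -` V)"
    have "norm z \<le> 1 / d" if "z \<in> ?C" for z
    proof (rule ccontr)
      assume n: "\<not> norm z \<le> 1 / d"
      hence z: "z \<noteq> 0" using d by auto
      have "1 / cnj z \<in> ball 0 d" using n d z by (simp add: norm_divide field_simps)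
      hence "inversion_chart (1 / cnj z) \<in> V" using d by blast
      thus False using z that by (simp add: inversion_chart_eq)
    qed
    hence "bounded ?C" by (auto simp: bounded_iff)
    moreover have "closed ?C" using * by (simp add: closed_Compl)
    ultimately have "compact ?C" by (simp add: compact_eq_bounded_closed)
    moreover have "V = insert None (Some ` (UNIV - ?C))"
      using True by (auto simp: image_iff not_Some_eq[symmetric])
    ultimately show ?thesis unfolding openin_Alexandroff_compactification
      using \<open>closed ?C\<close> by (intro disjI2 exI[of _ ?C]) simp
  qed
qed

definition sphere_chart :: "(complex \<Rightarrow> complex option) \<Rightarrow> bool" where
  "sphere_chart c \<longleftrightarrow> c = Some \<or> c = inversion_chart"

lemma sphere_chartI [simp, intro]: "sphere_chart Some" "sphere_chart inversion_chart"
  by (auto simp: sphere_chart_def)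

lemma closedin_csphere_iff:
  "closedin csphere K \<longleftrightarrow> closed (Some -` K) \<and> closed (inversion_chart -` K)"
  by (simp add: closedin_def openin_csphere_iff closed_def vimage_Diff Compl_eq_Diff_UNIV)

lemma inj_sphere_chart: "sphere_chart c \<Longrightarrow> inj c"
  by (auto simp: sphere_chart_def inj_def inversion_chart_eq split: if_splits)

lemma ex_sphere_chart: "\<exists>c w. sphere_chart c \<and> p = c w"
proof (cases p)
  case None
  hence "p = inversion_chart 0" by (simp add: inversion_chart_eq)
  thus ?thesis by blast
qed blast

lemma open_chart_vimage: "sphere_chart c \<Longrightarrow> openin csphere V \<Longrightarrow> open (c -` V)"
  by (auto simp: sphere_chart_def openin_csphere_iff)

lemma closed_chart_vimage: "sphere_chart c \<Longrightarrow> closedin csphere V \<Longrightarrow> closed (c -` V)"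
  by (auto simp: sphere_chart_def closedin_csphere_iff)

lemma openin_chart_image:
  assumes "sphere_chart c" "open B"
  shows "openin csphere (c ` B)"
proof -
  have inj: "inj Some" "inj inversion_chart" by (auto intro: inj_sphere_chart)
  have "inversion_chart -` (Some ` B) = {w. w \<noteq> 0 \<and> 1 / cnj w \<in> B}"
    by (auto simp: inversion_chart_eq split: if_splits)
  moreover have "Some -` (inversion_chart ` B) = {w. w \<noteq> 0 \<and> 1 / cnj w \<in> B}"
  proof -
    have "Some w \<in> inversion_chart ` B" if "w \<noteq> 0" "1 / cnj w \<in> B" for w
      by (rule image_eqI[OF _ that(2)]) (use that(1) in \<open>simp add: inversion_chart_eq\<close>)
    moreover have "w \<noteq> 0 \<and> 1 / cnj w \<in> B" if "Some w \<in> inversion_chart ` B" for w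
      using that by (auto simp: inversion_chart_eq split: if_splits)
    ultimately show ?thesis by blast
  qed
  ultimately show ?thesis
    using assms open_inverted[OF assms(2)] inj unfolding sphere_chart_def openin_csphere_iff
    by (auto simp: inj_vimage_image_eq)
qed

lemma compactin_csphere_iff: "compactin csphere K \<longleftrightarrow> closedin csphere K"
proof
  have H: "Hausdorff_space csphere"
    by (simp add: Hausdorff_space_Alexandroff_compactification locally_compact_space_euclidean)
  assume "compactin csphere K"
  with H show "closedin csphere K" by (rule compactin_imp_closedin)
next
  have C: "compact_space csphere" by simp
  assume "closedin csphere K"
  with C show "compactin csphere K" by (rule closedin_compact_space)
qed

text \<open>The transition map is w \<mapsto> 1/cnj w in both directions, so that arguments about a
  chart and the other one can be made once, without naming them.\<close>

definition other_chart :: "(complex \<Rightarrow> complex option) \<Rightarrow> complex \<Rightarrow> complex option" where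
  "other_chart c = (if c = Some then inversion_chart else Some)"

lemma inversion_chart_neq_Some: "inversion_chart \<noteq> Some"
  by (metis inversion_chart_eq option.distinct(1))

lemma other_chart_simps [simp]: "other_chart Some = inversion_chart" "other_chart inversion_chart = Some"
  using inversion_chart_neq_Some by (auto simp: other_chart_def)

lemma sphere_chart_other [simp]: "sphere_chart (other_chart c)"
  by (auto simp: other_chart_def)

lemma other_chart_eq: "sphere_chart c \<Longrightarrow> w \<noteq> 0 \<Longrightarrow> other_chart c w = c (1 / cnj w)"
  by (auto simp: sphere_chart_def inversion_chart_eq)

lemma other_chart_0: "sphere_chart c \<Longrightarrow> other_chart c 0 \<notin> range c"
  by (auto simp: sphere_chart_def inversion_chart_eq split: if_splits)

lemma chart_cases:
  assumes "sphere_chart c"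
  obtains w where "p = c w" | "p = other_chart c 0"
  using assms by (cases p) (auto simp: sphere_chart_def inversion_chart_eq, metis complex_cnj_zero_iff divide_eq_0_iff complex_cnj_cnj complex_cnj_divide complex_cnj_one divide_divide_eq_right mult_1 div_by_1)

subsection \<open>Measurability on the sphere\<close>

lemma sets_sphere_borel: "openin csphere V \<Longrightarrow> V \<in> sets sphere_borel"
  by (simp add: sphere_borel_def)

lemma space_sphere_borel [simp]: "space sphere_borel = UNIV"
  by (simp add: sphere_borel_def)

lemma sphere_continuous_measurable:
  fixes \<Phi> :: "complex option \<Rightarrow> real"
  assumes "\<And>c. sphere_chart c \<Longrightarrow> continuous_on UNIV (\<lambda>w. \<Phi> (c w))"
  shows "\<Phi> \<in> borel_measurable sphere_borel"
proof (rule borel_measurableI)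
  fix T :: "real set" assume T: "open T"
  have "open ((\<lambda>w. \<Phi> (c w)) -` T)" if "sphere_chart c" for c
    by (rule open_vimage[OF T assms[OF that]])
  from this[of Some] this[of inversion_chart]
  have "openin csphere (\<Phi> -` T)" by (simp add: openin_csphere_iff vimage_def)
  thus "\<Phi> -` T \<inter> space sphere_borel \<in> sets sphere_borel" by (simp add: sets_sphere_borel)
qed

lemma closedin_sets_sphere_borel: "closedin csphere K \<Longrightarrow> K \<in> sets sphere_borel"
  using sets_sphere_borel[of "UNIV - K"] sets.compl_sets[of "UNIV - K" sphere_borel]
  by (auto simp: closedin_def double_diff)

section \<open>Local integrability on the sphere\<close>

lemma AE_open_imp_ex:
  assumes "AE w in lborel. P (w::complex)" "open T" "T \<noteq> {}"
  shows "\<exists>w\<in>T. P w"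
proof (rule ccontr)
  assume "\<not> ?thesis"
  hence "AE w in lborel. w \<notin> T" using assms(1) by (auto elim!: eventually_mono)
  hence "T \<in> null_sets lborel" using assms(2) AE_iff_null_sets[of T lborel] by simp
  hence "negligible T" using null_sets_completionI[of T lborel] by (simp add: negligible_iff_null_sets)
  with assms open_not_negligible show False by blast
qed

text \<open>Let E be the interior of the set where u = -\<infinity>. A point outside E has points of
  finite u close by, and a disc around one of these covers a neighbourhood of it. There u is
  integrable and finite almost everywhere, so E is closed in D as well; since E misses
  \<open>z0\<close>, connectedness leaves E empty.\<close>

lemma subharmonic_locally_integrable:
  assumes D: "sphere_domain D" and u: "subharmonic_on D u" and z0: "z0 \<in> D" "u z0 \<noteq> - \<infinity>"
    and c: "sphere_chart c" and a: "a \<in> c -` D"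
  shows "\<exists>R>0. cball a R \<subseteq> c -` D \<and> integrable lborel (\<lambda>w. indicator (cball a R) w * real_of_ereal (u (c w)))
    \<and> (AE w in lborel. w \<in> cball a R \<longrightarrow> u (c w) \<noteq> - \<infinity>)"
proof -
  have Do: "openin csphere D" "connectedin csphere D" using D by (auto simp: sphere_domain_def)
  have uc: "planar_subharmonic_on (c -` D) (\<lambda>w. u (c w))" if "sphere_chart c" for c
    using u that by (auto simp: subharmonic_on_def sphere_chart_def o_def)
  define E where "E = \<Union>{V. openin csphere V \<and> V \<subseteq> D \<and> (\<forall>q\<in>V. u q = - \<infinity>)}"
  have Eo: "openin csphere E" "E \<subseteq> D" unfolding E_def by auto
  have key: "\<exists>R>0. cball a R \<subseteq> c -` D \<and> integrable lborel (\<lambda>w. indicator (cball a R) w * real_of_ereal (u (c w)))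
    \<and> (AE w in lborel. w \<in> cball a R \<longrightarrow> u (c w) \<noteq> - \<infinity>)"
    if c: "sphere_chart c" and a: "c a \<in> D" "c a \<notin> E" for c a
  proof -
    have o: "open (c -` D)" by (rule open_chart_vimage[OF c Do(1)])
    then obtain r where r: "r > 0" "cball a r \<subseteq> c -` D" using a open_contains_cball by blast
    have "\<exists>b\<in>ball a (r / 3). u (c b) \<noteq> - \<infinity>"
    proof (rule ccontr)
      assume "\<not> ?thesis"
      hence "c ` ball a (r / 3) \<subseteq> E"
        using r openin_chart_image[OF c, of "ball a (r / 3)"] unfolding E_def
        by (intro Union_upper) (auto simp: subset_iff)
      moreover have "c a \<in> c ` ball a (r / 3)" using r by simp
      ultimately show False using a by blast
    qed
    then obtain b where b: "dist a b < r / 3" "u (c b) \<noteq> - \<infinity>" by auto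
    \<comment> \<open>As |a - b| < r/3, the disc of radius r/2 about b lies in that of radius r
      about a and contains that of radius r/6 about a.\<close>
    have sub: "cball b (r / 2) \<subseteq> c -` D"
    proof -
      have "cball b (r / 2) \<subseteq> cball a r"
      proof
        fix x assume "x \<in> cball b (r / 2)"
        thus "x \<in> cball a r" using b r(1) dist_triangle[of a x b] by simp
      qed
      thus ?thesis using r by blast
    qed
    have sub2: "cball a (r / 6) \<subseteq> cball b (r / 2)"
    proof
      fix x assume "x \<in> cball a (r / 6)"
      thus "x \<in> cball b (r / 2)" using b dist_triangle[of b x a] by (simp add: dist_commute)
    qed
    note L = subharmonic_integrable_cball[OF o uc[OF c] _ sub b(2)]
    have "integrable lborel (\<lambda>w. indicator (cball a (r / 6)) w *\<^sub>R (indicator (cball b (r / 2)) w * real_of_ereal (u (c w))))"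
      using r L(2) by (intro integrable_mult_indicator) auto
    moreover have "(\<lambda>w. indicator (cball a (r / 6)) w *\<^sub>R (indicator (cball b (r / 2)) w * real_of_ereal (u (c w)))) =
        (\<lambda>w. indicator (cball a (r / 6)) w * real_of_ereal (u (c w)))"
    proof
      fix w show "indicator (cball a (r / 6)) w *\<^sub>R (indicator (cball b (r / 2)) w * real_of_ereal (u (c w))) =
        indicator (cball a (r / 6)) w * real_of_ereal (u (c w))"
        using subsetD[OF sub2, of w] by (cases "w \<in> cball a (r / 6)") (simp_all only: indicator_simps, simp_all)
    qed
    moreover have "AE w in lborel. w \<in> cball a (r / 6) \<longrightarrow> u (c w) \<noteq> - \<infinity>"
      using L(1) r sub2 by (auto elim!: eventually_mono)
    moreover have "cball a (r / 6) \<subseteq> c -` D" using sub sub2 by blast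
    ultimately show ?thesis using r by (intro exI[of _ "r / 6"]) auto
  qed
  have DEo: "openin csphere (D - E)"
  proof (subst openin_subopen, intro ballI)
    fix p assume p: "p \<in> D - E"
    obtain c a where c: "sphere_chart c" "p = c a" using ex_sphere_chart by blast
    obtain R where R: "R > 0" "cball a R \<subseteq> c -` D" "AE w in lborel. w \<in> cball a R \<longrightarrow> u (c w) \<noteq> - \<infinity>"
      using key[OF c(1), of a] p c(2) by blast
    have "c ` ball a R \<inter> E = {}"
    proof (rule ccontr)
      assume "c ` ball a R \<inter> E \<noteq> {}"
      then obtain V where V: "openin csphere V" "\<forall>q\<in>V. u q = - \<infinity>" "c ` ball a R \<inter> V \<noteq> {}" unfolding E_def by blast
      have "open (ball a R \<inter> c -` V)" "ball a R \<inter> c -` V \<noteq> {}"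
        using open_chart_vimage[OF c(1) V(1)] V(3) by auto
      from AE_open_imp_ex[OF R(3) this] V(2) show False by auto
    qed
    moreover have "openin csphere (c ` ball a R)" by (rule openin_chart_image[OF c(1)]) simp
    ultimately show "\<exists>T. openin csphere T \<and> p \<in> T \<and> T \<subseteq> D - E"
      using R c(2) by (intro exI[of _ "c ` ball a R"]) (auto simp: subset_iff)
  qed
  have "z0 \<notin> E" using z0 unfolding E_def by auto
  hence "E = {}"
    using connectedinD[OF Do(2) Eo(1) DEo] Eo(2) z0(1) by blast
  with key[OF c, of a] a show ?thesis by auto
qed

lemma integrable_on_compact_cover:
  fixes f :: "complex \<Rightarrow> real"
  assumes K: "compact K" and loc: "\<And>a. a \<in> K \<Longrightarrow> \<exists>R>0. integrable lborel (\<lambda>w. indicator (cball a R) w * f w)"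
  shows "integrable lborel (\<lambda>w. indicator K w * f w)"
proof -
  obtain R where R: "\<And>a. a \<in> K \<Longrightarrow> R a > 0 \<and> integrable lborel (\<lambda>w. indicator (cball a (R a)) w * f w)"
    using loc by metis
  have "K \<subseteq> (\<Union>a\<in>K. ball a (R a))" using R by auto
  then obtain F where F: "F \<subseteq> K" "finite F" "K \<subseteq> (\<Union>a\<in>F. ball a (R a))"
    using compactE_image[OF K, of K "\<lambda>a. ball a (R a)"] by auto
  have "set_integrable lborel (\<Union>a\<in>F. cball a (R a)) f"
    using F R by (intro set_integrable_UN) (auto simp: set_integrable_def)
  moreover have "K \<subseteq> (\<Union>a\<in>F. cball a (R a))" using F(3) ball_subset_cball by blast
  ultimately have "set_integrable lborel K f"
    using K by (rule_tac set_integrable_subset) (auto simp: borel_compact)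
  thus ?thesis by (simp add: set_integrable_def)
qed

lemma subharmonic_test_integrable:
  assumes D: "sphere_domain D" and u: "subharmonic_on D u" and z0: "z0 \<in> D" "u z0 \<noteq> - \<infinity>"
    and c: "sphere_chart c" and q: "continuous_on UNIV q" "compact K" "K \<subseteq> c -` D" "\<And>z. z \<notin> K \<Longrightarrow> q z = 0"
  shows "integrable lborel (\<lambda>w. real_of_ereal (u (c w)) * q w)"
proof -
  let ?f = "\<lambda>w. indicator K w * real_of_ereal (u (c w))"
  have i: "integrable lborel ?f"
    using subharmonic_locally_integrable[OF D u z0 c] q(3) by (intro integrable_on_compact_cover q(2)) blast
  obtain B where "\<forall>x\<in>q ` K. norm x \<le> B"
    using compact_imp_bounded[OF compact_continuous_image[OF continuous_on_subset[OF q(1)] q(2)]] unfolding bounded_iff by auto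
  hence B: "\<bar>q z\<bar> \<le> \<bar>B\<bar>" for z using q(4)[of z] by (cases "z \<in> K") force+
  have eq: "real_of_ereal (u (c w)) * q w = ?f w * q w" for w using q(4)[of w] by (cases "w \<in> K") auto
  have [measurable]: "q \<in> borel_measurable lborel" using borel_measurable_continuous_onI[OF q(1)] by simp
  show ?thesis unfolding eq
  proof (rule Bochner_Integration.integrable_bound)
    show "integrable lborel (\<lambda>w. \<bar>B\<bar> * ?f w)" using i by (intro integrable_mult_right)
    show "(\<lambda>w. ?f w * q w) \<in> borel_measurable lborel" using borel_measurable_integrable[OF i] by measurable
    show "AE w in lborel. norm (?f w * q w) \<le> norm (\<bar>B\<bar> * ?f w)"
    proof (intro AE_I2)
      fix w
      have "\<bar>?f w\<bar> * \<bar>q w\<bar> \<le> \<bar>?f w\<bar> * \<bar>B\<bar>" using B by (intro mult_left_mono) auto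
      thus "norm (?f w * q w) \<le> norm (\<bar>B\<bar> * ?f w)" by (simp only: real_norm_def abs_mult abs_abs mult.commute)
    qed
  qed
qed

section \<open>Smooth functions on the sphere\<close>

text \<open>The map 1/cnj w is not holomorphic, but its components are real parts of the holomorphic
  functions 1/w and \<i>/w, to which the results on real parts apply.\<close>

lemma inversion_components:
  "Re (1 / cnj w) = Re (1 / w)" "Im (1 / cnj w) = Re (\<i> * (1 / w))"
proof -
  have e: "1 / cnj w = cnj (1 / w)" by simp
  show "Re (1 / cnj w) = Re (1 / w)" "Im (1 / cnj w) = Re (\<i> * (1 / w))"
    unfolding e by (simp_all only: cnj.sel Re_i_times)
qed

lemma holomorphic_inverse: "(\<lambda>w. 1 / w) holomorphic_on - {0::complex}" "(\<lambda>w. \<i> * (1 / w)) holomorphic_on - {0}"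
  by (auto intro!: holomorphic_intros)

lemma Ck_on_inversion:
  assumes "open T" "Ck_on k T f"
  shows "Ck_on k {w. w \<noteq> 0 \<and> 1 / cnj w \<in> T} (\<lambda>w. f (1 / cnj w))"
proof (rule Ck_on_compose_plane[OF open_inverted[OF assms(1)] assms(1) _ assms(2)])
  have s: "{w. w \<noteq> 0 \<and> 1 / cnj w \<in> T} \<subseteq> - {0}" by auto
  show "Ck_on k {w. w \<noteq> 0 \<and> 1 / cnj w \<in> T} (\<lambda>w. Re (1 / cnj w))"
    unfolding inversion_components by (rule Ck_on_subset[OF Ck_on_Re_holomorphic[OF holomorphic_inverse(1)] s]) auto
  show "Ck_on k {w. w \<noteq> 0 \<and> 1 / cnj w \<in> T} (\<lambda>w. Im (1 / cnj w))"
    unfolding inversion_components by (rule Ck_on_subset[OF Ck_on_Re_holomorphic[OF holomorphic_inverse(2)] s]) auto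
qed auto

text \<open>The squared conformal factor of the inversion is |w|^(-4), which is also its Jacobian in
  absolute value. Integrals of a function against a Laplacian are therefore the same in both
  charts.\<close>

lemma laplacian_inversion:
  assumes T: "open T" "Ck_on 2 T f" and w: "w \<noteq> 0" "1 / cnj w \<in> T"
  shows "laplacian (\<lambda>w. f (1 / cnj w)) w = (1 / norm w ^ 4) * laplacian f (1 / cnj w)"
proof -
  let ?S = "{w. w \<noteq> 0 \<and> 1 / cnj w \<in> T}"
  have s: "?S \<subseteq> - {0}" by auto
  have w0: "w \<in> - {0}" using w by auto
  have o: "open (- {0::complex})" by auto
  define d where "d = - (1 / w\<^sup>2)"
  have D: "deriv (\<lambda>w. 1 / w) w = d" "deriv (\<lambda>w. \<i> * (1 / w)) w = \<i> * d"
    using w unfolding d_def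
    by (auto intro!: DERIV_imp_deriv derivative_eq_intros simp: power2_eq_square field_simps)
  have nd: "(norm d)\<^sup>2 = 1 / norm w ^ 4"
    by (simp add: d_def norm_divide norm_power power_divide flip: power_mult)
  have p: "dir_deriv v (\<lambda>w. Re (1 / cnj w)) w = Re (v * d)" for v
    unfolding inversion_components using dir_deriv_Re_holomorphic[OF holomorphic_inverse(1) o w0] D by simp
  have q: "dir_deriv v (\<lambda>w. Im (1 / cnj w)) w = Re (v * (\<i> * d))" for v
    unfolding inversion_components using dir_deriv_Re_holomorphic[OF holomorphic_inverse(2) o w0] D by simp
  show ?thesis
  proof (rule laplacian_compose_plane[OF open_inverted[OF T(1)] _ T(1) _ T(2)])
    show "Ck_on 2 ?S (\<lambda>w. Re (1 / cnj w))"
      unfolding inversion_components by (rule Ck_on_subset[OF Ck_on_Re_holomorphic[OF holomorphic_inverse(1) o] s])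
    show "Ck_on 2 ?S (\<lambda>w. Im (1 / cnj w))"
      unfolding inversion_components by (rule Ck_on_subset[OF Ck_on_Re_holomorphic[OF holomorphic_inverse(2) o] s])
    show "laplacian (\<lambda>w. Re (1 / cnj w)) w = 0"
      unfolding inversion_components by (rule laplacian_Re_holomorphic[OF holomorphic_inverse(1) o w0])
    show "laplacian (\<lambda>w. Im (1 / cnj w)) w = 0"
      unfolding inversion_components by (rule laplacian_Re_holomorphic[OF holomorphic_inverse(2) o w0])
  qed (use w nd in \<open>auto simp: p q cmod_power2\<close>)
qed

definition sphere_smooth :: "(complex option \<Rightarrow> real) \<Rightarrow> bool" where
  "sphere_smooth \<Phi> \<longleftrightarrow> (\<forall>c k. sphere_chart c \<longrightarrow> Ck_on k UNIV (\<lambda>w. \<Phi> (c w)))"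

lemma sphere_smoothD: "sphere_smooth \<Phi> \<Longrightarrow> sphere_chart c \<Longrightarrow> Ck_on k UNIV (\<lambda>w. \<Phi> (c w))"
  by (auto simp: sphere_smooth_def)

lemma sphere_smooth_mult: "sphere_smooth \<Phi> \<Longrightarrow> sphere_smooth \<Psi> \<Longrightarrow> sphere_smooth (\<lambda>p. \<Phi> p * \<Psi> p)"
  by (auto simp: sphere_smooth_def intro!: Ck_on_mult)

lemma sphere_smooth_diff: "sphere_smooth \<Phi> \<Longrightarrow> sphere_smooth \<Psi> \<Longrightarrow> sphere_smooth (\<lambda>p. \<Phi> p - \<Psi> p)"
  by (auto simp: sphere_smooth_def intro!: Ck_on_diff)

lemma sphere_smooth_const: "sphere_smooth (\<lambda>_. a)"
  by (simp add: sphere_smooth_def)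

lemma sphere_smooth_measurable:
  assumes "sphere_smooth \<Phi>"
  shows "\<Phi> \<in> borel_measurable sphere_borel"
  by (rule sphere_continuous_measurable) (use sphere_smoothD[OF assms, of _ 0] in auto)

text \<open>The second chart adds the single point \<open>other_chart c 0\<close>, near which the
  function is constant; everywhere else smoothness is transported by the inversion.\<close>

lemma sphere_smooth_extend:
  assumes c: "sphere_chart c" and sm: "\<And>k. Ck_on k UNIV (\<lambda>w. \<Phi> (c w))"
    and r: "r > 0" "\<And>w. norm w < r \<Longrightarrow> \<Phi> (other_chart c w) = a"
  shows "sphere_smooth \<Phi>"
proof -
  have "Ck_on k UNIV (\<lambda>w. \<Phi> (other_chart c w))" for k
  proof -
    have "Ck_on k (ball 0 r) (\<lambda>w. \<Phi> (other_chart c w))"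
      by (subst Ck_on_cong[of _ _ "\<lambda>_. a"]) (use r in auto)
    moreover have "Ck_on k {w. w \<noteq> 0 \<and> 1 / cnj w \<in> UNIV} (\<lambda>w. \<Phi> (other_chart c w))"
      using Ck_on_inversion[OF open_UNIV sm]
      by (subst Ck_on_cong[of _ _ "\<lambda>w. \<Phi> (c (1 / cnj w))"]) (auto simp: other_chart_eq[OF c] open_Collect_neq)
    ultimately have "Ck_on k (ball 0 r \<union> {w. w \<noteq> 0 \<and> 1 / cnj w \<in> UNIV}) (\<lambda>w. \<Phi> (other_chart c w))"
      by (intro Ck_on_Un) (auto simp: open_Collect_neq)
    moreover have "ball 0 r \<union> {w. w \<noteq> 0 \<and> 1 / cnj w \<in> UNIV} = (UNIV :: complex set)" using r by auto
    ultimately show ?thesis by simp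
  qed
  with sm c show ?thesis unfolding sphere_smooth_def sphere_chart_def
    by (auto simp: inversion_chart_neq_Some)
qed

text \<open>This is the integrand in \<open>chart_laplace_measure\<close>, named so that it can be
  handled as a function on the sphere.\<close>

definition chart_lift :: "(complex \<Rightarrow> complex option) \<Rightarrow> (complex \<Rightarrow> real) \<Rightarrow> complex option \<Rightarrow> real" where
  "chart_lift c \<phi> p = (if p \<in> range c then \<phi> (inv c p) else 0)"

lemma chart_lift_chart: "sphere_chart c \<Longrightarrow> chart_lift c \<phi> (c w) = \<phi> w"
  by (simp add: chart_lift_def inv_f_f inj_sphere_chart)

lemma test_functionI:
  assumes "\<And>k. Ck_on k UNIV \<phi>" "compact K" "K \<subseteq> S" "\<And>z. z \<notin> K \<Longrightarrow> \<phi> z = 0"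
  shows "test_function S \<phi>"
proof -
  have "closure {z. \<phi> z \<noteq> 0} \<subseteq> K"
    using assms(2,4) compact_imp_closed by (intro closure_minimal) auto
  moreover from this have "compact (closure {z. \<phi> z \<noteq> 0})"
    using compact_Int_closed[OF assms(2) closed_closure] by (metis inf.absorb2)
  ultimately show ?thesis using assms(1,3) by (auto simp: test_function_def)
qed

lemma cutoff_function:
  assumes R: "R > 0"
  obtains \<kappa> :: "complex option \<Rightarrow> real" where "sphere_smooth \<kappa>" "\<And>p. 0 \<le> \<kappa> p" "\<And>p. \<kappa> p \<le> 1"
    "\<And>z. norm z \<le> R \<Longrightarrow> \<kappa> (Some z) = 1" "\<And>z. norm z \<ge> R + 1 \<Longrightarrow> \<kappa> (Some z) = 0" "\<kappa> None = 0"
proof -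
  have "R\<^sup>2 < (R + 1)\<^sup>2" using R by (intro power_strict_mono) auto
  then obtain \<sigma> :: "real \<Rightarrow> real" where s: "\<And>k. Dk_on k UNIV \<sigma>" "\<And>x. 0 \<le> \<sigma> x" "\<And>x. \<sigma> x \<le> 1"
    "\<And>x. x \<le> R\<^sup>2 \<Longrightarrow> \<sigma> x = 0" "\<And>x. x \<ge> (R + 1)\<^sup>2 \<Longrightarrow> \<sigma> x = 1"
    by (rule smooth_step) blast
  define \<kappa> where "\<kappa> p = (case p of None \<Rightarrow> 0 | Some z \<Rightarrow> 1 - \<sigma> ((norm z)\<^sup>2))" for p :: "complex option"
  have out: "\<kappa> (Some z) = 0" if "norm z \<ge> R + 1" for z
    using s(5)[of "(norm z)\<^sup>2"] power_mono[OF that, of 2] R by (simp add: \<kappa>_def)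
  have "sphere_smooth \<kappa>"
  proof (rule sphere_smooth_extend[of Some])
    have "Ck_on k UNIV (\<lambda>z. (norm z)\<^sup>2)" for k using Ck_on_norm_sq[of k 0] by simp
    thus "Ck_on k UNIV (\<lambda>w. \<kappa> (Some w))" for k
      unfolding \<kappa>_def by (auto intro!: Ck_on_diff Ck_on_compose_real[OF open_UNIV s(1)])
    show "\<kappa> (other_chart Some w) = 0" if "norm w < 1 / (R + 1)" for w
    proof (cases "w = 0")
      case True
      thus ?thesis by (simp add: inversion_chart_eq \<kappa>_def)
    next
      case False
      have "norm (1 / cnj w) \<ge> R + 1" using that False R by (simp add: norm_divide field_simps)
      from out[OF this] show ?thesis using False by (simp add: inversion_chart_eq)
    qed
    show "1 / (R + 1) > 0" using R by simp
  qed simp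
  moreover have "\<kappa> (Some z) = 1" if "norm z \<le> R" for z
    using s(4)[of "(norm z)\<^sup>2"] power_mono[OF that, of 2] by (simp add: \<kappa>_def)
  moreover have "0 \<le> \<kappa> p" "\<kappa> p \<le> 1" for p using s(2,3) by (auto simp: \<kappa>_def split: option.splits)
  ultimately show ?thesis using that[of \<kappa>] out by (simp add: \<kappa>_def)
qed

subsection \<open>The Laplacian in different charts\<close>

text \<open>The Jacobian of the inversion absorbs the factor picked up by the Laplacian. Compact
  support in the chart c means vanishing near the origin of the other chart, so the point missed by
  c contributes nothing.\<close>

lemma chart_transfer:
  assumes c: "sphere_chart c" and sm: "sphere_smooth \<Psi>"
    and K: "compact K" "\<And>w. w \<notin> K \<Longrightarrow> \<Psi> (c w) = 0"
    and i: "integrable lborel (\<lambda>w. U (c w) * laplacian (\<lambda>w. \<Psi> (c w)) w)"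
  shows "integrable lborel (\<lambda>w. U (other_chart c w) * laplacian (\<lambda>w. \<Psi> (other_chart c w)) w)"
    and "(\<integral>w. U (other_chart c w) * laplacian (\<lambda>w. \<Psi> (other_chart c w)) w \<partial>lborel) =
         (\<integral>w. U (c w) * laplacian (\<lambda>w. \<Psi> (c w)) w \<partial>lborel)"
proof -
  let ?F = "\<lambda>w. U (c w) * laplacian (\<lambda>w. \<Psi> (c w)) w"
  let ?o = "other_chart c"
  have Fm: "?F \<in> borel_measurable borel" using borel_measurable_integrable[OF i] by simp
  obtain R where R: "\<And>z. z \<in> K \<Longrightarrow> norm z \<le> R" using compact_imp_bounded[OF K(1)] by (auto simp: bounded_iff)
  define d where "d = 1 / (\<bar>R\<bar> + 1)"
  have d: "d > 0" by (simp add: d_def)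
  have zero: "\<Psi> (?o w) = 0" if "w \<noteq> 0" "norm w < d" for w
  proof -
    have "\<bar>R\<bar> + 1 < norm (1 / cnj w)" using that by (simp add: d_def norm_divide field_simps)
    hence "norm (1 / cnj w) > R" by linarith
    hence "1 / cnj w \<notin> K" using R by force
    thus ?thesis using K(2) other_chart_eq[OF c that(1)] by simp
  qed
  \<comment> \<open>The hypothesis on K is silent about the point outside the chart c; continuity of
    \<Psi> supplies the value there.\<close>
  have zero0: "\<Psi> (?o 0) = 0"
  proof -
    have "isCont (\<lambda>w. \<Psi> (?o w)) 0"
      using sphere_smoothD[OF sm sphere_chart_other, of 0 c] by (simp add: continuous_on_eq_continuous_at)
    hence "((\<lambda>w. \<Psi> (?o w)) \<longlongrightarrow> \<Psi> (?o 0)) (at 0)" by (simp add: isCont_def)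
    moreover have "((\<lambda>w. \<Psi> (?o w)) \<longlongrightarrow> 0) (at 0)"
    proof (rule tendsto_eventually)
      have "\<forall>\<^sub>F w in at 0. w \<in> ball 0 d - {0}" using d by (intro eventually_at_in_open) auto
      thus "\<forall>\<^sub>F w in at 0. \<Psi> (?o w) = 0" by eventually_elim (use zero in auto)
    qed
    ultimately show ?thesis by (rule tendsto_unique[rotated]) simp
  qed
  have eq: "U (?o w) * laplacian (\<lambda>w. \<Psi> (?o w)) w = (1 / norm w ^ 4) * ?F (1 / cnj w)" for w
  proof (cases "w = 0")
    case True
    have "laplacian (\<lambda>w. \<Psi> (?o w)) 0 = laplacian (\<lambda>_. 0) 0"
      by (rule laplacian_cong[of "ball 0 d"]) (use d zero zero0 in \<open>auto, metis zero0 zero\<close>)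
    with True show ?thesis by simp
  next
    case False
    have "laplacian (\<lambda>w. \<Psi> (?o w)) w = laplacian (\<lambda>w. \<Psi> (c (1 / cnj w))) w"
      by (rule laplacian_cong[of "- {0}"]) (use False other_chart_eq[OF c] in auto)
    also have "\<dots> = (1 / norm w ^ 4) * laplacian (\<lambda>w. \<Psi> (c w)) (1 / cnj w)"
      using False by (intro laplacian_inversion[OF open_UNIV sphere_smoothD[OF sm c]]) auto
    finally show ?thesis using other_chart_eq[OF c False] by simp
  qed
  show "integrable lborel (\<lambda>w. U (?o w) * laplacian (\<lambda>w. \<Psi> (?o w)) w)"
    unfolding eq using integral_inversion(1)[OF Fm] i by simp
  show "(\<integral>w. U (?o w) * laplacian (\<lambda>w. \<Psi> (?o w)) w \<partial>lborel) = (\<integral>w. ?F w \<partial>lborel)"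
    unfolding eq using integral_inversion(2)[OF Fm] by simp
qed

lemma chart_transfer_any:
  assumes c: "sphere_chart c" "sphere_chart c'" and sm: "sphere_smooth \<Psi>"
    and K: "compact K" "\<And>w. w \<notin> K \<Longrightarrow> \<Psi> (c w) = 0"
    and i: "integrable lborel (\<lambda>w. U (c w) * laplacian (\<lambda>w. \<Psi> (c w)) w)"
  shows "integrable lborel (\<lambda>w. U (c' w) * laplacian (\<lambda>w. \<Psi> (c' w)) w) \<and>
     (\<integral>w. U (c' w) * laplacian (\<lambda>w. \<Psi> (c' w)) w \<partial>lborel) = (\<integral>w. U (c w) * laplacian (\<lambda>w. \<Psi> (c w)) w \<partial>lborel)"
proof (cases "c' = c")
  case False
  hence "c' = other_chart c" using c by (auto simp: sphere_chart_def)
  thus ?thesis using chart_transfer[OF c(1) sm K i] by simp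
qed (use i in simp)

section \<open>Measures dominated by the Riesz measure\<close>

text \<open>
  Domination is only required on nonnegative test functions, those in the chart at infinity being
  supported near infinity. This covers the Riesz measure as well as the counting measure of a
  sequence on which a holomorphic function vanishes.
\<close>

definition subriesz :: "complex option set \<Rightarrow> (complex option \<Rightarrow> ereal) \<Rightarrow> complex option measure \<Rightarrow> bool" where
  "subriesz D u \<nu> \<longleftrightarrow> sets \<nu> = sets sphere_borel \<and>
     (\<forall>\<phi>. test_function (Some -` D) \<phi> \<and> (\<forall>z. 0 \<le> \<phi> z) \<longrightarrow>
        0 \<le> (\<integral>w. real_of_ereal (u (Some w)) * laplacian \<phi> w \<partial>lborel) \<and>
        (\<integral>\<^sup>+p. ennreal (chart_lift Some \<phi> p) \<partial>\<nu>) \<le>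
          ennreal (1 / (2 * pi) * (\<integral>w. real_of_ereal (u (Some w)) * laplacian \<phi> w \<partial>lborel))) \<and>
     (None \<in> D \<longrightarrow> (\<exists>\<delta>>0. \<forall>\<phi>. test_function (inversion_chart -` D \<inter> ball 0 \<delta>) \<phi> \<and> (\<forall>z. 0 \<le> \<phi> z) \<longrightarrow>
        0 \<le> (\<integral>w. real_of_ereal (u (inversion_chart w)) * laplacian \<phi> w \<partial>lborel) \<and>
        (\<integral>\<^sup>+p. ennreal (chart_lift inversion_chart \<phi> p) \<partial>\<nu>) \<le>
          ennreal (1 / (2 * pi) * (\<integral>w. real_of_ereal (u (inversion_chart w)) * laplacian \<phi> w \<partial>lborel))))"

text \<open>The total integral vanishes by Green's identity against the constant 1.\<close>

lemma test_function_laplacian: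
  assumes "test_function S \<phi>"
  shows "continuous_on UNIV (laplacian \<phi>)" "\<And>z. z \<notin> closure {z. \<phi> z \<noteq> 0} \<Longrightarrow> laplacian \<phi> z = 0"
    "integrable lborel (laplacian \<phi>)" "(\<integral>z. laplacian \<phi> z \<partial>lborel) = 0"
proof -
  show c: "continuous_on UNIV (laplacian \<phi>)"
    using Ck_on_laplacian[OF open_UNIV, of 0] test_functionD(1)[OF assms, of "Suc (Suc 0)"] by simp
  show z: "laplacian \<phi> z = 0" if "z \<notin> closure {z. \<phi> z \<noteq> 0}" for z
    by (rule laplacian_zero_off_compact[OF test_functionD(2)[OF assms] test_functionD(4)[OF assms] that])
  have "test_function UNIV \<phi>" using assms by (simp add: test_function_def)
  from Green_identity[OF open_UNIV this Ck_on_const[of 2 UNIV 1]]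
  show "integrable lborel (laplacian \<phi>)" "(\<integral>z. laplacian \<phi> z \<partial>lborel) = 0" by simp_all
qed

text \<open>A cutoff splits \<Phi> into a part with compact support in the plane and a part
  supported near infinity, each a test function in its own chart. The integrals of both parts are
  moved to the chart c and added.\<close>

lemma sphere_test_integrals:
  assumes D: "sphere_domain D" and u: "subharmonic_on D u" and z0: "z0 \<in> D" "u z0 \<noteq> - \<infinity>"
    and sm: "sphere_smooth \<Phi>" and K: "closedin csphere K" "K \<subseteq> D" "\<And>p. p \<notin> K \<Longrightarrow> \<Phi> p = 0" and c: "sphere_chart c"
  shows "integrable lborel (\<lambda>w. real_of_ereal (u (c w)) * laplacian (\<lambda>w. \<Phi> (c w)) w)"
    and "integrable lborel (laplacian (\<lambda>w. \<Phi> (c w)))"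
    and "(\<integral>w. laplacian (\<lambda>w. \<Phi> (c w)) w \<partial>lborel) = 0"
    and "subriesz D u \<nu> \<Longrightarrow> (\<And>p. 0 \<le> \<Phi> p) \<Longrightarrow>
       0 \<le> (\<integral>w. real_of_ereal (u (c w)) * laplacian (\<lambda>w. \<Phi> (c w)) w \<partial>lborel) \<and>
       (\<integral>\<^sup>+p. ennreal (\<Phi> p) \<partial>\<nu>) \<le>
       ennreal (1 / (2 * pi) * (\<integral>w. real_of_ereal (u (c w)) * laplacian (\<lambda>w. \<Phi> (c w)) w \<partial>lborel))"
proof -
  have Do: "openin csphere D" using D by (simp add: sphere_domain_def)
  let ?u = "\<lambda>p. real_of_ereal (u p)"
  have split: "\<exists>\<Phi>1 \<Phi>2. sphere_smooth \<Phi>1 \<and> sphere_smooth \<Phi>2 \<and> (\<forall>p. \<Phi> p = \<Phi>1 p + \<Phi>2 p) \<and>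
     ((\<forall>p. 0 \<le> \<Phi> p) \<longrightarrow> (\<forall>p. 0 \<le> \<Phi>1 p \<and> 0 \<le> \<Phi>2 p)) \<and>
     test_function (Some -` D) (\<lambda>w. \<Phi>1 (Some w)) \<and> \<Phi>1 None = 0 \<and>
     test_function (inversion_chart -` D \<inter> ball 0 \<delta>) (\<lambda>w. \<Phi>2 (inversion_chart w)) \<and> \<Phi>2 (Some 0) = 0"
    if \<delta>: "\<delta> > 0" for \<delta>
  proof -
    \<comment> \<open>Points with |w| > \<delta>/2 in the inversion chart have |1/cnj w| < R, where
      the cutoff is 1; the second part is thus supported in the disc of radius \<delta>/2, inside
      \<open>ball 0 \<delta>\<close>.\<close>
    define R where "R = 2 / \<delta>"
    have R: "R > 0" using \<delta> by (simp add: R_def)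
    obtain \<kappa> :: "complex option \<Rightarrow> real" where k: "sphere_smooth \<kappa>" "\<And>p. 0 \<le> \<kappa> p" "\<And>p. \<kappa> p \<le> 1"
      "\<And>z. norm z \<le> R \<Longrightarrow> \<kappa> (Some z) = 1" "\<And>z. norm z \<ge> R + 1 \<Longrightarrow> \<kappa> (Some z) = 0" "\<kappa> None = 0"
      using cutoff_function[OF R] by metis
    let ?\<Phi>1 = "\<lambda>p. \<kappa> p * \<Phi> p" and ?\<Phi>2 = "\<lambda>p. (1 - \<kappa> p) * \<Phi> p"
    have s1: "sphere_smooth ?\<Phi>1" and s2: "sphere_smooth ?\<Phi>2"
      by (intro sphere_smooth_mult sphere_smooth_diff sphere_smooth_const k sm)+
    have t1: "test_function (Some -` D) (\<lambda>w. ?\<Phi>1 (Some w))"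
    proof (rule test_functionI)
      show "Ck_on k UNIV (\<lambda>w. ?\<Phi>1 (Some w))" for k using sphere_smoothD[OF s1, of Some] by simp
      show "compact (cball 0 (R + 1) \<inter> Some -` K)"
        by (intro compact_Int_closed compact_cball closed_chart_vimage K) simp
      show "cball 0 (R + 1) \<inter> Some -` K \<subseteq> Some -` D" using K by auto
      show "?\<Phi>1 (Some w) = 0" if "w \<notin> cball 0 (R + 1) \<inter> Some -` K" for w
        using that K(3)[of "Some w"] k(5)[of w] by auto
    qed
    have t2: "test_function (inversion_chart -` D \<inter> ball 0 \<delta>) (\<lambda>w. ?\<Phi>2 (inversion_chart w))"
    proof (rule test_functionI)
      show "Ck_on k UNIV (\<lambda>w. ?\<Phi>2 (inversion_chart w))" for k using sphere_smoothD[OF s2, of inversion_chart] by simp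
      show "compact (cball 0 (\<delta> / 2) \<inter> inversion_chart -` K)"
        by (intro compact_Int_closed compact_cball closed_chart_vimage K) simp
      show "cball 0 (\<delta> / 2) \<inter> inversion_chart -` K \<subseteq> inversion_chart -` D \<inter> ball 0 \<delta>" using K \<delta> by auto
      show "?\<Phi>2 (inversion_chart w) = 0" if "w \<notin> cball 0 (\<delta> / 2) \<inter> inversion_chart -` K" for w
      proof (cases "inversion_chart w \<in> K")
        case True
        hence n: "norm w > \<delta> / 2" using that by auto
        hence w: "w \<noteq> 0" using \<delta> by auto
        have "norm (1 / cnj w) \<le> R" using n \<delta> w by (simp add: norm_divide R_def field_simps)
        from k(4)[OF this] show ?thesis using w by (simp add: inversion_chart_eq)
      qed (simp add: K(3))
    qed
    have e: "\<forall>p. \<Phi> p = ?\<Phi>1 p + ?\<Phi>2 p" by (simp add: left_diff_distrib)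
    have n: "(\<forall>p. 0 \<le> \<Phi> p) \<longrightarrow> (\<forall>p. 0 \<le> ?\<Phi>1 p \<and> 0 \<le> ?\<Phi>2 p)" using k(2,3) by auto
    have z1: "?\<Phi>1 None = 0" and z2: "?\<Phi>2 (Some 0) = 0" using k(4)[of 0] k(6) R by auto
    show ?thesis by (intro exI[of _ ?\<Phi>1] exI[of _ ?\<Phi>2] conjI s1 s2 e n t1 t2 z1 z2)
  qed
  \<comment> \<open>The factor U is kept general: u gives the pairing with \<Delta>\<Phi>, and the
    constant 1 gives the vanishing of the integral of \<Delta>\<Phi>.\<close>
  have main: "integrable lborel (\<lambda>w. U (c w) * laplacian (\<lambda>w. \<Phi> (c w)) w) \<and>
      (\<integral>w. U (c w) * laplacian (\<lambda>w. \<Phi> (c w)) w \<partial>lborel) =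
      (\<integral>w. U (Some w) * laplacian (\<lambda>w. \<Phi>1 (Some w)) w \<partial>lborel) +
      (\<integral>w. U (inversion_chart w) * laplacian (\<lambda>w. \<Phi>2 (inversion_chart w)) w \<partial>lborel)"
    if s1: "sphere_smooth \<Phi>1" and s2: "sphere_smooth \<Phi>2" and eq: "\<forall>p. \<Phi> p = \<Phi>1 p + \<Phi>2 p"
      and t1: "test_function (Some -` D) (\<lambda>w. \<Phi>1 (Some w))"
      and t2: "test_function (inversion_chart -` D \<inter> ball 0 \<delta>) (\<lambda>w. \<Phi>2 (inversion_chart w))"
      and i1: "integrable lborel (\<lambda>w. U (Some w) * laplacian (\<lambda>w. \<Phi>1 (Some w)) w)"
      and i2: "integrable lborel (\<lambda>w. U (inversion_chart w) * laplacian (\<lambda>w. \<Phi>2 (inversion_chart w)) w)"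
    for U \<Phi>1 \<Phi>2 \<delta>
  proof -
    note a1 = chart_transfer_any[OF sphere_chartI(1) c s1 test_functionD(2)[OF t1] test_functionD(4)[OF t1] i1]
    note a2 = chart_transfer_any[OF sphere_chartI(2) c s2 test_functionD(2)[OF t2] test_functionD(4)[OF t2] i2]
    have "laplacian (\<lambda>w. \<Phi> (c w)) w = laplacian (\<lambda>w. \<Phi>1 (c w)) w + laplacian (\<lambda>w. \<Phi>2 (c w)) w" for w
      using laplacian_add[OF open_UNIV UNIV_I sphere_smoothD[OF s1 c] sphere_smoothD[OF s2 c]] eq by simp
    hence "U (c w) * laplacian (\<lambda>w. \<Phi> (c w)) w = U (c w) * laplacian (\<lambda>w. \<Phi>1 (c w)) w + U (c w) * laplacian (\<lambda>w. \<Phi>2 (c w)) w" for w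
      by (simp add: distrib_left)
    thus ?thesis using a1 a2 by simp
  qed
  have tint: "integrable lborel (\<lambda>w. ?u (c w) * laplacian \<phi> w)"
    if "sphere_chart c" "test_function (c -` D \<inter> T) \<phi>" for c \<phi> T
    using test_functionD(2,3)[OF that(2)] test_function_laplacian(1,2)[OF that(2)]
    by (intro subharmonic_test_integrable[OF D u z0 that(1), of _ "closure {z. \<phi> z \<noteq> 0}"]) auto
  have tint1: "integrable lborel (\<lambda>w. ?u (Some w) * laplacian \<phi> w)" if "test_function (Some -` D) \<phi>" for \<phi>
    using tint[of Some UNIV \<phi>] that by simp
  obtain \<Phi>1 \<Phi>2 where P: "sphere_smooth \<Phi>1" "sphere_smooth \<Phi>2" "\<forall>p. \<Phi> p = \<Phi>1 p + \<Phi>2 p"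
     "test_function (Some -` D) (\<lambda>w. \<Phi>1 (Some w))"
     "test_function (inversion_chart -` D \<inter> ball 0 1) (\<lambda>w. \<Phi>2 (inversion_chart w))"
    using split[of 1] by auto
  show "integrable lborel (\<lambda>w. ?u (c w) * laplacian (\<lambda>w. \<Phi> (c w)) w)"
    using main[OF P, of ?u] tint1[OF P(4)] tint[OF _ P(5)] by simp
  show "integrable lborel (laplacian (\<lambda>w. \<Phi> (c w)))" "(\<integral>w. laplacian (\<lambda>w. \<Phi> (c w)) w \<partial>lborel) = 0"
    using main[OF P, of "\<lambda>_. 1"] test_function_laplacian(3,4)[OF P(4)] test_function_laplacian(3,4)[OF P(5)] by simp_all
  assume \<nu>: "subriesz D u \<nu>" and nn: "\<And>p. 0 \<le> \<Phi> p"
  have sets: "sets \<nu> = sets sphere_borel" using \<nu> by (simp add: subriesz_def)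
  show "0 \<le> (\<integral>w. ?u (c w) * laplacian (\<lambda>w. \<Phi> (c w)) w \<partial>lborel) \<and>
      (\<integral>\<^sup>+p. ennreal (\<Phi> p) \<partial>\<nu>) \<le> ennreal (1 / (2 * pi) * (\<integral>w. ?u (c w) * laplacian (\<lambda>w. \<Phi> (c w)) w \<partial>lborel))"
  \<comment> \<open>\<open>subriesz\<close> provides a radius \<delta> only if infinity belongs to
    D. Otherwise K is compact in the plane and one chart is enough.\<close>
  proof (cases "None \<in> D")
    case False
    hence "None \<notin> K" using K(2) by blast
    then obtain C where C: "compact C" "K = Some ` C"
      using K(1) by (auto simp: closedin_Alexandroff_compactification)
    have CD: "C \<subseteq> Some -` D" using C(2) K(2) by auto
    have z: "\<Phi> (Some w) = 0" if "w \<notin> C" for w using that C(2) by (intro K(3)) auto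
    have t: "test_function (Some -` D) (\<lambda>w. \<Phi> (Some w))"
      by (rule test_functionI[OF sphere_smoothD[OF sm sphere_chartI(1)] C(1) CD z])
    have l: "chart_lift Some (\<lambda>w. \<Phi> (Some w)) p = \<Phi> p" for p
      using K(3)[OF \<open>None \<notin> K\<close>] chart_lift_chart[of Some "\<lambda>w. \<Phi> (Some w)"] by (cases p) (auto simp: chart_lift_def)
    have "0 \<le> (\<integral>w. ?u (Some w) * laplacian (\<lambda>w. \<Phi> (Some w)) w \<partial>lborel) \<and>
        (\<integral>\<^sup>+p. ennreal (chart_lift Some (\<lambda>w. \<Phi> (Some w)) p) \<partial>\<nu>) \<le>
        ennreal (1 / (2 * pi) * (\<integral>w. ?u (Some w) * laplacian (\<lambda>w. \<Phi> (Some w)) w \<partial>lborel))"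
      using \<nu> t nn unfolding subriesz_def by blast
    moreover have "(\<integral>w. ?u (Some w) * laplacian (\<lambda>w. \<Phi> (Some w)) w \<partial>lborel) = (\<integral>w. ?u (c w) * laplacian (\<lambda>w. \<Phi> (c w)) w \<partial>lborel)"
      using chart_transfer_any[OF sphere_chartI(1) c sm C(1) z tint1[OF t]] by simp
    ultimately show ?thesis unfolding l by simp
  next
    case True
    obtain \<delta> where \<delta>: "\<delta> > 0" "\<And>\<phi>. test_function (inversion_chart -` D \<inter> ball 0 \<delta>) \<phi> \<Longrightarrow> (\<And>z. 0 \<le> \<phi> z) \<Longrightarrow>
          0 \<le> (\<integral>w. ?u (inversion_chart w) * laplacian \<phi> w \<partial>lborel) \<and>
          (\<integral>\<^sup>+p. ennreal (chart_lift inversion_chart \<phi> p) \<partial>\<nu>) \<le>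
            ennreal (1 / (2 * pi) * (\<integral>w. ?u (inversion_chart w) * laplacian \<phi> w \<partial>lborel))"
      using \<nu> True unfolding subriesz_def by blast
    obtain \<Phi>1 \<Phi>2 where P: "sphere_smooth \<Phi>1" "sphere_smooth \<Phi>2" "\<forall>p. \<Phi> p = \<Phi>1 p + \<Phi>2 p"
       "test_function (Some -` D) (\<lambda>w. \<Phi>1 (Some w))"
       "test_function (inversion_chart -` D \<inter> ball 0 \<delta>) (\<lambda>w. \<Phi>2 (inversion_chart w))"
       and nn': "\<And>p. 0 \<le> \<Phi>1 p" "\<And>p. 0 \<le> \<Phi>2 p" and z: "\<Phi>1 None = 0" "\<Phi>2 (Some 0) = 0"
      using split[OF \<delta>(1)] nn by blast
    let ?A = "\<integral>w. ?u (Some w) * laplacian (\<lambda>w. \<Phi>1 (Some w)) w \<partial>lborel"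
    let ?B = "\<integral>w. ?u (inversion_chart w) * laplacian (\<lambda>w. \<Phi>2 (inversion_chart w)) w \<partial>lborel"
    have l1: "chart_lift Some (\<lambda>w. \<Phi>1 (Some w)) p = \<Phi>1 p" for p
      using z(1) chart_lift_chart[of Some "\<lambda>w. \<Phi>1 (Some w)"] by (cases p) (auto simp: chart_lift_def)
    have l2: "chart_lift inversion_chart (\<lambda>w. \<Phi>2 (inversion_chart w)) p = \<Phi>2 p" for p
    proof (cases rule: chart_cases[OF sphere_chartI(2), of p])
      case (1 w)
      thus ?thesis by (simp add: chart_lift_chart)
  next
      case 2
      thus ?thesis using other_chart_0[of inversion_chart] z(2) by (simp add: chart_lift_def)
    qed
    have A: "0 \<le> ?A" "(\<integral>\<^sup>+p. ennreal (\<Phi>1 p) \<partial>\<nu>) \<le> ennreal (1 / (2 * pi) * ?A)"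
    proof -
      have "0 \<le> ?A \<and> (\<integral>\<^sup>+p. ennreal (chart_lift Some (\<lambda>w. \<Phi>1 (Some w)) p) \<partial>\<nu>) \<le> ennreal (1 / (2 * pi) * ?A)"
        using \<nu> P(4) nn' unfolding subriesz_def by blast
      thus "0 \<le> ?A" "(\<integral>\<^sup>+p. ennreal (\<Phi>1 p) \<partial>\<nu>) \<le> ennreal (1 / (2 * pi) * ?A)" unfolding l1 by blast+
    qed
    have B: "0 \<le> ?B" "(\<integral>\<^sup>+p. ennreal (\<Phi>2 p) \<partial>\<nu>) \<le> ennreal (1 / (2 * pi) * ?B)"
      using \<delta>(2)[OF P(5)] nn' unfolding l2 by blast+
    have m: "\<Phi>1 \<in> borel_measurable \<nu>" "\<Phi>2 \<in> borel_measurable \<nu>"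
      using sphere_smooth_measurable[OF P(1)] sphere_smooth_measurable[OF P(2)] measurable_cong_sets[OF sets refl] by auto
    have "(\<integral>\<^sup>+p. ennreal (\<Phi> p) \<partial>\<nu>) = (\<integral>\<^sup>+p. ennreal (\<Phi>1 p) + ennreal (\<Phi>2 p) \<partial>\<nu>)"
      using P(3) nn' by (simp add: ennreal_plus)
    also have "\<dots> = (\<integral>\<^sup>+p. ennreal (\<Phi>1 p) \<partial>\<nu>) + (\<integral>\<^sup>+p. ennreal (\<Phi>2 p) \<partial>\<nu>)"
      using m by (intro nn_integral_add) auto
    also have "\<dots> \<le> ennreal (1 / (2 * pi) * ?A) + ennreal (1 / (2 * pi) * ?B)"
      by (intro add_mono A B)
    also have "\<dots> = ennreal (1 / (2 * pi) * (?A + ?B))"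
      using A(1) B(1) by (subst ennreal_plus[symmetric]) (auto simp: distrib_left add_divide_distrib)
    also have AB: "?A + ?B = (\<integral>w. ?u (c w) * laplacian (\<lambda>w. \<Phi> (c w)) w \<partial>lborel)"
      using main[OF P, of ?u] tint1[OF P(4)] tint[OF _ P(5)] by simp
    finally show ?thesis using A(1) B(1) AB by simp
  qed
qed

section \<open>A Jensen inequality for the Green function\<close>

lemma continuous_map_chart: "sphere_chart c \<Longrightarrow> continuous_map euclidean csphere c"
  using open_chart_vimage[of c] by (auto simp: continuous_map_def vimage_def)

lemma closedin_chart_image_compact:
  assumes "sphere_chart c" "compact K"
  shows "closedin csphere (c ` K)"
  using image_compactin[of euclidean K csphere c] continuous_map_chart[OF assms(1)] assms(2)
  by (simp add: compactin_csphere_iff)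

lemma harmonic_onD:
  assumes "harmonic_on S h" "sphere_chart c"
  shows "planar_harmonic_on (c -` S) (\<lambda>w. h (c w))"
  using assms by (auto simp: harmonic_on_def sphere_chart_def o_def)

text \<open>In a chart around the pole, g + ln |w - a| is bounded and harmonic off a, so its
  singularity is removable. For the pole at infinity the inversion chart turns ln |z| into -ln |w|,
  and both cases take one form.\<close>

lemma green_function_pole:
  assumes D: "openin csphere D" and z0: "z0 \<in> D" and g: "green_function D z0 g"
  obtains c a r P where "sphere_chart c" "z0 = c a" "r > 0" "ball a r \<subseteq> c -` D" "P holomorphic_on ball a r"
    "\<And>w. w \<in> ball a r - {a} \<Longrightarrow> real_of_ereal (g (c w)) = Re (P w) - ln (norm (w - a))"
proof -
  have "\<exists>c a B. sphere_chart c \<and> z0 = c a \<and> (\<forall>\<^sub>F w in at a. \<bar>real_of_ereal (g (c w)) + ln (norm (w - a))\<bar> \<le> B)"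
  proof (cases z0)
    case (Some a)
    then obtain B where "\<forall>\<^sub>F w in at a. \<bar>real_of_ereal (g (Some w)) + ln (norm (w - a))\<bar> \<le> B"
      using g by (auto simp: green_function_def)
    with Some show ?thesis by blast
  next
    case None
    then obtain B where B: "\<forall>\<^sub>F z in at_infinity. \<bar>real_of_ereal (g (Some z)) - ln (norm z)\<bar> \<le> B"
      using g by (auto simp: green_function_def)
    have "filterlim (\<lambda>w::complex. inverse (cnj w)) at_infinity (at 0)"
    proof (rule filterlim_compose[OF filterlim_inverse_at_infinity])
      show "filterlim cnj (at 0) (at (0::complex))"
        by (rule filterlim_atI) (auto intro!: tendsto_eq_intros simp: eventually_at_filter)
    qed
    from eventually_compose_filterlim[OF B this]
    have "\<forall>\<^sub>F w in at 0. \<bar>real_of_ereal (g (Some (inverse (cnj w)))) - ln (norm (inverse (cnj w)))\<bar> \<le> B" .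
    moreover have "\<forall>\<^sub>F w in at (0::complex). w \<noteq> 0" by (simp add: eventually_at_filter)
    ultimately have "\<forall>\<^sub>F w in at 0. \<bar>real_of_ereal (g (inversion_chart w)) + ln (norm (w - 0))\<bar> \<le> B"
      by eventually_elim (simp add: inversion_chart_eq norm_inverse ln_inverse inverse_eq_divide norm_divide ln_div)
    moreover have "z0 = inversion_chart 0" using None by (simp add: inversion_chart_eq)
    ultimately show ?thesis by blast
  qed
  then obtain c a B where c: "sphere_chart c" "z0 = c a"
    and B: "\<forall>\<^sub>F w in at a. \<bar>real_of_ereal (g (c w)) + ln (norm (w - a))\<bar> \<le> B" by blast
  obtain d where d: "d > 0" "\<And>w. w \<noteq> a \<Longrightarrow> dist w a < d \<Longrightarrow> \<bar>real_of_ereal (g (c w)) + ln (norm (w - a))\<bar> \<le> B"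
    using B by (auto simp: eventually_at)
  have "a \<in> c -` D" using z0 c by simp
  then obtain e where e: "e > 0" "ball a e \<subseteq> c -` D"
    using open_chart_vimage[OF c(1) D] open_contains_ball by blast
  define r where "r = min d e"
  have r: "r > 0" "ball a r \<subseteq> c -` D" using d e by (auto simp: r_def)
  have sub: "ball a r - {a} \<subseteq> c -` (D - {z0})"
    using r(2) inj_sphere_chart[OF c(1)] c(2) by (auto simp: inj_def)
  have h1: "planar_harmonic_on (ball a r - {a}) (\<lambda>w. real_of_ereal (g (c w)))"
    using g by (intro planar_harmonic_on_subset[OF harmonic_onD[OF _ c(1)] sub]) (auto simp: green_function_def)
  have h2: "planar_harmonic_on (ball a r - {a}) (\<lambda>w. ln (norm (w - a)))"
    by (rule planar_harmonic_on_subset[OF planar_harmonic_on_ln_norm]) auto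
  have h: "planar_harmonic_on (ball a r - {a}) (\<lambda>w. real_of_ereal (g (c w)) + ln (norm (w - a)))"
    by (intro planar_harmonic_on_add h1 h2) auto
  have bd: "\<bar>real_of_ereal (g (c w)) + ln (norm (w - a))\<bar> \<le> B" if "w \<in> ball a r - {a}" for w
    using d(2)[of w] that by (auto simp: r_def dist_commute)
  obtain P where P: "P holomorphic_on ball a r"
    "\<And>w. w \<in> ball a r - {a} \<Longrightarrow> real_of_ereal (g (c w)) + ln (norm (w - a)) = Re (P w)"
    using harmonic_removable_singularity[OF r(1) h bd] by blast
  show ?thesis
  proof (rule that[OF c r P(1)])
    show "real_of_ereal (g (c w)) = Re (P w) - ln (norm (w - a))" if "w \<in> ball a r - {a}" for w
      using P(2)[OF that] by simp
  qed
qed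

text \<open>Countably many of the discs of local integrability cover the open set by Lindelof's
  theorem.\<close>

lemma subharmonic_AE_finite:
  assumes D: "sphere_domain D" and u: "subharmonic_on D u" and z0: "z0 \<in> D" "u z0 \<noteq> - \<infinity>"
    and c: "sphere_chart c"
  shows "AE w in lborel. w \<in> c -` D \<longrightarrow> u (c w) \<noteq> - \<infinity>"
proof -
  let ?S = "c -` D"
  have "\<exists>R. \<forall>a\<in>?S. R a > 0 \<and> (AE w in lborel. w \<in> cball a (R a) \<longrightarrow> u (c w) \<noteq> - \<infinity>)"
    using subharmonic_locally_integrable[OF D u z0 c] by (intro bchoice) blast
  then obtain R where R: "\<And>a. a \<in> ?S \<Longrightarrow> R a > 0 \<and> (AE w in lborel. w \<in> cball a (R a) \<longrightarrow> u (c w) \<noteq> - \<infinity>)" by blast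
  obtain F where F: "F \<subseteq> (\<lambda>a. ball a (R a)) ` ?S" "countable F" "\<Union>F = (\<Union>a\<in>?S. ball a (R a))"
    using Lindelof[of "(\<lambda>a. ball a (R a)) ` ?S"] by auto
  have "AE w in lborel. \<forall>T\<in>F. w \<in> T \<longrightarrow> u (c w) \<noteq> - \<infinity>"
  proof (subst AE_ball_countable[OF F(2)], intro ballI)
    fix T assume "T \<in> F"
    then obtain a where "a \<in> ?S" "T = ball a (R a)" using F(1) by auto
    thus "AE w in lborel. w \<in> T \<longrightarrow> u (c w) \<noteq> - \<infinity>" using R[of a] by (auto elim!: eventually_mono)
  qed
  thus ?thesis
  proof eventually_elim
    case (elim w)
    show ?case
    proof
      assume "w \<in> ?S"
      hence "w \<in> (\<Union>a\<in>?S. ball a (R a))" using R[of w] by (intro UN_I[of w]) auto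
      hence "w \<in> \<Union>F" unfolding F(3) .
      with elim show "u (c w) \<noteq> - \<infinity>" by blast
    qed
  qed
qed

text \<open>Near the pole the test function is Re P - C0 - \<kappa>(|w - a|^2), which is g - C0 with
  the logarithm smoothed. The second conclusion, a maximum principle, ensures that
  \<open>ennreal\<close> does not cut B - u(z0) to 0 in later sums.\<close>

lemma green_jensen:
  assumes D: "sphere_domain D" and z0: "z0 \<in> D" and g: "green_function D z0 g"
    and s: "0 < s1" "s1 < s2" "s2 \<le> t0"
    and U0: "openin csphere (superlevel D g t0)"
    and K: "csphere closure_of (superlevel D g s1) \<subseteq> D"
    and u: "subharmonic_on D u" "u z0 \<noteq> - \<infinity>"
    and B: "\<And>z. z \<in> D \<Longrightarrow> g z \<le> ereal t0 \<Longrightarrow> ereal s1 \<le> g z \<Longrightarrow> u z \<le> ereal B"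
    and \<nu>: "subriesz D u \<nu>"
  shows "(\<integral>\<^sup>+z\<in>D - superlevel D g t0. ennreal (real_of_ereal (g z) - s2) \<partial>\<nu>) \<le> ennreal (B - real_of_ereal (u z0))"
    and "real_of_ereal (u z0) \<le> B"
proof -
  have Do: "openin csphere D" using D by (simp add: sphere_domain_def)
  obtain c a r0 P where c: "sphere_chart c" "z0 = c a" and r0: "r0 > 0" "ball a r0 \<subseteq> c -` D"
    and P: "P holomorphic_on ball a r0"
    and gP: "\<And>w. w \<in> ball a r0 - {a} \<Longrightarrow> real_of_ereal (g (c w)) = Re (P w) - ln (norm (w - a))"
    using green_function_pole[OF Do z0 g] by metis
  define gr where "gr p = real_of_ereal (g p)" for p
  have gz0: "g z0 = \<infinity>" using g by (simp add: green_function_def)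
  have gfin: "g p = ereal (gr p)" if "p \<in> D" "p \<noteq> z0" for p
    using g that by (auto simp: green_function_def gr_def ereal_real)
  have gharm: "planar_harmonic_on (c' -` (D - {z0})) (\<lambda>w. gr (c' w))" if "sphere_chart c'" for c'
    using harmonic_onD[OF _ that] g unfolding gr_def green_function_def by blast
  have Dz0: "openin csphere (D - {z0})"
  proof -
    have "closedin csphere {z0}" using closedin_chart_image_compact[OF c(1), of "{a}"] c(2) by simp
    thus ?thesis using Do by (intro openin_diff)
  qed
  have aU: "a \<in> c -` superlevel D g t0" using z0 gz0 c(2) by (simp add: superlevel_def)
  then obtain r1 where r1: "r1 > 0" "ball a r1 \<subseteq> c -` superlevel D g t0"
    using open_chart_vimage[OF c(1) U0] open_contains_ball by blast
  define r where "r = min r0 r1 / 2"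
  have r: "r > 0" "cball a r \<subseteq> ball a r0" "cball a r \<subseteq> c -` superlevel D g t0"
    using r0(1) r1 by (auto simp: r_def subset_iff min_def split: if_splits)
  obtain \<eta> \<eta>' \<eta>'' C0 where eta: "\<And>k. Dk_on k UNIV \<eta>"
    "\<And>x. (\<eta> has_real_derivative \<eta>' x) (at x)" "\<And>x. (\<eta>' has_real_derivative \<eta>'' x) (at x)"
    "\<And>x. 0 \<le> \<eta>'' x" "\<And>x. x \<le> s1 \<or> x \<ge> s2 \<Longrightarrow> \<eta>'' x = 0"
    "\<And>x. x \<le> s1 \<Longrightarrow> \<eta> x = 0" "\<And>x. 0 \<le> \<eta> x" "\<And>x. x \<ge> s2 \<Longrightarrow> \<eta> x = x - C0"
    "\<And>x. x - s2 \<le> \<eta> x" "s1 \<le> C0" "C0 \<le> s2"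
    using convex_ramp[OF s(2)] by metis
  have cP: "continuous_on (cball a r) (\<lambda>w. Re (P w))"
    using holomorphic_on_imp_continuous_on[OF P] r(2) by (intro continuous_intros) (auto intro: continuous_on_subset)
  obtain M where M: "\<And>w. w \<in> cball a r \<Longrightarrow> \<bar>Re (P w)\<bar> \<le> M"
  proof -
    obtain M where "\<forall>x\<in>(\<lambda>w. Re (P w)) ` cball a r. norm x \<le> M"
      using compact_imp_bounded[OF compact_continuous_image[OF cP compact_cball]] unfolding bounded_iff by blast
    hence "\<bar>Re (P w)\<bar> \<le> M" if "w \<in> cball a r" for w using that by (metis imageI real_norm_def)
    thus ?thesis by (rule that)
  qed
  \<comment> \<open>The radius r keeps the disc inside U_{t0}. The exponential makes the inner
    branch nonnegative: on the half-size disc \<kappa> is at most ln(\<epsilon>/2) \<le> -M - |C0|,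
    while Re P is at least -M.\<close>
  define \<epsilon> where "\<epsilon> = min r (exp (- M - \<bar>C0\<bar>))"
  have e: "\<epsilon> > 0" "\<epsilon> \<le> r" using r by (auto simp: \<epsilon>_def)
  have lne: "ln (\<epsilon> / 2) \<le> - M - \<bar>C0\<bar>"
  proof -
    have "ln (\<epsilon> / 2) \<le> ln \<epsilon>" using e by simp
    also have "\<dots> \<le> ln (exp (- M - \<bar>C0\<bar>))" using e(1) by (subst ln_le_cancel_iff) (auto simp: \<epsilon>_def)
    finally show ?thesis by simp
  qed
  have e4: "0 < (\<epsilon> / 4)\<^sup>2" "(\<epsilon> / 4)\<^sup>2 < (\<epsilon> / 2)\<^sup>2" using e by (auto intro!: power_strict_mono)
  obtain \<kappa> \<kappa>' \<kappa>'' \<sigma> \<sigma>' where kap: "\<And>k. Dk_on k UNIV \<kappa>"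
    "\<And>x. (\<kappa> has_real_derivative \<kappa>' x) (at x)" "\<And>x. (\<kappa>' has_real_derivative \<kappa>'' x) (at x)"
    "\<And>x. x \<ge> (\<epsilon> / 2)\<^sup>2 \<Longrightarrow> \<kappa> x = ln x / 2" "\<And>x. x \<le> (\<epsilon> / 2)\<^sup>2 \<Longrightarrow> \<kappa> x \<le> ln ((\<epsilon> / 2)\<^sup>2) / 2"
    "\<And>x. x * \<kappa>'' x + \<kappa>' x = \<sigma>' x / 2" "\<And>x. (\<sigma> has_real_derivative \<sigma>' x) (at x)"
    "continuous_on UNIV \<sigma>'" "\<And>x. 0 \<le> \<sigma>' x" "\<And>x. x \<le> (\<epsilon> / 4)\<^sup>2 \<or> x \<ge> (\<epsilon> / 2)\<^sup>2 \<Longrightarrow> \<sigma>' x = 0"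
    "\<And>x. x \<le> (\<epsilon> / 4)\<^sup>2 \<Longrightarrow> \<sigma> x = 0" "\<And>x. x \<ge> (\<epsilon> / 2)\<^sup>2 \<Longrightarrow> \<sigma> x = 1"
    by (rule log_profile[OF e4(1) e4(2)]) (rule that, assumption+)
  let ?k = "\<lambda>w. \<kappa> ((norm (w - a))\<^sup>2)"
  let ?in = "\<lambda>w. Re (P w) - C0 - ?k w"
  \<comment> \<open>On the annulus \<open>\<epsilon> / 2 \<le> norm (w - a) < \<epsilon>\<close> both branches agree: there \<open>g > s2\<close>, where \<open>\<eta>\<close> is affine.\<close>
  define \<Phi> where "\<Phi> p = (if p \<in> c ` ball a \<epsilon> then ?in (inv c p) else if p \<in> D then \<eta> (gr p) else 0)" for p
  have F1: "\<Phi> (c w) = ?in w" if "w \<in> ball a \<epsilon>" for w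
    using that inj_sphere_chart[OF c(1)] by (simp add: \<Phi>_def inv_f_f)
  have ballU: "c w \<in> superlevel D g t0" if "w \<in> ball a \<epsilon>" for w
    using that e r(3) by (auto simp: subset_iff)
  have ginside: "gr (c w) > t0" "gr (c w) = Re (P w) - ln (norm (w - a))" if "w \<in> ball a \<epsilon>" "w \<noteq> a" for w
  proof -
    have ne: "c w \<noteq> z0" using that inj_sphere_chart[OF c(1)] c(2) by (auto simp: inj_def)
    have "c w \<in> D" "g (c w) > ereal t0" using ballU[OF that(1)] by (auto simp: superlevel_def)
    thus "gr (c w) > t0" using gfin[of "c w"] ne by simp
    have "w \<in> ball a r0" using that e r(2) by (auto simp: subset_iff)
    thus "gr (c w) = Re (P w) - ln (norm (w - a))" using gP[of w] that unfolding gr_def by simp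
  qed
  have F2: "\<Phi> p = \<eta> (gr p)" if p: "p \<in> D" "p \<notin> c ` cball a (\<epsilon> / 2)" for p
  proof (cases "p \<in> c ` ball a \<epsilon>")
    case True
    then obtain w where w: "p = c w" "w \<in> ball a \<epsilon>" by auto
    have n: "norm (w - a) > \<epsilon> / 2" using p(2) w(1) by (force simp: dist_norm norm_minus_commute)
    have wa: "w \<noteq> a" using n e by auto
    have "(\<epsilon> / 2)\<^sup>2 \<le> (norm (w - a))\<^sup>2" using n e by (intro power_mono) auto
    from kap(4)[OF this] have "?k w = ln (norm (w - a))" using n e by (simp add: ln_realpow)
    thus ?thesis unfolding w(1) F1[OF w(2)] using ginside[OF w(2) wa] eta(8) s by simp
  qed (use p in \<open>simp add: \<Phi>_def\<close>)
  let ?K = "csphere closure_of (superlevel D g s1)"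
  have Kc: "closedin csphere ?K" by simp
  have supK: "superlevel D g s1 \<subseteq> ?K" by (rule closure_of_subset) simp
  have F0: "\<Phi> p = 0" if "p \<notin> ?K" for p
  proof -
    have ns: "p \<notin> superlevel D g s1" using supK that by blast
    have "superlevel D g t0 \<subseteq> superlevel D g s1" using s by (auto simp: superlevel_def intro: le_less_trans[rotated])
    hence nb: "p \<notin> c ` ball a \<epsilon>" using ns ballU by blast
    have "\<eta> (gr p) = 0" if "p \<in> D"
    proof -
      have "p \<noteq> z0" using ns gz0 z0 by (auto simp: superlevel_def)
      hence "gr p \<le> s1" using ns that gfin[OF that] by (simp add: superlevel_def not_less)
      thus ?thesis by (rule eta(6))
    qed
    thus ?thesis using nb by (simp add: \<Phi>_def)
  qed
  have Fin_smooth: "Ck_on k (ball a \<epsilon>) ?in" for k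
  proof -
    have "P holomorphic_on ball a \<epsilon>" by (rule holomorphic_on_subset[OF P]) (use e r(2) in \<open>auto simp: subset_iff\<close>)
    thus ?thesis
      by (intro Ck_on_diff Ck_on_Re_holomorphic Ck_on_const Ck_on_compose_real[OF _ kap(1)] Ck_on_subset[OF Ck_on_norm_sq]) auto
  qed
  have cbc: "closedin csphere (c ` cball a (\<epsilon> / 2))" by (rule closedin_chart_image_compact[OF c(1)]) simp
  define V where "V = D - c ` cball a (\<epsilon> / 2)"
  have Vo: "openin csphere V" unfolding V_def using Do cbc by (rule openin_diff)
  have Vz0: "V \<subseteq> D - {z0}" using c(2) e by (auto simp: V_def)
  have cV: "Ck_on k (c' -` V) (\<lambda>w. gr (c' w))" if "sphere_chart c'" for c' k
    using planar_harmonic_on_smooth[OF planar_harmonic_on_subset[OF gharm[OF that]]] open_chart_vimage[OF that Vo] Vz0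
    by blast
  have smooth: "sphere_smooth \<Phi>"
    unfolding sphere_smooth_def
  proof (intro allI impI)
    fix c' k assume c': "sphere_chart c'"
    show "Ck_on k UNIV (\<lambda>w. \<Phi> (c' w))"
    proof (rule Ck_on_local)
      fix w0 :: complex
      \<comment> \<open>The three local formulas are 0, \<eta> of g, and the inner branch. The last
        one holds on the larger disc \<open>ball a \<epsilon>\<close>, a full neighbourhood of the
        closed disc of half its radius.\<close>
      consider "c' w0 \<notin> ?K" | "c' w0 \<in> V" | "c' w0 \<in> c ` cball a (\<epsilon> / 2)" using K by (auto simp: V_def)
      thus "\<exists>V. open V \<and> w0 \<in> V \<and> Ck_on k V (\<lambda>w. \<Phi> (c' w))"
      proof cases
        case 1
        have o: "open (- (c' -` ?K))" by (rule open_Compl) (rule closed_chart_vimage[OF c' Kc])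
        have "Ck_on k (- (c' -` ?K)) (\<lambda>w. \<Phi> (c' w)) \<longleftrightarrow> Ck_on k (- (c' -` ?K)) (\<lambda>w. 0)"
          by (rule Ck_on_cong[OF o]) (auto simp: F0)
        with o 1 show ?thesis by (intro exI[of _ "- (c' -` ?K)"]) simp
      next
        case 2
        have o: "open (c' -` V)" by (rule open_chart_vimage[OF c' Vo])
        have "Ck_on k (c' -` V) (\<lambda>w. \<Phi> (c' w)) \<longleftrightarrow> Ck_on k (c' -` V) (\<lambda>w. \<eta> (gr (c' w)))"
          by (rule Ck_on_cong[OF o]) (auto simp: F2 V_def)
        moreover have "Ck_on k (c' -` V) (\<lambda>w. \<eta> (gr (c' w)))"
          by (rule Ck_on_compose_real[OF o eta(1) cV[OF c']]) auto
        ultimately show ?thesis using o 2 by (intro exI[of _ "c' -` V"]) simp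
      next
        case 3
        then obtain b where b: "b \<in> cball a (\<epsilon> / 2)" "c' w0 = c b" by auto
        have bb: "b \<in> ball a \<epsilon>" using b e by auto
        have Ckb: "Ck_on k (ball a \<epsilon>) (\<lambda>w. \<Phi> (c w))"
          using Fin_smooth[of k] Ck_on_cong[of "ball a \<epsilon>" "\<lambda>w. \<Phi> (c w)" ?in k] F1 by simp
        show ?thesis
        proof (cases "c' = c")
          case True
          hence "w0 = b" using b(2) inj_sphere_chart[OF c(1)] by (auto simp: inj_def)
          with True bb Ckb show ?thesis by (intro exI[of _ "ball a \<epsilon>"]) simp
        next
          case False
          hence c'o: "c' = other_chart c" using c' c(1) by (auto simp: sphere_chart_def)
          have w0: "w0 \<noteq> 0" using other_chart_0[OF c(1)] b(2) c'o by (metis rangeI)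
          have "1 / cnj w0 = b" using b(2) other_chart_eq[OF c(1) w0] c'o inj_sphere_chart[OF c(1)] by (auto simp: inj_def)
          let ?W = "{w. w \<noteq> 0 \<and> 1 / cnj w \<in> ball a \<epsilon>}"
          have o: "open ?W" by (rule open_inverted) simp
          have "Ck_on k ?W (\<lambda>w. \<Phi> (c' w)) \<longleftrightarrow> Ck_on k ?W (\<lambda>w. \<Phi> (c (1 / cnj w)))"
            by (rule Ck_on_cong[OF o]) (auto simp: c'o other_chart_eq[OF c(1)])
          hence "Ck_on k ?W (\<lambda>w. \<Phi> (c' w))" using Ck_on_inversion[OF open_ball Ckb] by simp
          with o w0 \<open>1 / cnj w0 = b\<close> bb show ?thesis by (intro exI[of _ ?W]) simp
        qed
      qed
    qed
  qed
  have nn: "0 \<le> \<Phi> p" for p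
  proof (cases "p \<in> c ` cball a (\<epsilon> / 2)")
    case True
    then obtain w where w: "p = c w" "w \<in> cball a (\<epsilon> / 2)" by auto
    have wb: "w \<in> ball a \<epsilon>" "w \<in> cball a r" using w e by auto
    have "(norm (w - a))\<^sup>2 \<le> (\<epsilon> / 2)\<^sup>2" using w by (intro power_mono) (auto simp: dist_norm norm_minus_commute)
    from kap(5)[OF this] have "?k w \<le> ln (\<epsilon> / 2)" using e by (simp add: ln_realpow)
    thus ?thesis unfolding w(1) F1[OF wb(1)] using lne M[OF wb(2)] by linarith
  next
    case False
    show ?thesis
    proof (cases "p \<in> D")
      case True
      thus ?thesis using F2 False eta(7) by simp
    next
      case False
      hence "p \<notin> ?K" using K by blast
      thus ?thesis using F0 by simp
    qed
  qed
  let ?u = "\<lambda>w. real_of_ereal (u (c w))"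
  let ?L = "laplacian (\<lambda>w. \<Phi> (c w))"
  note T = sphere_test_integrals[OF D u(1) z0 u(2) smooth Kc K F0 c(1)]
  define Q where "Q w = 2 * \<sigma>' ((norm (w - a))\<^sup>2)" for w
  have Qlap: "laplacian ?k w = Q w" for w
    unfolding Q_def laplacian_radial[OF kap(2,3)] kap(6) by simp
  have Q0: "0 \<le> Q w" for w by (simp add: Q_def kap(9))
  have Qout: "Q w = 0" if "norm (w - a) \<ge> \<epsilon> / 2" for w
    using that e by (auto simp: Q_def intro!: kap(10) power_mono)
  have Lin: "?L w = - Q w" if w: "w \<in> ball a \<epsilon>" for w
  proof -
    have Ph: "P holomorphic_on ball a \<epsilon>" by (rule holomorphic_on_subset[OF P]) (use e r(2) in \<open>auto simp: subset_iff\<close>)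
    have k2: "Ck_on 2 (ball a \<epsilon>) ?k"
      by (intro Ck_on_compose_real[OF _ kap(1)] Ck_on_subset[OF Ck_on_norm_sq]) auto
    have p2: "Ck_on 2 (ball a \<epsilon>) (\<lambda>w. Re (P w))" by (rule Ck_on_Re_holomorphic[OF Ph open_ball])
    have "?L w = laplacian ?in w" by (rule laplacian_cong[OF open_ball w F1])
    also have "\<dots> = laplacian (\<lambda>w. Re (P w) - C0) w - laplacian ?k w"
      by (intro laplacian_diff[OF open_ball w] Ck_on_diff p2 k2) auto
    also have "laplacian (\<lambda>w. Re (P w) - C0) w = laplacian (\<lambda>w. Re (P w)) w - laplacian (\<lambda>_. C0) w"
      by (intro laplacian_diff[OF open_ball w] p2) auto
    also have "laplacian (\<lambda>w. Re (P w)) w = 0" by (rule laplacian_Re_holomorphic[OF Ph open_ball w])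
    finally show ?thesis by (simp add: Qlap)
  qed
  have LV: "?L w = \<eta>'' (gr (c w)) * ((dir_deriv 1 (\<lambda>w. gr (c w)) w)\<^sup>2 + (dir_deriv \<i> (\<lambda>w. gr (c w)) w)\<^sup>2)"
    if w: "c w \<in> V" for w
  proof -
    have o: "open (c -` V)" by (rule open_chart_vimage[OF c(1) Vo])
    have wV: "w \<in> c -` V" using w by simp
    have "?L w = laplacian (\<lambda>w. \<eta> (gr (c w))) w"
      by (rule laplacian_cong[OF o wV]) (auto simp: F2 V_def)
    also have "\<dots> = \<eta>'' (gr (c w)) * ((dir_deriv 1 (\<lambda>w. gr (c w)) w)\<^sup>2 + (dir_deriv \<i> (\<lambda>w. gr (c w)) w)\<^sup>2)
        + \<eta>' (gr (c w)) * laplacian (\<lambda>w. gr (c w)) w"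
      by (rule laplacian_compose_real[OF o wV cV[OF c(1)], of UNIV]) (auto intro: eta)
    also have "laplacian (\<lambda>w. gr (c w)) w = 0"
      using gharm[OF c(1)] wV Vz0 unfolding planar_harmonic_on_def by auto
    finally show ?thesis by simp
  qed
  have Lout: "?L w = 0" if "c w \<notin> ?K" for w
  proof -
    have o: "open (- (c -` ?K))" by (rule open_Compl) (rule closed_chart_vimage[OF c(1) Kc])
    have "?L w = laplacian (\<lambda>_. 0) w"
      by (rule laplacian_cong[OF o]) (use that F0 in auto)
    thus ?thesis by simp
  qed
  \<comment> \<open>Thus \<Delta>\<Phi> = G - Q. The mass 2 \<pi> of Q is computed from its radial
    profile, and that of G follows because the Laplacian of \<Phi> integrates to 0.\<close>
  define G where "G w = ?L w + Q w" for w
  have G: "0 \<le> G w \<and> (G w \<noteq> 0 \<longrightarrow> c w \<in> D \<and> g (c w) \<le> ereal t0 \<and> ereal s1 \<le> g (c w))" for w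
  proof (cases "w \<in> ball a \<epsilon>")
    case True
    thus ?thesis using Lin by (simp add: G_def)
  next
    case False
    hence "Q w = 0" using e by (intro Qout) (auto simp: dist_norm norm_minus_commute)
    hence GL: "G w = ?L w" by (simp add: G_def)
    show ?thesis
    proof (cases "c w \<in> ?K")
      case True
      hence wV: "c w \<in> V" using K False e by (auto simp: V_def inj_image_mem_iff[OF inj_sphere_chart[OF c(1)]])
      have gf: "g (c w) = ereal (gr (c w))" using wV Vz0 by (intro gfin) auto
      have "0 \<le> G w" unfolding GL LV[OF wV] by (intro mult_nonneg_nonneg eta(4)) auto
      moreover have "s1 \<le> gr (c w) \<and> gr (c w) \<le> t0" if "G w \<noteq> 0"
      proof -
        have "\<eta>'' (gr (c w)) \<noteq> 0" using that unfolding GL LV[OF wV] by auto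
        with eta(5)[of "gr (c w)"] s(3) show ?thesis by force
      qed
      ultimately show ?thesis using gf True K by auto
    qed (use GL Lout in simp)
  qed
  have [measurable]: "\<sigma>' \<in> borel_measurable borel" by (rule borel_measurable_continuous_onI[OF kap(8)])
  have Qnn: "(\<integral>\<^sup>+w. ennreal (Q w) \<partial>lborel) = ennreal (2 * pi)"
    unfolding Q_def
    by (rule integral_radial_profile[OF kap(7,8,9), of "(\<epsilon> / 2)\<^sup>2"])
       (use e in \<open>auto intro!: kap(10-12) order_trans[OF _ zero_le_power2]\<close>)
  have Qint: "integrable lborel Q"
    using Qnn Q0 unfolding Q_def[abs_def] by (intro integrableI_nonneg) (auto simp: Q_def)
  have QI: "(\<integral>w. Q w \<partial>lborel) = 2 * pi"
    using Qnn Q0 Qint nn_integral_eq_integral[OF Qint] by simp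
  define \<rho> where "\<rho> x = 2 * \<sigma>' (x\<^sup>2) * indicator {0..} x" for x :: real
  have rhoQ: "\<rho> (norm (w - a)) = Q w" for w by (simp add: \<rho>_def Q_def)
  obtain B\<sigma> where Bs: "\<And>x. \<sigma>' x \<le> B\<sigma>"
  proof -
    have "compact (\<sigma>' ` {(\<epsilon> / 4)\<^sup>2..(\<epsilon> / 2)\<^sup>2})"
      by (intro compact_continuous_image continuous_on_subset[OF kap(8)]) auto
    from compact_imp_bounded[OF this]
    obtain b where b: "\<forall>x\<in>\<sigma>' ` {(\<epsilon> / 4)\<^sup>2..(\<epsilon> / 2)\<^sup>2}. norm x \<le> b" unfolding bounded_iff by blast
    have "\<sigma>' x \<le> \<bar>b\<bar>" for x
    proof (cases "x \<in> {(\<epsilon> / 4)\<^sup>2..(\<epsilon> / 2)\<^sup>2}")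
      case True
      hence "norm (\<sigma>' x) \<le> b" using b by blast
      thus ?thesis by simp
    next
      case False
      hence "\<sigma>' x = 0" by (intro kap(10)) auto
      thus ?thesis by simp
    qed
    thus ?thesis by (rule that)
  qed
  have rho: "\<rho> \<in> borel_measurable borel" "\<And>x. 0 \<le> \<rho> x" "\<And>x. \<rho> x \<le> 2 * \<bar>B\<sigma>\<bar>" "\<And>x. x > \<epsilon> / 2 \<Longrightarrow> \<rho> x = 0"
  proof -
    show "\<rho> \<in> borel_measurable borel" unfolding \<rho>_def by measurable
    show "0 \<le> \<rho> x" for x by (simp add: \<rho>_def kap(9))
    show "\<rho> x \<le> 2 * \<bar>B\<sigma>\<bar>" for x using Bs[of "x\<^sup>2"] by (auto simp: \<rho>_def indicator_def intro: order_trans[OF _ abs_ge_self])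
    show "\<rho> x = 0" if "x > \<epsilon> / 2" for x using that e by (auto simp: \<rho>_def intro!: kap(10) power_mono)
  qed
  have uc: "planar_subharmonic_on (c -` D) (\<lambda>w. u (c w))"
    using u(1) c(1) by (auto simp: subharmonic_on_def sphere_chart_def o_def)
  have cbD: "cball a (\<epsilon> / 2) \<subseteq> c -` D" using ballU e by (auto simp: superlevel_def subset_iff)
  have e2: "\<epsilon> / 2 > 0" using e by simp
  have ua: "u (c a) \<noteq> - \<infinity>" using u(2) c(2) by simp
  note W = subharmonic_weighted_submean[OF open_chart_vimage[OF c(1) Do] uc e2 cbD ua rho, unfolded rhoQ QI]
  have Gint: "integrable lborel G" unfolding G_def using T(2) Qint by simp
  have GI: "(\<integral>w. G w \<partial>lborel) = 2 * pi" unfolding G_def using T(2,3) Qint QI by simp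
  have uGint: "integrable lborel (\<lambda>w. ?u w * G w)" unfolding G_def using T(1) W(1) by (simp add: distrib_left)
  have "(\<integral>w. ?u w * G w \<partial>lborel) \<le> (\<integral>w. B * G w \<partial>lborel)"
  proof (rule integral_mono_AE[OF uGint])
    show "integrable lborel (\<lambda>w. B * G w)" using Gint by simp
    \<comment> \<open>Where u = -\<infinity> the integrand reads 0, which may exceed B if B is
      negative; this set is null.\<close>
    show "AE w in lborel. ?u w * G w \<le> B * G w"
      using subharmonic_AE_finite[OF D u(1) z0 u(2) c(1)]
    proof eventually_elim
      case (elim w)
      show ?case
      proof (cases "G w = 0")
        case False
        hence w: "c w \<in> D" "u (c w) \<le> ereal B" using G[of w] B by auto
        hence "?u w \<le> B" using elim by (cases "u (c w)") auto
        thus ?thesis using G[of w] by (intro mult_right_mono) auto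
      qed simp
    qed
  qed
  also have "\<dots> = 2 * pi * B" using GI by simp
  finally have le: "(\<integral>w. ?u w * G w \<partial>lborel) \<le> 2 * pi * B" .
  have "(\<integral>w. ?u w * ?L w \<partial>lborel) = (\<integral>w. ?u w * G w - ?u w * Q w \<partial>lborel)"
    by (simp add: G_def algebra_simps)
  also have "\<dots> = (\<integral>w. ?u w * G w \<partial>lborel) - (\<integral>w. ?u w * Q w \<partial>lborel)"
    using uGint W(1) by simp
  also have "\<dots> \<le> 2 * pi * (B - real_of_ereal (u z0))" using le W(2) c(2) by (simp add: algebra_simps)
  finally have fin: "1 / (2 * pi) * (\<integral>w. ?u w * ?L w \<partial>lborel) \<le> B - real_of_ereal (u z0)"
    by (simp add: field_simps)
  have "0 \<le> 1 / (2 * pi) * (\<integral>w. ?u w * ?L w \<partial>lborel)" using T(4)[OF _ \<nu> nn] by simp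
  with fin show "real_of_ereal (u z0) \<le> B" by linarith
  have "(\<integral>\<^sup>+z\<in>D - superlevel D g t0. ennreal (real_of_ereal (g z) - s2) \<partial>\<nu>) \<le> (\<integral>\<^sup>+p. ennreal (\<Phi> p) \<partial>\<nu>)"
  proof (rule nn_integral_mono)
    fix p
    show "ennreal (real_of_ereal (g p) - s2) * indicator (D - superlevel D g t0) p \<le> ennreal (\<Phi> p)"
    proof (cases "p \<in> D - superlevel D g t0")
      case True
      have "p \<notin> c ` cball a (\<epsilon> / 2)" using True ballU e by (auto simp: subset_iff)
      hence "\<Phi> p = \<eta> (gr p)" using F2 True by simp
      thus ?thesis using eta(9)[of "gr p"] True by (simp add: gr_def ennreal_leI)
    qed simp
  qed
  also have "\<dots> \<le> ennreal (1 / (2 * pi) * (\<integral>w. ?u w * ?L w \<partial>lborel))" using T(4)[OF _ \<nu> nn] by blast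
  also have "\<dots> \<le> ennreal (B - real_of_ereal (u z0))" using fin by (rule ennreal_leI)
  finally show "(\<integral>\<^sup>+z\<in>D - superlevel D g t0. ennreal (real_of_ereal (g z) - s2) \<partial>\<nu>) \<le> ennreal (B - real_of_ereal (u z0))" .
qed

section \<open>Nonnegativity of the Green function\<close>

lemma green_openin:
  assumes D: "openin csphere D" and z0: "z0 \<in> D" and g: "green_function D z0 g" and T: "open T"
  shows "openin csphere {p \<in> D - {z0}. real_of_ereal (g p) \<in> T}"
proof -
  obtain c0 a where c0: "sphere_chart c0" "z0 = c0 a" using ex_sphere_chart by blast
  have "closedin csphere {z0}" using closedin_chart_image_compact[OF c0(1), of "{a}"] c0(2) by simp
  hence Do: "openin csphere (D - {z0})" using D by (intro openin_diff)
  have "open (c -` {p \<in> D - {z0}. real_of_ereal (g p) \<in> T})" if c: "sphere_chart c" for c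
  proof -
    have "planar_harmonic_on (c -` (D - {z0})) (\<lambda>w. real_of_ereal (g (c w)))"
      using harmonic_onD[OF _ c] g unfolding green_function_def by blast
    hence "continuous_on (c -` (D - {z0})) (\<lambda>w. real_of_ereal (g (c w)))"
      using Ck_on_le[of 2 _ _ 0] by (auto simp: planar_harmonic_on_def)
    from continuous_open_preimage[OF this open_chart_vimage[OF c Do] T]
    have "open (c -` (D - {z0}) \<inter> (\<lambda>w. real_of_ereal (g (c w))) -` T)" .
    moreover have "c -` (D - {z0}) \<inter> (\<lambda>w. real_of_ereal (g (c w))) -` T =
        c -` {p \<in> D - {z0}. real_of_ereal (g p) \<in> T}" by auto
    ultimately show ?thesis by simp
  qed
  from this[of Some] this[of inversion_chart] show ?thesis by (simp add: openin_csphere_iff)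
qed

text \<open>\<open>green_function\<close> postulates boundary values but no sign, so the minimum
  principle is needed. If g had a value m < 0, the set where g \<le> m would be compact: it stays
  away from the boundary, where g tends to 0, and from the pole, where g exceeds t0. The minimum
  attained there would spread over an open and relatively closed part of D that misses the
  pole.\<close>

lemma green_nonneg:
  assumes D: "sphere_domain D" and z0: "z0 \<in> D" and g: "green_function D z0 g"
    and U0: "openin csphere (superlevel D g t0)" "t0 > 0" and p: "p \<in> D"
  shows "0 \<le> g p"
proof (rule ccontr)
  assume neg: "\<not> 0 \<le> g p"
  have Do: "openin csphere D" "connectedin csphere D" using D by (auto simp: sphere_domain_def)
  define gr where "gr p = real_of_ereal (g p)" for p
  have gz0: "g z0 = \<infinity>" using g by (simp add: green_function_def)
  have gfin: "g p = ereal (gr p)" if "p \<in> D" "p \<noteq> z0" for p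
    using g that by (auto simp: green_function_def gr_def ereal_real)
  have go: "openin csphere {p \<in> D - {z0}. gr p \<in> T}" if "open T" for T
    unfolding gr_def by (rule green_openin[OF Do(1) z0 g that])
  have pz: "p \<noteq> z0" using neg gz0 by auto
  define m where "m = gr p"
  have m: "m < 0" using neg gfin[OF p pz] by (simp add: m_def)
  define K where "K = {q \<in> D - {z0}. gr q \<le> m}"
  have "openin csphere (UNIV - K)"
  proof (subst openin_subopen, intro ballI)
    fix q assume q: "q \<in> UNIV - K"
    consider "q = z0" | "q \<in> D" "q \<noteq> z0" | "q \<notin> D" by blast
    thus "\<exists>T. openin csphere T \<and> q \<in> T \<and> T \<subseteq> UNIV - K"
    proof cases
      case 1
      have "superlevel D g t0 \<subseteq> UNIV - K"
        using gfin U0(2) m by (auto simp: superlevel_def K_def)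
      moreover have "q \<in> superlevel D g t0" using 1 z0 gz0 by (simp add: superlevel_def)
      ultimately show ?thesis using U0(1) by blast
    next
      case 2
      hence "q \<in> {p \<in> D - {z0}. gr p \<in> {m<..}}" using q by (auto simp: K_def)
      moreover have "{p \<in> D - {z0}. gr p \<in> {m<..}} \<subseteq> UNIV - K" by (auto simp: K_def)
      moreover have "openin csphere {p \<in> D - {z0}. gr p \<in> {m<..}}" by (rule go) simp
      ultimately show ?thesis by (intro exI[of _ "{p \<in> D - {z0}. gr p \<in> {m<..}}"] conjI)
    next
      case 3
      show ?thesis
      proof (cases "q \<in> csphere closure_of D")
        case True
        hence "q \<in> csphere frontier_of D" using 3 Do(1) by (simp add: frontier_of_def interior_of_openin)
        hence "(g \<longlongrightarrow> 0) (atin_within csphere q D)" using g by (simp add: green_function_def)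
        hence "\<forall>\<^sub>F x in atin_within csphere q D. g x > ereal m" using m by (intro order_tendstoD(1)) auto
        then obtain V where V: "openin csphere V" "q \<in> V" "\<And>x. x \<in> V \<inter> D - {q} \<Longrightarrow> g x > ereal m"
          unfolding eventually_atin_within by auto
        have "V \<subseteq> UNIV - K" using V(3) 3 gfin by (force simp: K_def)
        thus ?thesis using V(1,2) by (intro exI[of _ V] conjI)
      next
        case False
        have "openin csphere (UNIV - csphere closure_of D)"
          using closedin_closure_of[of csphere D] by (simp add: closedin_def)
        moreover have "UNIV - csphere closure_of D \<subseteq> UNIV - K"
          using closure_of_subset[of D csphere] by (auto simp: K_def)
        ultimately show ?thesis using False by blast
      qed
    qed
  qed
  hence Kc: "compactin csphere K" by (simp add: compactin_csphere_iff closedin_def)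
  have "compactin (subtopology csphere (D - {z0})) K"
    using Kc by (auto simp: compactin_subtopology K_def)
  moreover have "continuous_map (subtopology csphere (D - {z0})) euclideanreal gr"
    unfolding continuous_map_def
  proof (intro conjI allI impI)
    fix T :: "real set" assume "openin euclideanreal T"
    hence "openin csphere {p \<in> D - {z0}. gr p \<in> T}" by (intro go) simp
    thus "openin (subtopology csphere (D - {z0})) {x \<in> topspace (subtopology csphere (D - {z0})). gr x \<in> T}"
      by (auto simp: openin_subtopology intro!: exI[of _ "{p \<in> D - {z0}. gr p \<in> T}"])
  qed simp
  ultimately have "compactin euclideanreal (gr ` K)" by (rule image_compactin)
  moreover have "gr ` K \<noteq> {}" using p pz by (auto simp: K_def m_def)
  ultimately obtain q where q: "q \<in> K" "\<And>x. x \<in> K \<Longrightarrow> gr q \<le> gr x"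
    using compact_attains_inf[of "gr ` K"] by auto
  have min: "gr q \<le> gr x" if "x \<in> D - {z0}" for x
    using q(2)[of x] q(1) that by (cases "x \<in> K") (auto simp: K_def)
  define E where "E = {x \<in> D - {z0}. gr x = gr q}"
  have "openin csphere E"
  proof (subst openin_subopen, intro ballI)
    fix x assume x: "x \<in> E"
    obtain c w where c: "sphere_chart c" "x = c w" using ex_sphere_chart by blast
    have "w \<in> c -` {p \<in> D - {z0}. gr p \<in> UNIV}" using x c by (auto simp: E_def)
    then obtain r where r: "r > 0" "ball w r \<subseteq> c -` {p \<in> D - {z0}. gr p \<in> UNIV}"
      using open_chart_vimage[OF c(1) go[of UNIV]] open_contains_ball by blast
    hence sub: "ball w r \<subseteq> c -` (D - {z0})" by auto
    have "planar_harmonic_on (c -` (D - {z0})) (\<lambda>w. gr (c w))"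
      using harmonic_onD[OF _ c(1)] g unfolding green_function_def gr_def by blast
    hence h: "planar_harmonic_on (ball w r) (\<lambda>w. gr (c w))" by (rule planar_harmonic_on_subset[OF _ sub])
    have "gr (c y) = gr (c w)" if "y \<in> ball w r" for y
      by (rule harmonic_local_min_constant[OF h r(1) _ that]) (use min sub x c(2) in \<open>auto simp: E_def subset_iff\<close>)
    hence "c ` ball w r \<subseteq> E" using sub x c(2) by (auto simp: E_def subset_iff)
    moreover have "openin csphere (c ` ball w r)" by (rule openin_chart_image[OF c(1)]) simp
    ultimately show "\<exists>T. openin csphere T \<and> x \<in> T \<and> T \<subseteq> E"
      using r(1) c(2) by (intro exI[of _ "c ` ball w r"]) auto
  qed
  moreover have "openin csphere (D - E)"
  proof -
    \<comment> \<open>At the pole the real value of g reads 0, so a neighbourhood of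
      \<open>z0\<close> has to come from the superlevel set.\<close>
    have "D - E = superlevel D g t0 \<union> {x \<in> D - {z0}. gr x \<in> - {gr q}}"
      using gz0 z0 gfin U0(2) m q(1) by (auto simp: superlevel_def E_def K_def)
    moreover have "openin csphere {x \<in> D - {z0}. gr x \<in> - {gr q}}" by (rule go) auto
    ultimately show ?thesis using openin_Un[OF U0(1)] by (simp only:)
  qed
  moreover have "E \<subseteq> D" "q \<in> E" "z0 \<notin> E" using q(1) by (auto simp: E_def K_def)
  ultimately show False using connectedinD[OF Do(2), of E "D - E"] z0 by blast
qed

section \<open>The Riesz measure\<close>

lemma chart_lift_smooth:
  assumes c: "sphere_chart c" and \<phi>: "test_function S \<phi>"
  shows "sphere_smooth (chart_lift c \<phi>)"
proof -
  let ?K = "closure {z. \<phi> z \<noteq> 0}"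
  obtain R where R: "\<And>z. z \<in> ?K \<Longrightarrow> norm z \<le> R"
    using compact_imp_bounded[OF test_functionD(2)[OF \<phi>]] by (auto simp: bounded_iff)
  show ?thesis
  proof (rule sphere_smooth_extend[OF c])
    show "Ck_on k UNIV (\<lambda>w. chart_lift c \<phi> (c w))" for k
      using test_functionD(1)[OF \<phi>] by (simp add: chart_lift_chart[OF c])
    show "1 / (\<bar>R\<bar> + 1) > 0" by simp
    show "chart_lift c \<phi> (other_chart c w) = 0" if "norm w < 1 / (\<bar>R\<bar> + 1)" for w
    proof (cases "w = 0")
      case True
      thus ?thesis using other_chart_0[OF c] by (simp add: chart_lift_def)
    next
      case False
      have "\<bar>R\<bar> + 1 < norm (1 / cnj w)" using that False by (simp add: norm_divide field_simps)
      hence "1 / cnj w \<notin> ?K" using R by force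
      from test_functionD(4)[OF \<phi> this] have "chart_lift c \<phi> (c (1 / cnj w)) = 0"
        by (simp only: chart_lift_chart[OF c])
      thus ?thesis by (simp only: other_chart_eq[OF c False])
    qed
  qed
qed

text \<open>The distributional identity says nothing about integrability, since a non-integrable
  function has Bochner integral 0. Finiteness of the measure on the compact support supplies
  it.\<close>

lemma riesz_measure_test:
  assumes \<nu>: "riesz_measure D u \<nu>" and c: "sphere_chart c" and \<phi>: "test_function S \<phi>" "S \<subseteq> c -` D"
  shows "integrable \<nu> (chart_lift c \<phi>)"
    and "(\<integral>p. chart_lift c \<phi> p \<partial>\<nu>) = 1 / (2 * pi) * (\<integral>w. real_of_ereal (u (c w)) * laplacian \<phi> w \<partial>lborel)"
proof -
  have sets: "sets \<nu> = sets sphere_borel" using \<nu> by (simp add: riesz_measure_def)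
  let ?K = "closure {z. \<phi> z \<noteq> 0}"
  note K = test_functionD(2)[OF \<phi>(1)]
  have cK: "closedin csphere (c ` ?K)" by (rule closedin_chart_image_compact[OF c K])
  have "compactin csphere (c ` ?K)" "c ` ?K \<subseteq> D"
    using cK test_functionD(3)[OF \<phi>(1)] \<phi>(2) by (auto simp: compactin_csphere_iff)
  hence fin: "emeasure \<nu> (c ` ?K) < \<infinity>" using \<nu> by (simp add: riesz_measure_def)
  obtain B where B: "\<And>z. \<bar>\<phi> z\<bar> \<le> B"
  proof -
    have cont: "continuous_on ?K \<phi>" using test_functionD(1)[OF \<phi>(1), of 0] by (auto intro: continuous_on_subset)
    obtain b where "\<forall>x\<in>\<phi> ` ?K. norm x \<le> b"
      using compact_imp_bounded[OF compact_continuous_image[OF cont K]] unfolding bounded_iff by blast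
    hence "\<bar>\<phi> z\<bar> \<le> \<bar>b\<bar>" for z
      using test_functionD(4)[OF \<phi>(1), of z] by (cases "z \<in> ?K") force+
    thus ?thesis by (rule that)
  qed
  show "integrable \<nu> (chart_lift c \<phi>)"
  proof (rule Bochner_Integration.integrable_bound)
    show "integrable \<nu> (\<lambda>p. B * indicator (c ` ?K) p)"
      using fin closedin_sets_sphere_borel[OF cK] sets by (intro integrable_mult_right integrable_real_indicator) auto
    show "chart_lift c \<phi> \<in> borel_measurable \<nu>"
      using sphere_smooth_measurable[OF chart_lift_smooth[OF c \<phi>(1)]] measurable_cong_sets[OF sets refl] by auto
    have "\<bar>chart_lift c \<phi> p\<bar> \<le> B * indicator (c ` ?K) p" for p
    proof (cases rule: chart_cases[OF c, of p])
      case (1 w)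
      have "0 \<le> B" using B[of w] by linarith
      thus ?thesis using 1 B[of w] test_functionD(4)[OF \<phi>(1), of w]
        by (cases "w \<in> ?K") (simp_all add: chart_lift_chart[OF c] inj_image_mem_iff[OF inj_sphere_chart[OF c]])
    next
      case 2
      have "0 \<le> B" using B[of 0] by linarith
      with 2 show ?thesis using other_chart_0[OF c] by (simp add: chart_lift_def)
    qed
    thus "AE p in \<nu>. norm (chart_lift c \<phi> p) \<le> norm (B * indicator (c ` ?K) p)"
      by (intro AE_I2) (simp, meson abs_ge_self order_trans)
  qed
  have "test_function (c -` D) \<phi>" using \<phi> by (auto simp: test_function_def)
  hence "(\<integral>z. (if z \<in> range c then \<phi> (inv c z) else 0) \<partial>\<nu>) =
        1 / (2 * pi) * (\<integral>w. real_of_ereal (u (c w)) * laplacian \<phi> w \<partial>lborel)"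
    using \<nu> c unfolding riesz_measure_def chart_laplace_measure_def sphere_chart_def by blast
  thus "(\<integral>p. chart_lift c \<phi> p \<partial>\<nu>) = 1 / (2 * pi) * (\<integral>w. real_of_ereal (u (c w)) * laplacian \<phi> w \<partial>lborel)"
    unfolding chart_lift_def .
qed

text \<open>On nonnegative test functions the required inequality is the defining identity. The
  radius 1 at infinity is an arbitrary choice.\<close>

lemma riesz_imp_subriesz:
  assumes \<nu>: "riesz_measure D u \<nu>"
  shows "subriesz D u \<nu>"
proof -
  have key: "0 \<le> (\<integral>w. real_of_ereal (u (c w)) * laplacian \<phi> w \<partial>lborel) \<and>
        (\<integral>\<^sup>+p. ennreal (chart_lift c \<phi> p) \<partial>\<nu>) \<le>
          ennreal (1 / (2 * pi) * (\<integral>w. real_of_ereal (u (c w)) * laplacian \<phi> w \<partial>lborel))"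
    if c: "sphere_chart c" and \<phi>: "test_function S \<phi>" "S \<subseteq> c -` D" and nn: "\<And>z. 0 \<le> \<phi> z" for c \<phi> S
  proof -
    note * = riesz_measure_test[OF \<nu> c \<phi>]
    have nn': "0 \<le> chart_lift c \<phi> p" for p using nn by (simp add: chart_lift_def)
    have "0 \<le> (\<integral>p. chart_lift c \<phi> p \<partial>\<nu>)" using nn' by simp
    hence 1: "0 \<le> (\<integral>w. real_of_ereal (u (c w)) * laplacian \<phi> w \<partial>lborel)"
      unfolding *(2) using pi_gt_zero by (simp add: zero_le_mult_iff zero_le_divide_iff not_le[symmetric])
    have "(\<integral>\<^sup>+p. ennreal (chart_lift c \<phi> p) \<partial>\<nu>) = ennreal (\<integral>p. chart_lift c \<phi> p \<partial>\<nu>)"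
      using nn' by (intro nn_integral_eq_integral *(1)) simp
    with 1 show ?thesis unfolding *(2) by simp
  qed
  have "sets \<nu> = sets sphere_borel" using \<nu> by (simp add: riesz_measure_def)
  thus ?thesis unfolding subriesz_def
    using key[OF sphere_chartI(1), of "Some -` D"] key[OF sphere_chartI(2), of "inversion_chart -` D \<inter> ball 0 1"]
    by (auto intro!: exI[of _ 1])
qed

section \<open>The logarithm of the modulus of a holomorphic function\<close>

text \<open>For |z| < 1 one has |ln |z|| \<le> 1/|z|, which is s^(-1/2) in the variable s = |z|^2;
  this is integrable over (0,1), and area becomes \<pi> ds.\<close>

lemma ln_norm_integrable_ball:
  fixes a :: complex
  shows "integrable lborel (\<lambda>z. indicator (ball a 1) z * ln (norm (z - a)))"
proof -
  let ?f = "\<lambda>z::complex. indicator (ball 0 1) z * ln (norm z)"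
  have m: "?f \<in> borel_measurable borel"
    by (intro borel_measurable_times borel_measurable_indicator borel_measurable_ln borel_measurable_norm) auto
  have "integrable lborel ?f"
  proof (rule integrableI_bounded)
    show "?f \<in> borel_measurable lborel" using m by simp
    have p: "(\<lambda>s::real. s powr (-1/2)) \<in> borel_measurable borel" by measurable
    have "((\<lambda>s::real. s powr (-1/2)) has_integral (1 powr (-1/2 + 1) / (-1/2 + 1))) {0..1}"
      by (rule has_integral_powr_from_0) auto
    hence "((\<lambda>s::real. indicator {0..1} s * s powr (-1/2)) has_integral 2) UNIV"
      by (subst (asm) has_integral_restrict_UNIV[symmetric]) (auto elim!: has_integral_eq[rotated] simp: indicator_def)
    hence N: "(\<integral>\<^sup>+s. ennreal (indicator {0..1} s * s powr (-1/2)) \<partial>lborel) = ennreal 2"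
      by (intro nn_integral_has_integral_lborel) auto
    have "(\<integral>\<^sup>+z. ennreal (norm (?f z)) \<partial>lborel) \<le>
       (\<integral>\<^sup>+z. indicator (ball 0 1) z * ennreal ((norm (z::complex))\<^sup>2 powr (-1/2)) \<partial>lborel)"
    proof (rule nn_integral_mono)
      fix z :: complex
      show "ennreal (norm (?f z)) \<le> indicator (ball 0 1) z * ennreal ((norm z)\<^sup>2 powr (-1/2))"
      proof (cases "z \<in> ball 0 1 \<and> z \<noteq> 0")
        case True
        hence n: "0 < norm z" "norm z < 1" by auto
        have "- ln (norm z) = ln (1 / norm z)" using n by (simp add: ln_div)
        also have "\<dots> \<le> 1 / norm z" using n ln_le_minus_one[of "1 / norm z"] by simp
        also have "\<dots> = (norm z)\<^sup>2 powr (-1/2)"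
          using n powr_minus_divide[of "(norm z)\<^sup>2" "1/2"] by (simp add: powr_half_sqrt)
        finally have "\<bar>ln (norm z)\<bar> \<le> (norm z)\<^sup>2 powr (-1/2)" using n by simp
        with True show ?thesis by (simp add: ennreal_leI)
      qed (auto simp: indicator_def)
    qed
    also have "\<dots> = (\<integral>\<^sup>+z. ennreal ((norm z)\<^sup>2 powr (-1/2)) \<partial>density lborel (indicator (ball (0::complex) 1)))"
      by (subst nn_integral_density) (auto intro!: borel_measurable_indicator)
    also have "\<dots> = (\<integral>\<^sup>+s. ennreal (s powr (-1/2)) \<partial>distr (density lborel (indicator (ball (0::complex) 1))) borel (\<lambda>z. (norm z)\<^sup>2))"
      by (subst nn_integral_distr) auto
    also have "\<dots> = (\<integral>\<^sup>+s. ennreal pi * indicator {0<..<1} s * ennreal (s powr (-1/2)) \<partial>lborel)"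
      by (subst distr_norm_sq) (auto simp: nn_integral_density)
    also have "\<dots> \<le> (\<integral>\<^sup>+s. ennreal pi * ennreal (indicator {0..1} s * s powr (-1/2)) \<partial>lborel)"
      by (intro nn_integral_mono) (auto simp: indicator_def)
    also have "\<dots> = ennreal pi * ennreal 2"
      by (subst nn_integral_cmult) (use N in auto)
    also have "\<dots> < \<infinity>" by (simp add: ennreal_mult_less_top)
    finally show "(\<integral>\<^sup>+z. ennreal (norm (?f z)) \<partial>lborel) < \<infinity>" .
  qed
  moreover have "(\<lambda>w. ?f (- a + w)) = (\<lambda>z. indicator (ball a 1) z * ln (norm (z - a)))"
    by (auto simp: indicator_def fun_eq_iff dist_norm norm_minus_commute)
  ultimately show ?thesis using integral_translate(1)[OF m, of "- a"] by simp
qed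

lemma ln_norm_test_integrable:
  fixes a :: complex
  assumes q: "continuous_on UNIV q" "compact K" "\<And>z. z \<notin> K \<Longrightarrow> q z = (0::real)"
  shows "integrable lborel (\<lambda>z. ln (norm (z - a)) * q z)"
proof -
  obtain B where B: "\<And>z. \<bar>q z\<bar> \<le> B"
  proof -
    obtain b where "\<forall>x\<in>q ` K. norm x \<le> b"
      using compact_imp_bounded[OF compact_continuous_image[OF continuous_on_subset[OF q(1)] q(2)]] unfolding bounded_iff by blast
    hence "\<bar>q z\<bar> \<le> \<bar>b\<bar>" for z using q(3)[of z] by (cases "z \<in> K") force+
    thus ?thesis by (rule that)
  qed
  have [measurable]: "q \<in> borel_measurable borel" by (rule borel_measurable_continuous_onI[OF q(1)])
  obtain R where R: "\<And>z. z \<in> K \<Longrightarrow> norm (z - a) \<le> R"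
  proof -
    obtain R where "\<And>z. z \<in> K \<Longrightarrow> norm z \<le> R" using compact_imp_bounded[OF q(2)] by (auto simp: bounded_iff)
    hence "norm (z - a) \<le> R + norm a" if "z \<in> K" for z
      using norm_triangle_ineq4[of z a] that by force
    thus ?thesis by (rule that)
  qed
  show ?thesis
  proof (rule Bochner_Integration.integrable_bound)
    show "integrable lborel (\<lambda>z. B * \<bar>indicator (ball a 1) z * ln (norm (z - a))\<bar> + B * (\<bar>R\<bar> * indicator (cball a \<bar>R\<bar>) z))"
      using emeasure_bounded_finite[OF bounded_cball]
      by (intro Bochner_Integration.integrable_add integrable_mult_right integrable_abs ln_norm_integrable_ball integrable_real_indicator) auto
    show "(\<lambda>z. ln (norm (z - a)) * q z) \<in> borel_measurable lborel" by measurable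
    have "\<bar>ln (norm (z - a)) * q z\<bar> \<le> B * \<bar>indicator (ball a 1) z * ln (norm (z - a))\<bar> + B * (\<bar>R\<bar> * indicator (cball a \<bar>R\<bar>) z)" for z
    proof (cases "z \<in> K")
      case False
      have "0 \<le> B" using B[of z] by linarith
      thus ?thesis using q(3)[OF False] by simp
    next
      case True
      have B0: "0 \<le> B" using B[of z] by linarith
      have *: "\<bar>ln (norm (z - a)) * q z\<bar> \<le> \<bar>ln (norm (z - a))\<bar> * B" unfolding abs_mult using B by (intro mult_left_mono) auto
      show ?thesis
      proof (cases "z \<in> ball a 1")
        case True
        have "\<bar>ln (norm (z - a))\<bar> * B \<le> B * \<bar>indicator (ball a 1) z * ln (norm (z - a))\<bar>" using True by simp
        moreover have "0 \<le> B * (\<bar>R\<bar> * indicator (cball a \<bar>R\<bar>) z)" using B0 by simp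
        ultimately show ?thesis using * by linarith
      next
        case False
        hence n: "1 \<le> norm (z - a)" "norm (z - a) \<le> \<bar>R\<bar>" using R[OF True] by (auto simp: dist_norm norm_minus_commute)
        hence "\<bar>ln (norm (z - a))\<bar> \<le> \<bar>R\<bar>" using ln_le_minus_one[of "norm (z - a)"] ln_ge_zero[OF n(1)] by linarith
        hence "\<bar>ln (norm (z - a))\<bar> * B \<le> \<bar>R\<bar> * B" using B0 by (rule mult_right_mono)
        with * False n B0 show ?thesis by (simp add: dist_norm norm_minus_commute mult.commute)
      qed
    qed
    thus "AE z in lborel. norm (ln (norm (z - a)) * q z) \<le>
        norm (B * \<bar>indicator (ball a 1) z * ln (norm (z - a))\<bar> + B * (\<bar>R\<bar> * indicator (cball a \<bar>R\<bar>) z))"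
      by (intro AE_I2) (simp only: real_norm_def, meson abs_ge_self order_trans)
  qed
qed

text \<open>The logarithm is, up to 2 \<pi>, the fundamental solution of the Laplacian. Smoothed
  profiles k n have as Laplacian an approximate identity Q n of mass 2 \<pi>; Green's identity for k
  n passes to the limit, by domination on one side and by continuity of \<phi> at a on the
  other.\<close>

lemma ln_norm_laplacian:
  assumes \<phi>: "test_function S \<phi>"
  shows "integrable lborel (\<lambda>z. ln (norm (z - a)) * laplacian \<phi> z)"
    and "(\<integral>z. ln (norm (z - a)) * laplacian \<phi> z \<partial>lborel) = 2 * pi * \<phi> a"
proof -
  let ?K = "closure {z. \<phi> z \<noteq> 0}" and ?L = "laplacian \<phi>"
  note L = test_function_laplacian(1,2)[OF \<phi>]
  show int: "integrable lborel (\<lambda>z. ln (norm (z - a)) * ?L z)"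
    by (rule ln_norm_test_integrable[OF L(1) test_functionD(2)[OF \<phi>] L(2)])
  have t\<phi>: "test_function UNIV \<phi>" using \<phi> by (simp add: test_function_def)
  have c\<phi>: "continuous_on UNIV \<phi>" using test_functionD(1)[OF \<phi>, of 0] by simp
  have prof: "\<exists>k Q. Ck_on 2 UNIV k \<and> (\<forall>z. laplacian k z = Q z) \<and> (\<forall>z. 0 \<le> Q z) \<and> continuous_on UNIV Q \<and>
      (\<forall>z. norm (z - a) \<ge> \<epsilon> \<longrightarrow> Q z = 0 \<and> k z = ln (norm (z - a))) \<and>
      integrable lborel Q \<and> (\<integral>z. Q z \<partial>lborel) = 2 * pi \<and>
      (\<forall>z. z \<noteq> a \<longrightarrow> \<bar>k z\<bar> \<le> ln 2 + \<bar>ln (norm (z - a))\<bar>)" if e: "0 < \<epsilon>" "\<epsilon> \<le> 1" for \<epsilon>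
  proof -
    have e4: "0 < (\<epsilon> / 2)\<^sup>2" "(\<epsilon> / 2)\<^sup>2 < \<epsilon>\<^sup>2" using e by (auto intro!: power_strict_mono)
    obtain \<kappa> \<kappa>' \<kappa>'' \<sigma> \<sigma>' where kap: "\<And>k. Dk_on k UNIV \<kappa>"
      "\<And>x. (\<kappa> has_real_derivative \<kappa>' x) (at x)" "\<And>x. (\<kappa>' has_real_derivative \<kappa>'' x) (at x)"
      "\<And>x. x \<ge> \<epsilon>\<^sup>2 \<Longrightarrow> \<kappa> x = ln x / 2" "\<And>x. x \<le> \<epsilon>\<^sup>2 \<Longrightarrow> \<kappa> x \<le> ln (\<epsilon>\<^sup>2) / 2" "\<And>x. \<kappa> x \<ge> ln ((\<epsilon> / 2)\<^sup>2) / 2"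
      "\<And>x. x * \<kappa>'' x + \<kappa>' x = \<sigma>' x / 2" "\<And>x. (\<sigma> has_real_derivative \<sigma>' x) (at x)"
      "continuous_on UNIV \<sigma>'" "\<And>x. 0 \<le> \<sigma>' x" "\<And>x. x \<le> (\<epsilon> / 2)\<^sup>2 \<or> x \<ge> \<epsilon>\<^sup>2 \<Longrightarrow> \<sigma>' x = 0"
      "\<And>x. x \<le> (\<epsilon> / 2)\<^sup>2 \<Longrightarrow> \<sigma> x = 0" "\<And>x. x \<ge> \<epsilon>\<^sup>2 \<Longrightarrow> \<sigma> x = 1"
      by (rule log_profile[OF e4(1) e4(2)]) (rule that, assumption+)
    define k where "k z = \<kappa> ((norm (z - a))\<^sup>2)" for z
    define Q where "Q z = 2 * \<sigma>' ((norm (z - a))\<^sup>2)" for z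
    have p1: "Ck_on 2 UNIV k" unfolding k_def by (intro Ck_on_compose_real[OF open_UNIV kap(1)] Ck_on_norm_sq) auto
    have p2: "laplacian k z = Q z" for z
      unfolding Q_def k_def laplacian_radial[OF kap(2,3)] kap(7) by simp
    have Q0: "0 \<le> Q z" for z by (simp add: Q_def kap(10))
    have Qc: "continuous_on UNIV Q"
      unfolding Q_def by (intro continuous_intros continuous_on_compose2[OF kap(9)]) auto
    have p5: "Q z = 0 \<and> k z = ln (norm (z - a))" if "norm (z - a) \<ge> \<epsilon>" for z
    proof -
      have "\<epsilon>\<^sup>2 \<le> (norm (z - a))\<^sup>2" using that e by (intro power_mono) auto
      thus ?thesis using kap(4)[of "(norm (z - a))\<^sup>2"] kap(11)[of "(norm (z - a))\<^sup>2"] that e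
        by (simp add: Q_def k_def ln_realpow)
    qed
    \<comment> \<open>Inside the disc the profile lies between ln(\<epsilon>/2) and ln \<epsilon>
      \<le> 0, and ln |z - a| is below ln \<epsilon>. The ratio 2 of the radii is the ln 2, so the
      bound does not depend on \<epsilon> and can serve as dominating function.\<close>
    have p8: "\<bar>k z\<bar> \<le> ln 2 + \<bar>ln (norm (z - a))\<bar>" if za: "z \<noteq> a" for z
    proof (cases "norm (z - a) \<ge> \<epsilon>")
      case True
      hence "k z = ln (norm (z - a))"
        using kap(4)[of "(norm (z - a))\<^sup>2"] e by (simp add: k_def ln_realpow power_mono)
      thus ?thesis by simp
    next
      case False
      have "(norm (z - a))\<^sup>2 \<le> \<epsilon>\<^sup>2" using False by (intro power_mono) auto
      from kap(5)[OF this] have "k z \<le> ln \<epsilon>" using e by (simp add: k_def ln_realpow)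
      moreover have "ln (\<epsilon> / 2) \<le> k z" using kap(6)[of "(norm (z - a))\<^sup>2"] e by (simp add: k_def ln_realpow)
      moreover have "ln (\<epsilon> / 2) = ln \<epsilon> - ln 2" using e by (simp add: ln_div)
      moreover have "ln \<epsilon> \<le> 0" using e by simp
      moreover have "ln (norm (z - a)) \<le> ln \<epsilon>" using False za e by (subst ln_le_cancel_iff) auto
      moreover have "0 \<le> ln (2::real)" by simp
      ultimately show ?thesis unfolding abs_if by (smt (verit))
    qed
    have Qnn: "(\<integral>\<^sup>+w. ennreal (Q w) \<partial>lborel) = ennreal (2 * pi)"
      unfolding Q_def
      by (rule integral_radial_profile[OF kap(8,9,10), of "\<epsilon>\<^sup>2"])
         (use e in \<open>auto intro!: kap(11-13) order_trans[OF _ zero_le_power2]\<close>)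
    have Qint: "integrable lborel Q"
      using Qnn Q0 borel_measurable_continuous_onI[OF Qc] by (intro integrableI_nonneg) auto
    have p7: "(\<integral>w. Q w \<partial>lborel) = 2 * pi"
      using Qnn Q0 nn_integral_eq_integral[OF Qint] by (simp add: integral_nonneg_AE)
    show ?thesis
      by (rule exI[of _ k], rule exI[of _ Q], intro conjI allI impI) (simp_all add: p1 p2 Q0 Qc p5 p8 Qint p7)
  qed
  have "\<exists>k Q. \<forall>n. Ck_on 2 UNIV (k n) \<and> (\<forall>z. laplacian (k n) z = Q n z) \<and> (\<forall>z. 0 \<le> Q n z) \<and> continuous_on UNIV (Q n) \<and>
      (\<forall>z. norm (z - a) \<ge> 1 / real (Suc n) \<longrightarrow> Q n z = 0 \<and> k n z = ln (norm (z - a))) \<and>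
      integrable lborel (Q n) \<and> (\<integral>z. Q n z \<partial>lborel) = 2 * pi \<and>
      (\<forall>z. z \<noteq> a \<longrightarrow> \<bar>k n z\<bar> \<le> ln 2 + \<bar>ln (norm (z - a))\<bar>)"
    by (subst choice_iff[symmetric], subst choice_iff[symmetric], intro allI prof) auto
  then obtain k Q where kQ: "\<And>n. Ck_on 2 UNIV (k n)" "\<And>n z. laplacian (k n) z = Q n z" "\<And>n z. 0 \<le> Q n z"
     "\<And>n. continuous_on UNIV (Q n)" "\<And>n z. norm (z - a) \<ge> 1 / real (Suc n) \<Longrightarrow> Q n z = 0 \<and> k n z = ln (norm (z - a))"
     "\<And>n. integrable lborel (Q n)" "\<And>n. (\<integral>z. Q n z \<partial>lborel) = 2 * pi"
     "\<And>n z. z \<noteq> a \<Longrightarrow> \<bar>k n z\<bar> \<le> ln 2 + \<bar>ln (norm (z - a))\<bar>" by metis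
  have gi: "(\<integral>z. k n z * ?L z \<partial>lborel) = (\<integral>z. \<phi> z * Q n z \<partial>lborel)" for n
    using Green_identity(2)[OF open_UNIV t\<phi> kQ(1), of n] by (simp add: kQ(2))
  have inv0: "(\<lambda>n. 1 / real (Suc n)) \<longlonglongrightarrow> 0" using LIMSEQ_inverse_real_of_nat by (simp add: inverse_eq_divide)
  have lim1: "(\<lambda>n. \<integral>z. k n z * ?L z \<partial>lborel) \<longlonglongrightarrow> (\<integral>z. ln (norm (z - a)) * ?L z \<partial>lborel)"
  proof (rule integral_dominated_convergence)
    show "(\<lambda>z. ln (norm (z - a)) * ?L z) \<in> borel_measurable lborel" using int by auto
    show "(\<lambda>z. k n z * ?L z) \<in> borel_measurable lborel" for n
      using Green_identity(1)[OF open_UNIV t\<phi> kQ(1)] by auto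
    have "integrable lborel (\<lambda>z. ln 2 * \<bar>?L z\<bar> + \<bar>ln (norm (z - a)) * ?L z\<bar>)"
      using test_function_laplacian(3)[OF \<phi>] int by (intro Bochner_Integration.integrable_add integrable_mult_right integrable_abs)
    thus "integrable lborel (\<lambda>z. (ln 2 + \<bar>ln (norm (z - a))\<bar>) * \<bar>?L z\<bar>)" by (simp add: distrib_right abs_mult)
    show "AE z in lborel. (\<lambda>n. k n z * ?L z) \<longlonglongrightarrow> ln (norm (z - a)) * ?L z"
      using AE_lborel_singleton[of a]
    proof eventually_elim
      case (elim z)
      have "\<forall>\<^sub>F n in sequentially. 1 / real (Suc n) < norm (z - a)"
        using order_tendstoD(2)[OF inv0] elim by simp
      hence "\<forall>\<^sub>F n in sequentially. k n z = ln (norm (z - a))"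
        by eventually_elim (use kQ(5) in \<open>auto simp: less_imp_le\<close>)
      thus ?case by (intro tendsto_mult tendsto_const tendsto_eventually)
    qed
    show "AE z in lborel. norm (k n z * ?L z) \<le> (ln 2 + \<bar>ln (norm (z - a))\<bar>) * \<bar>?L z\<bar>" for n
      using AE_lborel_singleton[of a]
      by eventually_elim (use kQ(8) in \<open>auto simp: abs_mult intro!: mult_right_mono\<close>)
  qed
  have lim2: "(\<lambda>n. \<integral>z. \<phi> z * Q n z \<partial>lborel) \<longlonglongrightarrow> 2 * pi * \<phi> a"
  proof (rule LIMSEQ_I)
    fix e :: real assume e: "e > 0"
    define e' where "e' = e / (4 * pi)"
    have e': "e' > 0" using e by (simp add: e'_def)
    have "isCont \<phi> a" using c\<phi> by (simp add: continuous_on_eq_continuous_at)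
    then obtain d where d: "d > 0" "\<And>z. norm (z - a) < d \<Longrightarrow> \<bar>\<phi> z - \<phi> a\<bar> < e'"
      using e' unfolding continuous_at_eps_delta by (auto simp: dist_norm)
    have "\<forall>\<^sub>F n in sequentially. 1 / real (Suc n) < d" using order_tendstoD(2)[OF inv0 d(1)] .
    then obtain N where N: "\<And>n. n \<ge> N \<Longrightarrow> 1 / real (Suc n) < d" by (auto simp: eventually_sequentially)
    have "norm ((\<integral>z. \<phi> z * Q n z \<partial>lborel) - 2 * pi * \<phi> a) < e" if n: "n \<ge> N" for n
    proof -
      have b: "\<bar>(\<phi> z - \<phi> a) * Q n z\<bar> \<le> e' * Q n z" for z
      proof (cases "norm (z - a) < d")
        case True
        thus ?thesis using d(2)[OF True] kQ(3)[of n z] by (simp add: abs_mult mult_right_mono less_imp_le)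
      next
        case False
        hence "Q n z = 0" using kQ(5)[of n z] N[OF n] by simp
        thus ?thesis by simp
      qed
      have "(\<lambda>z. (\<phi> z - \<phi> a) * Q n z) \<in> borel_measurable borel"
        by (intro borel_measurable_continuous_onI continuous_intros c\<phi> kQ)
      hence i: "integrable lborel (\<lambda>z. (\<phi> z - \<phi> a) * Q n z)"
        using b by (intro Bochner_Integration.integrable_bound[OF integrable_mult_right[OF kQ(6)[of n], of e']])
           (auto intro!: AE_I2 order_trans[OF _ abs_ge_self])
      have "integrable lborel (\<lambda>z. \<phi> a * Q n z + (\<phi> z - \<phi> a) * Q n z)" using i kQ(6) by simp
      hence "(\<integral>z. \<phi> z * Q n z \<partial>lborel) = (\<integral>z. \<phi> a * Q n z + (\<phi> z - \<phi> a) * Q n z \<partial>lborel)"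
        by (simp add: algebra_simps)
      also have "\<dots> = \<phi> a * (2 * pi) + (\<integral>z. (\<phi> z - \<phi> a) * Q n z \<partial>lborel)" using i kQ(6,7) by simp
      finally have "norm ((\<integral>z. \<phi> z * Q n z \<partial>lborel) - 2 * pi * \<phi> a) = \<bar>\<integral>z. (\<phi> z - \<phi> a) * Q n z \<partial>lborel\<bar>" by simp
      also have "\<dots> \<le> (\<integral>z. \<bar>(\<phi> z - \<phi> a) * Q n z\<bar> \<partial>lborel)" by (rule integral_abs_bound)
      also have "\<dots> \<le> (\<integral>z. e' * Q n z \<partial>lborel)" using i kQ(6) b by (intro integral_mono) auto
      also have "\<dots> = e / 2" using kQ(7) by (simp add: e'_def)
      also have "\<dots> < e" using e by simp
      finally show ?thesis .
    qed
    thus "\<exists>no. \<forall>n\<ge>no. norm ((\<integral>z. \<phi> z * Q n z \<partial>lborel) - 2 * pi * \<phi> a) < e" by blast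
  qed
  show "(\<integral>z. ln (norm (z - a)) * ?L z \<partial>lborel) = 2 * pi * \<phi> a"
    by (rule LIMSEQ_unique[OF lim1]) (simp only: gi lim2)
qed

text \<open>H = G (w - a)^n with G free of zeros; on a disc G has a holomorphic logarithm P, and ln
  |G| = Re P.\<close>

lemma log_norm_factorization:
  assumes H: "H holomorphic_on ball a r0" and r0: "r0 > 0" and ne: "\<exists>w\<in>ball a r0. H w \<noteq> 0"
  shows "\<exists>r>0. \<exists>P. r \<le> r0 \<and> P holomorphic_on ball a r \<and> 0 \<le> zorder H a \<and> (H a = 0 \<longleftrightarrow> zorder H a \<noteq> 0) \<and>
    (\<forall>w\<in>ball a r. w \<noteq> a \<or> zorder H a = 0 \<longrightarrow>
       H w \<noteq> 0 \<and> ln (norm (H w)) = of_int (zorder H a) * ln (norm (w - a)) + Re (P w))"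
proof -
  define G where "G = zor_poly H a"
  define n where "n = nat (zorder H a)"
  from zorder_exist_zero[OF H open_ball connected_ball _ ne] r0
  have z: "if H a = 0 then zorder H a > 0 else zorder H a = 0"
    and "\<exists>r. r > 0 \<and> cball a r \<subseteq> ball a r0 \<and> G holomorphic_on cball a r \<and>
        (\<forall>w\<in>cball a r. H w = G w * (w - a) ^ n \<and> G w \<noteq> 0)"
    unfolding G_def n_def by auto
  then obtain r where r: "r > 0" "cball a r \<subseteq> ball a r0" "G holomorphic_on cball a r"
     "\<And>w. w \<in> cball a r \<Longrightarrow> H w = G w * (w - a) ^ n \<and> G w \<noteq> 0" by blast
  have rr: "r \<le> r0" using r(1,2) cball_subset_ball_iff[of a r a r0] by simp
  have G: "G holomorphic_on ball a r" using r(3) by (rule holomorphic_on_subset) auto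
  obtain P where P: "P holomorphic_on ball a r" "\<And>w. w \<in> ball a r \<Longrightarrow> exp (P w) = G w"
    by (rule holomorphic_logarithm_exists[OF convex_ball open_ball G, of a]) (use r in auto)
  have zn: "of_int (zorder H a) = real n" using z by (auto simp: n_def split: if_splits)
  have "H w \<noteq> 0 \<and> ln (norm (H w)) = of_int (zorder H a) * ln (norm (w - a)) + Re (P w)"
    if w: "w \<in> ball a r" "w \<noteq> a \<or> zorder H a = 0" for w
  proof -
    have h: "H w = G w * (w - a) ^ n" "G w \<noteq> 0" using r(4)[of w] w(1) by auto
    have lG: "ln (norm (G w)) = Re (P w)" using P(2)[OF w(1)] by (metis norm_exp_eq_Re ln_exp)
    have nz: "(w - a) ^ n \<noteq> 0" using w(2) by (auto simp: n_def)
    have "ln (norm (H w)) = ln (norm (G w)) + ln (norm ((w - a) ^ n))"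
      unfolding h(1) norm_mult by (rule ln_mult_pos) (use h(2) nz in auto)
    moreover have "ln (norm ((w - a) ^ n)) = real n * ln (norm (w - a))"
    proof (cases "w = a")
      case True
      hence "n = 0" using w(2) by (simp add: n_def)
      thus ?thesis by simp
    qed (simp add: norm_power ln_realpow)
    ultimately show ?thesis using h nz lG by (simp add: zn)
  qed
  moreover have "0 \<le> zorder H a" "H a = 0 \<longleftrightarrow> zorder H a \<noteq> 0" using z by (auto split: if_splits)
  ultimately show ?thesis using r(1) rr P(1) by (intro exI[of _ r] exI[of _ P] conjI) auto
qed

text \<open>Centred charts suffice: every finite point is handled in \<open>Some\<close>, infinity at the origin of the inversion chart.\<close>

lemma log_holomorphic_local:
  assumes h: "sphere_holomorphic_on h D" and D: "openin csphere D" and c: "c = Some \<or> c = inversion_chart \<and> a = 0"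
    and a: "c a \<in> D" and ne: "\<And>r. r > 0 \<Longrightarrow> \<exists>w\<in>ball a r. h (c w) \<noteq> 0"
  shows "\<exists>r>0. \<exists>v. ball a r \<subseteq> c -` D \<and> planar_harmonic_on (ball a r) v \<and>
    0 \<le> zero_mult h (c a) \<and> (h (c a) = 0 \<longleftrightarrow> zero_mult h (c a) \<noteq> 0) \<and>
    (\<forall>w\<in>ball a r. w \<noteq> a \<or> zero_mult h (c a) = 0 \<longrightarrow>
       h (c w) \<noteq> 0 \<and> ln (norm (h (c w))) = of_int (zero_mult h (c a)) * ln (norm (w - a)) + v w)"
proof -
  have "sphere_chart c" using c by auto
  then obtain r0 where r0: "r0 > 0" "ball a r0 \<subseteq> c -` D"
    using open_chart_vimage[OF _ D] a open_contains_ball[of "c -` D"] by blast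
  from c show ?thesis
  proof
    assume c: "c = Some"
    have H: "(h \<circ> Some) holomorphic_on ball a r0"
      using h r0(2) by (auto simp: sphere_holomorphic_on_def c intro: holomorphic_on_subset)
    have "\<exists>w\<in>ball a r0. (h \<circ> Some) w \<noteq> 0" using ne[OF r0(1)] by (simp add: c)
    from log_norm_factorization[OF H r0(1) this] obtain r P where r: "r > 0" "r \<le> r0" "P holomorphic_on ball a r"
      "0 \<le> zorder (h \<circ> Some) a" "(h \<circ> Some) a = 0 \<longleftrightarrow> zorder (h \<circ> Some) a \<noteq> 0"
      "\<forall>w\<in>ball a r. w \<noteq> a \<or> zorder (h \<circ> Some) a = 0 \<longrightarrow>
       (h \<circ> Some) w \<noteq> 0 \<and> ln (norm ((h \<circ> Some) w)) = of_int (zorder (h \<circ> Some) a) * ln (norm (w - a)) + Re (P w)"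
      by blast
    have "ball a r \<subseteq> c -` D" using r(2) r0(2) by auto
    thus ?thesis using r planar_harmonic_on_Re_holomorphic[OF r(3) open_ball]
      by (intro exI[of _ r] exI[of _ "\<lambda>w. Re (P w)"] conjI) (simp_all add: c zero_mult_def)
  next
    assume c: "c = inversion_chart \<and> a = 0"
    let ?H = "h \<circ> recip_chart"
    have hc: "h (c w) = ?H (cnj w)" for w using c by (simp add: inversion_chart_def)
    have "cnj w \<in> recip_chart -` D" if "w \<in> ball 0 r0" for w
      using that r0(2) c by (auto simp: inversion_chart_def)
    from this[of "cnj _"] have sub: "ball 0 r0 \<subseteq> recip_chart -` D" by auto
    hence H: "?H holomorphic_on ball 0 r0"
      using h by (auto simp: sphere_holomorphic_on_def intro: holomorphic_on_subset)
    obtain w0 where "w0 \<in> ball a r0" "h (c w0) \<noteq> 0" using ne[OF r0(1)] by blast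
    hence "\<exists>w\<in>ball 0 r0. ?H w \<noteq> 0" using c hc by (intro bexI[of _ "cnj w0"]) auto
    from log_norm_factorization[OF H r0(1) this] obtain r P where r: "r > 0" "r \<le> r0" "P holomorphic_on ball 0 r"
      "0 \<le> zorder ?H 0" "?H 0 = 0 \<longleftrightarrow> zorder ?H 0 \<noteq> 0"
      "\<forall>w\<in>ball 0 r. w \<noteq> 0 \<or> zorder ?H 0 = 0 \<longrightarrow>
       ?H w \<noteq> 0 \<and> ln (norm (?H w)) = of_int (zorder ?H 0) * ln (norm (w - 0)) + Re (P w)"
      by blast
    \<comment> \<open>The inversion chart is the holomorphic chart composed with conjugation, so P
      occurs as P(cnj w). Its real part is harmonic because conjugating the value as well restores
      holomorphy without changing the real part.\<close>
    have "(\<lambda>w. cnj (P (cnj w))) holomorphic_on ball 0 r"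
    proof -
      have "cnj ` ball 0 r = ball 0 r" by (auto simp: image_iff intro!: bexI[of _ "cnj _"])
      hence "P holomorphic_on cnj ` ball 0 r" using r(3) by simp
      from holomorphic_on_compose_cnj_cnj[OF this open_ball] show ?thesis by (simp add: o_def)
    qed
    from planar_harmonic_on_Re_holomorphic[OF this open_ball]
    have v: "planar_harmonic_on (ball 0 r) (\<lambda>w. Re (P (cnj w)))" by simp
    have z: "zero_mult h (c a) = zorder ?H 0" using c by (simp add: zero_mult_def inversion_chart_def recip_chart_def)
    have b: "ball a r \<subseteq> c -` D" using r(2) r0(2) by auto
    have "h (c w) \<noteq> 0 \<and> ln (norm (h (c w))) = of_int (zorder ?H 0) * ln (norm (w - a)) + Re (P (cnj w))"
      if "w \<in> ball a r" "w \<noteq> a \<or> zorder ?H 0 = 0" for w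
      using r(6)[rule_format, of "cnj w"] that c hc[of w] by simp
    moreover have "h (c a) = ?H 0" using hc[of a] c by simp
    ultimately show ?thesis using r(1,4,5) v b c unfolding z
      by (intro exI[of _ r] exI[of _ "\<lambda>w. Re (P (cnj w))"] conjI) auto
  qed
qed

lemma planar_harmonic_on_ln_sum:
  assumes "finite A" "open S" "A \<inter> S = {}" "planar_harmonic_on S v"
  shows "planar_harmonic_on S (\<lambda>w. v w - (\<Sum>a\<in>A. k a * ln (norm (w - a))))"
  using assms(1,3)
proof (induction A rule: finite_induct)
  case empty
  thus ?case using assms(4) by simp
next
  case (insert a A)
  have "planar_harmonic_on S (\<lambda>w. - k a * ln (norm (w - a)))"
  proof -
    have "planar_harmonic_on S (\<lambda>w. ln (norm (w - a)))"
      by (rule planar_harmonic_on_subset[OF planar_harmonic_on_ln_norm]) (use insert.prems in auto)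
    hence "Ck_on 2 S (\<lambda>w. - k a * ln (norm (w - a)))"
        "\<And>z. z \<in> S \<Longrightarrow> laplacian (\<lambda>w. - k a * ln (norm (w - a))) z = 0"
      using Ck_on_cmult[OF assms(2)] laplacian_cmult[OF assms(2)]
      by (simp_all only: planar_harmonic_on_def mult_zero_right)
    thus ?thesis by (simp only: planar_harmonic_on_def) blast
  qed
  from planar_harmonic_on_add[OF assms(2) insert.IH this] insert
  show ?case by (simp add: algebra_simps)
qed

lemma planar_harmonic_on_local:
  assumes "\<And>z. z \<in> S \<Longrightarrow> \<exists>T. open T \<and> z \<in> T \<and> planar_harmonic_on T v" and S: "open S"
  shows "planar_harmonic_on S v"
  unfolding planar_harmonic_on_def
proof
  show "Ck_on 2 S v"
  proof (rule Ck_on_local)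
    fix z assume "z \<in> S"
    with assms(1) obtain T where "open T" "z \<in> T" "planar_harmonic_on T v" by blast
    thus "\<exists>V. open V \<and> z \<in> V \<and> Ck_on 2 V v" by (auto simp: planar_harmonic_on_def)
  qed
  show "\<forall>z\<in>S. laplacian v z = 0" using assms(1) by (fastforce simp: planar_harmonic_on_def)
qed

text \<open>A function with finitely many logarithmic poles differs from the sum of its poles by a harmonic function.\<close>

lemma log_poles_laplacian:
  assumes W: "open W" and A: "finite A"
    and loc: "\<And>w. w \<in> W \<Longrightarrow> \<exists>r>0. \<exists>v. planar_harmonic_on (ball w r) v \<and>
      (\<forall>y\<in>ball w r. y \<noteq> w \<or> w \<notin> A \<longrightarrow> L y = (if w \<in> A then k w else 0) * ln (norm (y - w)) + v y)"
    and \<phi>: "test_function W \<phi>"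
  shows "integrable lborel (\<lambda>w. L w * laplacian \<phi> w)"
    and "(\<integral>w. L w * laplacian \<phi> w \<partial>lborel) = 2 * pi * (\<Sum>a\<in>A. k a * \<phi> a)"
proof -
  obtain r v where rv: "\<And>w. w \<in> W \<Longrightarrow> 0 < r w" "\<And>w. w \<in> W \<Longrightarrow> planar_harmonic_on (ball w (r w)) (v w)"
    "\<And>w y. w \<in> W \<Longrightarrow> y \<in> ball w (r w) \<Longrightarrow> y \<noteq> w \<or> w \<notin> A \<Longrightarrow>
       L y = (if w \<in> A then k w else 0) * ln (norm (y - w)) + v w y"
    using loc by metis
  \<comment> \<open>At a pole the value of L is unspecified; there the local harmonic part replaces
    it, and only the other poles are subtracted.\<close>
  define V where "V y = (if y \<in> A then v y y else L y) - (\<Sum>b\<in>A - {y}. k b * ln (norm (y - b)))" for y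
  have V: "planar_harmonic_on W V"
  proof (rule planar_harmonic_on_local[OF _ W])
    fix w assume w: "w \<in> W"
    let ?T = "ball w (r w) - (A - {w})"
    have T: "open ?T" using A by (intro open_Diff finite_imp_closed) auto
    have eq: "V y = v w y - (\<Sum>b\<in>A - {w}. k b * ln (norm (y - b)))" if y: "y \<in> ?T" for y
    proof (cases "y = w")
      case True
      thus ?thesis using rv(3)[OF w, of w] rv(1)[OF w] by (simp add: V_def)
    next
      case False
      hence yA: "y \<notin> A" using y by auto
      have "L y = (if w \<in> A then k w else 0) * ln (norm (y - w)) + v w y" using rv(3)[OF w, of y] y False by simp
      moreover have "(\<Sum>b\<in>A. k b * ln (norm (y - b))) =
          (if w \<in> A then k w else 0) * ln (norm (y - w)) + (\<Sum>b\<in>A - {w}. k b * ln (norm (y - b)))"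
        using A by (simp add: sum.remove[of A w])
      ultimately show ?thesis using yA by (simp add: V_def)
    qed
    have "planar_harmonic_on ?T (\<lambda>y. v w y - (\<Sum>b\<in>A - {w}. k b * ln (norm (y - b))))"
      by (rule planar_harmonic_on_ln_sum) (use A T planar_harmonic_on_subset[OF rv(2)[OF w], of ?T] in auto)
    hence "planar_harmonic_on ?T V" using planar_harmonic_on_cong[OF T eq] by simp
    thus "\<exists>T. open T \<and> w \<in> T \<and> planar_harmonic_on T V" using T w rv(1)[OF w] by (intro exI[of _ ?T]) auto
  qed
  hence V2: "Ck_on 2 W V" by (simp add: planar_harmonic_on_def)
  note G = Green_identity[OF W \<phi> V2] and ln = ln_norm_laplacian[OF \<phi>]
  have zero: "\<phi> z * laplacian V z = 0" for z
  proof (cases "z \<in> W")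
    case True
    thus ?thesis using V by (simp add: planar_harmonic_on_def)
  next
    case False
    hence "z \<notin> closure {z. \<phi> z \<noteq> 0}" using test_functionD(3)[OF \<phi>] by blast
    from test_functionD(4)[OF \<phi> this] show ?thesis by simp
  qed
  have G0: "(\<integral>z. V z * laplacian \<phi> z \<partial>lborel) = 0" unfolding G(2) by (simp only: zero) simp
  let ?R = "\<lambda>z. V z * laplacian \<phi> z + (\<Sum>a\<in>A. k a * (ln (norm (z - a)) * laplacian \<phi> z))"
  have iR: "integrable lborel ?R"
    by (intro Bochner_Integration.integrable_add Bochner_Integration.integrable_sum integrable_mult_right G(1) ln(1))
  have "(\<integral>z. ?R z \<partial>lborel) = (\<Sum>a\<in>A. k a * (2 * pi * \<phi> a))"
    by (subst Bochner_Integration.integral_add)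
       (simp_all add: G(1) ln G0 Bochner_Integration.integral_sum Bochner_Integration.integrable_sum)
  hence IR: "(\<integral>z. ?R z \<partial>lborel) = 2 * pi * (\<Sum>a\<in>A. k a * \<phi> a)" by (simp add: sum_distrib_left algebra_simps)
  \<comment> \<open>The identity may fail at the finitely many poles, which form a null set.\<close>
  have off: "L z * laplacian \<phi> z = ?R z" if z: "z \<notin> A" for z
  proof (cases "z \<in> W")
    case True
    have "L z = V z + (\<Sum>a\<in>A. k a * ln (norm (z - a)))" using z by (simp add: V_def)
    thus ?thesis by (simp add: distrib_right sum_distrib_right mult.assoc)
  next
    case False
    hence "z \<notin> closure {z. \<phi> z \<noteq> 0}" using test_functionD(3)[OF \<phi>] by auto
    hence "laplacian \<phi> z = 0" by (rule test_function_laplacian(2)[OF \<phi>])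
    thus ?thesis by simp
  qed
  show "integrable lborel (\<lambda>w. L w * laplacian \<phi> w)"
    using iR integrable_discrete_difference[of A lborel ?R "\<lambda>w. L w * laplacian \<phi> w"] A off
    by (simp add: countable_finite)
  have "(\<integral>w. L w * laplacian \<phi> w \<partial>lborel) = (\<integral>z. ?R z \<partial>lborel)"
    by (rule integral_discrete_difference[of A]) (use A off in \<open>auto simp: countable_finite\<close>)
  thus "(\<integral>w. L w * laplacian \<phi> w \<partial>lborel) = 2 * pi * (\<Sum>a\<in>A. k a * \<phi> a)" using IR by simp
qed

section \<open>Zeros of holomorphic functions on the sphere\<close>

text \<open>That h does not vanish identically is encoded in the finiteness of u = log |h| at
  \<open>z0\<close>.\<close>

locale log_holomorphic =
  fixes D :: "complex option set" and u :: "complex option \<Rightarrow> ereal" and h :: "complex option \<Rightarrow> complex"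
    and z0 :: "complex option"
  assumes D: "sphere_domain D" and sub: "subharmonic_on D u" and z0: "z0 \<in> D" "u z0 \<noteq> - \<infinity>"
    and hol: "sphere_holomorphic_on h D" and u_eq: "\<And>z. z \<in> D \<Longrightarrow> u z = log_abs (h z)"
begin

lemma openin_D: "openin csphere D" using D by (simp add: sphere_domain_def)

text \<open>An identity theorem obtained from potential theory: u is finite almost everywhere near
  each point of D, so the zeros of h have no interior point.\<close>

lemma nonzero_dense:
  assumes c: "sphere_chart c" and a: "c a \<in> D" and r: "r > 0"
  shows "\<exists>w\<in>ball a r. h (c w) \<noteq> 0"
proof -
  obtain R where R: "R > 0" "cball a R \<subseteq> c -` D" "AE w in lborel. w \<in> cball a R \<longrightarrow> u (c w) \<noteq> - \<infinity>"
    using subharmonic_locally_integrable[OF D sub z0 c, of a] a by blast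
  have "\<exists>w\<in>ball a (min r R). w \<in> cball a R \<longrightarrow> u (c w) \<noteq> - \<infinity>"
    by (rule AE_open_imp_ex[OF R(3)]) (use r R(1) in auto)
  then obtain w where w: "w \<in> ball a (min r R)" "w \<in> cball a R \<longrightarrow> u (c w) \<noteq> - \<infinity>" by blast
  hence "w \<in> cball a R" by simp
  hence "u (c w) \<noteq> - \<infinity>" "c w \<in> D" using R(2) w(2) by blast+
  hence "h (c w) \<noteq> 0" using u_eq[of "c w"] by (auto simp: log_abs_def)
  with w(1) show ?thesis by auto
qed

lemma log_form:
  assumes c: "c = Some \<or> c = inversion_chart \<and> a = 0" and a: "c a \<in> D"
  shows "\<exists>r>0. \<exists>v. ball a r \<subseteq> c -` D \<and> planar_harmonic_on (ball a r) v \<and>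
    0 \<le> zero_mult h (c a) \<and> (h (c a) = 0 \<longleftrightarrow> zero_mult h (c a) \<noteq> 0) \<and>
    (\<forall>w\<in>ball a r. w \<noteq> a \<or> zero_mult h (c a) = 0 \<longrightarrow>
       h (c w) \<noteq> 0 \<and> real_of_ereal (u (c w)) = of_int (zero_mult h (c a)) * ln (norm (w - a)) + v w)"
proof -
  have "sphere_chart c" using c by auto
  from log_holomorphic_local[OF hol openin_D c a nonzero_dense[OF this a]] obtain r v where rv:
    "r > 0" "ball a r \<subseteq> c -` D" "planar_harmonic_on (ball a r) v"
    "0 \<le> zero_mult h (c a)" "h (c a) = 0 \<longleftrightarrow> zero_mult h (c a) \<noteq> 0"
    "\<forall>w\<in>ball a r. w \<noteq> a \<or> zero_mult h (c a) = 0 \<longrightarrow>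
       h (c w) \<noteq> 0 \<and> ln (norm (h (c w))) = of_int (zero_mult h (c a)) * ln (norm (w - a)) + v w" by blast
  have "real_of_ereal (u (c w)) = ln (norm (h (c w)))" if "w \<in> ball a r" for w
    using u_eq[of "c w"] that rv(2) by (auto simp: log_abs_def)
  thus ?thesis using rv by (intro exI[of _ r] exI[of _ v] conjI ballI impI) auto
qed

lemma zero_mult_eq_0_iff:
  assumes "p \<in> D"
  shows "0 \<le> zero_mult h p" "zero_mult h p = 0 \<longleftrightarrow> h p \<noteq> 0"
proof -
  have "\<exists>c a. (c = Some \<or> c = inversion_chart \<and> a = 0) \<and> c a = p"
  proof (cases p)
    case None
    thus ?thesis by (intro exI[of _ inversion_chart] exI[of _ 0]) (simp add: inversion_chart_eq)
  qed blast
  then obtain c a where "c = Some \<or> c = inversion_chart \<and> a = 0" "c a = p" by blast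
  thus "0 \<le> zero_mult h p" "zero_mult h p = 0 \<longleftrightarrow> h p \<noteq> 0" using log_form[of c a] assms by blast+
qed

text \<open>The disc is so small that its centre is the only possible zero. Infinity, with the
  radius demanded by \<open>subriesz\<close>, and the single atoms of the Riesz measure are treated
  by this case.\<close>

lemma log_test_centred:
  assumes c: "c = Some \<or> c = inversion_chart \<and> a = 0" and a: "c a \<in> D"
  obtains r where "r > 0" "ball a r \<subseteq> c -` D" "\<And>w. w \<in> ball a r \<Longrightarrow> w \<noteq> a \<Longrightarrow> h (c w) \<noteq> 0"
    "\<And>\<phi>. test_function (ball a r) \<phi> \<Longrightarrow>
       (\<integral>w. real_of_ereal (u (c w)) * laplacian \<phi> w \<partial>lborel) = 2 * pi * (of_int (zero_mult h (c a)) * \<phi> a)"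
proof -
  from log_form[OF c a] obtain r v where rv: "r > 0" "ball a r \<subseteq> c -` D" "planar_harmonic_on (ball a r) v"
    "\<And>w. w \<in> ball a r \<Longrightarrow> w \<noteq> a \<or> zero_mult h (c a) = 0 \<Longrightarrow>
       h (c w) \<noteq> 0 \<and> real_of_ereal (u (c w)) = of_int (zero_mult h (c a)) * ln (norm (w - a)) + v w" by blast
  have loc: "\<exists>s>0. \<exists>v. planar_harmonic_on (ball w s) v \<and> (\<forall>y\<in>ball w s. y \<noteq> w \<or> w \<notin> {a} \<longrightarrow>
      real_of_ereal (u (c y)) = (if w \<in> {a} then of_int (zero_mult h (c a)) else 0) * ln (norm (y - w)) + v y)"
    if w: "w \<in> ball a r" for w
  proof (cases "w = a")
    case True
    thus ?thesis using rv by (intro exI[of _ r] exI[of _ v]) auto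
  next
    case False
    have "open (ball a r - {a})" by auto
    then obtain s where s: "s > 0" "ball w s \<subseteq> ball a r - {a}"
      using w False open_contains_ball[of "ball a r - {a}"] by blast
    have "planar_harmonic_on (ball w s) (\<lambda>y. v y - (\<Sum>a\<in>{a}. - of_int (zero_mult h (c a)) * ln (norm (y - a))))"
      by (rule planar_harmonic_on_ln_sum) (use s planar_harmonic_on_subset[OF rv(3), of "ball w s"] in auto)
    hence hs: "planar_harmonic_on (ball w s) (\<lambda>y. v y + of_int (zero_mult h (c a)) * ln (norm (y - a)))" by simp
    have "y \<in> ball a r" "y \<noteq> a" if "y \<in> ball w s" for y using that s(2) by blast+
    hence "real_of_ereal (u (c y)) = v y + of_int (zero_mult h (c a)) * ln (norm (y - a))"
      if "y \<in> ball w s" for y using rv(4)[of y] that by simp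
    with hs s(1) False show ?thesis
      by (intro exI[of _ s] conjI exI[of _ "\<lambda>y. v y + of_int (zero_mult h (c a)) * ln (norm (y - a))"]) auto
  qed
  show thesis
  proof (rule that[OF rv(1,2)])
    show "h (c w) \<noteq> 0" if "w \<in> ball a r" "w \<noteq> a" for w using rv(4) that by blast
    show "(\<integral>w. real_of_ereal (u (c w)) * laplacian \<phi> w \<partial>lborel) = 2 * pi * (of_int (zero_mult h (c a)) * \<phi> a)"
      if "test_function (ball a r) \<phi>" for \<phi>
      using log_poles_laplacian(2)[OF open_ball _ loc that] by simp
  qed
qed

text \<open>Finitely many discs of the local form cover the support, and only their centres can be
  zeros; so finitely many logarithmic poles meet the support and \<open>log_poles_laplacian\<close>
  applies.\<close>

lemma log_test_finite:
  assumes \<phi>: "test_function (Some -` D) \<phi>"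
  obtains A where "finite A" "Some ` A \<subseteq> D" "\<And>a. \<phi> a \<noteq> 0 \<Longrightarrow> h (Some a) = 0 \<Longrightarrow> a \<in> A"
    "(\<integral>w. real_of_ereal (u (Some w)) * laplacian \<phi> w \<partial>lborel) =
       2 * pi * (\<Sum>a\<in>A. of_int (zero_mult h (Some a)) * \<phi> a)"
proof -
  let ?K = "closure {z. \<phi> z \<noteq> 0}" and ?m = "\<lambda>a. real_of_int (zero_mult h (Some a))"
  note K = test_functionD(2,3)[OF \<phi>]
  have "\<exists>r>0. \<exists>v. ball a r \<subseteq> Some -` D \<and> planar_harmonic_on (ball a r) v \<and>
    (\<forall>w\<in>ball a r. w \<noteq> a \<or> zero_mult h (Some a) = 0 \<longrightarrow>
       h (Some w) \<noteq> 0 \<and> real_of_ereal (u (Some w)) = ?m a * ln (norm (w - a)) + v w)" if "Some a \<in> D" for a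
    using log_form[of Some a] that by blast
  then obtain r v where rv: "\<And>a. Some a \<in> D \<Longrightarrow> 0 < r a" "\<And>a. Some a \<in> D \<Longrightarrow> ball a (r a) \<subseteq> Some -` D"
    "\<And>a. Some a \<in> D \<Longrightarrow> planar_harmonic_on (ball a (r a)) (v a)"
    "\<And>a w. Some a \<in> D \<Longrightarrow> w \<in> ball a (r a) \<Longrightarrow> w \<noteq> a \<or> zero_mult h (Some a) = 0 \<Longrightarrow>
       h (Some w) \<noteq> 0 \<and> real_of_ereal (u (Some w)) = ?m a * ln (norm (w - a)) + v a w"
    by metis
  have "?K \<subseteq> (\<Union>a\<in>?K. ball a (r a))" using rv(1) K(2) by force
  from compactE_image[OF K(1) _ this] obtain N where N: "N \<subseteq> ?K" "finite N" "?K \<subseteq> (\<Union>a\<in>N. ball a (r a))" by blast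
  define W where "W = (\<Union>a\<in>N. ball a (r a))"
  define A where "A = {a \<in> W. h (Some a) = 0}"
  have ND: "Some a \<in> D" if "a \<in> N" for a using that N(1) K(2) by auto
  have WD: "W \<subseteq> Some -` D" using rv(2) ND by (auto simp: W_def)
  have "A \<subseteq> N" using rv(4)[OF ND] by (force simp: A_def W_def)
  hence A: "finite A" using N(2) finite_subset by blast
  have \<phi>W: "test_function W \<phi>" using \<phi> N(3) by (auto simp: test_function_def W_def)
  have "open W" by (auto simp: W_def)
  have loc: "\<exists>s>0. \<exists>v. planar_harmonic_on (ball w s) v \<and> (\<forall>y\<in>ball w s. y \<noteq> w \<or> w \<notin> A \<longrightarrow>
      real_of_ereal (u (Some y)) = (if w \<in> A then ?m w else 0) * ln (norm (y - w)) + v y)" if w: "w \<in> W" for w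
  proof -
    have wD: "Some w \<in> D" using w WD by auto
    have "w \<notin> A \<longleftrightarrow> zero_mult h (Some w) = 0" using zero_mult_eq_0_iff(2)[OF wD] w by (simp add: A_def)
    thus ?thesis using rv[OF wD] by (intro exI[of _ "r w"] exI[of _ "v w"]) auto
  qed
  show thesis
  proof (rule that[OF A])
    show "Some ` A \<subseteq> D" using WD by (auto simp: A_def)
    show "a \<in> A" if "\<phi> a \<noteq> 0" "h (Some a) = 0" for a
    proof -
      have "a \<in> ?K" using that(1) closure_subset[of "{z. \<phi> z \<noteq> 0}"] by blast
      hence "a \<in> W" unfolding W_def using N(3) by blast
      thus ?thesis using that(2) by (simp add: A_def)
    qed
    show "(\<integral>w. real_of_ereal (u (Some w)) * laplacian \<phi> w \<partial>lborel) = 2 * pi * (\<Sum>a\<in>A. ?m a * \<phi> a)"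
      by (rule log_poles_laplacian(2)[OF \<open>open W\<close> A loc \<phi>W])
  qed
qed

text \<open>A term of the sequence at which \<phi> is nonzero sits at a point of positive
  multiplicity, hence in A. Grouping the indices by their point in A, each group has at most as many
  members as the multiplicity.\<close>

lemma vanishing_sequence_sum_le:
  assumes Z: "range Z \<subseteq> D" "vanishes_on D h Z" and c: "sphere_chart c" and A: "finite A" "c ` A \<subseteq> D"
    and nn: "\<And>w. 0 \<le> \<phi> w" and zA: "\<And>w. \<phi> w \<noteq> 0 \<Longrightarrow> c w \<in> D \<Longrightarrow> h (c w) = 0 \<Longrightarrow> w \<in> A"
  shows "(\<Sum>k. ennreal (chart_lift c \<phi> (Z k))) \<le> ennreal (\<Sum>a\<in>A. of_int (zero_mult h (c a)) * \<phi> a)"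
proof -
  have fin: "finite {k. Z k = c a}" "int (card {k. Z k = c a}) \<le> zero_mult h (c a)" if "a \<in> A" for a
    using Z(2) A(2) that by (auto simp: vanishes_on_def)
  have le: "ennreal (chart_lift c \<phi> (Z k)) \<le> (\<Sum>a\<in>A. ennreal (\<phi> a) * indicator {k. Z k = c a} k)" for k
  proof (cases rule: chart_cases[OF c, of "Z k"])
    case (1 w)
    show ?thesis
    proof (cases "\<phi> w = 0")
      case False
      have wD: "c w \<in> D" using Z(1) 1 by (metis range_subsetD)
      have "k \<in> {j. Z j = c w}" "finite {j. Z j = c w}" "int (card {j. Z j = c w}) \<le> zero_mult h (c w)"
        using Z(2) wD 1 by (auto simp: vanishes_on_def)
      hence "zero_mult h (c w) \<noteq> 0" using card_gt_0_iff[of "{j. Z j = c w}"] by force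
      hence w: "w \<in> A" using zA[OF False wD] zero_mult_eq_0_iff(2)[OF wD] by auto
      have "ennreal (chart_lift c \<phi> (Z k)) = ennreal (\<phi> w) * indicator {k. Z k = c w} k"
        by (simp add: 1 chart_lift_chart[OF c])
      also have "\<dots> \<le> (\<Sum>a\<in>A. ennreal (\<phi> a) * indicator {k. Z k = c a} k)"
        by (rule member_le_sum[OF w]) (use A in auto)
      finally show ?thesis .
    qed (simp add: 1 chart_lift_chart[OF c])
  next
    case 2
    thus ?thesis using other_chart_0[OF c] by (simp add: chart_lift_def)
  qed
  have "(\<Sum>k. ennreal (chart_lift c \<phi> (Z k))) = (\<integral>\<^sup>+k. ennreal (chart_lift c \<phi> (Z k)) \<partial>count_space UNIV)"
    by (simp add: nn_integral_count_space_nat)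
  also have "\<dots> \<le> (\<integral>\<^sup>+k. (\<Sum>a\<in>A. ennreal (\<phi> a) * indicator {k. Z k = c a} k) \<partial>count_space UNIV)"
    by (intro nn_integral_mono le)
  also have "\<dots> = (\<Sum>a\<in>A. ennreal (\<phi> a) * of_nat (card {k. Z k = c a}))"
    by (subst nn_integral_sum) (auto simp: nn_integral_cmult_indicator fin emeasure_count_space_finite intro!: sum.cong)
  also have "\<dots> \<le> (\<Sum>a\<in>A. ennreal (of_int (zero_mult h (c a)) * \<phi> a))"
  proof (rule sum_mono)
    fix a assume a: "a \<in> A"
    have "real (card {k. Z k = c a}) \<le> of_int (zero_mult h (c a))" using fin(2)[OF a] by linarith
    hence "ennreal (\<phi> a * real (card {k. Z k = c a})) \<le> ennreal (of_int (zero_mult h (c a)) * \<phi> a)"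
      using nn[of a] by (intro ennreal_leI) (simp add: mult.commute[of _ "\<phi> a"] mult_left_mono)
    thus "ennreal (\<phi> a) * of_nat (card {k. Z k = c a}) \<le> ennreal (of_int (zero_mult h (c a)) * \<phi> a)"
      using nn[of a] by (simp add: ennreal_mult ennreal_of_nat_eq_real_of_nat)
  qed
  also have "\<dots> = ennreal (\<Sum>a\<in>A. of_int (zero_mult h (c a)) * \<phi> a)"
    using nn zero_mult_eq_0_iff(1) A(2) by (intro sum_ennreal mult_nonneg_nonneg) auto
  finally show ?thesis .
qed

text \<open>The pairing of log |h| with a nonnegative test function is the sum of its values over
  all zeros with multiplicity, which dominates the sum over the sequence. At infinity the radius is
  that of a disc without other zeros.\<close>

lemma subriesz_vanishing_sequence:
  assumes Z: "range Z \<subseteq> D" "vanishes_on D h Z"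
  shows "subriesz D u (distr (count_space UNIV) sphere_borel Z)"
  unfolding subriesz_def
proof (intro conjI allI impI)
  have nn: "(\<integral>\<^sup>+p. ennreal (chart_lift c \<phi> p) \<partial>distr (count_space UNIV) sphere_borel Z) =
      (\<Sum>k. ennreal (chart_lift c \<phi> (Z k)))" if "sphere_chart c" "test_function S \<phi>" for c S \<phi>
    using sphere_smooth_measurable[OF chart_lift_smooth[OF that]]
    by (subst nn_integral_distr) (auto simp: nn_integral_count_space_nat)
  have pos: "0 \<le> (\<Sum>a\<in>A. real_of_int (zero_mult h (c a)) * \<phi> a)" if "c ` A \<subseteq> D" "\<And>w. 0 \<le> \<phi> w" for A \<phi> and c :: "complex \<Rightarrow> complex option"
    using that zero_mult_eq_0_iff(1) by (intro sum_nonneg mult_nonneg_nonneg) auto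
  show "sets (distr (count_space UNIV) sphere_borel Z) = sets sphere_borel" by simp
  {
    fix \<phi> assume "test_function (Some -` D) \<phi> \<and> (\<forall>z. 0 \<le> \<phi> z)"
    hence \<phi>: "test_function (Some -` D) \<phi>" "\<And>z. 0 \<le> \<phi> z" by auto
    from log_test_finite[OF \<phi>(1)] obtain A where A: "finite A" "Some ` A \<subseteq> D"
      "\<And>a. \<phi> a \<noteq> 0 \<Longrightarrow> h (Some a) = 0 \<Longrightarrow> a \<in> A"
      "(\<integral>w. real_of_ereal (u (Some w)) * laplacian \<phi> w \<partial>lborel) =
       2 * pi * (\<Sum>a\<in>A. of_int (zero_mult h (Some a)) * \<phi> a)" by blast
    show "0 \<le> (\<integral>w. real_of_ereal (u (Some w)) * laplacian \<phi> w \<partial>lborel)"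
      using pos[OF A(2) \<phi>(2)] by (simp add: A(4))
    show "(\<integral>\<^sup>+p. ennreal (chart_lift Some \<phi> p) \<partial>distr (count_space UNIV) sphere_borel Z) \<le>
          ennreal (1 / (2 * pi) * (\<integral>w. real_of_ereal (u (Some w)) * laplacian \<phi> w \<partial>lborel))"
      using vanishing_sequence_sum_le[OF Z sphere_chartI(1) A(1,2) \<phi>(2) A(3)] by (simp add: A(4) nn[OF _ \<phi>(1)])
  }
  assume inf: "None \<in> D"
  hence "inversion_chart 0 \<in> D" by (simp add: inversion_chart_eq)
  then obtain r where r: "r > 0" "ball 0 r \<subseteq> inversion_chart -` D"
    "\<And>w. w \<in> ball 0 r \<Longrightarrow> w \<noteq> 0 \<Longrightarrow> h (inversion_chart w) \<noteq> 0"
    "\<And>\<phi>. test_function (ball 0 r) \<phi> \<Longrightarrow> (\<integral>w. real_of_ereal (u (inversion_chart w)) * laplacian \<phi> w \<partial>lborel) =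
        2 * pi * (of_int (zero_mult h (inversion_chart 0)) * \<phi> 0)"
    using log_test_centred[of inversion_chart 0] by blast
  show "\<exists>\<delta>>0. \<forall>\<phi>. test_function (inversion_chart -` D \<inter> ball 0 \<delta>) \<phi> \<and> (\<forall>z. 0 \<le> \<phi> z) \<longrightarrow>
        0 \<le> (\<integral>w. real_of_ereal (u (inversion_chart w)) * laplacian \<phi> w \<partial>lborel) \<and>
        (\<integral>\<^sup>+p. ennreal (chart_lift inversion_chart \<phi> p) \<partial>distr (count_space UNIV) sphere_borel Z) \<le>
          ennreal (1 / (2 * pi) * (\<integral>w. real_of_ereal (u (inversion_chart w)) * laplacian \<phi> w \<partial>lborel))"
  proof (intro exI[of _ r] conjI allI impI r(1))
    fix \<phi> assume "test_function (inversion_chart -` D \<inter> ball 0 r) \<phi> \<and> (\<forall>z. 0 \<le> \<phi> z)"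
    hence \<phi>: "test_function (ball 0 r) \<phi>" "\<And>z. 0 \<le> \<phi> z" by (auto simp: test_function_def)
    have A: "w \<in> {0}" if "\<phi> w \<noteq> 0" "inversion_chart w \<in> D" "h (inversion_chart w) = 0" for w
    proof -
      have "w \<in> ball 0 r" using that(1) test_functionD(3,4)[OF \<phi>(1)] by blast
      with r(3) that(3) show ?thesis by blast
    qed
    have D0: "inversion_chart ` {0} \<subseteq> D" using inf by (simp add: inversion_chart_eq)
    show "0 \<le> (\<integral>w. real_of_ereal (u (inversion_chart w)) * laplacian \<phi> w \<partial>lborel)"
      using pos[of inversion_chart "{0}" \<phi>, OF D0 \<phi>(2)] by (simp add: r(4)[OF \<phi>(1)])
    show "(\<integral>\<^sup>+p. ennreal (chart_lift inversion_chart \<phi> p) \<partial>distr (count_space UNIV) sphere_borel Z) \<le>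
          ennreal (1 / (2 * pi) * (\<integral>w. real_of_ereal (u (inversion_chart w)) * laplacian \<phi> w \<partial>lborel))"
    proof -
      have "1 / (2 * pi) * (2 * pi * x) = x" for x :: real by simp
      moreover have "(\<Sum>k. ennreal (chart_lift inversion_chart \<phi> (Z k))) \<le>
          ennreal (\<Sum>a\<in>{0}. of_int (zero_mult h (inversion_chart a)) * \<phi> a)"
        by (rule vanishing_sequence_sum_le[OF Z sphere_chartI(2) _ D0 \<phi>(2) A]) auto
      ultimately show ?thesis unfolding nn[OF sphere_chartI(2) \<phi>(1)] r(4)[OF \<phi>(1)] by simp
    qed
  qed
qed

section \<open>Atoms of the Riesz measure of log |h|\<close>

lemma radial_bump:
  fixes a :: complex
  assumes s: "0 < s" "s < t"
  obtains \<phi> where "test_function (cball a t) \<phi>" "\<And>z. 0 \<le> \<phi> z" "\<And>z. \<phi> z \<le> 1"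
    "\<And>z. z \<in> cball a s \<Longrightarrow> \<phi> z = 1" "\<And>z. z \<notin> cball a t \<Longrightarrow> \<phi> z = 0"
proof -
  have "s\<^sup>2 < t\<^sup>2" using s by (intro power_strict_mono) auto
  then obtain \<sigma> :: "real \<Rightarrow> real" where \<sigma>: "\<And>k. Dk_on k UNIV \<sigma>" "\<And>x. 0 \<le> \<sigma> x" "\<And>x. \<sigma> x \<le> 1"
    "\<And>x. x \<le> s\<^sup>2 \<Longrightarrow> \<sigma> x = 0" "\<And>x. x \<ge> t\<^sup>2 \<Longrightarrow> \<sigma> x = 1"
    by (rule smooth_step) blast
  define \<phi> where "\<phi> z = 1 - \<sigma> ((norm (z - a))\<^sup>2)" for z
  have out: "\<phi> z = 0" if "z \<notin> cball a t" for z
  proof -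
    have "t \<le> norm (z - a)" using that by (simp add: dist_norm norm_minus_commute)
    from power_mono[OF this, of 2] s \<sigma>(5) show ?thesis by (simp add: \<phi>_def)
  qed
  have inn: "\<phi> z = 1" if "z \<in> cball a s" for z
  proof -
    have "norm (z - a) \<le> s" using that by (simp add: dist_norm norm_minus_commute)
    from power_mono[OF this, of 2] \<sigma>(4) show ?thesis by (simp add: \<phi>_def)
  qed
  have "Ck_on k UNIV \<phi>" for k
    unfolding \<phi>_def by (intro Ck_on_diff Ck_on_const Ck_on_compose_real[OF open_UNIV \<sigma>(1)] Ck_on_norm_sq) auto
  from this compact_cball subset_refl out have "test_function (cball a t) \<phi>" by (rule test_functionI)
  thus ?thesis by (rule that) (use \<sigma>(2,3) out inn in \<open>auto simp: \<phi>_def\<close>)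
qed

text \<open>A bump equal to 1 at the centre has integral exactly the multiplicity, whatever its
  radii. Squeezing it between indicators of concentric discs shows that all small discs have this
  same measure, and so has their intersection, the centre.\<close>

lemma riesz_atom:
  assumes \<nu>: "riesz_measure D u \<nu>" and p: "p \<in> D"
  shows "\<exists>V. openin csphere V \<and> p \<in> V \<and> V - {p} \<in> null_sets \<nu> \<and> emeasure \<nu> {p} = ennreal (of_int (zero_mult h p))"
proof -
  have sets: "sets \<nu> = sets sphere_borel" using \<nu> by (simp add: riesz_measure_def)
  have "\<exists>c a. (c = Some \<or> c = inversion_chart \<and> a = 0) \<and> c a = p"
  proof (cases p)
    case None
    thus ?thesis by (intro exI[of _ inversion_chart] exI[of _ 0]) (simp add: inversion_chart_eq)
  qed blast
  then obtain c a where ca: "c = Some \<or> c = inversion_chart \<and> a = 0" "p = c a" by blast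
  have c: "sphere_chart c" using ca by auto
  obtain r where r: "r > 0" "ball a r \<subseteq> c -` D"
    "\<And>\<phi>. test_function (ball a r) \<phi> \<Longrightarrow>
       (\<integral>w. real_of_ereal (u (c w)) * laplacian \<phi> w \<partial>lborel) = 2 * pi * (of_int (zero_mult h (c a)) * \<phi> a)"
    using log_test_centred[OF ca(1)] p ca(2) by metis
  let ?n = "ennreal (of_int (zero_mult h p))"
  have nn: "(\<integral>\<^sup>+q. ennreal (chart_lift c \<phi> q) \<partial>\<nu>) = ennreal (of_int (zero_mult h p) * \<phi> a)"
    if \<phi>: "test_function (ball a r) \<phi>" "\<And>z. 0 \<le> \<phi> z" for \<phi>
  proof -
    note * = riesz_measure_test[OF \<nu> c \<phi>(1) r(2)]
    have "(\<integral>\<^sup>+q. ennreal (chart_lift c \<phi> q) \<partial>\<nu>) = ennreal (\<integral>q. chart_lift c \<phi> q \<partial>\<nu>)"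
      using \<phi>(2) by (intro nn_integral_eq_integral *(1)) (simp add: chart_lift_def)
    thus ?thesis unfolding *(2) r(3)[OF \<phi>(1)] by (simp add: ca(2))
  qed
  have cs: "c ` cball a s \<in> sets \<nu>" for s
    unfolding sets by (intro closedin_sets_sphere_borel closedin_chart_image_compact c compact_cball)
  have le: "emeasure \<nu> (c ` cball a s) \<le> ?n \<and> ?n \<le> emeasure \<nu> (c ` cball a t)" if st: "0 < s" "s < t" "t < r" for s t
  proof -
    obtain \<phi> where \<phi>: "test_function (cball a t) \<phi>" "\<And>z. 0 \<le> \<phi> z" "\<And>z. \<phi> z \<le> 1"
      "\<And>z. z \<in> cball a s \<Longrightarrow> \<phi> z = 1" "\<And>z. z \<notin> cball a t \<Longrightarrow> \<phi> z = 0"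
      using radial_bump[OF st(1,2)] by blast
    have "test_function (ball a r) \<phi>" using \<phi>(1) st by (auto simp: test_function_def)
    note N = nn[OF this \<phi>(2)]
    have 1: "indicator (c ` cball a s) q \<le> ennreal (chart_lift c \<phi> q)" for q
    proof (cases "q \<in> c ` cball a s")
      case True
      then obtain z where "z \<in> cball a s" "q = c z" by blast
      thus ?thesis using \<phi>(4) by (simp add: chart_lift_chart[OF c])
    qed simp
    have 2: "ennreal (chart_lift c \<phi> q) \<le> indicator (c ` cball a t) q" for q
    proof (cases rule: chart_cases[OF c, of q])
      case (1 w)
      thus ?thesis using \<phi>(3,5)[of w]
        by (cases "w \<in> cball a t") (simp_all add: chart_lift_chart[OF c] inj_image_mem_iff[OF inj_sphere_chart[OF c]] ennreal_le_1)
    next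
      case 2
      thus ?thesis using other_chart_0[OF c] by (simp add: chart_lift_def)
    qed
    have "emeasure \<nu> (c ` cball a s) \<le> (\<integral>\<^sup>+q. ennreal (chart_lift c \<phi> q) \<partial>\<nu>)"
      unfolding nn_integral_indicator[OF cs, symmetric] by (intro nn_integral_mono 1)
    moreover have "(\<integral>\<^sup>+q. ennreal (chart_lift c \<phi> q) \<partial>\<nu>) \<le> emeasure \<nu> (c ` cball a t)"
      unfolding nn_integral_indicator[OF cs, symmetric] by (intro nn_integral_mono 2)
    moreover have "\<phi> a = 1" using \<phi>(4)[of a] st by simp
    ultimately show ?thesis unfolding N by simp
  qed
  \<comment> \<open>The squeeze is used twice, with s as inner radius and with s as outer
    radius.\<close>
  have eq: "emeasure \<nu> (c ` cball a s) = ?n" if "0 < s" "s < r" for s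
    using le[of s "(s + r) / 2"] le[of "s / 2" s] that by (intro antisym) auto
  define s where "s n = r / (2 * real (Suc n))" for n
  have s: "0 < s n" "s n < r" for n using r(1) by (auto simp: s_def field_simps intro!: add_pos_nonneg)
  have dec: "decseq (\<lambda>n. c ` cball a (s n))"
    unfolding decseq_def using r(1) by (intro allI impI image_mono subset_cball) (auto simp: s_def field_simps)
  have s0: "s \<longlonglongrightarrow> 0"
  proof -
    have "(\<lambda>n. r / 2 * inverse (real (Suc n))) \<longlonglongrightarrow> r / 2 * 0"
      by (intro tendsto_mult tendsto_const LIMSEQ_inverse_real_of_nat)
    thus ?thesis by (simp add: s_def[abs_def] field_simps)
  qed
  have "(\<Inter>n. c ` cball a (s n)) = {p}"
  proof
    show "{p} \<subseteq> (\<Inter>n. c ` cball a (s n))" using s(1) by (auto simp: ca(2) less_imp_le)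
    show "(\<Inter>n. c ` cball a (s n)) \<subseteq> {p}"
    proof
      fix q assume q: "q \<in> (\<Inter>n. c ` cball a (s n))"
      then obtain w where w: "q = c w" by blast
      have "dist a w \<le> s n" for n
        using q w by (auto simp: inj_image_mem_iff[OF inj_sphere_chart[OF c]])
      hence "dist a w \<le> 0" by (intro LIMSEQ_le_const[OF s0]) auto
      thus "q \<in> {p}" by (simp add: w ca(2))
    qed
  qed
  moreover have "(\<lambda>n. emeasure \<nu> (c ` cball a (s n))) \<longlonglongrightarrow> emeasure \<nu> (\<Inter>n. c ` cball a (s n))"
    by (rule Lim_emeasure_decseq) (use cs dec eq[OF s] in auto)
  ultimately have at: "emeasure \<nu> {p} = ?n" using eq[OF s] by (auto dest: LIMSEQ_unique[OF tendsto_const])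
  have "{p} \<in> sets \<nu>" using cs[of 0] by (simp add: ca(2))
  hence "emeasure \<nu> (c ` cball a (r / 2) - {p}) = 0"
    using emeasure_Diff[of \<nu> "{p}" "c ` cball a (r / 2)"] cs at eq[of "r / 2"] r(1) by (simp add: ca(2))
  hence "c ` cball a (r / 2) - {p} \<in> null_sets \<nu>" using cs \<open>{p} \<in> sets \<nu>\<close> by (intro null_setsI) auto
  moreover have Vo: "openin csphere (c ` ball a (r / 2))" by (rule openin_chart_image[OF c open_ball])
  moreover have "c ` ball a (r / 2) - {p} \<in> sets \<nu>"
    using sets_sphere_borel[OF Vo] sets \<open>{p} \<in> sets \<nu>\<close> by auto
  ultimately have "c ` ball a (r / 2) - {p} \<in> null_sets \<nu>" by (elim null_sets_subset) auto
  with Vo at r(1) show ?thesis by (intro exI[of _ "c ` ball a (r / 2)"]) (auto simp: ca(2))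
qed

lemma singleton_sets: "{p} \<in> sets sphere_borel"
proof -
  obtain c a where c: "sphere_chart c" "p = c a" using ex_sphere_chart by blast
  have "closedin csphere (c ` {a})" by (rule closedin_chart_image_compact[OF c(1)]) simp
  from closedin_sets_sphere_borel[OF this] show ?thesis by (simp add: c(2))
qed

text \<open>Each finite point of D has a neighbourhood that is null apart from the point. By
  Lindelof countably many of these suffice, and their exceptional points form P; infinity is simply
  added to P if it lies in D.\<close>

lemma riesz_concentrated:
  assumes \<nu>: "riesz_measure D u \<nu>"
  obtains P where "countable P" "P \<subseteq> D" "D - P \<in> null_sets \<nu>"
proof -
  have sets: "sets \<nu> = sets sphere_borel" using \<nu> by (simp add: riesz_measure_def)
  define F where "F = {B. open B \<and> (\<exists>p. Some p \<in> D \<and> Some ` B - {Some p} \<in> null_sets \<nu>)}"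
  obtain F' where F': "F' \<subseteq> F" "countable F'" "\<Union>F' = \<Union>F" by (rule Lindelof[of F]) (auto simp: F_def)
  have cover: "Some w \<in> D \<Longrightarrow> w \<in> \<Union>F" for w
  proof -
    assume w: "Some w \<in> D"
    obtain V where V: "openin csphere V" "Some w \<in> V" "V - {Some w} \<in> null_sets \<nu>" using riesz_atom[OF \<nu> w] by blast
    let ?B = "Some -` V"
    have oB: "open ?B" by (rule open_chart_vimage[OF sphere_chartI(1) V(1)])
    have "Some ` ?B \<in> sets \<nu>" unfolding sets by (intro sets_sphere_borel openin_chart_image sphere_chartI oB)
    hence "Some ` ?B - {Some w} \<in> null_sets \<nu>"
      using singleton_sets[of "Some w"] sets by (intro null_sets_subset[OF V(3)]) auto
    with oB w have "?B \<in> F" by (auto simp: F_def)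
    moreover have "w \<in> ?B" using V(2) by simp
    ultimately show ?thesis by blast
  qed
  have "\<forall>B\<in>F'. \<exists>p. Some p \<in> D \<and> Some ` B - {Some p} \<in> null_sets \<nu>" using F'(1) by (auto simp: F_def)
  then obtain p where p: "\<And>B. B \<in> F' \<Longrightarrow> Some (p B) \<in> D" "\<And>B. B \<in> F' \<Longrightarrow> Some ` B - {Some (p B)} \<in> null_sets \<nu>" by metis
  define P where "P = (insert None ((\<lambda>B. Some (p B)) ` F')) \<inter> D"
  have N: "(\<Union>B\<in>F'. Some ` B - {Some (p B)}) \<in> null_sets \<nu>" by (rule null_sets_UN'[OF F'(2) p(2)])
  have "D - P \<subseteq> (\<Union>B\<in>F'. Some ` B - {Some (p B)})"
  proof
    fix q assume q: "q \<in> D - P"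
    have "None \<in> D \<Longrightarrow> None \<in> P" by (simp add: P_def)
    then obtain w where w: "q = Some w" using q by (cases q) auto
    then obtain B where B: "B \<in> F'" "w \<in> B" using cover[of w] q F'(3) by auto
    have "q \<noteq> Some (p B)" using q B(1) by (auto simp: P_def)
    with w B show "q \<in> (\<Union>B\<in>F'. Some ` B - {Some (p B)})" by auto
  qed
  moreover have "countable P" using F'(2) by (auto simp: P_def)
  moreover from this have "D - P \<in> sets \<nu>"
    unfolding sets by (intro sets.Diff sets_sphere_borel openin_D sets.countable[OF singleton_sets])
  ultimately show thesis using N by (intro that[of P] null_sets_subset[OF N]) (auto simp: P_def)
qed

end

section \<open>Comparison of purely atomic measures\<close>

lemma nn_integral_countable_support:
  assumes f: "f \<in> borel_measurable M" and P: "countable P" "\<And>x. x \<in> P \<Longrightarrow> {x} \<in> sets M"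
    and zero: "AE x in M. x \<notin> P \<longrightarrow> f x = 0"
  shows "(\<integral>\<^sup>+x. f x \<partial>M) = (\<integral>\<^sup>+x. f x * emeasure M {x} \<partial>count_space P)"
proof -
  have PM: "P \<in> sets M" using P by (rule sets.countable[rotated])
  have "(\<integral>\<^sup>+x. f x \<partial>M) = (\<integral>\<^sup>+x. f x * indicator P x \<partial>M)"
    by (rule nn_integral_cong_AE) (use zero in eventually_elim, auto simp: indicator_def)
  also have "\<dots> = emeasure (density M f) P" using f PM by (simp add: emeasure_density)
  also have "\<dots> = (\<integral>\<^sup>+x. emeasure (density M f) {x} \<partial>count_space P)"
    by (rule emeasure_countable_singleton) (use P in auto)
  also have "\<dots> = (\<integral>\<^sup>+x. f x * emeasure M {x} \<partial>count_space P)"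
  proof (rule nn_integral_cong)
    fix x assume "x \<in> space (count_space P)"
    hence x: "{x} \<in> sets M" using P(2) by simp
    have "emeasure (density M f) {x} = (\<integral>\<^sup>+y. f x * indicator {x} y \<partial>M)"
      using f x by (subst emeasure_density) (auto intro!: nn_integral_cong simp: indicator_def)
    thus "emeasure (density M f) {x} = f x * emeasure M {x}" using x by (simp add: nn_integral_cmult_indicator)
  qed
  finally show ?thesis .
qed

context log_holomorphic
begin

text \<open>Both the Riesz measure and the counting measure of the sequence live on the countable
  set P, so they are compared atom by atom: multiplicity against number of repetitions. For a full
  zero sequence the atoms agree.\<close>

lemma riesz_mass_vanishing_sequence:
  fixes w :: "complex option \<Rightarrow> ennreal"
  assumes \<nu>: "riesz_measure D u \<nu>" and Z: "range Z \<subseteq> D" "vanishes_on D h Z"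
    and w: "w \<in> borel_measurable sphere_borel" "\<And>p. p \<notin> D \<Longrightarrow> w p = 0"
  shows "(\<Sum>k. w (Z k)) \<le> (\<integral>\<^sup>+p. w p \<partial>\<nu>)"
    and "zero_sequence D h Z \<Longrightarrow> (\<integral>\<^sup>+p. w p \<partial>\<nu>) = (\<Sum>k. w (Z k))"
proof -
  let ?\<mu> = "distr (count_space UNIV) sphere_borel Z"
  have sets: "sets \<nu> = sets sphere_borel" using \<nu> by (simp add: riesz_measure_def)
  obtain P where P: "countable P" "P \<subseteq> D" "D - P \<in> null_sets \<nu>" using riesz_concentrated[OF \<nu>] by blast
  have at\<nu>: "emeasure \<nu> {p} = ennreal (of_int (zero_mult h p))" if "p \<in> D" for p using riesz_atom[OF \<nu> that] by blast
  have at\<mu>: "emeasure ?\<mu> {p} = of_nat (card {k. Z k = p})" if "p \<in> D" for p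
  proof -
    have "Z -` {p} = {k. Z k = p}" by auto
    moreover have "finite {k. Z k = p}" using Z(2) that by (auto simp: vanishes_on_def)
    ultimately show ?thesis using singleton_sets[of p] by (simp add: emeasure_distr emeasure_count_space_finite)
  qed
  have at_le: "emeasure ?\<mu> {p} \<le> emeasure \<nu> {p}" if "p \<in> D" for p
  proof -
    have "int (card {k. Z k = p}) \<le> zero_mult h p" using Z(2) that by (auto simp: vanishes_on_def)
    hence "real (card {k. Z k = p}) \<le> of_int (zero_mult h p)" by linarith
    thus ?thesis unfolding at\<nu>[OF that] at\<mu>[OF that] by (simp add: ennreal_of_nat_eq_real_of_nat ennreal_leI)
  qed
  \<comment> \<open>Each \<open>Z k\<close> is an atom of mass at least 1 for the counting measure,
    hence carries positive Riesz mass and cannot lie in the null set D - P.\<close>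
  have ZP: "Z k \<in> P" for k
  proof (rule ccontr)
    assume "Z k \<notin> P"
    hence k: "{Z k} \<subseteq> D - P" "Z k \<in> D" using Z(1) by auto
    have "emeasure \<nu> {Z k} \<le> emeasure \<nu> (D - P)" using P(3) by (intro emeasure_mono k(1)) auto
    hence "emeasure ?\<mu> {Z k} = 0" using P(3) at_le[OF k(2)] by (simp add: null_setsD1)
    moreover have "finite {j. Z j = Z k}" using Z(2) k(2) by (auto simp: vanishes_on_def)
    ultimately show False using at\<mu>[OF k(2)] card_gt_0_iff[of "{j. Z j = Z k}"] by auto
  qed
  have I\<nu>: "(\<integral>\<^sup>+p. w p \<partial>\<nu>) = (\<integral>\<^sup>+p. w p * emeasure \<nu> {p} \<partial>count_space P)"
  proof (rule nn_integral_countable_support[OF _ P(1)])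
    show "w \<in> borel_measurable \<nu>" using w(1) measurable_cong_sets[OF sets refl] by blast
    show "AE x in \<nu>. x \<notin> P \<longrightarrow> w x = 0" using AE_not_in[OF P(3)] by eventually_elim (use w(2) in auto)
  qed (use singleton_sets sets in auto)
  have I\<mu>: "(\<Sum>k. w (Z k)) = (\<integral>\<^sup>+p. w p * emeasure ?\<mu> {p} \<partial>count_space P)"
  proof -
    have "(\<Sum>k. w (Z k)) = (\<integral>\<^sup>+p. w p \<partial>?\<mu>)" using w(1) by (simp add: nn_integral_distr nn_integral_count_space_nat)
    also have "\<dots> = (\<integral>\<^sup>+p. w p * emeasure ?\<mu> {p} \<partial>count_space P)"
    proof (rule nn_integral_countable_support[OF _ P(1)])
      have "P \<in> sets sphere_borel" by (rule sets.countable[OF singleton_sets P(1)])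
      moreover have "{x \<in> space sphere_borel. x \<notin> P \<longrightarrow> w x = 0} = P \<union> (w -` {0} \<inter> space sphere_borel)" by auto
      ultimately have "{x \<in> space sphere_borel. x \<notin> P \<longrightarrow> w x = 0} \<in> sets sphere_borel"
        using measurable_sets[OF w(1), of "{0}"] by auto
      thus "AE x in ?\<mu>. x \<notin> P \<longrightarrow> w x = 0" using ZP by (subst AE_distr_iff) auto
    qed (use w(1) singleton_sets in auto)
    finally show ?thesis .
  qed
  show "(\<Sum>k. w (Z k)) \<le> (\<integral>\<^sup>+p. w p \<partial>\<nu>)"
    unfolding I\<nu> I\<mu> using at_le P(2) by (intro nn_integral_mono mult_left_mono) auto
  assume zs: "zero_sequence D h Z"
  have "emeasure \<nu> {p} = emeasure ?\<mu> {p}" if "p \<in> D" for p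
  proof -
    have "of_int (zero_mult h p) = real (card {k. Z k = p})" using zs that by (auto simp: zero_sequence_def)
    thus ?thesis unfolding at\<nu>[OF that] at\<mu>[OF that] by (simp add: ennreal_of_nat_eq_real_of_nat)
  qed
  thus "(\<integral>\<^sup>+p. w p \<partial>\<nu>) = (\<Sum>k. w (Z k))"
    unfolding I\<nu> I\<mu> using P(2) by (intro nn_integral_cong) auto
qed

end

section \<open>The one-variable estimate\<close>

text \<open>
  The shifted linear interpolant of \<open>f\<close> with mesh \<open>h\<close>, extended by 0 to the left, is
  \<open>\<Sum>i. knot_slope f h i * max (x - (i + 1) * h) 0\<close>; the shift keeps it below \<open>f\<close>.
\<close>

definition knot_slope :: "(real \<Rightarrow> real) \<Rightarrow> real \<Rightarrow> nat \<Rightarrow> real" where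
  "knot_slope f h i =
     (f (real (Suc i) * h) - 2 * f (real i * h) + (if i = 0 then 0 else f ((real i - 1) * h))) / h"

text \<open>Second differences sum up to the current chord. The value at x is that of the chord of f
  over the mesh interval from jh to (j + 1)h, taken at x - h.\<close>

lemma knot_slope_linear_sum:
  assumes "f 0 = 0" "h > 0"
  shows "(\<Sum>i<Suc j. knot_slope f h i * (x - real (Suc i) * h)) =
    f (real j * h) + (x - real (Suc j) * h) * ((f (real (Suc j) * h) - f (real j * h)) / h)"
proof (induction j)
  case 0
  thus ?case using assms by (simp add: knot_slope_def)
next
  case (Suc j)
  have k: "knot_slope f h (Suc j) = (f (real (Suc (Suc j)) * h) - 2 * f (real (Suc j) * h) + f (real j * h)) / h"
    by (simp add: knot_slope_def)
  define A B C where "A = f (real j * h)" and "B = f (real (Suc j) * h)" and "C = f (real (Suc (Suc j)) * h)"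
  have "A + (x - real (Suc j) * h) * ((B - A) / h) + (C - 2 * B + A) / h * (x - real (Suc (Suc j)) * h)
      = B + (x - real (Suc (Suc j)) * h) * ((C - B) / h)"
    using assms(2) by (simp add: field_simps)
  thus ?case unfolding sum.lessThan_Suc[of _ "Suc j"] Suc.IH k A_def B_def C_def .
qed

lemma knot_slope_sum:
  assumes "f 0 = 0" "h > 0"
  shows "(\<Sum>i<Suc j. knot_slope f h i) = (f (real (Suc j) * h) - f (real j * h)) / h"
proof (induction j)
  case 0
  thus ?case using assms by (simp add: knot_slope_def)
next
  case (Suc j)
  thus ?case using assms(2) unfolding sum.lessThan_Suc[of _ "Suc j"] Suc.IH
    by (simp add: knot_slope_def add_divide_distrib[symmetric])
qed

text \<open>Midpoint convexity on three consecutive knots; at the first knot the missing left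
  neighbour is counted as 0, and f(0) = 0 leaves f(h)/h.\<close>

lemma knot_slope_nonneg:
  assumes f: "convex_on {0..} f" "\<And>t. 0 \<le> t \<Longrightarrow> 0 \<le> f t" "f 0 = 0" and h: "h > 0"
  shows "0 \<le> knot_slope f h i"
proof (cases i)
  case 0
  thus ?thesis using f(2)[of h] f(3) h by (simp add: knot_slope_def)
next
  case (Suc j)
  have "f ((1 - 1 / 2) *\<^sub>R (real j * h) + (1 / 2) *\<^sub>R (real (Suc i) * h)) \<le>
      (1 - 1 / 2) * f (real j * h) + (1 / 2) * f (real (Suc i) * h)"
    by (rule convex_onD[OF f(1)]) (use h in auto)
  moreover have "(1 - 1 / 2) *\<^sub>R (real j * h) + (1 / 2) *\<^sub>R (real (Suc i) * h) = real i * h"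
    using Suc by (simp add: algebra_simps)
  ultimately show ?thesis using h Suc by (simp add: knot_slope_def)
qed

text \<open>If x lies in the mesh interval starting at mh with m > 0, the shifted interpolant takes
  a value between f((m - 1)h) and f(mh). The upper end is at most f x, and the lower end is at least
  f(x - 2h) because x - 2h < (m - 1)h; this is the origin of the 2.\<close>

lemma knot_slope_minorant:
  assumes f: "convex_on {0..} f" "mono_on {0..} f" "\<And>t. 0 \<le> t \<Longrightarrow> 0 \<le> f t" "f 0 = 0" and h: "h > 0"
    and x: "0 \<le> x" "x \<le> real n * h"
  shows "(\<Sum>i<n. knot_slope f h i * max (x - real (Suc i) * h) 0) \<le> f x"
    and "2 * h \<le> x \<Longrightarrow> f (x - 2 * h) \<le> (\<Sum>i<n. knot_slope f h i * max (x - real (Suc i) * h) 0)"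
proof -
  define m where "m = nat \<lfloor>x / h\<rfloor>"
  have mx: "real m * h \<le> x" "x < real (Suc m) * h"
  proof -
    have "real m = of_int \<lfloor>x / h\<rfloor>" using x h by (simp add: m_def)
    hence "real m \<le> x / h" "x / h < real m + 1" by linarith+
    thus "real m * h \<le> x" "x < real (Suc m) * h" using h by (simp_all add: field_simps)
  qed
  have mn: "m \<le> n"
  proof -
    have "real m * h \<le> real n * h" using mx(1) x(2) by linarith
    thus ?thesis using h by simp
  qed
  have eq: "(\<Sum>i<n. knot_slope f h i * max (x - real (Suc i) * h) 0) = (\<Sum>i<m. knot_slope f h i * (x - real (Suc i) * h))"
  proof (rule sum.mono_neutral_cong_right)
    show "\<forall>i\<in>{..<n} - {..<m}. knot_slope f h i * max (x - real (Suc i) * h) 0 = 0"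
    proof
      fix i assume "i \<in> {..<n} - {..<m}"
      hence "real (Suc m) * h \<le> real (Suc i) * h" using h by (intro mult_right_mono) auto
      thus "knot_slope f h i * max (x - real (Suc i) * h) 0 = 0" using mx(2) by simp
    qed
    fix i assume "i \<in> {..<m}"
    hence "real (Suc i) * h \<le> real m * h" using h by (intro mult_right_mono) auto
    thus "knot_slope f h i * max (x - real (Suc i) * h) 0 = knot_slope f h i * (x - real (Suc i) * h)"
      using mx(1) by simp
  qed (use mn in auto)
  have "(\<Sum>i<m. knot_slope f h i * (x - real (Suc i) * h)) \<le> f x \<and>
     (2 * h \<le> x \<longrightarrow> f (x - 2 * h) \<le> (\<Sum>i<m. knot_slope f h i * (x - real (Suc i) * h)))"
  proof (cases m)
    case 0
    thus ?thesis using f(3)[OF x(1)] mx(2) h by simp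
  next
    case (Suc j)
    define d where "d = f (real m * h) - f (real j * h)"
    have d: "0 \<le> d" unfolding d_def using h Suc mono_onD[OF f(2), of "real j * h" "real m * h"] by auto
    have S: "(\<Sum>i<m. knot_slope f h i * (x - real (Suc i) * h)) = f (real j * h) + (x - real m * h) / h * d"
      unfolding Suc knot_slope_linear_sum[where f = f, OF f(4) h] d_def by simp
    have q: "0 \<le> (x - real m * h) / h" "(x - real m * h) / h \<le> 1"
      using mx h by (simp_all add: field_simps)
    have "(x - real m * h) / h * d \<le> 1 * d" using q(2) d by (rule mult_right_mono)
    moreover have "f (real m * h) \<le> f x" using mx(1) h x(1) by (intro mono_onD[OF f(2)]) auto
    moreover have "0 \<le> (x - real m * h) / h * d" by (rule mult_nonneg_nonneg[OF q(1) d])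
    moreover have "f (x - 2 * h) \<le> f (real j * h)" if "2 * h \<le> x"
      using that mx(2) Suc h by (intro mono_onD[OF f(2)]) (auto simp: algebra_simps)
    ultimately show ?thesis unfolding S by (simp add: d_def) linarith
  qed
  thus "(\<Sum>i<n. knot_slope f h i * max (x - real (Suc i) * h) 0) \<le> f x"
    and "2 * h \<le> x \<Longrightarrow> f (x - 2 * h) \<le> (\<Sum>i<n. knot_slope f h i * max (x - real (Suc i) * h) 0)"
    unfolding eq by blast+
qed

section \<open>Convex functions of class C^2 and Taylor's formula\<close>

lemma C2_onD:
  assumes "C2_on {..<0} F" "x < 0"
  shows "(F has_real_derivative deriv F x) (at x)" "(deriv F has_real_derivative deriv (deriv F) x) (at x)"
  using assms by (auto simp: C2_on_def differentiable_on_eq_differentiable_at DERIV_deriv_iff_real_differentiable)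

lemma convex_C2_derivs:
  assumes F: "convex_on {..<0} F" "mono_on {..<0} F" "C2_on {..<0} F" and x: "x < (0::real)"
  shows "0 \<le> deriv F x" "0 \<le> deriv (deriv F) x" "y < 0 \<Longrightarrow> deriv F x * (y - x) \<le> F y - F x"
proof -
  have tan: "deriv F x * (y - x) \<le> F y - F x" if "x < 0" "y < 0" for x y
    by (rule convex_on_imp_above_tangent[OF F(1)])
       (use that C2_onD(1)[OF F(3) that(1)] in \<open>auto simp: interior_open intro: has_field_derivative_at_within\<close>)
  thus "y < 0 \<Longrightarrow> deriv F x * (y - x) \<le> F y - F x" using x by blast
  show "0 \<le> deriv F x"
    by (rule mono_on_imp_deriv_nonneg[OF F(2) C2_onD(1)[OF F(3) x]]) (use x in \<open>simp add: interior_open\<close>)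
  have "mono_on {..<0} (deriv F)"
  proof (rule mono_onI)
    fix r s :: real assume rs: "r \<in> {..<0}" "s \<in> {..<0}" "r \<le> s"
    show "deriv F r \<le> deriv F s"
    proof (cases "r = s")
      case False
      have "deriv F r * (s - r) \<le> deriv F s * (s - r)" using tan[of r s] tan[of s r] rs by (simp add: algebra_simps)
      thus ?thesis using False rs(3) by simp
    qed simp
  qed
  from mono_on_imp_deriv_nonneg[OF this C2_onD(2)[OF F(3) x]] x
  show "0 \<le> deriv (deriv F) x" by (simp add: interior_open)
qed

text \<open>An antiderivative of (q - s) F''(-q) is -(q - s) F'(-q) - F(-q); between s and t it
  yields Taylor's formula at -t with integral remainder. The indicator extends F'' measurably to the
  line, and the remainder is nonnegative since F lies above its tangent.\<close>

lemma Taylor_nn_integral: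
  assumes F: "convex_on {..<0} F" "mono_on {..<0} F" "C2_on {..<0} F" and s: "0 < s" "s \<le> t"
  shows "(\<lambda>q. indicator {0<..} q * deriv (deriv F) (- q)) \<in> borel_measurable borel"
    and "(\<integral>\<^sup>+q. ennreal ((q - s) * (indicator {0<..} q * deriv (deriv F) (- q))) * indicator {s..t} q \<partial>lborel) =
       ennreal (F (- s) - F (- t) - (t - s) * deriv F (- t))"
    and "0 \<le> F (- s) - F (- t) - (t - s) * deriv F (- t)"
proof -
  let ?G = "\<lambda>q. indicator {0<..} q * deriv (deriv F) (- q)"
  have "continuous_on {0<..} (\<lambda>q. deriv (deriv F) (- q))"
    using F(3) by (intro continuous_on_compose2[of "{..<0}" "deriv (deriv F)" "{0<..}" uminus]) (auto simp: C2_on_def intro!: continuous_intros)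
  from borel_measurable_continuous_on_indicator[OF _ this]
  show m: "?G \<in> borel_measurable borel" by simp
  let ?\<Phi> = "\<lambda>q. - (q - s) * deriv F (- q) - F (- q)"
  have G0: "0 \<le> ?G q" for q using convex_C2_derivs(2)[OF F, of "- q"] by (cases "q > 0") auto
  have "(\<integral>\<^sup>+q. ennreal ((q - s) * ?G q) * indicator {s..t} q \<partial>lborel) = ennreal (?\<Phi> t - ?\<Phi> s)"
  proof (rule nn_integral_FTC_Icc[where F = "?\<Phi>"])
    show "(\<lambda>q. (q - s) * ?G q) \<in> borel_measurable borel" using m by simp
    fix q assume "q \<in> {s..t}"
    hence q: "s \<le> q" "q \<le> t" by auto
    have n: "- q < 0" using q s by simp
    have dm: "((\<lambda>x. - x) has_real_derivative - 1) (at q)" by (auto intro!: derivative_eq_intros)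
    have d1: "((\<lambda>q. F (- q)) has_real_derivative - deriv F (- q)) (at q)"
      using DERIV_chain2[where f = F and g = "\<lambda>x. - x", OF C2_onD(1)[OF F(3) n] dm] by simp
    have d2: "((\<lambda>q. deriv F (- q)) has_real_derivative - deriv (deriv F) (- q)) (at q)"
      using DERIV_chain2[where f = "deriv F" and g = "\<lambda>x. - x", OF C2_onD(2)[OF F(3) n] dm] by simp
    show "(?\<Phi> has_real_derivative (q - s) * ?G q) (at q)"
      by (rule derivative_eq_intros d1 d2 refl)+ (use q s in \<open>simp add: algebra_simps\<close>)
    show "0 \<le> (q - s) * ?G q" by (rule mult_nonneg_nonneg[OF _ G0]) (use q in simp)
  qed (use s in auto)
  thus "(\<integral>\<^sup>+q. ennreal ((q - s) * ?G q) * indicator {s..t} q \<partial>lborel) =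
       ennreal (F (- s) - F (- t) - (t - s) * deriv F (- t))" by (simp add: algebra_simps)
  show "0 \<le> F (- s) - F (- t) - (t - s) * deriv F (- t)"
    using convex_C2_derivs(3)[OF F, of "- t" "- s"] s by (simp add: algebra_simps)
qed

text \<open>Up to t1 = t0/2 the function f is approximated from below by ramps, and each F(-s) is
  expanded at -t1: the remainders assemble to the integral of the minorant against F'', the affine
  parts to a constant. Above t1 the value f y is at most b \<le> (4b/t0)(y - t0/4), which
  \<open>N\<close> at t0/4 controls.\<close>

lemma convex_mono_mass_bound:
  fixes \<gamma> :: "'a \<Rightarrow> real"
  assumes f: "convex_on {0..} f" "mono_on {0..} f" "\<And>t. 0 \<le> t \<Longrightarrow> 0 \<le> f t" "f 0 = 0" "f t0 \<le> b"
    and F: "convex_on {..<0} F" "mono_on {..<0} F" "C2_on {..<0} F" and t0: "t0 > 0"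
    and \<gamma>: "\<gamma> \<in> borel_measurable M" "\<And>x. x \<in> space M \<Longrightarrow> 0 \<le> \<gamma> x \<and> \<gamma> x \<le> t0"
    and N: "\<And>s. 0 < s \<Longrightarrow> s < t0 \<Longrightarrow> (\<integral>\<^sup>+x. ennreal (\<gamma> x - s) \<partial>M) \<le> ennreal (F (- s) - u0)"
    and u0: "\<And>s. 0 < s \<Longrightarrow> s < t0 \<Longrightarrow> u0 \<le> F (- s)"
  shows "(\<integral>\<^sup>+x. ennreal (f (\<gamma> x)) \<partial>M) \<le> majorant_integral F t0 f +
    ennreal (6 * b / t0 * (2 * \<bar>F (- (t0 / 8))\<bar> + \<bar>F (- (t0 / 2))\<bar>) - 6 * b / t0 * u0)"
    and "0 \<le> 6 * b / t0 * (2 * \<bar>F (- (t0 / 8))\<bar> + \<bar>F (- (t0 / 2))\<bar>) - 6 * b / t0 * u0"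
proof -
  define t1 where "t1 = t0 / 2"
  define F' where "F' = deriv F (- t1)"
  define h where "h n = t1 / real (Suc n)" for n
  define a where "a n = knot_slope f (h n)" for n
  define s where "s n i = real (Suc i) * h n" for n i
  define fn where "fn n y = (\<Sum>i<Suc n. a n i * max (y - s n i) 0)" for n y
  define G where "G q = indicator {0<..} q * deriv (deriv F) (- q)" for q
  \<comment> \<open>The affine part of the expansions at -t1, summed over the knots: the total slope
    is at most 2b/t0, and the factor of F'(-t1) is the minorant at t1, which is at most f(t1) \<le>
    b.\<close>
  define K1 where "K1 = 2 * b / t0 * (F (- t1) - u0) + b * F'"
  have b: "0 \<le> b" using f(3)[of t0] f(5) t0 by simp
  have t1: "0 < t1" "t1 < t0" using t0 by (auto simp: t1_def)
  have h: "0 < h n" "real (Suc n) * h n = t1" for n using t1 by (auto simp: h_def)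
  have sn: "0 < s n i" for n i using h(1) by (simp add: s_def)
  have st: "s n i \<le> t1" if "i < Suc n" for n i
  proof -
    have "s n i \<le> real (Suc n) * h n" unfolding s_def using that h(1)[of n] by (intro mult_right_mono) auto
    thus ?thesis using h(2) by simp
  qed
  have a0: "0 \<le> a n i" for n i unfolding a_def by (rule knot_slope_nonneg[OF f(1,3,4) h(1)])
  \<comment> \<open>The knot slopes telescope to the last chord before t1, which by convexity is no
    steeper than the chord from t1 to t0, of slope at most b / (t0/2).\<close>
  have asum: "(\<Sum>i<Suc n. a n i) \<le> 2 * b / t0" for n
  proof -
    let ?x = "real n * h n"
    have x: "0 \<le> ?x" "?x < t1" "t1 - ?x = h n" using h(1)[of n] h(2)[of n] by (auto simp: algebra_simps)
    have "(f t1 - f ?x) / (t1 - ?x) \<le> (f t0 - f t1) / (t0 - t1)"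
      using convex_on_slope_le[OF f(1), of ?x t0 t1] x t1 by (simp add: field_simps)
    also have "\<dots> \<le> b / (t0 - t1)" using f(5) f(3)[of t1] t1 by (intro divide_right_mono) auto
    also have "\<dots> = 2 * b / t0" by (simp add: t1_def field_simps)
    finally show ?thesis unfolding a_def knot_slope_sum[where f = f, OF f(4) h(1)] h(2) x(3) .
  qed
  have F'0: "0 \<le> F'" unfolding F'_def using convex_C2_derivs(1)[OF F] t1 by simp
  have Gm: "G \<in> borel_measurable borel" unfolding G_def by (rule Taylor_nn_integral(1)[OF F t1(1) order_refl])
  have G0: "0 \<le> G q" for q using convex_C2_derivs(2)[OF F, of "- q"] by (cases "q > 0") (auto simp: G_def)
  have fn_le: "fn n q \<le> f q" if "0 \<le> q" "q \<le> t1" for n q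
    unfolding fn_def a_def s_def using that h(2)[of n] by (intro knot_slope_minorant(1)[OF f(1-4) h(1)]) auto
  have fn0: "0 \<le> fn n q" for n q unfolding fn_def using a0 by (intro sum_nonneg mult_nonneg_nonneg) auto
  have step: "(\<integral>\<^sup>+x. ennreal (fn n (\<gamma> x)) \<partial>M) \<le> majorant_integral F t0 f + ennreal K1" for n
  proof -
    define J where "J i = (\<integral>\<^sup>+q. ennreal ((q - s n i) * G q) * indicator {s n i..t1} q \<partial>lborel)" for i
    \<comment> \<open>Taylor's formula at -t1. Both summands are nonnegative before being turned
      into extended nonnegative numbers, so nothing is cut off.\<close>
    have lin: "ennreal (F (- s n i) - u0) = ennreal (F (- t1) - u0 + (t1 - s n i) * F') + J i" if "i < Suc n" for i
    proof -
      note T = Taylor_nn_integral[OF F sn[of n i] st[OF that], folded G_def]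
      have "0 \<le> F (- t1) - u0 + (t1 - s n i) * F'" using u0[OF t1] st[OF that] F'0 by simp
      thus ?thesis unfolding J_def T(2) using T(3) by (simp add: F'_def flip: ennreal_plus)
    qed
    have m: "(\<lambda>x. ennreal (\<gamma> x - s n i)) \<in> borel_measurable M" for i using \<gamma>(1) by simp
    have "(\<integral>\<^sup>+x. ennreal (fn n (\<gamma> x)) \<partial>M) = (\<integral>\<^sup>+x. (\<Sum>i<Suc n. ennreal (a n i) * ennreal (\<gamma> x - s n i)) \<partial>M)"
    proof (rule nn_integral_cong)
      fix x
      have "ennreal (max y 0) = ennreal y" for y by (simp add: max_def ennreal_neg)
      thus "ennreal (fn n (\<gamma> x)) = (\<Sum>i<Suc n. ennreal (a n i) * ennreal (\<gamma> x - s n i))"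
        unfolding fn_def using a0 by (subst sum_ennreal[symmetric]) (auto simp: ennreal_mult)
    qed
    also have "\<dots> = (\<Sum>i<Suc n. ennreal (a n i) * (\<integral>\<^sup>+x. ennreal (\<gamma> x - s n i) \<partial>M))"
      using m by (subst nn_integral_sum) (auto simp: nn_integral_cmult)
    also have "\<dots> \<le> (\<Sum>i<Suc n. ennreal (a n i) * (ennreal (F (- t1) - u0 + (t1 - s n i) * F') + J i))"
    proof (rule sum_mono)
      fix i assume "i \<in> {..<Suc n}"
      hence i: "i < Suc n" by simp
      have "(\<integral>\<^sup>+x. ennreal (\<gamma> x - s n i) \<partial>M) \<le> ennreal (F (- s n i) - u0)"
        by (rule N[OF sn]) (use st[OF i] t1 in linarith)
      thus "ennreal (a n i) * (\<integral>\<^sup>+x. ennreal (\<gamma> x - s n i) \<partial>M) \<le>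
          ennreal (a n i) * (ennreal (F (- t1) - u0 + (t1 - s n i) * F') + J i)"
        unfolding lin[OF i] by (rule mult_left_mono) simp
    qed
    also have "\<dots> = (\<Sum>i<Suc n. ennreal (a n i * (F (- t1) - u0 + (t1 - s n i) * F'))) + (\<Sum>i<Suc n. ennreal (a n i) * J i)"
      unfolding ennreal_mult'[OF a0] by (simp only: distrib_left sum.distrib)
    also have "(\<Sum>i<Suc n. ennreal (a n i * (F (- t1) - u0 + (t1 - s n i) * F'))) \<le> ennreal K1"
    proof -
      have nn: "0 \<le> a n i * (F (- t1) - u0 + (t1 - s n i) * F')" if "i \<in> {..<Suc n}" for i
        using that a0 u0[OF t1] st[of i n] F'0 by (intro mult_nonneg_nonneg add_nonneg_nonneg) auto
      have fnt: "fn n t1 = (\<Sum>i<Suc n. a n i * (t1 - s n i))"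
        unfolding fn_def
      proof (rule sum.cong)
        fix i assume "i \<in> {..<Suc n}"
        thus "a n i * max (t1 - s n i) 0 = a n i * (t1 - s n i)" using st[of i n] by simp
      qed simp
      have "(\<Sum>i<Suc n. a n i * (F (- t1) - u0 + (t1 - s n i) * F')) = (\<Sum>i<Suc n. a n i) * (F (- t1) - u0) + fn n t1 * F'"
        unfolding fnt sum_distrib_right sum.distrib[symmetric] by (rule sum.cong) (auto simp: algebra_simps)
      also have "\<dots> \<le> 2 * b / t0 * (F (- t1) - u0) + b * F'"
      proof -
        have "fn n t1 \<le> b" using fn_le[of t1 n] t1 mono_onD[OF f(2), of t1 t0] f(5) by simp
        thus ?thesis using asum u0[OF t1] F'0 by (intro add_mono mult_right_mono) auto
      qed
      finally have "(\<Sum>i<Suc n. a n i * (F (- t1) - u0 + (t1 - s n i) * F')) \<le> K1" unfolding K1_def .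
      thus ?thesis using nn by (subst sum_ennreal) (auto intro: ennreal_leI)
    qed
    also have "(\<Sum>i<Suc n. ennreal (a n i) * J i) =
       (\<integral>\<^sup>+q. (\<Sum>i<Suc n. ennreal (a n i) * (ennreal ((q - s n i) * G q) * indicator {s n i..t1} q)) \<partial>lborel)"
      unfolding J_def using Gm by (subst nn_integral_sum) (auto simp: nn_integral_cmult)
    also have "\<dots> \<le> majorant_integral F t0 f"
      unfolding majorant_integral_def
    proof (rule nn_integral_mono)
      fix q :: real
      show "(\<Sum>i<Suc n. ennreal (a n i) * (ennreal ((q - s n i) * G q) * indicator {s n i..t1} q))
          \<le> ennreal (f q * deriv (deriv F) (- q)) * indicator {0<..<t0} q"
      proof (cases "0 < q \<and> q \<le> t1")
        case True
        have "(\<Sum>i<Suc n. ennreal (a n i) * (ennreal ((q - s n i) * G q) * indicator {s n i..t1} q))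
            \<le> (\<Sum>i<Suc n. ennreal (a n i * max (q - s n i) 0 * G q))"
        proof (rule sum_mono)
          fix i
          show "ennreal (a n i) * (ennreal ((q - s n i) * G q) * indicator {s n i..t1} q) \<le> ennreal (a n i * max (q - s n i) 0 * G q)"
            using a0[of n i] by (cases "s n i \<le> q") (auto simp: indicator_def ennreal_mult'[symmetric] mult.assoc)
        qed
        also have "\<dots> = ennreal (fn n q * G q)"
          unfolding fn_def sum_distrib_right using a0 G0 by (intro sum_ennreal mult_nonneg_nonneg) auto
        also have "\<dots> \<le> ennreal (f q * G q)" using fn_le[of q n] True G0 by (intro ennreal_leI mult_right_mono) auto
        finally show ?thesis using True t1 by (simp add: G_def)
      next
        case False
        have "ennreal (a n i) * (ennreal ((q - s n i) * G q) * indicator {s n i..t1} q) = 0" for i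
          using False sn[of n i] by (auto simp: indicator_def)
        thus ?thesis by (simp only: sum.neutral_const) simp
      qed
    qed
    finally show ?thesis by (simp add: add.commute add_mono)
  qed
  have fcont: "continuous_on {0<..} f" by (rule convex_on_continuous) (auto intro: convex_on_subset[OF f(1)])
  \<comment> \<open>The meshes are not nested, so the minorants need not increase with n. A lower
    limit and Fatou's lemma replace monotone convergence; continuity of f away from 0 gives f(y -
    2h) \<longrightarrow> f y.\<close>
  have lim: "ennreal (f y) \<le> liminf (\<lambda>n. ennreal (fn n y)) + ennreal (4 * b / t0 * (y - t0 / 4))"
    if y: "0 \<le> y" "y \<le> t0" for y
  proof -
    consider "y = 0" | "0 < y" "y \<le> t1" | "t1 < y" using y by linarith
    thus ?thesis
    proof cases
      case 1
      thus ?thesis using f(4) by simp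
    next
      case 2
      have h0: "h \<longlonglongrightarrow> 0"
      proof -
        have "(\<lambda>n. t1 * inverse (real (Suc n))) \<longlonglongrightarrow> t1 * 0"
          by (intro tendsto_mult tendsto_const LIMSEQ_inverse_real_of_nat)
        thus ?thesis by (simp add: h_def[abs_def] divide_inverse)
      qed
      have "(\<lambda>n. y - 2 * h n) \<longlonglongrightarrow> y - 2 * 0" by (intro tendsto_intros h0)
      moreover have "isCont f y" using fcont 2 by (simp add: continuous_on_eq_continuous_at)
      ultimately have "(\<lambda>n. f (y - 2 * h n)) \<longlonglongrightarrow> f y" by (intro isCont_tendsto_compose[of y f]) auto
      hence "(\<lambda>n. ennreal (f (y - 2 * h n))) \<longlonglongrightarrow> ennreal (f y)" by (rule tendsto_ennrealI)
      hence "ennreal (f y) = liminf (\<lambda>n. ennreal (f (y - 2 * h n)))" by (intro lim_imp_Liminf[symmetric]) auto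
      also have "\<dots> \<le> liminf (\<lambda>n. ennreal (fn n y))"
      proof (rule Liminf_mono)
        have "\<forall>\<^sub>F n in sequentially. h n < y / 2" using order_tendstoD(2)[OF h0, of "y / 2"] 2 by simp
        thus "\<forall>\<^sub>F n in sequentially. ennreal (f (y - 2 * h n)) \<le> ennreal (fn n y)"
        proof eventually_elim
          case (elim n)
          show ?case unfolding fn_def a_def s_def
            by (intro ennreal_leI knot_slope_minorant(2)[OF f(1-4) h(1)]) (use 2 elim h(2)[of n] in auto)
        qed
      qed
      also have "\<dots> \<le> liminf (\<lambda>n. ennreal (fn n y)) + ennreal (4 * b / t0 * (y - t0 / 4))" by simp
      finally show ?thesis .
    next
      case 3
      have "f y \<le> b" using mono_onD[OF f(2), of y t0] y t0 f(5) by simp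
      also have "b = 4 * b / t0 * (t0 / 4)" using t0 by simp
      also have "\<dots> \<le> 4 * b / t0 * (y - t0 / 4)" using 3 b t0 by (intro mult_left_mono) (auto simp: t1_def)
      finally have "ennreal (f y) \<le> ennreal (4 * b / t0 * (y - t0 / 4))" by (rule ennreal_leI)
      also have "\<dots> \<le> liminf (\<lambda>n. ennreal (fn n y)) + ennreal (4 * b / t0 * (y - t0 / 4))" by simp
      finally show ?thesis .
    qed
  qed
  have fnm: "(\<lambda>x. ennreal (fn n (\<gamma> x))) \<in> borel_measurable M" for n unfolding fn_def using \<gamma>(1) by simp
  have lm: "(\<lambda>x. liminf (\<lambda>n. ennreal (fn n (\<gamma> x)))) \<in> borel_measurable M" by (rule borel_measurable_liminf[OF fnm])
  have m4: "(\<lambda>x. ennreal (\<gamma> x - t0 / 4)) \<in> borel_measurable M" using \<gamma>(1) by simp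
  have b4: "0 \<le> 4 * b / t0" using b t0 by simp
  have K0: "0 \<le> K1" "0 \<le> 4 * b / t0 * (F (- (t0 / 4)) - u0)"
  proof -
    show "0 \<le> K1" unfolding K1_def using b t0 u0[OF t1] F'0 by simp
    show "0 \<le> 4 * b / t0 * (F (- (t0 / 4)) - u0)" using b4 u0[of "t0 / 4"] t0 by (intro mult_nonneg_nonneg) auto
  qed
  \<comment> \<open>With B = b/t0, the chord from -t0/2 to -t0/8, of length 3 t0/8, gives b F'(-t1)
    \<le> (8/3) B (F8 - F2), and F(-t0/4) \<le> F8. Together with the coefficients 2 and 4 this
    makes B (20/3 F8 - 2/3 F2 - 6 u0). The first two coefficients are rounded up to 12 and 6 in
    absolute value, so that 6 can be factored out; the last one is kept.\<close>
  have K: "K1 + 4 * b / t0 * (F (- (t0 / 4)) - u0) \<le>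
      6 * b / t0 * (2 * \<bar>F (- (t0 / 8))\<bar> + \<bar>F (- (t0 / 2))\<bar>) - 6 * b / t0 * u0"
  proof -
    let ?F8 = "F (- (t0 / 8))" and ?F2 = "F (- (t0 / 2))" and ?B = "b / t0"
    have B: "0 \<le> ?B" using b t0 by simp
    have "F' * (3 * t0 / 8) \<le> ?F8 - ?F2"
      using convex_C2_derivs(3)[OF F, of "- t1" "- (t0 / 8)"] t0 by (simp add: F'_def t1_def)
    hence "?B * (8 / 3 * (F' * (3 * t0 / 8))) \<le> ?B * (8 / 3 * (?F8 - ?F2))" using B by (intro mult_left_mono) auto
    moreover have "?B * (8 / 3 * (F' * (3 * t0 / 8))) = b * F'" using t0 by simp
    ultimately have "b * F' \<le> ?B * (8 / 3 * (?F8 - ?F2))" by linarith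
    moreover have "F (- (t0 / 4)) \<le> ?F8" using t0 by (intro mono_onD[OF F(2)]) auto
    hence "4 * ?B * (F (- (t0 / 4)) - u0) \<le> 4 * ?B * (?F8 - u0)" using B by (intro mult_left_mono) auto
    ultimately have "K1 + 4 * b / t0 * (F (- (t0 / 4)) - u0) \<le>
        2 * ?B * (?F2 - u0) + ?B * (8 / 3 * (?F8 - ?F2)) + 4 * ?B * (?F8 - u0)"
      by (simp add: K1_def t1_def)
    also have "\<dots> = ?B * (20 / 3 * ?F8 - 2 / 3 * ?F2 - 6 * u0)" by (simp add: algebra_simps)
    also have "\<dots> \<le> ?B * (6 * (2 * \<bar>?F8\<bar> + \<bar>?F2\<bar>) - 6 * u0)" using B by (intro mult_left_mono) (auto simp: abs_if)
    also have "\<dots> = 6 * b / t0 * (2 * \<bar>?F8\<bar> + \<bar>?F2\<bar>) - 6 * b / t0 * u0" by (simp add: algebra_simps)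
    finally show "K1 + 4 * b / t0 * (F (- (t0 / 4)) - u0) \<le> 6 * b / t0 * (2 * \<bar>?F8\<bar> + \<bar>?F2\<bar>) - 6 * b / t0 * u0" .
  qed
  have "(\<integral>\<^sup>+x. ennreal (f (\<gamma> x)) \<partial>M) \<le>
      (\<integral>\<^sup>+x. liminf (\<lambda>n. ennreal (fn n (\<gamma> x))) + ennreal (4 * b / t0) * ennreal (\<gamma> x - t0 / 4) \<partial>M)"
    using lim \<gamma>(2) b4 by (intro nn_integral_mono) (simp add: ennreal_mult'[symmetric])
  also have "\<dots> = (\<integral>\<^sup>+x. liminf (\<lambda>n. ennreal (fn n (\<gamma> x))) \<partial>M) + ennreal (4 * b / t0) * (\<integral>\<^sup>+x. ennreal (\<gamma> x - t0 / 4) \<partial>M)"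
    using lm m4 by (simp add: nn_integral_add nn_integral_cmult)
  also have "\<dots> \<le> (majorant_integral F t0 f + ennreal K1) + ennreal (4 * b / t0) * ennreal (F (- (t0 / 4)) - u0)"
  proof (intro add_mono mult_left_mono)
    have "(\<integral>\<^sup>+x. liminf (\<lambda>n. ennreal (fn n (\<gamma> x))) \<partial>M) \<le> liminf (\<lambda>n. \<integral>\<^sup>+x. ennreal (fn n (\<gamma> x)) \<partial>M)"
      by (rule nn_integral_liminf[OF fnm])
    also have "\<dots> \<le> liminf (\<lambda>n. majorant_integral F t0 f + ennreal K1)" by (intro Liminf_mono always_eventually allI step)
    also have "\<dots> = majorant_integral F t0 f + ennreal K1" by (intro Liminf_const) auto
    finally show "(\<integral>\<^sup>+x. liminf (\<lambda>n. ennreal (fn n (\<gamma> x))) \<partial>M) \<le> majorant_integral F t0 f + ennreal K1" .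
    show "(\<integral>\<^sup>+x. ennreal (\<gamma> x - t0 / 4) \<partial>M) \<le> ennreal (F (- (t0 / 4)) - u0)" using N[of "t0 / 4"] t0 by simp
  qed auto
  also have "\<dots> = majorant_integral F t0 f + ennreal (K1 + 4 * b / t0 * (F (- (t0 / 4)) - u0))"
    using K0 b4 by (simp only: ennreal_mult'[symmetric] ennreal_plus add.assoc)
  also have "\<dots> \<le> majorant_integral F t0 f +
    ennreal (6 * b / t0 * (2 * \<bar>F (- (t0 / 8))\<bar> + \<bar>F (- (t0 / 2))\<bar>) - 6 * b / t0 * u0)"
    by (intro add_left_mono ennreal_leI K)
  finally show "(\<integral>\<^sup>+x. ennreal (f (\<gamma> x)) \<partial>M) \<le> majorant_integral F t0 f +
    ennreal (6 * b / t0 * (2 * \<bar>F (- (t0 / 8))\<bar> + \<bar>F (- (t0 / 2))\<bar>) - 6 * b / t0 * u0)" .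
  show "0 \<le> 6 * b / t0 * (2 * \<bar>F (- (t0 / 8))\<bar> + \<bar>F (- (t0 / 2))\<bar>) - 6 * b / t0 * u0"
    using K K0 by linarith
qed

text \<open>Convexity of f at the points 1/x and 1/y, with weights that bring their combination to
  the reciprocal of the combination of x and y. Monotonicity holds because 1/t and f both decrease.
  At t = 0 the convention 1/0 = 0 is harmless thanks to the factor t.\<close>

lemma perspective_convex:
  fixes f :: "real \<Rightarrow> real"
  assumes f: "convex_on {0..} f" "antimono_on {0..} f" "\<And>t. 0 \<le> t \<Longrightarrow> 0 \<le> f t"
  shows "convex_on {0..} (\<lambda>t. t * f (1 / t))" "mono_on {0..} (\<lambda>t. t * f (1 / t))"
proof -
  have anti: "f y \<le> f x" if "0 \<le> x" "x \<le> y" for x y using f(2) that by (auto simp: monotone_on_def)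
  have scale: "c * y * f (1 / (c * y)) \<le> c * (y * f (1 / y))" if "0 < c" "c < 1" "0 \<le> y" for c y
  proof (cases "y = 0")
    case False
    have "1 / y \<le> 1 / (c * y)" using that False by (intro divide_left_mono) (auto simp: mult_le_cancel_right1)
    hence "f (1 / (c * y)) \<le> f (1 / y)" using that by (intro anti) auto
    hence "c * y * f (1 / (c * y)) \<le> c * y * f (1 / y)" using that by (intro mult_left_mono) auto
    thus ?thesis by (simp add: mult.assoc)
  qed simp
  show "convex_on {0..} (\<lambda>t. t * f (1 / t))"
  proof (rule convex_onI)
    fix t x y :: real assume t: "0 < t" "t < 1" and xy: "x \<in> {0..}" "y \<in> {0..}"
    show "((1 - t) *\<^sub>R x + t *\<^sub>R y) * f (1 / ((1 - t) *\<^sub>R x + t *\<^sub>R y)) \<le> (1 - t) * (x * f (1 / x)) + t * (y * f (1 / y))"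
    proof (cases "x = 0 \<or> y = 0")
      case True
      thus ?thesis using scale[of t y] scale[of "1 - t" x] t xy by auto
    next
      case False
      hence pos: "0 < x" "0 < y" using xy by auto
      define Z where "Z = (1 - t) * x + t * y"
      have Z: "0 < Z" unfolding Z_def using t pos by (intro add_pos_pos mult_pos_pos) auto
      \<comment> \<open>Chosen so that (1 - l)/x + l/y = 1/Z.\<close>
      define l where "l = t * y / Z"
      have l: "0 \<le> l" "l \<le> 1" "1 - l = (1 - t) * x / Z"
        using t pos Z by (auto simp: l_def Z_def field_simps)
      have "f ((1 - l) *\<^sub>R (1 / x) + l *\<^sub>R (1 / y)) \<le> (1 - l) * f (1 / x) + l * f (1 / y)"
        by (rule convex_onD[OF f(1)]) (use l pos in auto)
      moreover have "(1 - l) *\<^sub>R (1 / x) + l *\<^sub>R (1 / y) = 1 / Z"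
        unfolding l(3) using pos Z by (simp add: l_def add_divide_distrib[symmetric])
      ultimately have "Z * f (1 / Z) \<le> Z * ((1 - l) * f (1 / x) + l * f (1 / y))" using Z by (intro mult_left_mono) auto
      also have "\<dots> = (1 - t) * (x * f (1 / x)) + t * (y * f (1 / y))"
        unfolding l(3) using Z by (simp add: l_def distrib_left)
      finally show ?thesis by (simp add: Z_def)
    qed
  qed simp
  show "mono_on {0..} (\<lambda>t. t * f (1 / t))"
  proof (rule mono_onI)
    fix r s :: real assume rs: "r \<in> {0..}" "s \<in> {0..}" "r \<le> s"
    show "r * f (1 / r) \<le> s * f (1 / s)"
    proof (cases "r = 0")
      case True
      thus ?thesis using rs f(3)[of "1 / s"] by simp
    next
      case False
      hence "1 / s \<le> 1 / r" "0 \<le> 1 / s" using rs by (auto intro!: divide_left_mono)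
      hence "f (1 / r) \<le> f (1 / s)" by (intro anti)
      thus ?thesis using rs f(3)[of "1 / r"] by (intro mult_mono) auto
    qed
  qed
qed

section \<open>The integral bounds on the domain\<close>

text \<open>The trace in each chart is open and closed in the plane, hence empty or everything. The
  charts share the point \<open>Some 1\<close>, so the two alternatives agree.\<close>

lemma csphere_clopen:
  assumes "openin csphere T" "closedin csphere T"
  shows "T = {} \<or> T = UNIV"
proof -
  have cl: "c -` T = {} \<or> c -` T = UNIV" if "sphere_chart c" for c
    using open_chart_vimage[OF that assms(1)] closed_chart_vimage[OF that assms(2)] clopen[of "c -` T"] by blast
  have one: "inversion_chart 1 = Some 1" by (simp add: inversion_chart_eq)
  have iff: "(1 :: complex) \<in> Some -` T \<longleftrightarrow> 1 \<in> inversion_chart -` T" by (simp add: one)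
  consider "Some -` T = {}" "inversion_chart -` T = {}" | "Some -` T = UNIV" "inversion_chart -` T = UNIV"
    using cl[of Some] cl[of inversion_chart] iff by (metis UNIV_I empty_iff sphere_chartI)
  thus ?thesis
  proof cases
    case 1
    have "p \<notin> T" for p using ex_sphere_chart[of p] 1 by (auto simp: sphere_chart_def)
    thus ?thesis by auto
  next
    case 2
    have "p \<in> T" for p using ex_sphere_chart[of p] 2 by (auto simp: sphere_chart_def)
    thus ?thesis by auto
  qed
qed

lemma green_weight_measurable:
  fixes f :: "real \<Rightarrow> real"
  assumes D: "sphere_domain D" and z0: "z0 \<in> D" and g: "green_function D z0 g"
    and U0: "openin csphere (superlevel D g t0)" "t0 > 0"
    and f: "mono_on {0..} f"
  defines "A \<equiv> D - superlevel D g t0"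
  shows "A \<in> sets sphere_borel"
    and "(\<lambda>p. real_of_ereal (g p)) \<in> borel_measurable (restrict_space sphere_borel A)"
    and "(\<lambda>p. ennreal (f (real_of_ereal (g p))) * indicator A p) \<in> borel_measurable sphere_borel"
    and "p \<in> A \<Longrightarrow> g p = ereal (real_of_ereal (g p)) \<and> 0 \<le> real_of_ereal (g p) \<and> real_of_ereal (g p) \<le> t0"
proof -
  have Do: "openin csphere D" using D by (simp add: sphere_domain_def)
  show A: "A \<in> sets sphere_borel" unfolding A_def by (intro sets.Diff sets_sphere_borel Do U0(1))
  have gz0: "g z0 = \<infinity>" using g by (simp add: green_function_def)
  have zA: "z0 \<notin> A" using gz0 z0 by (simp add: A_def superlevel_def)
  have bounds: "g p = ereal (real_of_ereal (g p)) \<and> 0 \<le> real_of_ereal (g p) \<and> real_of_ereal (g p) \<le> t0" if p: "p \<in> A" for p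
  proof -
    have "p \<in> D - {z0}" using p zA by (auto simp: A_def)
    hence fin: "g p = ereal (real_of_ereal (g p))" using g by (auto simp: green_function_def ereal_real)
    have "0 \<le> g p" using p by (intro green_nonneg[OF D z0 g U0]) (auto simp: A_def)
    moreover have "g p \<le> ereal t0" using p by (auto simp: A_def superlevel_def)
    ultimately show ?thesis using fin by (metis ereal_less_eq(3) zero_ereal_def)
  qed
  thus "p \<in> A \<Longrightarrow> g p = ereal (real_of_ereal (g p)) \<and> 0 \<le> real_of_ereal (g p) \<and> real_of_ereal (g p) \<le> t0" .
  show gm: "(\<lambda>p. real_of_ereal (g p)) \<in> borel_measurable (restrict_space sphere_borel A)"
  proof (rule borel_measurableI)
    fix T :: "real set" assume "open T"
    from green_openin[OF Do z0 g this]
    have "A \<inter> {p \<in> D - {z0}. real_of_ereal (g p) \<in> T} \<in> sets (restrict_space sphere_borel A)"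
      by (auto simp: sets_restrict_space dest: sets_sphere_borel)
    moreover have "A \<inter> {p \<in> D - {z0}. real_of_ereal (g p) \<in> T} =
        (\<lambda>p. real_of_ereal (g p)) -` T \<inter> space (restrict_space sphere_borel A)"
      using zA by (auto simp: space_restrict_space A_def)
    ultimately show "(\<lambda>p. real_of_ereal (g p)) -` T \<inter> space (restrict_space sphere_borel A)
        \<in> sets (restrict_space sphere_borel A)" by simp
  qed
  \<comment> \<open>Monotonicity of f is known on the half-line only; composed with max x 0 it
    becomes monotone on the whole line and thus Borel. On \<open>A\<close> this changes nothing,
    since g is nonnegative there.\<close>
  have "mono (\<lambda>x. f (max x 0))" using f by (auto simp: mono_def monotone_on_def)
  hence "(\<lambda>x. f (max x 0)) \<in> borel_measurable borel" by (rule borel_measurable_mono)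
  from measurable_compose[OF gm this]
  have "(\<lambda>p. ennreal (f (max (real_of_ereal (g p)) 0))) \<in> borel_measurable (restrict_space sphere_borel A)" by simp
  hence "(\<lambda>p. ennreal (f (max (real_of_ereal (g p)) 0)) * indicator A p) \<in> borel_measurable sphere_borel"
    using borel_measurable_restrict_space_iff_ennreal[of A sphere_borel] A by simp
  moreover have "ennreal (f (max (real_of_ereal (g p)) 0)) * indicator A p = ennreal (f (real_of_ereal (g p))) * indicator A p" for p
  proof (cases "p \<in> A")
    case True
    hence "max (real_of_ereal (g p)) 0 = real_of_ereal (g p)" using bounds by (simp add: max_absorb1)
    thus ?thesis by (simp only:)
  qed simp
  ultimately show "(\<lambda>p. ennreal (f (real_of_ereal (g p))) * indicator A p) \<in> borel_measurable sphere_borel" by simp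
qed

text \<open>The one-variable estimate is applied to the values of g under the restriction of \<nu>
  to D - U_{t0}, where 0 \<le> g \<le> t0; its hypothesis on truncated moments is the limiting form
  of \<open>green_jensen\<close>.\<close>

lemma weighted_mass_bound:
  assumes D: "sphere_domain D" and z0: "z0 \<in> D" and g: "green_function D z0 g" and t0: "t0 > 0"
    and U: "openin csphere (superlevel D g t0)" "\<And>t. 0 < t \<Longrightarrow> t \<le> t0 \<Longrightarrow> csphere closure_of (superlevel D g t) \<subseteq> D"
    and F: "convex_on {..<0} F" "mono_on {..<0} F" "C2_on {..<0} F"
    and u: "subharmonic_on D u" "u z0 \<noteq> - \<infinity>" "\<And>z. z \<in> D - superlevel D g t0 \<Longrightarrow> u z \<le> extend_neg_inf F (- g z)"
    and f: "convex_on {0..} f" "mono_on {0..} f" "\<And>t. 0 \<le> t \<Longrightarrow> 0 \<le> f t" "f 0 = 0" "f t0 \<le> b"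
    and \<nu>: "subriesz D u \<nu>"
  defines "K \<equiv> 6 * b / t0 * (2 * \<bar>F (- (t0 / 8))\<bar> + \<bar>F (- (t0 / 2))\<bar>) - 6 * b / t0 * real_of_ereal (u z0)"
  shows "weighted_mass \<nu> (D - superlevel D g t0) g f \<le> majorant_integral F t0 f + ennreal K" and "0 \<le> K"
proof -
  let ?A = "D - superlevel D g t0" and ?g = "\<lambda>p. real_of_ereal (g p)" and ?u0 = "real_of_ereal (u z0)"
  note A = green_weight_measurable[OF D z0 g U(1) t0 f(2)]
  have sets: "sets \<nu> = sets sphere_borel" using \<nu> by (simp add: subriesz_def)
  hence space: "space \<nu> = UNIV" by (metis sets_eq_imp_space_eq space_sphere_borel)
  \<comment> \<open>For g z \<ge> s the majorant F(-g z) is at most F(-s), as F increases; g z is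
    finite here, so the extension of F to -\<infinity> is not involved.\<close>
  have B: "u z \<le> ereal (F (- s))" if z: "z \<in> D" "g z \<le> ereal t0" "ereal s \<le> g z" and s: "0 < s" for z s
  proof -
    have zA: "z \<in> ?A" using z by (auto simp: superlevel_def)
    note b = A(4)[OF zA]
    have s': "s \<le> ?g z" using z(3) b by (metis ereal_less_eq(3))
    have "extend_neg_inf F (- g z) = ereal (F (- ?g z))"
      using b by (metis MInfty_neq_ereal(1) extend_neg_inf_def real_of_ereal.simps(1) uminus_ereal.simps(1))
    moreover have "F (- ?g z) \<le> F (- s)" using s s' by (intro mono_onD[OF F(2)]) auto
    ultimately show ?thesis using u(3)[OF zA] by (metis ereal_less_eq(3) order_trans)
  qed
  note J = green_jensen[OF D z0 g _ _ _ U(1) U(2) u(1,2) B \<nu>]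
  \<comment> \<open>\<open>green_jensen\<close> asks for a second level above s and not beyond t0;
    the midpoint of s and t0 serves.\<close>
  have u0: "?u0 \<le> F (- s)" if "0 < s" "s < t0" for s
    by (rule J(2)[of s "(s + t0) / 2"]) (use that in auto)
  have N: "(\<integral>\<^sup>+z\<in>?A. ennreal (?g z - s) \<partial>\<nu>) \<le> ennreal (F (- s) - ?u0)" if s: "0 < s" "s < t0" for s
  proof (rule tendsto_lowerbound)
    have "isCont F (- s)" using C2_onD(1)[OF F(3), of "- s"] s DERIV_isCont by auto
    hence "((\<lambda>r. F (- r)) \<longlongrightarrow> F (- s)) (at_left s)"
      by (rule isCont_tendsto_compose) (intro tendsto_intros)
    thus "((\<lambda>r. ennreal (F (- r) - ?u0)) \<longlongrightarrow> ennreal (F (- s) - ?u0)) (at_left s)"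
      by (intro tendsto_ennrealI tendsto_intros)
    have "\<forall>\<^sub>F r in at_left s. r \<in> {0<..<s}" using s(1) by (rule eventually_at_left_real)
    thus "\<forall>\<^sub>F r in at_left s. (\<integral>\<^sup>+z\<in>?A. ennreal (?g z - s) \<partial>\<nu>) \<le> ennreal (F (- r) - ?u0)"
    proof eventually_elim
      case (elim r)
      show ?case by (rule J(1)[of r s]) (use elim s in auto)
    qed
  qed simp
  have An: "?A \<inter> space \<nu> \<in> sets \<nu>" using A(1) sets space by simp
  let ?M = "restrict_space \<nu> ?A"
  have gm: "?g \<in> borel_measurable ?M"
    using A(2) measurable_cong_sets[OF sets_restrict_space_cong[OF sets] refl] by blast
  have gb: "0 \<le> ?g x \<and> ?g x \<le> t0" if "x \<in> space ?M" for x
    using that A(4)[of x] by (simp add: space_restrict_space)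
  have NM: "(\<integral>\<^sup>+x. ennreal (?g x - s) \<partial>?M) \<le> ennreal (F (- s) - ?u0)" if "0 < s" "s < t0" for s
    using N[OF that] by (simp add: nn_integral_restrict_space[OF An])
  note bound = convex_mono_mass_bound[OF f F t0 gm gb NM u0]
  show "weighted_mass \<nu> ?A g f \<le> majorant_integral F t0 f + ennreal K"
    using bound(1) unfolding K_def weighted_mass_def nn_integral_restrict_space[OF An] .
  show "0 \<le> K" using bound(2) unfolding K_def .
qed

lemma weighted_zero_sum_eq:
  "weighted_zero_sum Z A g w = (\<Sum>k. ennreal (w (real_of_ereal (g (Z k)))) * indicator A (Z k))"
  unfolding weighted_zero_sum_def by (rule suminf_cong) (simp add: indicator_def)

text \<open>The majorant may be infinite and u(z0) may have either sign. The estimate is therefore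
  proved with one nonnegative constant K and split only after passing to extended reals, where K is
  finite.\<close>

lemma ennreal_bound_to_ereal:
  assumes W: "W \<le> Maj + ennreal K" and K: "K = A - c * r" "0 \<le> K" and v: "v = ereal r"
  shows "enn2ereal W \<le> enn2ereal Maj + ereal A - ereal c * v \<and> (Maj < \<infinity> \<longrightarrow> W < \<infinity>)"
proof
  have "enn2ereal W \<le> enn2ereal (Maj + ennreal K)" using W by (simp add: less_eq_ennreal.rep_eq)
  also have "\<dots> = enn2ereal Maj + ereal K" using K(2) by (simp add: plus_ennreal.rep_eq enn2ereal_ennreal)
  also have "\<dots> = enn2ereal Maj + ereal A - ereal c * v"
    unfolding v K(1) by (cases "enn2ereal Maj") auto
  finally show "enn2ereal W \<le> enn2ereal Maj + ereal A - ereal c * v" .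
  show "Maj < \<infinity> \<longrightarrow> W < \<infinity>" using W by (auto simp: ennreal_add_less_top intro: le_less_trans)
qed

text \<open>Common form of (a) and (b), with f standing for the weight itself. The sum over the
  sequence is the weighted mass for its counting measure, so one estimate for dominated measures
  yields both conclusions.\<close>

lemma weighted_bounds:
  assumes D: "sphere_domain D" and z0: "z0 \<in> D" and g: "green_function D z0 g" and t0: "t0 > 0"
    and U: "openin csphere (superlevel D g t0)" "\<forall>t. 0 < t \<and> t \<le> t0 \<longrightarrow> csphere closure_of (superlevel D g t) \<subseteq> D"
    and F: "convex_on {..<0} F" "mono_on {..<0} F" "C2_on {..<0} F"
    and u: "subharmonic_on D u" "u z0 \<noteq> - \<infinity>" "\<forall>z\<in>D - superlevel D g t0. u z \<le> extend_neg_inf F (- g z)"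
    and f: "convex_on {0..} f" "mono_on {0..} f" "\<forall>t\<ge>0. 0 \<le> f t" "f 0 = 0" "f t0 \<le> b"
    and C: "C = 6 * b / t0" "B = 2 * \<bar>F (- (t0 / 8))\<bar> + \<bar>F (- (t0 / 2))\<bar>"
  shows "\<forall>\<nu>. riesz_measure D u \<nu> \<longrightarrow>
      enn2ereal (weighted_mass \<nu> (D - superlevel D g t0) g f)
        \<le> enn2ereal (majorant_integral F t0 f) + ereal (C * B) - ereal C * u z0 \<and>
      (majorant_integral F t0 f < \<infinity> \<longrightarrow> weighted_mass \<nu> (D - superlevel D g t0) g f < \<infinity>)" (is ?mass)
    and "\<forall>h Z. sphere_holomorphic_on h D \<and> (\<exists>z\<in>D. h z \<noteq> 0) \<and> (\<forall>z\<in>D. u z = log_abs (h z)) \<and>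
          range Z \<subseteq> D \<and> vanishes_on D h Z \<longrightarrow>
      enn2ereal (weighted_zero_sum Z (D - superlevel D g t0) g f)
        \<le> enn2ereal (majorant_integral F t0 f) + ereal (C * B) - ereal C * u z0 \<and>
      (majorant_integral F t0 f < \<infinity> \<longrightarrow> weighted_zero_sum Z (D - superlevel D g t0) g f < \<infinity>) \<and>
      (\<forall>\<nu>. riesz_measure D u \<nu> \<longrightarrow>
         weighted_zero_sum Z (D - superlevel D g t0) g f \<le> weighted_mass \<nu> (D - superlevel D g t0) g f \<and>
         (zero_sequence D h Z \<longrightarrow>
            weighted_mass \<nu> (D - superlevel D g t0) g f = weighted_zero_sum Z (D - superlevel D g t0) g f))" (is ?zeros)
proof -
  let ?A = "D - superlevel D g t0"
  let ?w = "\<lambda>p. ennreal (f (real_of_ereal (g p))) * indicator ?A p"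
  note wm = green_weight_measurable(3)[OF D z0 g U(1) t0 f(2)]
  obtain c a where c: "sphere_chart c" "z0 = c a" using ex_sphere_chart by blast
  have "planar_subharmonic_on (c -` D) (u \<circ> c)" using u(1) c(1) by (auto simp: subharmonic_on_def sphere_chart_def)
  hence "u z0 < \<infinity>" using z0 c(2) by (auto simp: planar_subharmonic_on_def)
  hence u0: "u z0 = ereal (real_of_ereal (u z0))" using u(2) by (cases "u z0") auto
  have main: "enn2ereal (weighted_mass \<nu> ?A g f) \<le> enn2ereal (majorant_integral F t0 f) + ereal (C * B) - ereal C * u z0 \<and>
      (majorant_integral F t0 f < \<infinity> \<longrightarrow> weighted_mass \<nu> ?A g f < \<infinity>)" if "subriesz D u \<nu>" for \<nu>
  proof (rule ennreal_bound_to_ereal[OF _ _ _ u0])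
    note W = weighted_mass_bound[OF D z0 g t0 U(1) _ F u(1,2) _ f(1,2) _ f(4,5) that, folded C]
    show "weighted_mass \<nu> ?A g f \<le> majorant_integral F t0 f + ennreal (C * B - C * real_of_ereal (u z0))"
      by (rule W(1)) (use U(2) u(3) f(3) in blast)+
    show "0 \<le> C * B - C * real_of_ereal (u z0)" by (rule W(2)) (use U(2) u(3) f(3) in blast)+
  qed simp
  show ?mass using main riesz_imp_subriesz by blast
  show ?zeros
  proof (intro allI impI)
    fix h Z assume "sphere_holomorphic_on h D \<and> (\<exists>z\<in>D. h z \<noteq> 0) \<and> (\<forall>z\<in>D. u z = log_abs (h z)) \<and>
          range Z \<subseteq> D \<and> vanishes_on D h Z"
    hence h: "sphere_holomorphic_on h D" "\<forall>z\<in>D. u z = log_abs (h z)" and Z: "range Z \<subseteq> D" "vanishes_on D h Z" by auto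
    interpret log_holomorphic D u h z0
      by unfold_locales (use D u z0 h in auto)
    let ?\<mu> = "distr (count_space UNIV) sphere_borel Z"
    have "weighted_mass ?\<mu> ?A g f = (\<Sum>k. ?w (Z k))"
      unfolding weighted_mass_def using wm by (subst nn_integral_distr) (auto simp: nn_integral_count_space_nat)
    hence eq: "weighted_zero_sum Z ?A g f = weighted_mass ?\<mu> ?A g f" by (simp add: weighted_zero_sum_eq)
    have w0: "?w p = 0" if "p \<notin> D" for p using that by simp
    have R: "weighted_zero_sum Z ?A g f \<le> weighted_mass \<nu> ?A g f \<and>
         (zero_sequence D h Z \<longrightarrow> weighted_mass \<nu> ?A g f = weighted_zero_sum Z ?A g f)" if \<nu>: "riesz_measure D u \<nu>" for \<nu>
      using riesz_mass_vanishing_sequence[OF \<nu> Z wm w0] unfolding weighted_zero_sum_eq weighted_mass_def by blast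
    show "enn2ereal (weighted_zero_sum Z ?A g f)
        \<le> enn2ereal (majorant_integral F t0 f) + ereal (C * B) - ereal C * u z0 \<and>
      (majorant_integral F t0 f < \<infinity> \<longrightarrow> weighted_zero_sum Z ?A g f < \<infinity>) \<and>
      (\<forall>\<nu>. riesz_measure D u \<nu> \<longrightarrow> weighted_zero_sum Z ?A g f \<le> weighted_mass \<nu> ?A g f \<and>
         (zero_sequence D h Z \<longrightarrow> weighted_mass \<nu> ?A g f = weighted_zero_sum Z ?A g f))"
      using main[OF subriesz_vanishing_sequence[OF Z]] R unfolding eq by blast
  qed
qed

theorem mainTheorem11:
  fixes D :: "complex option set" and z0 :: "complex option"
    and g :: "complex option \<Rightarrow> ereal" and t0 :: real and U :: "real \<Rightarrow> complex option set"
  assumes "regular_domain D" and "z0 \<in> D" and "green_function D z0 g" and "t0 > 0"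
    and U_def: "U = superlevel D g"
    and "\<And>t. 0 < t \<Longrightarrow> t \<le> t0 \<Longrightarrow>
           regular_domain (U t) \<and>
           compactin csphere (csphere closure_of U t) \<and> csphere closure_of U t \<subseteq> D \<and>
           C1_boundary (U t) \<and>
           csphere frontier_of U t = {z \<in> D. g z = ereal t}"
  shows "\<exists>(C :: real \<Rightarrow> real) (Cbar :: (complex option \<Rightarrow> ereal) \<Rightarrow> real).
    (\<forall>b. 0 \<le> C b) \<and> (\<forall>M. 0 \<le> Cbar M) \<and>
    (\<forall>(F :: real \<Rightarrow> real) M u b.
       convex_on {..<0} F \<and> mono_on {..<0} F \<and> C2_on {..<0} F \<and>
       M = (\<lambda>z. extend_neg_inf F (- g z)) \<and>
       subharmonic_on D u \<and> u z0 \<noteq> -\<infinity> \<and> (\<forall>z\<in>D - U t0. u z \<le> M z) \<and> 0 \<le> b \<longrightarrow>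
       (\<forall>f :: real \<Rightarrow> real.
          convex_on {0..} f \<and> mono_on {0..} f \<and> (\<forall>t\<ge>0. 0 \<le> f t) \<and> f 0 = 0 \<and> f t0 \<le> b \<longrightarrow>
          (\<forall>\<nu>. riesz_measure D u \<nu> \<longrightarrow>
             enn2ereal (weighted_mass \<nu> (D - U t0) g f)
               \<le> enn2ereal (majorant_integral F t0 f) + ereal (C b * Cbar M) - ereal (C b) * u z0 \<and>
             (majorant_integral F t0 f < \<infinity> \<longrightarrow> weighted_mass \<nu> (D - U t0) g f < \<infinity>)) \<and>
          (\<forall>h Z. sphere_holomorphic_on h D \<and> (\<exists>z\<in>D. h z \<noteq> 0) \<and> (\<forall>z\<in>D. u z = log_abs (h z)) \<and>
              range Z \<subseteq> D \<and> vanishes_on D h Z \<longrightarrow>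
             enn2ereal (weighted_zero_sum Z (D - U t0) g f)
               \<le> enn2ereal (majorant_integral F t0 f) + ereal (C b * Cbar M) - ereal (C b) * u z0 \<and>
             (majorant_integral F t0 f < \<infinity> \<longrightarrow> weighted_zero_sum Z (D - U t0) g f < \<infinity>) \<and>
             (\<forall>\<nu>. riesz_measure D u \<nu> \<longrightarrow>
                weighted_zero_sum Z (D - U t0) g f \<le> weighted_mass \<nu> (D - U t0) g f \<and>
                (zero_sequence D h Z \<longrightarrow>
                   weighted_mass \<nu> (D - U t0) g f = weighted_zero_sum Z (D - U t0) g f)))) \<and>
       (\<forall>f :: real \<Rightarrow> real.
          convex_on {0..} f \<and> antimono_on {0..} f \<and> (\<forall>t\<ge>0. 0 \<le> f t) \<and>
          right_deriv f 0 < \<infinity> \<and> f 0 \<le> b / t0 \<longrightarrow>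
          (\<forall>\<nu>. riesz_measure D u \<nu> \<longrightarrow>
             enn2ereal (weighted_mass \<nu> (D - U t0) g (\<lambda>t. t * f (1 / t)))
               \<le> enn2ereal (majorant_integral F t0 (\<lambda>t. t * f (1 / t)))
                  + ereal (C b * Cbar M) - ereal (C b) * u z0 \<and>
             (majorant_integral F t0 (\<lambda>t. t * f (1 / t)) < \<infinity> \<longrightarrow>
                weighted_mass \<nu> (D - U t0) g (\<lambda>t. t * f (1 / t)) < \<infinity>)) \<and>
          (\<forall>h Z. sphere_holomorphic_on h D \<and> (\<exists>z\<in>D. h z \<noteq> 0) \<and> (\<forall>z\<in>D. u z = log_abs (h z)) \<and>
              range Z \<subseteq> D \<and> vanishes_on D h Z \<longrightarrow>
             enn2ereal (weighted_zero_sum Z (D - U t0) g (\<lambda>t. t * f (1 / t)))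
               \<le> enn2ereal (majorant_integral F t0 (\<lambda>t. t * f (1 / t)))
                  + ereal (C b * Cbar M) - ereal (C b) * u z0 \<and>
             (majorant_integral F t0 (\<lambda>t. t * f (1 / t)) < \<infinity> \<longrightarrow>
                weighted_zero_sum Z (D - U t0) g (\<lambda>t. t * f (1 / t)) < \<infinity>) \<and>
             (\<forall>\<nu>. riesz_measure D u \<nu> \<longrightarrow>
                weighted_zero_sum Z (D - U t0) g (\<lambda>t. t * f (1 / t))
                  \<le> weighted_mass \<nu> (D - U t0) g (\<lambda>t. t * f (1 / t)) \<and>
                (zero_sequence D h Z \<longrightarrow>
                   weighted_mass \<nu> (D - U t0) g (\<lambda>t. t * f (1 / t))
                   = weighted_zero_sum Z (D - U t0) g (\<lambda>t. t * f (1 / t)))))))"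
proof -
  let ?A = "D - superlevel D g t0"
  have D: "sphere_domain D" using assms(1) by (simp add: regular_domain_def)
  have U: "openin csphere (superlevel D g t)" "superlevel D g t \<noteq> UNIV"
      "csphere closure_of (superlevel D g t) \<subseteq> D" "csphere frontier_of (superlevel D g t) = {z \<in> D. g z = ereal t}"
    if "0 < t" "t \<le> t0" for t
    using assms(6)[OF that] unfolding U_def regular_domain_def sphere_domain_def by blast+
  \<comment> \<open>An empty level line would leave U_t without boundary, hence open and closed in
    the sphere; but U_t contains \<open>z0\<close> and is not the whole sphere.\<close>
  have level: "\<exists>z. g z = ereal t" if t: "0 < t" "t \<le> t0" for t
  proof (rule ccontr)
    assume "\<nexists>z. g z = ereal t"
    hence "csphere frontier_of (superlevel D g t) = {}" using U(4)[OF t] by blast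
    hence "closedin csphere (superlevel D g t)"
      using frontier_of_eq_empty[of "superlevel D g t" csphere] openin_subset[OF U(1)[OF t]] by blast
    hence "superlevel D g t = {}" using csphere_clopen[OF U(1)[OF t]] U(2)[OF t] by blast
    moreover have "z0 \<in> superlevel D g t" using assms(2,3) by (simp add: superlevel_def green_function_def)
    ultimately show False by blast
  qed
  obtain p8 p2 where p: "g p8 = ereal (t0 / 8)" "g p2 = ereal (t0 / 2)"
    using level[of "t0 / 8"] level[of "t0 / 2"] assms(4) by auto
  \<comment> \<open>The absolute value makes C nonnegative for every real b, as the statement
    demands.\<close>
  define C where "C b = 6 * \<bar>b\<bar> / t0" for b
  \<comment> \<open>The points \<open>p8\<close> and \<open>p2\<close> depend on D, g and t0 only,
    so this is a function of M alone; for M = F(-g) it returns the values of F at -t0/8 and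
    -t0/2.\<close>
  define Cbar where "Cbar M = 2 * \<bar>real_of_ereal (M p8)\<bar> + \<bar>real_of_ereal (M p2)\<bar>" for M :: "complex option \<Rightarrow> ereal"
  show ?thesis
  proof (rule exI[of _ C], rule exI[of _ Cbar], intro conjI[of "\<forall>b. 0 \<le> C b"] conjI[of "\<forall>M. 0 \<le> Cbar M"], goal_cases)
    case 1
    show ?case using assms(4) by (simp add: C_def)
  next
    case 2
    show ?case unfolding Cbar_def by (intro allI add_nonneg_nonneg mult_nonneg_nonneg abs_ge_zero) simp
  next
    case 3
    show ?case
    proof (intro allI impI, elim conjE, goal_cases)
      case (1 F M u b)
      have M: "Cbar M = 2 * \<bar>F (- (t0 / 8))\<bar> + \<bar>F (- (t0 / 2))\<bar>"
        unfolding 1(4) Cbar_def p by (simp add: extend_neg_inf_def)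
      have C: "C b = 6 * b / t0" using 1 by (simp add: C_def)
      have u: "\<forall>z\<in>?A. u z \<le> extend_neg_inf F (- g z)" using 1 U_def by simp
      have cl: "\<forall>t. 0 < t \<and> t \<le> t0 \<longrightarrow> csphere closure_of (superlevel D g t) \<subseteq> D" using U(3) by blast
      note W = weighted_bounds[OF D assms(2-4) U(1)[OF assms(4) order_refl] cl 1(1-3) 1(5,6) u _ _ _ _ _ C M]
      have persp: "convex_on {0..} (\<lambda>t. t * f (1 / t))" "mono_on {0..} (\<lambda>t. t * f (1 / t))"
          "\<forall>t\<ge>0. 0 \<le> t * f (1 / t)" "0 * f (1 / 0) = 0" "t0 * f (1 / t0) \<le> b"
        if f: "convex_on {0..} f" "antimono_on {0..} f" "\<forall>t\<ge>0. 0 \<le> f t" "f 0 \<le> b / t0" for f :: "real \<Rightarrow> real"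
      proof -
        show "convex_on {0..} (\<lambda>t. t * f (1 / t))" "mono_on {0..} (\<lambda>t. t * f (1 / t))"
          using perspective_convex[OF f(1,2)] f(3) by blast+
        show "\<forall>t\<ge>0. 0 \<le> t * f (1 / t)" using f(3) by simp
        show "0 * f (1 / 0) = 0" by simp
        have "f (1 / t0) \<le> f 0" using monotone_onD[OF f(2), of 0 "1 / t0"] assms(4) by simp
        hence "f (1 / t0) \<le> b / t0" using f(4) by linarith
        thus "t0 * f (1 / t0) \<le> b" using assms(4) by (simp add: field_simps)
      qed
      show ?case
      proof (intro conjI allI[where 'a = "real \<Rightarrow> real"] impI, goal_cases)
        case (1 f)
        hence f: "convex_on {0..} f" "mono_on {0..} f" "\<forall>t\<ge>0. 0 \<le> f t" "f 0 = 0" "f t0 \<le> b" by blast+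
        show ?case unfolding U_def by (rule W(1)[OF f])
      next
        case (2 f)
        hence f: "convex_on {0..} f" "mono_on {0..} f" "\<forall>t\<ge>0. 0 \<le> f t" "f 0 = 0" "f t0 \<le> b" by blast+
        show ?case unfolding U_def by (rule W(2)[OF f])
      next
        case (3 f)
        show ?case unfolding U_def by (rule W(1)[OF persp]) (use 3 in blast)+
      next
        case (4 f)
        show ?case unfolding U_def by (rule W(2)[OF persp]) (use 4 in blast)+
      qed
    qed
  qed
qed

end
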